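(* Assume that $\mu^{-1}$ and $\varepsilon_\sigma$ are piecewise polynomial on the partition $\mathcal{P}$ and that $\boldsymbol{f}|_{T}\in\mathbf{H}^1(T;\mathbb{C})$ for all $T\in\mathscr{T}_h$. Let $\mathbf{u}^*\in U_{ad}$ be a local solution of $\min\{j(\mathbf{u}):\mathbf{u}\in U_{ad}\}$ with state $\boldsymbol{y}^*=\mathcal{S}\mathbf{u}^*$. Let $\mathbf{u}^*_h$ be a local minimum of the discrete optimal control problem $\min\{j_h(\mathbf{u}_h):\mathbf{u}_h\in U_{ad}\}$ with corresponding state $\boldsymbol{y}^*_h=\mathcal{S}_h\mathbf{u}^*_h$. Then, for $T\in\mathscr{T}_h$, the local error indicator $\mathcal{E}_{st,T}$ satisfies $$\mathcal{E}_{st,T}\le C\left(\|\mathbf{u}^*-\mathbf{u}^*_h\|_{\mathbb{R}^\ell}+\|\boldsymbol{y}^*-\boldsymbol{y}^*_h\|_{\mathbf{H}(\mathbf{curl},\mathcal{N}_T)}+\mathrm{osc}(\boldsymbol{f};T)\right),$$ with a constant $C>0$ independent of the continuous and discrete optimal variables, the size of the elements in $\mathscr{T}_h$, and the number $\#\mathscr{T}_h$ of elements.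
   Context: $\Omega\subset\mathbb{R}^3$ is an open, bounded, simply connected polyhedral domain with Lipschitz boundary $\Gamma$ and outward unit normal $\boldsymbol{n}$. For a set $G$ (domain or face), $(v,w)_G=\int_G v\cdot\overline{w}$ and $\|\cdot\|_G$ are the $L^2(G;\mathbb{C})$ inner product and norm (scalar or vector fields). $\mathbf{H}(\mathbf{curl},G)$ is the space of $\boldsymbol{w}\in\mathbf{L}^2(G;\mathbb{C})$ with $\mathbf{curl}\,\boldsymbol{w}\in\mathbf{L}^2(G;\mathbb{C})$, with graph norm; $\mathbf{H}_0(\mathbf{curl},\Omega)=\{\boldsymbol{w}\in\mathbf{H}(\mathbf{curl},\Omega):\boldsymbol{w}\times\boldsymbol{n}=\mathbf{0}\text{ on }\Gamma\}$. Data: $\omega>0$; $\mu\in L^\infty(\Omega)$ real with $\mu\ge\mu_0>0$; $\varepsilon,\sigma\in L^\infty(\Omega)$ real with $0<\varepsilon_+\le\varepsilon\le\varepsilon^+$ and $0<\sigma_+\le\sigma\le\sigma^+$ (constants); $\varepsilon_\sigma:=\varepsilon+i\sigma\omega^{-1}$; $\ell\in\mathbb{N}$; $\mathcal{P}=\{\Omega_k\}_{k=1}^\ell$ is a partition of $\Omega$ into pairwise disjoint subdomains with $\overline\Omega=\cup_k\overline{\Omega}_k$. For $\mathbf{u}\in\mathbb{R}^\ell$, $\varepsilon_\sigma\cdot\mathbf{u}$ denotes the function equal to $\mathbf{u}_k\varepsilon_\sigma$ on $\Omega_k$. $\boldsymbol{f},\boldsymbol{y}_\Omega,\boldsymbol{E}_\Omega\in\mathbf{L}^2(\Omega;\mathbb{C})$,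 $\alpha>0$. Vector inequalities are componentwise; $\mathbf{a},\mathbf{b}\in\mathbb{R}^\ell$ with $\mathbf{0}<\mathbf{a}<\mathbf{b}$ and $U_{ad}:=\{\mathbf{v}\in\mathbb{R}^\ell:\mathbf{a}\le\mathbf{v}\le\mathbf{b}\}$. Meshes: $\mathscr{T}_h$ belongs to a collection $\mathbb{T}$ of conforming, shape regular simplicial meshes of $\overline\Omega$, all refinements of an initial mesh, such that each $T\in\mathscr{T}_h$ is contained in (the closure of) one element of $\mathcal{P}$. $h_T=\mathrm{diam}(T)$. $\mathbf{V}(\mathscr{T}_h)=\{\boldsymbol{v}_h\in\mathbf{H}_0(\mathbf{curl},\Omega):\boldsymbol{v}_h|_T\in[\mathbb{P}_0(T)]^3\oplus\boldsymbol{x}\times[\widetilde{\mathbb{P}}_0(T)]^3\ \forall T\in\mathscr{T}_h\}$ is the lowest-order Nédélec space ($\widetilde{\mathbb P}_0$: homogeneous polynomials of degree $0$). $\mathscr{S}_T$ is the set of faces of $T$ and $\mathscr{S}_T^I$ the set of those not contained in $\Gamma$; $\mathcal{N}_T=\{T'\in\mathscr{T}_h:\mathscr{S}_T\cap\mathscr{S}_{T'}\ne\emptyset\}$, also denoting the union of these elements. $\llbracket\boldsymbol{v}\rrbracket(\boldsymbol{x})=\lim_{t\to0^+}\boldsymbol{v}(\boldsymbol{x}-t\boldsymbol{n}_T)-\lim_{t\to0^+}\boldsymbol{v}(\boldsymbol{x}+t\boldsymbol{n}_T)$ is the jump across an interior face, $\boldsymbol{n}_T$ being the outer unit normal of $T$.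 Write $a_{\mathbf{u}}(\boldsymbol{y},\boldsymbol{w})=(\mu^{-1}\mathbf{curl}\,\boldsymbol{y},\mathbf{curl}\,\boldsymbol{w})_\Omega-\omega^2((\varepsilon_\sigma\cdot\mathbf{u})\boldsymbol{y},\boldsymbol{w})_\Omega$. For $\mathbf{u}>\mathbf{0}$, $\mathcal{S}\mathbf{u}\in\mathbf{H}_0(\mathbf{curl},\Omega)$ and $\mathcal{S}_h\mathbf{u}\in\mathbf{V}(\mathscr{T}_h)$ are the unique solutions of $a_{\mathbf{u}}(\mathcal{S}\mathbf{u},\boldsymbol{w})=(\boldsymbol{f},\boldsymbol{w})_\Omega$ for all $\boldsymbol{w}\in\mathbf{H}_0(\mathbf{curl},\Omega)$ and $a_{\mathbf{u}}(\mathcal{S}_h\mathbf{u},\boldsymbol{w}_h)=(\boldsymbol{f},\boldsymbol{w}_h)_\Omega$ for all $\boldsymbol{w}_h\in\mathbf{V}(\mathscr{T}_h)$. With $\mathcal{J}(\boldsymbol{y},\mathbf{u})=\tfrac12\|\boldsymbol{y}-\boldsymbol{y}_\Omega\|_\Omega^2+\tfrac12\|\mathbf{curl}\,\boldsymbol{y}-\boldsymbol{E}_\Omega\|_\Omega^2+\tfrac{\alpha}{2}\|\mathbf{u}\|_{\mathbb{R}^\ell}^2$, $j(\mathbf{u})=\mathcal{J}(\mathcal{S}\mathbf{u},\mathbf{u})$ and $j_h(\mathbf{u})=\mathcal{J}(\mathcal{S}_h\mathbf{u},\mathbf{u})$. Indicator: $\mathcal{E}_{st,T}^2=\mathcal{E}_{T,1}^2+\mathcal{E}_{T,2}^2$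 with $\mathcal{E}_{T,1}^2=h_T^2\|\mathrm{div}(\boldsymbol{f}+\omega^2(\varepsilon_\sigma\cdot\mathbf{u}^*_h)\boldsymbol{y}^*_h)\|_T^2+\tfrac{h_T}{2}\sum_{S\in\mathscr{S}_T^I}\|\llbracket(\boldsymbol{f}+\omega^2(\varepsilon_\sigma\cdot\mathbf{u}^*_h)\boldsymbol{y}^*_h)\cdot\boldsymbol{n}\rrbracket\|_S^2$, $\mathcal{E}_{T,2}^2=h_T^2\|\boldsymbol{f}-\mathbf{curl}(\mu^{-1}\mathbf{curl}\,\boldsymbol{y}^*_h)+\omega^2(\varepsilon_\sigma\cdot\mathbf{u}^*_h)\boldsymbol{y}^*_h\|_T^2+\tfrac{h_T}{2}\sum_{S\in\mathscr{S}_T^I}\|\llbracket\mu^{-1}\mathbf{curl}\,\boldsymbol{y}^*_h\times\boldsymbol{n}\rrbracket\|_S^2$. Oscillation: for $\boldsymbol{v}$ elementwise in $\mathbf{H}^1$, $\mathrm{osc}(\boldsymbol{v};T)=\sum_{T'\in\mathcal{N}_T}(h_{T'}\|\boldsymbol{v}-\boldsymbol{\pi}\boldsymbol{v}\|_{T'}+h_{T'}\|\mathrm{div}\,\boldsymbol{v}-\pi\,\mathrm{div}\,\boldsymbol{v}\|_{T'})+\sum_{S'\in\mathscr{S}_T^I}h_T^{1/2}\|\llbracket(\boldsymbol{v}-\boldsymbol{\pi}\boldsymbol{v})\cdot\boldsymbol{n}\rrbracket\|_{S'}$, where $\pi$ and $\boldsymbol{\pi}$ are, on each element $T'$, the $L^2(T')$-orthogonal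 projections onto $\mathbb{P}_0(T')$ and $[\mathbb{P}_0(T')]^3$ (divergences taken elementwise). *)

theory Defs
  imports "HOL-Analysis.Analysis"
begin

text \<open>
  Elements of Lebesgue and Sobolev spaces are represented by functions on \<open>real^3\<close>; all notions
  below are insensitive to changes on null sets and to values outside the set \<open>G\<close> at hand.
  \<open>G\<close> is either open (the domain) or closed (an element or a patch of elements).
\<close>

type_synonym point = "real^3"
type_synonym cfield = "real^3 \<Rightarrow> complex^3"


section \<open>Complex vectors\<close>

definition of_real_vec :: "real^3 \<Rightarrow> complex^3" where
  "of_real_vec n = (\<chi> i. complex_of_real (n $ i))"

definition cdot :: "complex^3 \<Rightarrow> complex^3 \<Rightarrow> complex" where
  "cdot v w = (\<Sum>i\<in>UNIV. v $ i * w $ i)"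

definition ccross :: "complex^3 \<Rightarrow> complex^3 \<Rightarrow> complex^3" where
  "ccross v w = vector [v$2 * w$3 - v$3 * w$2, v$3 * w$1 - v$1 * w$3, v$1 * w$2 - v$2 * w$1]"


section \<open>Lebesgue spaces\<close>

definition L2_on :: "point set \<Rightarrow> (point \<Rightarrow> 'b::euclidean_space) \<Rightarrow> bool" where
  "L2_on G v \<longleftrightarrow> v \<in> borel_measurable (lebesgue_on G) \<and>
                 integrable (lebesgue_on G) (\<lambda>x. (norm (v x))\<^sup>2)"

definition L2_norm :: "point set \<Rightarrow> (point \<Rightarrow> 'b::euclidean_space) \<Rightarrow> real" where
  "L2_norm G v = sqrt (LINT x|lebesgue_on G. (norm (v x))\<^sup>2)"

definition sprod :: "point set \<Rightarrow> (point \<Rightarrow> complex) \<Rightarrow> (point \<Rightarrow> complex) \<Rightarrow> complex" where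
  "sprod G v w = (LINT x|lebesgue_on G. v x * cnj (w x))"

definition vprod :: "point set \<Rightarrow> cfield \<Rightarrow> cfield \<Rightarrow> complex" where
  "vprod G v w = (LINT x|lebesgue_on G. (\<Sum>i\<in>UNIV. v x $ i * cnj (w x $ i)))"

definition Linf_on :: "point set \<Rightarrow> (point \<Rightarrow> real) \<Rightarrow> bool" where
  "Linf_on G g \<longleftrightarrow> g \<in> borel_measurable (lebesgue_on G) \<and>
                   (\<exists>M. AE x in lebesgue_on G. \<bar>g x\<bar> \<le> M)"


section \<open>Smooth functions and weak derivatives\<close>

definition partial :: "3 \<Rightarrow> (point \<Rightarrow> 'b::real_normed_vector) \<Rightarrow> point \<Rightarrow> 'b" where
  "partial i \<phi> x = frechet_derivative \<phi> (at x) (axis i 1)"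

primrec Ck :: "nat \<Rightarrow> (point \<Rightarrow> 'b::real_normed_vector) \<Rightarrow> bool" where
  "Ck 0 \<phi> \<longleftrightarrow> continuous_on UNIV \<phi>"
| "Ck (Suc k) \<phi> \<longleftrightarrow> (\<forall>x. \<phi> differentiable at x) \<and> (\<forall>i. Ck k (partial i \<phi>))"

definition smooth :: "(point \<Rightarrow> 'b::real_normed_vector) \<Rightarrow> bool" where
  "smooth \<phi> \<longleftrightarrow> (\<forall>k. Ck k \<phi>)"

definition test_fun :: "point set \<Rightarrow> (point \<Rightarrow> 'b::real_normed_vector) \<Rightarrow> bool" where
  "test_fun G \<phi> \<longleftrightarrow> smooth \<phi> \<and> compact (closure {x. \<phi> x \<noteq> 0}) \<and>
                     closure {x. \<phi> x \<noteq> 0} \<subseteq> interior G"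

definition classical_grad :: "(point \<Rightarrow> complex) \<Rightarrow> cfield" where
  "classical_grad \<phi> x = (\<chi> i. partial i \<phi> x)"

definition classical_curl :: "cfield \<Rightarrow> cfield" where
  "classical_curl \<phi> x = vector
     [partial 2 \<phi> x $ 3 - partial 3 \<phi> x $ 2,
      partial 3 \<phi> x $ 1 - partial 1 \<phi> x $ 3,
      partial 1 \<phi> x $ 2 - partial 2 \<phi> x $ 1]"

definition has_weak_curl :: "point set \<Rightarrow> cfield \<Rightarrow> cfield \<Rightarrow> bool" where
  "has_weak_curl G w c \<longleftrightarrow> L2_on G c \<and>
     (\<forall>\<phi>. test_fun G \<phi> \<longrightarrow> vprod G c \<phi> = vprod G w (classical_curl \<phi>))"

definition has_weak_div :: "point set \<Rightarrow> cfield \<Rightarrow> (point \<Rightarrow> complex) \<Rightarrow> bool" where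
  "has_weak_div G w d \<longleftrightarrow> L2_on G d \<and>
     (\<forall>\<phi>. test_fun G \<phi> \<longrightarrow> sprod G d \<phi> = - vprod G w (classical_grad \<phi>))"

definition wcurl :: "point set \<Rightarrow> cfield \<Rightarrow> cfield" where
  "wcurl G w = (SOME c. has_weak_curl G w c)"

definition wdiv :: "point set \<Rightarrow> cfield \<Rightarrow> point \<Rightarrow> complex" where
  "wdiv G w = (SOME d. has_weak_div G w d)"

definition H1_on :: "point set \<Rightarrow> cfield \<Rightarrow> bool" where
  "H1_on G v \<longleftrightarrow> L2_on G v \<and>
     (\<forall>i. \<exists>g. L2_on G g \<and> (\<forall>\<phi>. test_fun G \<phi> \<longrightarrow> vprod G g \<phi> = - vprod G v (partial i \<phi>)))"

definition Hcurl :: "point set \<Rightarrow> cfield \<Rightarrow> bool" where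
  "Hcurl G w \<longleftrightarrow> L2_on G w \<and> (\<exists>c. has_weak_curl G w c)"

definition Hcurl_norm :: "point set \<Rightarrow> cfield \<Rightarrow> real" where
  "Hcurl_norm G w = sqrt ((L2_norm G w)\<^sup>2 + (L2_norm G (wcurl G w))\<^sup>2)"

text \<open>
  The tangential trace \<open>w \<times> n\<close> of a field in \<open>H(curl)\<close> of a bounded Lipschitz domain is the
  functional defined by Green's formula, up to sign
  \<open>\<phi> \<mapsto> (curl w, \<phi>) - (w, curl \<phi>)\<close> with \<open>\<phi>\<close> smooth up to the boundary. No support condition
  on \<open>\<phi>\<close> is needed since the domain is bounded.
\<close>

definition H0curl :: "point set \<Rightarrow> cfield \<Rightarrow> bool" where
  "H0curl G w \<longleftrightarrow> Hcurl G w \<and>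
     (\<forall>\<phi>. smooth \<phi> \<longrightarrow> vprod G (wcurl G w) \<phi> - vprod G w (classical_curl \<phi>) = 0)"


section \<open>The domain, the partition and piecewise polynomial functions\<close>

text \<open>Locally, in the direction \<open>e\<close>, the domain is the set below a Lipschitz graph over the plane
  orthogonal to \<open>e\<close>.\<close>

definition lipschitz_boundary :: "point set \<Rightarrow> bool" where
  "lipschitz_boundary Om \<longleftrightarrow>
     (\<forall>x\<in>frontier Om. \<exists>e r L. \<exists>\<gamma>::point \<Rightarrow> real. norm e = 1 \<and> r > 0 \<and> L-lipschitz_on UNIV \<gamma> \<and>
        (\<forall>y\<in>ball x r. y \<in> Om \<longleftrightarrow> y \<bullet> e < \<gamma> (y - (y \<bullet> e) *\<^sub>R e)))"

definition polyhedral :: "point set \<Rightarrow> bool" where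
  "polyhedral Om \<longleftrightarrow> (\<exists>F. finite F \<and> (\<forall>P\<in>F. polytope P) \<and> closure Om = \<Union>F)"

text \<open>The subdomains cover the domain up to a null set, so that a function prescribed on each of
  them is an element of \<open>L\<^sup>\<infinity>\<close> of the domain.\<close>

definition is_partition :: "point set \<Rightarrow> ('l::finite \<Rightarrow> point set) \<Rightarrow> bool" where
  "is_partition Om P \<longleftrightarrow>
     (\<forall>k. open (P k) \<and> connected (P k) \<and> P k \<noteq> {} \<and> P k \<subseteq> Om) \<and>
     (\<forall>j k. j \<noteq> k \<longrightarrow> P j \<inter> P k = {}) \<and>
     closure Om = (\<Union>k. closure (P k)) \<and>
     negligible (Om - (\<Union>k. P k))"

definition piecewise_polynomial ::
    "('l::finite \<Rightarrow> point set) \<Rightarrow> (point \<Rightarrow> 'b::euclidean_space) \<Rightarrow> bool" where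
  "piecewise_polynomial P g \<longleftrightarrow>
     (\<forall>k. \<exists>p. polynomial_function p \<and> (AE x in lebesgue_on (P k). g x = p x))"


section \<open>Meshes\<close>

definition conforming_mesh :: "point set \<Rightarrow> point set set \<Rightarrow> bool" where
  "conforming_mesh Om \<T> \<longleftrightarrow> triangulation \<T> \<and> (\<forall>T\<in>\<T>. 3 simplex T) \<and> \<Union>\<T> = closure Om"

definition mesh_refines :: "point set set \<Rightarrow> point set set \<Rightarrow> bool" where
  "mesh_refines \<T> \<T>0 \<longleftrightarrow> (\<forall>T\<in>\<T>. \<exists>T0\<in>\<T>0. T \<subseteq> T0)"

definition resolves_partition :: "('l::finite \<Rightarrow> point set) \<Rightarrow> point set set \<Rightarrow> bool" where
  "resolves_partition P \<T> \<longleftrightarrow> (\<forall>T\<in>\<T>. \<exists>k. T \<subseteq> closure (P k))"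

text \<open>Uniformly over the collection, each element contains a ball of radius comparable to its
  diameter.\<close>

definition shape_regular :: "point set set set \<Rightarrow> bool" where
  "shape_regular \<TT> \<longleftrightarrow>
     (\<exists>\<kappa>>0. \<forall>\<T>\<in>\<TT>. \<forall>T\<in>\<T>. \<exists>x r. 0 < r \<and> cball x r \<subseteq> T \<and> diameter T \<le> \<kappa> * r)"

definition faces :: "point set \<Rightarrow> point set set" where
  "faces T = {S. S facet_of T}"

definition interior_faces :: "point set \<Rightarrow> point set \<Rightarrow> point set set" where
  "interior_faces Om T = {S \<in> faces T. \<not> S \<subseteq> frontier Om}"

definition neighbours :: "point set set \<Rightarrow> point set \<Rightarrow> point set set" where
  "neighbours \<T> T = {T' \<in> \<T>. faces T \<inter> faces T' \<noteq> {}}"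

definition outer_normal :: "point set \<Rightarrow> point set \<Rightarrow> point" where
  "outer_normal T S = (THE n. norm n = 1 \<and> (\<forall>x\<in>S. \<forall>y\<in>T. n \<bullet> (y - x) \<le> 0))"

text \<open>Surface integral over a triangle, pulled back to the reference triangle; the value does not
  depend on the chosen numbering of the vertices.\<close>

definition face_integral :: "point set \<Rightarrow> (point \<Rightarrow> real) \<Rightarrow> real" where
  "face_integral S g =
     (let (p, q, r) = (SOME (p, q, r). S = convex hull {p, q, r}) in
        norm (cross3 (q - p) (r - p)) *
        (LINT z|lebesgue_on {z::real \<times> real. 0 \<le> fst z \<and> 0 \<le> snd z \<and> fst z + snd z \<le> 1}.
           g (p + fst z *\<^sub>R (q - p) + snd z *\<^sub>R (r - p))))"

definition face_L2_norm :: "point set \<Rightarrow> (point \<Rightarrow> 'b::euclidean_space) \<Rightarrow> real" where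
  "face_L2_norm S g = sqrt (face_integral S (\<lambda>x. (norm (g x))\<^sup>2))"

text \<open>
  The one-sided limits are essential limits (null sets of parameters \<open>t\<close> are ignored). They agree
  with ordinary limits whenever these exist. For a function in \<open>H\<^sup>1\<close> of an element they exist at
  almost every point of a face, do not depend there on the representative, and give the trace.
\<close>

definition ess_at_right_0 :: "real filter" where
  "ess_at_right_0 = inf (at_right 0) (ae_filter lborel)"

definition jump :: "point \<Rightarrow> (point \<Rightarrow> 'b::euclidean_space) \<Rightarrow> point \<Rightarrow> 'b" where
  "jump n v x = Lim ess_at_right_0 (\<lambda>t. v (x - t *\<^sub>R n)) - Lim ess_at_right_0 (\<lambda>t. v (x + t *\<^sub>R n))"

definition normal_jump :: "point set \<Rightarrow> point set \<Rightarrow> cfield \<Rightarrow> point \<Rightarrow> complex" where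
  "normal_jump T S v =
     (let n = outer_normal T S in jump n (\<lambda>x. cdot (v x) (of_real_vec n)))"

definition tangential_jump :: "point set \<Rightarrow> point set \<Rightarrow> cfield \<Rightarrow> cfield" where
  "tangential_jump T S v =
     (let n = outer_normal T S in jump n (\<lambda>x. ccross (v x) (of_real_vec n)))"

text \<open>\<open>v = a + x \<times> b\<close> on each element.\<close>

definition Nedelec_space :: "point set \<Rightarrow> point set set \<Rightarrow> cfield \<Rightarrow> bool" where
  "Nedelec_space Om \<T> v \<longleftrightarrow> H0curl Om v \<and>
     (\<forall>T\<in>\<T>. \<exists>a b. AE x in lebesgue_on T. v x = a + ccross (of_real_vec x) b)"


section \<open>The control problem and its discretization\<close>

definition eps_sig :: "real \<Rightarrow> (point \<Rightarrow> real) \<Rightarrow> (point \<Rightarrow> real) \<Rightarrow> point \<Rightarrow> complex" where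
  "eps_sig \<omega> \<epsilon> \<sigma> x = complex_of_real (\<epsilon> x) + \<i> * complex_of_real (\<sigma> x) * inverse (complex_of_real \<omega>)"

definition ctrl_coeff ::
    "('l::finite \<Rightarrow> point set) \<Rightarrow> (point \<Rightarrow> complex) \<Rightarrow> real^'l \<Rightarrow> point \<Rightarrow> complex" where
  "ctrl_coeff P \<epsilon>\<sigma> u x = (\<Sum>k\<in>UNIV. if x \<in> P k then complex_of_real (u $ k) * \<epsilon>\<sigma> x else 0)"

definition state_form ::
    "point set \<Rightarrow> ('l::finite \<Rightarrow> point set) \<Rightarrow> real \<Rightarrow> (point \<Rightarrow> real) \<Rightarrow> (point \<Rightarrow> complex) \<Rightarrow>
     real^'l \<Rightarrow> cfield \<Rightarrow> cfield \<Rightarrow> complex" where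
  "state_form Om P \<omega> \<mu> \<epsilon>\<sigma> u y w =
     vprod Om (\<lambda>x. inverse (\<mu> x) *\<^sub>R wcurl Om y x) (wcurl Om w)
     - complex_of_real (\<omega>\<^sup>2) * vprod Om (\<lambda>x. ctrl_coeff P \<epsilon>\<sigma> u x *s y x) w"

definition is_state ::
    "point set \<Rightarrow> ('l::finite \<Rightarrow> point set) \<Rightarrow> real \<Rightarrow> (point \<Rightarrow> real) \<Rightarrow> (point \<Rightarrow> complex) \<Rightarrow>
     cfield \<Rightarrow> real^'l \<Rightarrow> cfield \<Rightarrow> bool" where
  "is_state Om P \<omega> \<mu> \<epsilon>\<sigma> f u y \<longleftrightarrow>
     H0curl Om y \<and> (\<forall>w. H0curl Om w \<longrightarrow> state_form Om P \<omega> \<mu> \<epsilon>\<sigma> u y w = vprod Om f w)"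

definition is_discrete_state ::
    "point set \<Rightarrow> ('l::finite \<Rightarrow> point set) \<Rightarrow> real \<Rightarrow> (point \<Rightarrow> real) \<Rightarrow> (point \<Rightarrow> complex) \<Rightarrow>
     cfield \<Rightarrow> point set set \<Rightarrow> real^'l \<Rightarrow> cfield \<Rightarrow> bool" where
  "is_discrete_state Om P \<omega> \<mu> \<epsilon>\<sigma> f \<T> u y \<longleftrightarrow>
     Nedelec_space Om \<T> y \<and>
     (\<forall>w. Nedelec_space Om \<T> w \<longrightarrow> state_form Om P \<omega> \<mu> \<epsilon>\<sigma> u y w = vprod Om f w)"

definition J_functional ::
    "point set \<Rightarrow> cfield \<Rightarrow> cfield \<Rightarrow> real \<Rightarrow> cfield \<Rightarrow> real^'l::finite \<Rightarrow> real" where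
  "J_functional Om yOm EOm \<alpha> y u =
     1/2 * (L2_norm Om (\<lambda>x. y x - yOm x))\<^sup>2
     + 1/2 * (L2_norm Om (\<lambda>x. wcurl Om y x - EOm x))\<^sup>2
     + \<alpha>/2 * (norm u)\<^sup>2"

text \<open>The state is determined up to a null set, hence the value of the reduced functionals does not
  depend on the chosen representative.\<close>

definition reduced_j ::
    "point set \<Rightarrow> ('l::finite \<Rightarrow> point set) \<Rightarrow> real \<Rightarrow> (point \<Rightarrow> real) \<Rightarrow> (point \<Rightarrow> complex) \<Rightarrow>
     cfield \<Rightarrow> cfield \<Rightarrow> cfield \<Rightarrow> real \<Rightarrow> real^'l \<Rightarrow> real" where
  "reduced_j Om P \<omega> \<mu> \<epsilon>\<sigma> f yOm EOm \<alpha> u =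
     J_functional Om yOm EOm \<alpha> (SOME y. is_state Om P \<omega> \<mu> \<epsilon>\<sigma> f u y) u"

definition discrete_reduced_j ::
    "point set \<Rightarrow> ('l::finite \<Rightarrow> point set) \<Rightarrow> real \<Rightarrow> (point \<Rightarrow> real) \<Rightarrow> (point \<Rightarrow> complex) \<Rightarrow>
     cfield \<Rightarrow> cfield \<Rightarrow> cfield \<Rightarrow> real \<Rightarrow> point set set \<Rightarrow> real^'l \<Rightarrow> real" where
  "discrete_reduced_j Om P \<omega> \<mu> \<epsilon>\<sigma> f yOm EOm \<alpha> \<T> u =
     J_functional Om yOm EOm \<alpha> (SOME y. is_discrete_state Om P \<omega> \<mu> \<epsilon>\<sigma> f \<T> u y) u"

definition admissible :: "real^'l::finite \<Rightarrow> real^'l \<Rightarrow> (real^'l) set" where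
  "admissible a b = {v. \<forall>k. a $ k \<le> v $ k \<and> v $ k \<le> b $ k}"

definition local_min_on :: "('b::real_normed_vector) set \<Rightarrow> ('b \<Rightarrow> real) \<Rightarrow> 'b \<Rightarrow> bool" where
  "local_min_on U F u \<longleftrightarrow> u \<in> U \<and> (\<exists>\<rho>>0. \<forall>v\<in>U. norm (v - u) < \<rho> \<longrightarrow> F u \<le> F v)"


section \<open>Error indicator and oscillation\<close>

definition indicator1_sq ::
    "point set \<Rightarrow> ('l::finite \<Rightarrow> point set) \<Rightarrow> real \<Rightarrow> (point \<Rightarrow> complex) \<Rightarrow> cfield \<Rightarrow>
     real^'l \<Rightarrow> cfield \<Rightarrow> point set \<Rightarrow> real" where
  "indicator1_sq Om P \<omega> \<epsilon>\<sigma> f uh yh T =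
     (let q = (\<lambda>x. f x + (complex_of_real (\<omega>\<^sup>2) * ctrl_coeff P \<epsilon>\<sigma> uh x) *s yh x) in
        (diameter T)\<^sup>2 * (L2_norm T (wdiv T q))\<^sup>2
        + diameter T / 2 * (\<Sum>S\<in>interior_faces Om T. (face_L2_norm S (normal_jump T S q))\<^sup>2))"

definition indicator2_sq ::
    "point set \<Rightarrow> ('l::finite \<Rightarrow> point set) \<Rightarrow> real \<Rightarrow> (point \<Rightarrow> real) \<Rightarrow> (point \<Rightarrow> complex) \<Rightarrow>
     cfield \<Rightarrow> real^'l \<Rightarrow> cfield \<Rightarrow> point set \<Rightarrow> real" where
  "indicator2_sq Om P \<omega> \<mu> \<epsilon>\<sigma> f uh yh T =
     (let z = (\<lambda>x. inverse (\<mu> x) *\<^sub>R wcurl Om yh x) in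
        (diameter T)\<^sup>2 * (L2_norm T (\<lambda>x. f x - wcurl T z x
            + (complex_of_real (\<omega>\<^sup>2) * ctrl_coeff P \<epsilon>\<sigma> uh x) *s yh x))\<^sup>2
        + diameter T / 2 * (\<Sum>S\<in>interior_faces Om T. (face_L2_norm S (tangential_jump T S z))\<^sup>2))"

definition indicator_st ::
    "point set \<Rightarrow> ('l::finite \<Rightarrow> point set) \<Rightarrow> real \<Rightarrow> (point \<Rightarrow> real) \<Rightarrow> (point \<Rightarrow> complex) \<Rightarrow>
     cfield \<Rightarrow> real^'l \<Rightarrow> cfield \<Rightarrow> point set \<Rightarrow> real" where
  "indicator_st Om P \<omega> \<mu> \<epsilon>\<sigma> f uh yh T =
     sqrt (indicator1_sq Om P \<omega> \<epsilon>\<sigma> f uh yh T + indicator2_sq Om P \<omega> \<mu> \<epsilon>\<sigma> f uh yh T)"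

definition proj0_vec :: "point set \<Rightarrow> cfield \<Rightarrow> complex^3" where
  "proj0_vec T v = (THE c. \<forall>q. vprod T (\<lambda>x. v x - c) (\<lambda>_. q) = 0)"

definition proj0_scal :: "point set \<Rightarrow> (point \<Rightarrow> complex) \<Rightarrow> complex" where
  "proj0_scal T g = (THE c. \<forall>q. sprod T (\<lambda>x. g x - c) (\<lambda>_. q) = 0)"

definition pw_proj0_vec :: "point set set \<Rightarrow> cfield \<Rightarrow> cfield" where
  "pw_proj0_vec \<T> v x = proj0_vec (THE T. T \<in> \<T> \<and> x \<in> interior T) v"

definition oscillation :: "point set \<Rightarrow> point set set \<Rightarrow> cfield \<Rightarrow> point set \<Rightarrow> real" where
  "oscillation Om \<T> v T =
     (\<Sum>T'\<in>neighbours \<T> T.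
        diameter T' * L2_norm T' (\<lambda>x. v x - proj0_vec T' v)
        + diameter T' * L2_norm T' (\<lambda>x. wdiv T' v x - proj0_scal T' (wdiv T' v)))
     + (\<Sum>S\<in>interior_faces Om T.
          sqrt (diameter T) * face_L2_norm S (normal_jump T S (\<lambda>x. v x - pw_proj0_vec \<T> v x)))"

end

theory Submission
  imports Defs "HOL-Real_Asymp.Real_Asymp"
begin

text \<open>
Testing the state equation with smooth fields shows that the residual of the discrete state is
bounded, on the patch, by the control and state errors; testing with gradients bounds the residual
of the divergence equation in the same way. All test functions are a fixed smooth radial bump times
a polynomial: a polynomial of bounded degree is controlled on a ball by its integral against a bump
on a smaller concentric ball, which replaces the usual element and face bubbles. On an element one
multiplies the bump by the elementwise residual with the data replaced by its mean. On a face the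
bump is centred at the centroid, where shape regularity leaves half balls in both neighbours, and
the jump is extended constantly in the normal direction. The jump of the non-polynomial datum
needs traces of \<open>H\<^sup>1\<close> functions as essential limits along normals together with Green's formula;
both follow by integrating the weak normal derivative along lines. The factor in front of the
control error contains the norm of the exact state, which the imaginary part of the coefficient
bounds uniformly over admissible controls.
\<close>

text \<open>The constant has to be chosen before the mesh, so every estimate is reduced to
  translations and dilations of one ball. Shape regularity provides a ball of radius
  \<open>r0\<close> in each element. An affine function with values between 0 and 1 on the element
  has gradient at most 1 / (2 r0), so the barycentric coordinates belonging to a face stay positive
  within 2 r0 / 3 of its centroid. This places half balls on both sides of an interior face without
  mapping to a reference element. Polynomial degrees are bounded once and for all, because the
  Nedelec field has degree one on an element and there are finitely many subdomains. A second
  obstacle is that elements are closed while the domain is open: the Lipschitz condition gives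
  \<open>interior (closure Om) = Om\<close>, so interiors of elements lie in the domain and the rest
  of an element is a null set. Finally, the jump of the datum is not known beforehand to be square
  integrable over the whole face; the normal jump estimate therefore distinguishes two
  cases.\<close>

lemmas continuous_borel = borel_measurable_continuous_onI

section \<open>Smooth functions\<close>

text \<open>The derivative is existentially quantified, so that closure under sums, products and
  affine substitution produces it along with the proof.\<close>

primrec C1k :: "nat => (real => real) => bool" where
 "C1k 0 g \<longleftrightarrow> continuous_on UNIV g"
| "C1k (Suc k) g \<longleftrightarrow> (EX g'. (ALL t. (g has_real_derivative g' t) (at t)) & C1k k g')"

definition smooth1 :: "(real => real) => bool" where
 "smooth1 g \<longleftrightarrow> (ALL k. C1k k g)"

lemma C1k_Suc: "C1k (Suc k) g ==> C1k k g"
proof (induction k arbitrary: g)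
 case 0
 then show ?case by (metis C1k.simps continuous_at_imp_continuous_on DERIV_isCont)
next
 case (Suc k)
 then show ?case by (metis C1k.simps(2))
qed

lemma C1k_const [simp]: "C1k k (%_. c)" by (induction k arbitrary: c) (auto intro!: exI[of _ "%_. 0"])

lemma C1k_add: "C1k k f ==> C1k k g ==> C1k k (%t. f t + g t)"
proof (induction k arbitrary: f g)
 case (Suc k)
 then obtain f' g' where "ALL t. (f has_real_derivative f' t) (at t)" "C1k k f'"
   "ALL t. (g has_real_derivative g' t) (at t)" "C1k k g'" by auto
 then show ?case using Suc.IH[of f' g'] by (auto intro!: exI[of _ "%t. f' t + g' t"] DERIV_add)
qed (auto intro: continuous_intros)

lemma C1k_mult: "C1k k f ==> C1k k g ==> C1k k (%t. f t * g t)"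
proof (induction k arbitrary: f g)
 case (Suc k)
 then obtain f' g' where d: "ALL t. (f has_real_derivative f' t) (at t)" "C1k k f'"
   "ALL t. (g has_real_derivative g' t) (at t)" "C1k k g'" by auto
 have "C1k k (%t. f' t * g t + g' t * f t)" using d Suc.prems[THEN C1k_Suc] by (intro C1k_add Suc.IH)
 then show ?case unfolding C1k.simps using d
  by (intro exI[of _ "%t. f' t * g t + g' t * f t"] conjI allI DERIV_mult) simp_all
qed (auto intro: continuous_intros)

lemma C1k_affine: "C1k k g ==> C1k k (%t. g (a * t + b))"
proof (induction k arbitrary: g)
 case 0
 then show ?case by (auto intro!: continuous_on_compose2[of UNIV g] continuous_intros)
next
 case (Suc k)
 then obtain g' where d: "ALL t. (g has_real_derivative g' t) (at t)" "C1k k g'" by auto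
 have "((%t. g (a * t + b)) has_real_derivative g' (a * t + b) * a) (at t)" for t
  by (rule DERIV_chain2[of g]) (use d in \<open>auto intro!: derivative_eq_intros\<close>)
 moreover have "C1k k (%t. g' (a * t + b) * a)" using Suc.IH d by (intro C1k_mult) auto
 ultimately show ?case by (auto intro!: exI[of _ "%t. g' (a * t + b) * a"])
qed

lemma smooth1_mult: "smooth1 f ==> smooth1 g ==> smooth1 (%t. f t * g t)" by (simp add: smooth1_def C1k_mult)

lemma smooth1_affine: "smooth1 g ==> smooth1 (%t. g (a * t + b))" by (simp add: smooth1_def C1k_affine)

lemma smooth1_antideriv:
 assumes "!!t. (g has_real_derivative g' t) (at t)" "smooth1 g'"
 shows "smooth1 g"
 unfolding smooth1_def
proof
 fix k show "C1k k g" using assms C1k_Suc[of k g] by (auto simp: smooth1_def)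
qed

lemma smooth1_continuous: "smooth1 g ==> continuous_on UNIV g" unfolding smooth1_def by (metis C1k.simps(1))

section \<open>Smooth cutoffs in one variable\<close>

definition flat_exp :: "nat => real => real" where
 "flat_exp n s = (if s > 0 then (1 / s) ^ n * exp (- (1 / s)) else 0)"

lemma flat_exp_tendsto_0: "((%h. flat_exp n h) \<longlongrightarrow> 0) (at 0)"
proof -
 have "((%h::real. flat_exp n h) \<longlongrightarrow> 0) (at_right 0)"
 proof -
  have "((%h::real. (inverse h) ^ n / exp (inverse h)) \<longlongrightarrow> 0) (at_right 0)"
   by (rule filterlim_compose[OF tendsto_power_div_exp_0 filterlim_inverse_at_top_right])
  moreover have "\<forall>\<^sub>F h::real in at_right 0. (inverse h) ^ n / exp (inverse h) = flat_exp n h"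
   unfolding eventually_at_right_field by (intro exI[of _ 1]) (auto simp: flat_exp_def exp_minus field_simps)
  ultimately show ?thesis using tendsto_cong by fast
 qed
 moreover have "((%h::real. flat_exp n h) \<longlongrightarrow> 0) (at_left 0)"
 proof -
  have "\<forall>\<^sub>F h::real in at_left 0. 0 = flat_exp n h" unfolding eventually_at_left_field
   by (intro exI[of _ "-1"]) (auto simp: flat_exp_def)
  then show ?thesis using tendsto_cong[of "%_. 0" "flat_exp n"] by auto
 qed
 ultimately show ?thesis by (simp add: filterlim_at_split)
qed

text \<open>The functions s^(-n) exp(-1/s), continued by 0, are closed under differentiation up to
  linear combinations, so smoothness of exp(-1/s) comes from one induction over all \<open>n\<close>
  together. Only s = 0 is delicate.\<close>

lemma flat_exp_DERIV:
 "(flat_exp n has_real_derivative (- real n * flat_exp (Suc n) s + flat_exp (Suc (Suc n)) s)) (at s)"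
proof -
 consider "s > 0" | "s < 0" | "s = 0" by linarith
 then show ?thesis
 proof cases
  case 1
  have "((%s. (1 / s) ^ n * exp (- (1 / s))) has_real_derivative
      (- real n * flat_exp (Suc n) s + flat_exp (Suc (Suc n)) s)) (at s)"
   using 1 by (cases n) (auto intro!: derivative_eq_intros
     simp: flat_exp_def field_simps power2_eq_square,
     metis One_nat_def mult.commute neq0_conv power_minus_mult)
  then show ?thesis
  proof (rule has_field_derivative_transform_within_open[where S = "{0<..}"])
   show "!!x. x : {0<..} ==> (1 / x) ^ n * exp (- (1 / x)) = flat_exp n x" by (simp add: flat_exp_def)
  qed (use 1 in auto)
 next
  case 2
  have "((%s. 0) has_real_derivative
      (- real n * flat_exp (Suc n) s + flat_exp (Suc (Suc n)) s)) (at s)"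
   using 2 by (auto intro!: derivative_eq_intros simp: flat_exp_def)
  then show ?thesis
  proof (rule has_field_derivative_transform_within_open[where S = "{..<0}"])
   show "!!x. x : {..<0} ==> 0 = flat_exp n x" by (simp add: flat_exp_def)
  qed (use 2 in auto)
 next
  case 3
  \<comment> \<open>The difference quotient of \<open>flat_exp n\<close> at 0 is literally
    \<open>flat_exp (Suc n) h\<close>: both vanish for h <= 0, and otherwise the division by h
    raises the exponent of 1/h by one.\<close>
  have "((%h. flat_exp (Suc n) h) \<longlongrightarrow> 0) (at 0)" by (rule flat_exp_tendsto_0)
  then have "((%h. (flat_exp n (0 + h) - flat_exp n 0) / h) \<longlongrightarrow> 0) (at 0)"
   by (rule Lim_transform_eventually)
    (auto simp: eventually_at_topological flat_exp_def intro!: exI[of _ UNIV])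
  then show ?thesis using 3 by (simp add: DERIV_def flat_exp_def)
 qed
qed

lemma C1k_flat_exp: "C1k k (flat_exp n)"
proof (induction k arbitrary: n)
 case 0
 then show ?case by (auto intro!: continuous_at_imp_continuous_on DERIV_isCont flat_exp_DERIV)
next
 case (Suc k)
 have "C1k k (%s. - real n * flat_exp (Suc n) s + flat_exp (Suc (Suc n)) s)" by (intro C1k_add C1k_mult C1k_const Suc)
 then show ?case unfolding C1k.simps
  by (intro exI[of _ "%s. - real n * flat_exp (Suc n) s + flat_exp (Suc (Suc n)) s"] conjI allI flat_exp_DERIV)
qed

abbreviation flat :: "real => real" where "flat \<equiv> flat_exp 0"

lemma smooth1_flat: "smooth1 flat" by (simp add: smooth1_def C1k_flat_exp)

lemma flat_bounds: "0 <= flat s" "flat s <= 1" "flat s > 0 \<longleftrightarrow> s > 0" "s <= 0 ==> flat s = 0"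
 by (auto simp: flat_exp_def)

lemma flat_mono: "s <= t ==> flat s <= flat t" by (auto simp: flat_exp_def frac_le)

lemma flat_scaled_LIMSEQ:
 assumes "s > 0" shows "(%k. flat (real k * s - 1)) \<longlonglongrightarrow> 1"
proof -
 have lim: "filterlim (%k. real k * s - 1) at_top sequentially" using assms by real_asymp
 have "((%u::real. exp (- (1 / u))) \<longlongrightarrow> 1) at_top" by real_asymp
 then have "(%k. exp (- (1 / (real k * s - 1)))) \<longlonglongrightarrow> 1" by (rule filterlim_compose[OF _ lim])
 moreover have "\<forall>\<^sub>F k in sequentially. exp (- (1 / (real k * s - 1))) = flat (real k * s - 1)"
  using filterlim_at_top_dense[THEN iffD1, OF lim, rule_format, of 0] by eventually_elim (auto simp: flat_exp_def)
 ultimately show ?thesis using tendsto_cong by fast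
qed

text \<open>Smooth functions with values in [0, 1] that tend pointwise to the indicator of the open
  interval. The shift by 1 inside \<open>flat\<close> keeps the support in [a + 1/k, b - 1/k], hence
  compactly inside the interval; for k = 0 the function vanishes.\<close>

definition box_bump :: "nat => real => real => real => real" where
 "box_bump k a b t = flat (real k * (t - a) - 1) * flat (real k * (b - t) - 1)"

lemma smooth1_box_bump: "smooth1 (box_bump k a b)"
proof -
 have "smooth1 (%t. flat (real k * t + (- real k * a - 1)) * flat ((- real k) * t + (real k * b - 1)))"
  by (intro smooth1_mult smooth1_affine smooth1_flat)
 then show ?thesis by (simp add: box_bump_def[abs_def] algebra_simps)
qed

lemma box_bump_bounds: "0 <= box_bump k a b t" "box_bump k a b t <= 1"
 by (auto simp: box_bump_def flat_bounds intro!: mult_nonneg_nonneg mult_le_one)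

lemma box_bump_zero: "\<not> (a + 1 / real k <= t & t <= b - 1 / real k) ==> box_bump k a b t = 0"
 by (cases "k = 0") (auto simp: box_bump_def not_le field_simps flat_bounds(4))

lemma box_bump_zero': "t ~: {a<..<b} ==> box_bump k a b t = 0"
proof -
 have "t <= a ==> real k * (t - a) - 1 <= 0" "b <= t ==> real k * (b - t) - 1 <= 0"
  by (smt (verit) mult_nonneg_nonpos of_nat_0_le_iff)+
 then show "t ~: {a<..<b} ==> box_bump k a b t = 0" by (auto simp: box_bump_def flat_bounds(4) not_less)
qed

lemma box_bump_LIMSEQ: "(%k. box_bump k a b t) \<longlonglongrightarrow> indicator {a<..<b} t"
proof (cases "t : {a<..<b}")
 case True
 then have "(%k. box_bump k a b t) \<longlonglongrightarrow> 1 * 1"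
  unfolding box_bump_def by (intro tendsto_mult flat_scaled_LIMSEQ) auto
 then show ?thesis using True by simp
qed (simp add: box_bump_zero')

section \<open>Partial derivatives and smoothness in three variables\<close>

lemma partial_eq: "(phi has_derivative D) (at x) ==> partial i phi x = D (axis i 1)"
 by (simp add: partial_def frechet_derivative_at[symmetric])

lemma frechet_axis: "frechet_derivative phi (at x) (axis i 1) = partial i phi x" by (simp add: partial_def)

lemma Ck_Suc: "Ck (Suc k) phi ==> Ck k phi"
proof (induction k arbitrary: phi)
 case 0
 then show ?case by (auto intro!: continuous_at_imp_continuous_on differentiable_imp_continuous_within)
qed auto

lemma has_deriv_Ck: "Ck (Suc k) phi ==> (phi has_derivative frechet_derivative phi (at x)) (at x)"
 by (simp add: frechet_derivative_works[symmetric])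

lemma Ck_const [simp]: "Ck k (%_. c)"
proof (induction k arbitrary: c)
 case (Suc k)
 have "partial i (%_. c) = (%_. 0)" for i by (rule ext) (simp add: partial_eq[OF has_derivative_const])
 then show ?case using Suc by simp
qed auto

lemma Ck_add: "Ck k f ==> Ck k g ==> Ck k (%x. f x + g x)"
proof (induction k arbitrary: f g)
 case (Suc k)
 have "partial i (%x. f x + g x) = (%x. partial i f x + partial i g x)" for i
  by (intro ext) (simp add: partial_eq[OF has_derivative_add[OF has_deriv_Ck[OF Suc.prems(1)]
     has_deriv_Ck[OF Suc.prems(2)]]] frechet_axis)
 then show ?case using Suc by auto
qed (auto intro: continuous_intros)

lemma partial_bilinear:
 assumes "bounded_bilinear pr" "f differentiable at x" "g differentiable at x"
 shows "partial i (%x. pr (f x) (g x)) x = pr (f x) (partial i g x) + pr (partial i f x) (g x)"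
 using bounded_bilinear.FDERIV[OF assms(1) frechet_derivative_works[THEN iffD1, OF assms(2)]
   frechet_derivative_works[THEN iffD1, OF assms(3)]] by (simp add: partial_eq frechet_axis)

lemma partial_linear:
 assumes "bounded_linear h" "f differentiable at x"
 shows "partial i (%x. h (f x)) x = h (partial i f x)"
 using bounded_linear.has_derivative[OF assms(1) frechet_derivative_works[THEN iffD1, OF assms(2)]]
 by (simp add: partial_eq frechet_axis)

lemma Ck_bilinear:
 assumes "bounded_bilinear pr"
 shows "Ck k f ==> Ck k g ==> Ck k (%x. pr (f x) (g x))"
proof (induction k arbitrary: f g)
 case 0
 then show ?case by (auto intro: bounded_bilinear.continuous_on[OF assms])
next
 case (Suc k)
 have "(%x. pr (f x) (g x)) differentiable at x" for x
  using bounded_bilinear.FDERIV[OF assms has_deriv_Ck[OF Suc.prems(1)] has_deriv_Ck[OF Suc.prems(2)]]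
  by (auto simp: differentiable_def)
 moreover have "partial i (%x. pr (f x) (g x))
   = (%x. pr (f x) (partial i g x) + pr (partial i f x) (g x))" for i
  using Suc.prems by (intro ext partial_bilinear assms) auto
 moreover have "Ck k (%x. pr (f x) (partial i g x) + pr (partial i f x) (g x))" for i
  using Suc.prems Suc.prems[THEN Ck_Suc] by (intro Ck_add Suc.IH) simp_all
 ultimately show ?case by simp
qed

lemma Ck_linear:
 assumes "bounded_linear h"
 shows "Ck k f ==> Ck k (%x. h (f x))"
proof (induction k arbitrary: f)
 case 0
 then show ?case by (auto intro: bounded_linear.continuous_on[OF assms])
next
 case (Suc k)
 have "(%x. h (f x)) differentiable at x" for x
  using bounded_linear.has_derivative[OF assms has_deriv_Ck[OF Suc.prems]] by (auto simp: differentiable_def)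
 moreover have "partial i (%x. h (f x)) = (%x. h (partial i f x))" for i
  using Suc.prems by (intro ext partial_linear assms) auto
 ultimately show ?case using Suc by simp
qed

lemma Ck_id_linear: "bounded_linear h ==> Ck k h"
proof (induction k)
 case 0
 then show ?case by (simp add: linear_continuous_on)
next
 case (Suc k)
 have "partial i h = (%_. h (axis i 1))" for i
  using Suc.prems by (intro ext partial_eq) (rule bounded_linear_imp_has_derivative)
 then show ?case using Suc.prems by (auto intro: bounded_linear_imp_differentiable)
qed

lemma partial_comp:
 fixes phi :: "point => real"
 assumes "(g has_real_derivative g') (at (phi x))" "phi differentiable at x"
 shows "partial i (%x. g (phi x)) x = g' * partial i phi x"
 using has_derivative_compose[OF frechet_derivative_works[THEN iffD1, OF assms(2)]
   assms(1)[unfolded has_field_derivative_def]] by (simp add: partial_eq frechet_axis)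

lemma Ck_comp:
 fixes phi :: "point => real"
 shows "C1k k g ==> Ck k phi ==> Ck k (%x. g (phi x))"
proof (induction k arbitrary: g)
 case 0
 then show ?case by (auto intro: continuous_on_compose2[of UNIV g])
next
 case (Suc k)
 then obtain g' where g': "!!t. (g has_real_derivative g' t) (at t)" "C1k k g'" by auto
 have "(%x. g (phi x)) differentiable at x" for x using has_derivative_compose[OF has_deriv_Ck[OF Suc.prems(2)]
    g'(1)[unfolded has_field_derivative_def]] by (auto simp: differentiable_def)
 moreover have "partial i (%x. g (phi x)) = (%x. g' (phi x) * partial i phi x)" for i
  using Suc.prems(2) by (intro ext partial_comp[OF g'(1)]) simp
 moreover have "Ck k (%x. g' (phi x) * partial i phi x)" for i
  by (rule Ck_bilinear[OF bounded_bilinear_mult Suc.IH[OF g'(2) Ck_Suc[OF Suc.prems(2)]]])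
   (use Suc.prems(2) in simp)
 ultimately show ?case by simp
qed

lemma smooth_const [simp]: "smooth (%_. c)" by (simp add: smooth_def)

lemma smooth_add: "smooth f ==> smooth g ==> smooth (%x. f x + g x)" by (simp add: smooth_def Ck_add)

lemma smooth_bilinear: "bounded_bilinear pr ==> smooth f ==> smooth g ==> smooth (%x. pr (f x) (g x))"
 by (simp add: smooth_def Ck_bilinear)

lemmas smooth_mult = smooth_bilinear[OF bounded_bilinear_mult]
 and smooth_scaleR = smooth_bilinear[OF bounded_bilinear_scaleR]

lemma smooth_linear: "bounded_linear h ==> smooth f ==> smooth (%x. h (f x))" by (simp add: smooth_def Ck_linear)

lemma smooth_bounded_linear: "bounded_linear h ==> smooth h" by (simp add: smooth_def Ck_id_linear)

lemma smooth_comp: "smooth1 g ==> smooth phi ==> smooth (%x. g (phi x))" by (simp add: smooth_def smooth1_def Ck_comp)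

lemma smooth_minus: "smooth f ==> smooth (%x. - f x)"
 by (rule smooth_linear[OF bounded_linear_minus[OF bounded_linear_ident]])

lemma smooth_diff: "smooth f ==> smooth g ==> smooth (%x. f x - g x)"
 unfolding diff_conv_add_uminus by (intro smooth_add smooth_minus)

lemma smooth_sum: "(!!i. i : I ==> smooth (f i)) ==> smooth (%x. SUM i:I. f i x)"
 by (induction I rule: infinite_finite_induct) (auto intro: smooth_add)

lemma smooth_partial: "smooth f ==> smooth (partial i f)" unfolding smooth_def by (metis Ck.simps(2))

lemma smooth_differentiable: "smooth f ==> f differentiable at x" unfolding smooth_def by (metis Ck.simps(2))

lemma smooth_continuous: "smooth f ==> continuous_on UNIV f" unfolding smooth_def by (metis Ck.simps(1))

lemma partial_add: "smooth f ==> smooth g ==> partial i (%x. f x + g x) x = partial i f x + partial i g x"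
 using has_derivative_add[OF frechet_derivative_works[THEN iffD1, OF smooth_differentiable]
   frechet_derivative_works[THEN iffD1, OF smooth_differentiable], of f g x] by (simp add: partial_eq frechet_axis)

lemma partial_mult:
 fixes f g :: "point => 'b::real_normed_algebra"
 shows "smooth f ==> smooth g ==> partial i (%x. f x * g x) x = f x * partial i g x + partial i f x * g x"
 by (rule partial_bilinear[OF bounded_bilinear_mult]) (auto intro: smooth_differentiable)

lemma partial_scaleR:
 "smooth f ==> smooth g ==> partial i (%x. f x *\<^sub>R g x) x = f x *\<^sub>R partial i g x + partial i f x *\<^sub>R g x"
 by (rule partial_bilinear[OF bounded_bilinear_scaleR]) (auto intro: smooth_differentiable)

lemma partial_const [simp]: "partial i (%_. c) x = 0" by (simp add: partial_eq[OF has_derivative_const])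

lemma partial_zero_outside:
 assumes "closed K" "!!x. x ~: K ==> phi x = 0" "x ~: K"
 shows "partial i phi x = 0"
proof -
 have "(phi has_derivative (%_. 0)) (at x)"
  by (rule has_derivative_transform_within_open[OF has_derivative_const, of "- K" x 0 phi])
   (use assms in auto)
 then show ?thesis by (simp add: partial_eq)
qed

lemma test_funI:
 assumes "smooth phi" "compact K" "K <= interior G" "!!x. x ~: K ==> phi x = 0"
 shows "test_fun G phi"
proof -
 have "closure {x. phi x ~= 0} <= K" using assms by (intro closure_minimal) (auto simp: compact_imp_closed)
 then have "compact (closure {x. phi x ~= 0})" "closure {x. phi x ~= 0} <= interior G"
  using assms bounded_subset[OF compact_imp_bounded[of K]] by (auto simp: compact_eq_bounded_closed)
 then show ?thesis using assms(1) unfolding test_fun_def by blast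
qed

lemma test_funE:
 assumes "test_fun G phi"
 obtains K where "smooth phi" "compact K" "K <= interior G" "!!x. x ~: K ==> phi x = 0"
proof
 show "smooth phi" "compact (closure {x. phi x ~= 0})" "closure {x. phi x ~= 0} <= interior G"
  using assms unfolding test_fun_def by blast+
 show "phi x = 0" if "x ~: closure {x. phi x ~= 0}" for x using that closure_subset[of "{x. phi x ~= 0}"] by blast
qed

section \<open>Integration lemmas\<close>

lemma LINT_lebesgue_on:
 fixes u :: "'a::euclidean_space => 'b::{banach,second_countable_topology}"
 shows "G : sets lebesgue ==>
  (LINT x|lebesgue_on G. u x) = (LINT x|lebesgue. indicator G x *\<^sub>R u x)" by (simp add: integral_restrict_space)

lemma integrable_lebesgue_on_iff:
 fixes u :: "'a::euclidean_space => 'b::{banach,second_countable_topology}"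
 shows "G : sets lebesgue ==>
  integrable (lebesgue_on G) u \<longleftrightarrow> integrable lebesgue (%x. indicator G x *\<^sub>R u x)"
 by (simp add: integrable_restrict_space)

lemma AE_lebesgue_on_iff:
 "G : sets lebesgue ==> (AE x in lebesgue_on G. P x) \<longleftrightarrow> (AE x in lebesgue. x : G --> P x)"
 by (simp add: AE_restrict_space_iff)

lemma AE_lebesgue_iff: "(AE x in lebesgue. P x) \<longleftrightarrow> (AE x in lborel. P x)"
 by (rule AE_completion_iff)

lemma borel_measurable_AE_eq:
 fixes f g :: "'a::euclidean_space => 'b::topological_space"
 assumes f: "f : borel_measurable lebesgue" and ae: "AE x in lebesgue. f x = g x"
 shows "g : borel_measurable lebesgue"
proof (rule measurableI)
 fix A :: "'b set" assume A: "A : sets borel"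
 show "g -` A Int space lebesgue : sets lebesgue"
 proof (rule completion.in_sets_AE[where A = "f -` A Int space lebesgue"])
  show "AE x in lebesgue. x : f -` A Int space lebesgue \<longleftrightarrow> x : g -` A Int space lebesgue"
   using ae by eventually_elim auto
  show "f -` A Int space lebesgue : sets lebesgue" using measurable_sets[OF f A] by simp
 qed simp
qed simp

text \<open>Product measures and images under coordinate maps are handled with Borel functions, so
  Lebesgue measurable data pass through such a representative first.\<close>

lemma lebesgue_borel_representative:
 fixes f :: "'a::euclidean_space => 'b::euclidean_space"
 assumes f: "f : borel_measurable lebesgue"
 obtains f' where "f' : borel_measurable borel" "AE x in lborel. f x = f' x"
proof -
 have "EX h:borel_measurable lborel. AE x in lborel. f x \<bullet> b = h x" for b
  using f by (intro completion_ex_borel_measurable_real) (simp add: borel_measurable_inner)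
 then obtain h where h: "!!b. h b : borel_measurable lborel" "!!b. AE x in lborel. f x \<bullet> b = h b x" by metis
 have "AE x in lborel. ALL b:Basis. f x \<bullet> b = h b x" by (rule AE_finite_allI) (auto intro: h)
 then have "AE x in lborel. f x = (SUM b:Basis. h b x *\<^sub>R b)"
 proof eventually_elim
  case (elim x)
  have "f x = (SUM b:Basis. (f x \<bullet> b) *\<^sub>R b)" by (simp add: euclidean_representation)
  also have "... = (SUM b:Basis. h b x *\<^sub>R b)" using elim by (intro sum.cong) auto
  finally show ?case .
 qed
 moreover have "(%x. SUM b:Basis. h b x *\<^sub>R b) : borel_measurable borel"
  using h(1) by (intro borel_measurable_sum borel_measurable_scaleR) auto
 ultimately show thesis using that by blast
qed

lemma integrable_compact_support:
 fixes F :: "'a::euclidean_space => 'b::{banach,second_countable_topology}"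
 assumes "continuous_on UNIV F" "compact K" "!!x. x ~: K ==> F x = 0"
 shows "integrable lborel F"
proof -
 have "integrable lborel (%x. indicator K x *\<^sub>R F x)"
  using assms by (intro borel_integrable_compact) (auto intro: continuous_on_subset)
 moreover have "(%x. indicator K x *\<^sub>R F x) = F" using assms(3) by (auto simp: indicator_def)
 ultimately show ?thesis by simp
qed

lemma LINT_translate:
 fixes F :: "'a::euclidean_space => 'b::{banach,second_countable_topology}"
 assumes "F : borel_measurable borel"
 shows "(LINT x|lborel. F (x + c)) = (LINT x|lborel. F x)"
proof -
 have "(LINT x|lborel. F x) = (LINT x|distr lborel borel ((+) c). F x)" by (simp add: lborel_distr_plus)
 also have "... = (LINT x|lborel. F (c + x))" using assms by (subst integral_distr) auto
 finally show ?thesis by (simp add: add.commute)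
qed

section \<open>Integration by parts for smooth functions\<close>

lemma partial_vector_derivative:
 assumes "smooth F"
 shows "((%t. F (x + t *\<^sub>R axis i 1)) has_vector_derivative partial i F (x + t *\<^sub>R axis i 1)) (at t)"
proof -
 let ?y = "x + t *\<^sub>R axis i 1"
 have F: "(F has_derivative frechet_derivative F (at ?y)) (at ?y)"
  using smooth_differentiable[OF assms] by (simp add: frechet_derivative_works)
 have "((%t. x + t *\<^sub>R axis i 1) has_derivative (%s. s *\<^sub>R axis i 1)) (at t)"
  by (auto intro!: derivative_eq_intros)
 from has_derivative_compose[OF this F]
 have "((%t. F (x + t *\<^sub>R axis i 1)) has_derivative (%s. frechet_derivative F (at ?y) (s *\<^sub>R axis i 1))) (at t)" .
 moreover have "frechet_derivative F (at ?y) (s *\<^sub>R axis i 1) = s *\<^sub>R partial i F ?y" for s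
  using linear_scale[OF has_derivative_linear[OF F]] by (simp add: partial_def)
 ultimately show ?thesis by (simp add: has_vector_derivative_def)
qed

text \<open>Difference quotients integrate to zero by translation invariance. They converge to the
  partial derivative, and the mean value inequality dominates them by a constant on a ball; since
  the steps are at most 1, enlarging the radius of the support by 1 suffices.\<close>

lemma LINT_partial_zero:
 fixes F :: "point => 'b::euclidean_space"
 assumes F: "smooth F" and K: "compact K" "!!x. x ~: K ==> F x = 0"
 shows "(LINT x|lborel. partial i F x) = 0"
proof -
 define s where "s n = inverse (real (Suc n))" for n
 have s: "0 < s n" "s n <= 1" for n by (auto simp: s_def field_simps)
 have s0: "s \<longlonglongrightarrow> 0" unfolding s_def by (rule LIMSEQ_inverse_real_of_nat)
 define e :: point where "e = axis i 1"
 have ne: "norm e = 1" by (simp add: e_def)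
 define D where "D n x = (F (x + s n *\<^sub>R e) - F x) /\<^sub>R s n" for n x
 obtain R where R: "!!x. x : K ==> norm x <= R" using compact_imp_bounded[OF K(1)] by (auto simp: bounded_iff)
 have contP: "continuous_on UNIV (partial i F)" by (intro smooth_continuous smooth_partial F)
 have contF: "continuous_on UNIV F" by (rule smooth_continuous[OF F])
 have mF: "F : borel_measurable borel" "partial i F : borel_measurable borel"
  using contF contP by (auto intro: continuous_borel)
 have "compact (partial i F ` K)" by (intro compact_continuous_image continuous_on_subset[OF contP] K) auto
 then obtain B' where B': "!!x. x : K ==> norm (partial i F x) <= B'"
  using compact_imp_bounded by (force simp: bounded_iff)
 define B where "B = max B' 0"
 have B: "norm (partial i F x) <= B" for x
 proof (cases "x : K")
  case False
  then have "partial i F x = 0" using K by (intro partial_zero_outside[of K]) (auto intro: compact_imp_closed)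
  then show ?thesis by (simp add: B_def)
 qed (use B' in \<open>auto simp: B_def le_max_iff_disj\<close>)
 have Dlim: "(%n. D n x) \<longlonglongrightarrow> partial i F x" for x
 proof -
  have "((%t. F (x + t *\<^sub>R e)) has_vector_derivative partial i F x) (at 0)"
   using partial_vector_derivative[OF F, of x i 0] by (simp add: e_def)
  then have lim: "((%h. norm (F (x + h *\<^sub>R e) - F x - h *\<^sub>R partial i F x) / norm h) \<longlongrightarrow> 0) (at 0)"
   by (simp add: has_vector_derivative_def has_derivative_at)
  have "norm ((F (x + h *\<^sub>R e) - F x) /\<^sub>R h - partial i F x)
    = norm (F (x + h *\<^sub>R e) - F x - h *\<^sub>R partial i F x) / norm h" if "h ~= 0" for h
  proof -
   have "(F (x + h *\<^sub>R e) - F x) /\<^sub>R h - partial i F x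
     = (F (x + h *\<^sub>R e) - F x - h *\<^sub>R partial i F x) /\<^sub>R h"
    using that by (simp add: scaleR_diff_right)
   then show ?thesis by (simp add: divide_inverse mult.commute)
  qed
  then have "((%h. norm ((F (x + h *\<^sub>R e) - F x) /\<^sub>R h - partial i F x)) \<longlongrightarrow> 0) (at 0)"
   by (intro Lim_transform_eventually[OF lim]) (simp add: eventually_at_filter)
  then have "((%h. (F (x + h *\<^sub>R e) - F x) /\<^sub>R h) \<longlongrightarrow> partial i F x) (at 0)"
   using LIM_zero_cancel tendsto_norm_zero_iff by blast
  moreover have "filterlim s (at 0) sequentially" using s0 s(1) by (auto simp: filterlim_at less_imp_neq[symmetric])
  ultimately show ?thesis unfolding D_def by (rule filterlim_compose)
 qed
 have Dbound: "norm (D n x) <= B * indicator (cball 0 (R + 1)) x" for n x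
 proof (cases "norm x <= R + 1")
  case True
  have "EX t:{0<..<s n}. norm (F (x + s n *\<^sub>R e) - F (x + 0 *\<^sub>R e))
    <= norm ((s n - 0) *\<^sub>R partial i F (x + t *\<^sub>R e))"
   by (rule mvt_general[where f = "%t. F (x + t *\<^sub>R e)"])
    (use s partial_vector_derivative[OF F, of x i] in
     \<open>auto simp: has_vector_derivative_def e_def
      intro!: continuous_at_imp_continuous_on has_derivative_continuous\<close>)
  then obtain t where "norm (F (x + s n *\<^sub>R e) - F x) <= s n * norm (partial i F (x + t *\<^sub>R e))"
   using s(1)[of n] by auto
  also have "... <= s n * B" using s(1)[of n] B by (intro mult_left_mono) auto
  finally show ?thesis
   using True s(1)[of n] by (simp add: D_def divide_inverse_commute[symmetric] pos_divide_le_eq ac_simps)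
 next
  case False
  have "norm (x + s n *\<^sub>R e) \<ge> norm x - norm (s n *\<^sub>R e)" by (rule norm_diff_ineq)
  then have "norm (x + s n *\<^sub>R e) > R" "norm x > R" using False s[of n] ne by auto
  then have "F (x + s n *\<^sub>R e) = 0" "F x = 0" using R K(2) by force+
  then show ?thesis using False by (simp add: D_def)
 qed
 have "(%n. LINT x|lborel. D n x) \<longlonglongrightarrow> (LINT x|lborel. partial i F x)"
 proof (rule integral_dominated_convergence[where w = "%x. B * indicator (cball 0 (R + 1)) x"])
  show "integrable lborel (%x::point. B * indicator (cball 0 (R + 1)) x)"
   using borel_integrable_compact[of "cball 0 (R + 1)" "%_. B"] by (simp add: mult.commute)
  show "D n : borel_measurable lborel" for n unfolding D_def using mF by measurable
 qed (use mF Dlim Dbound in auto)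
 moreover have "(LINT x|lborel. D n x) = 0" for n
 proof -
  have i1: "integrable lborel F" by (rule integrable_compact_support[OF contF K])
  have i2: "integrable lborel (%x. F (x + s n *\<^sub>R e))"
  proof (rule integrable_compact_support[where K = "(%x. x - s n *\<^sub>R e) ` K"])
   show "compact ((%x. x - s n *\<^sub>R e) ` K)" by (intro compact_continuous_image continuous_intros K)
   fix x assume "x ~: (%x. x - s n *\<^sub>R e) ` K"
   then have "x + s n *\<^sub>R e ~: K" by (force simp: image_iff)
   then show "F (x + s n *\<^sub>R e) = 0" by (rule K)
  qed (auto intro!: continuous_on_compose2[OF contF] continuous_intros)
  show ?thesis unfolding D_def using i1 i2 LINT_translate[OF mF(1), of "s n *\<^sub>R e"] by simp
 qed
 ultimately show ?thesis using LIMSEQ_unique by (auto simp: tendsto_const_iff)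
qed

lemma integral_by_parts:
 fixes u v :: "point => complex"
 assumes "smooth u" "smooth v" "compact K" "!!x. x ~: K ==> u x = 0"
 shows "(LINT x|lborel. u x * partial i v x) = - (LINT x|lborel. partial i u x * v x)"
proof -
 have z: "partial i u x = 0" if "x ~: K" for x
  using assms that by (intro partial_zero_outside[of K]) (auto intro: compact_imp_closed)
 have "(LINT x|lborel. partial i (%x. u x * v x) x) = 0"
  using assms by (intro LINT_partial_zero[of _ K] smooth_mult) auto
 moreover have "partial i (%x. u x * v x) = (%x. u x * partial i v x + partial i u x * v x)"
  using assms by (intro ext partial_mult)
 moreover have "integrable lborel (%x. u x * partial i v x)" "integrable lborel (%x. partial i u x * v x)"
  using assms z by (auto intro!: integrable_compact_support[OF smooth_continuous \<open>compact K\<close>]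
    smooth_mult smooth_partial)
 ultimately show ?thesis by (simp add: eq_neg_iff_add_eq_0)
qed

text \<open>Boxes are stable under intersection and generate the Borel sets, so the vanishing
  integral extends to all of them by Dynkin's argument. Passing to complements uses the integral
  over the whole space, which is the limit over growing boxes.\<close>

lemma AE_zero_boxes_real:
 fixes f :: "'a::euclidean_space => real"
 assumes f: "integrable lborel f" and z: "!!a b. (LINT x:box a b|lborel. f x) = 0"
 shows "AE x in lborel. f x = 0"
proof (rule density_unique_real[OF f integrable_zero])
 fix A :: "'a set" assume "A : sets lborel"
 then have A: "A : sigma_sets UNIV (range (%(a, b). box a b))" by (simp add: borel_eq_box)
 have si: "set_integrable lborel B f" if "B : sets lborel" for B
  unfolding set_integrable_def using f that by (rule integrable_mult_indicator[rotated])
 have tot: "(LINT x|lborel. f x) = 0"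
 proof -
  let ?A = "%n::nat. box (- (real n *\<^sub>R One)) (real n *\<^sub>R One) :: 'a set"
  have lim: "(%n. LINT x|lborel. indicator (?A n) x *\<^sub>R f x) \<longlonglongrightarrow> (LINT x|lborel. f x)"
  proof (rule integral_dominated_convergence[where w = "%x. norm (f x)"])
   show "AE x in lborel. (%n. indicator (?A n) x *\<^sub>R f x) \<longlonglongrightarrow> f x"
   proof (rule AE_I2)
    fix x :: 'a
    obtain N where N: "x : ?A N" using UN_box_eq_UNIV[where 'a = 'a] by blast
    have "x : ?A n" if "n \<ge> N" for n using N that by (force simp: mem_box inner_diff_left)
    then have "\<forall>\<^sub>F n in sequentially. f x = indicator (?A n) x *\<^sub>R f x"
     unfolding eventually_sequentially by (intro exI[of _ N]) simp
    then show "(%n. indicator (?A n) x *\<^sub>R f x) \<longlonglongrightarrow> f x"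
     by (rule Lim_transform_eventually[OF tendsto_const])
   qed
  qed (use f in \<open>auto simp: indicator_def\<close>)
  then show ?thesis using z lim LIMSEQ_unique[OF lim, of 0] by (simp add: set_lebesgue_integral_def)
 qed
 have "Int_stable (range (%(a, b). box a b :: 'a set))" by (auto simp: Int_stable_def box_Int_box)
 moreover have "range (%(a, b). box a b :: 'a set) <= Pow UNIV" by simp
 moreover note A
 ultimately have "(LINT x:A|lborel. f x) = 0"
 proof (induction rule: sigma_sets_induct_disjoint)
  case (basic A)
  then show ?case using z by auto
 next
  case (compl A)
  then have "A : sets lborel" by (simp add: borel_eq_box)
  then have "(LINT x:UNIV|lborel. f x) = (LINT x:A|lborel. f x) + (LINT x:UNIV - A|lborel. f x)"
   using set_integral_Un[of A "UNIV - A" lborel f] si by simp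
  then show ?case using compl tot by (simp add: set_lebesgue_integral_def)
 next
  case (union A)
  then have "A i : sets lborel" for i by (auto simp: borel_eq_box)
  then show ?case using union by (subst lebesgue_integral_countable_add) (auto simp: disjoint_family_on_def intro: si)
 qed (auto simp: set_lebesgue_integral_def)
 then show "(LINT x:A|lborel. f x) = (LINT x:A|lborel. 0)" by simp
qed

lemma AE_zero_boxes:
 fixes f :: "'a::euclidean_space => 'b::euclidean_space"
 assumes f: "integrable lborel f"
  and z: "!!a b. (LINT x|lborel. indicator (box a b) x *\<^sub>R f x) = 0"
 shows "AE x in lborel. f x = 0"
proof -
 have "AE x in lborel. f x \<bullet> c = 0" if "c : Basis" for c
 proof (rule AE_zero_boxes_real)
  show "integrable lborel (%x. f x \<bullet> c)" using f by simp
  fix a b :: 'a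
  have "integrable lborel (%x. indicator (box a b) x *\<^sub>R f x)" using f by (intro integrable_mult_indicator) auto
  then have "(LINT x|lborel. (indicator (box a b) x *\<^sub>R f x) \<bullet> c) = 0"
   using z[of a b] integral_inner_left[of c lborel "%x. indicator (box a b) x *\<^sub>R f x"]
   by (simp del: inner_scaleR_left)
  then show "(LINT x:box a b|lborel. f x \<bullet> c) = 0" by (simp add: set_lebesgue_integral_def)
 qed
 then have "AE x in lborel. ALL c:Basis. f x \<bullet> c = 0" by (intro AE_finite_allI) auto
 then show ?thesis by eventually_elim (simp add: euclidean_eq_iff[of _ "0::'b"])
qed

text \<open>An open set is a countable union of boxes, and the intersection of one of these with any
  box is again a box inside \<open>G\<close>, so the global statement applies to \<open>f\<close>
  times its indicator.\<close>

lemma AE_zero_open: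
 fixes f :: "'a::euclidean_space => 'b::euclidean_space"
 assumes G: "open G" and f: "integrable lborel (%x. indicator G x *\<^sub>R f x)"
  and z: "!!a b. box a b <= G ==> (LINT x|lborel. indicator (box a b) x *\<^sub>R f x) = 0"
 shows "AE x in lborel. x : G --> f x = 0"
proof -
 obtain D where D: "countable D" "D <= Pow G" "!!X. X : D ==> EX a b. X = box a b" "\<Union>D = G"
  using open_countable_Union_open_box[OF G] by metis
 have "AE x in lborel. x : X --> f x = 0" if XD: "X : D" for X
 proof -
  obtain c d where X: "X = box c d" using D(3) XD by blast
  have XG: "box c d <= G" using D(2) XD X by auto
  have "AE x in lborel. indicator (box c d) x *\<^sub>R f x = 0"
  proof (rule AE_zero_boxes)
   have "integrable lborel (%x. indicator (box c d) x *\<^sub>R (indicator G x *\<^sub>R f x))"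
    using f by (rule integrable_mult_indicator[rotated]) simp
   moreover have "(%x. indicator (box c d) x *\<^sub>R (indicator G x *\<^sub>R f x)) = (%x. indicator (box c d) x *\<^sub>R f x)"
    using XG by (auto simp: indicator_def fun_eq_iff)
   ultimately show "integrable lborel (%x. indicator (box c d) x *\<^sub>R f x)" by simp
   fix a b
   obtain a' b' where ab: "box a b Int box c d = box a' b'" using box_Int_box[of a b c d] by blast
   then have "box a' b' <= G" using XG by auto
   moreover have "indicator (box a b) x *\<^sub>R indicator (box c d) x *\<^sub>R f x = indicator (box a' b') x *\<^sub>R f x" for x
    by (simp add: ab[symmetric] indicator_inter_arith)
   ultimately show "(LINT x|lborel. indicator (box a b) x *\<^sub>R indicator (box c d) x *\<^sub>R f x) = 0"
    using z[of a' b'] by (simp only:)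
  qed
  then show ?thesis by eventually_elim (auto simp: X indicator_def split: if_splits)
 qed
 then have "AE x in lborel. ALL X:D. x : X --> f x = 0" using D(1) by (subst AE_ball_countable) auto
 then show ?thesis by eventually_elim (use D(4) in auto)
qed

text \<open>By Lindelof countably many of the neighbourhoods cover the set, so locally null
  exceptions remain null.\<close>

lemma AE_open_local:
 fixes U :: "'a::euclidean_space set"
 assumes "!!z. z : U ==> EX V. open V & z : V & (AE y in lborel. y : V --> Q y)"
 shows "AE y in lborel. y : U --> Q y"
proof -
 define F where "F = {V. open V & (AE y in lborel. y : V --> Q y)}"
 obtain F' where F': "F' <= F" "countable F'" "\<Union>F' = \<Union>F" using Lindelof[of F] by (auto simp: F_def)
 have "AE y in lborel. ALL V:F'. y : V --> Q y" using F' by (subst AE_ball_countable) (auto simp: F_def)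
 then show ?thesis
 proof eventually_elim
  case (elim y)
  show ?case
  proof
   assume "y : U"
   then have "y : \<Union>F" using assms by (auto simp: F_def)
   then show "Q y" using F'(3) elim by auto
  qed
 qed
qed

section \<open>Test functions and uniqueness of weak derivatives\<close>

definition box_test :: "nat => point => point => point => real" where
 "box_test k a b x = (\<Prod>i\<in>UNIV. box_bump k (a $ i) (b $ i) (x $ i))"

lemma smooth_prod:
 fixes f :: "'i => point => real"
 shows "(!!i. i : I ==> smooth (f i)) ==> smooth (%x. \<Prod>i\<in>I. f i x)"
 by (induction I rule: infinite_finite_induct) (auto intro: smooth_mult)

lemma smooth_box_test: "smooth (box_test k a b)"
proof -
 have "smooth (%x::point. box_bump k (a $ i) (b $ i) (x $ i))" for i
  by (rule smooth_comp[OF smooth1_box_bump smooth_bounded_linear[OF bounded_linear_vec_nth]])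
 then show ?thesis unfolding box_test_def[abs_def] by (intro smooth_prod)
qed

lemma box_test_bounds: "0 <= box_test k a b x" "box_test k a b x <= 1"
 by (auto simp: box_test_def box_bump_bounds intro!: prod_nonneg prod_le_1)

lemma box_test_LIMSEQ: "(%k. box_test k a b x) \<longlonglongrightarrow> indicator (box a b) x"
proof -
 have "(%k. box_test k a b x) \<longlonglongrightarrow> (\<Prod>i\<in>UNIV. indicator {a $ i<..<b $ i} (x $ i))"
  unfolding box_test_def by (intro tendsto_prod box_bump_LIMSEQ)
 also have "(\<Prod>i\<in>UNIV. indicator {a $ i<..<b $ i} (x $ i)) = (indicator (box a b) x :: real)"
  by (auto simp: indicator_def mem_box_cart)
 finally show ?thesis .
qed

lemma box_test_support:
 "x ~: cbox (\<chi> i. a $ i + 1 / real k) (\<chi> i. b $ i - 1 / real k) ==> box_test k a b x = 0"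
proof -
 assume "x ~: cbox (\<chi> i. a $ i + 1 / real k) (\<chi> i. b $ i - 1 / real k)"
 then obtain i where "\<not> (a $ i + 1 / real k <= x $ i & x $ i <= b $ i - 1 / real k)" by (auto simp: mem_box_cart)
 from box_bump_zero[OF this] show ?thesis unfolding box_test_def by (intro prod_zero) auto
qed

lemma box_test_zero_0: "box_test 0 a b x = 0" by (simp add: box_test_def box_bump_def flat_bounds)

lemma test_fun_box_test:
 assumes "box a b <= interior G" "k > 0"
 shows "test_fun G (%x. complex_of_real (box_test k a b x))"
proof (rule test_funI[where K = "cbox (\<chi> i. a $ i + 1 / real k) (\<chi> i. b $ i - 1 / real k)"])
 show "smooth (%x. complex_of_real (box_test k a b x))"
  by (rule smooth_linear[OF bounded_linear_of_real smooth_box_test])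
 have "cbox (\<chi> i. a $ i + 1 / real k) (\<chi> i. b $ i - 1 / real k) <= box a b"
  using assms(2) by (auto simp: mem_box_cart) (smt (verit, best) divide_pos_pos of_nat_0_less_iff)+
 then show "cbox (\<chi> i. a $ i + 1 / real k) (\<chi> i. b $ i - 1 / real k) <= interior G" using assms(1) by blast
qed (auto simp: box_test_support)

text \<open>The functions \<open>box_test k a b\<close> tend boundedly to the indicator of a box, so
  orthogonality to test functions makes all integrals over boxes in the interior vanish. Nothing is
  claimed on the rest of \<open>G\<close>: test functions cannot see the boundary of a closed
  set.\<close>

lemma weak_zero:
 fixes u :: "point => complex"
 assumes G: "G : sets lebesgue" and u: "integrable (lebesgue_on G) u"
  and z: "!!phi. test_fun G phi ==> sprod G u phi = 0"
 shows "AE x in lebesgue. x : interior G --> u x = 0"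
proof -
 have iu: "integrable lebesgue (%x. indicator G x *\<^sub>R u x)" using u G by (simp add: integrable_lebesgue_on_iff)
 obtain v where v: "v : borel_measurable borel" "AE x in lborel. indicator G x *\<^sub>R u x = v x"
  using lebesgue_borel_representative[OF borel_measurable_integrable[OF iu]] .
 have v': "AE x in lebesgue. indicator G x *\<^sub>R u x = v x" using v(2) by (simp add: AE_lebesgue_iff)
 have "integrable lebesgue v"
 proof (rule integrable_cong_AE_imp[OF iu])
  show "v : borel_measurable lebesgue" using v(1) by (intro measurable_completion) simp
 qed (use v' in simp)
 then have iv: "integrable lborel v" using v by (simp add: integrable_completion)
 have "AE x in lborel. x : interior G --> v x = 0"
 proof (rule AE_zero_open)
  show "integrable lborel (%x. indicator (interior G) x *\<^sub>R v x)"
   using iv by (intro integrable_mult_indicator) auto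
  fix a b assume ab: "box a b <= interior G"
  have "(%k. LINT x|lborel. box_test k a b x *\<^sub>R v x) \<longlonglongrightarrow> (LINT x|lborel. indicator (box a b) x *\<^sub>R v x)"
  proof (rule integral_dominated_convergence[where w = "%x. norm (v x)"])
   show "(%x. box_test k a b x *\<^sub>R v x) : borel_measurable lborel" for k
    using v(1) continuous_borel[OF smooth_continuous[OF smooth_box_test]] by (simp add: borel_measurable_scaleR)
   show "AE x in lborel. (%k. box_test k a b x *\<^sub>R v x) \<longlonglongrightarrow> indicator (box a b) x *\<^sub>R v x"
    by (intro AE_I2 tendsto_scaleR box_test_LIMSEQ tendsto_const)
   show "AE x in lborel. norm (box_test k a b x *\<^sub>R v x) <= norm (v x)" for k
    using box_test_bounds by (intro AE_I2) (auto intro!: mult_left_le_one_le)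
  qed (use iv v in auto)
  moreover have "(LINT x|lborel. box_test k a b x *\<^sub>R v x) = 0" for k
  proof (cases "k = 0")
   case False
   let ?phi = "%x. complex_of_real (box_test k a b x)"
   have b: "?phi : borel_measurable borel" by (intro continuous_borel smooth_continuous
      smooth_linear[OF bounded_linear_of_real smooth_box_test])
   have "0 = sprod G u ?phi" using False test_fun_box_test[OF ab] z by simp
   also have "... = (LINT x|lebesgue. indicator G x *\<^sub>R (u x * cnj (?phi x)))"
    using G by (simp add: sprod_def LINT_lebesgue_on)
   also have "... = (LINT x|lebesgue. box_test k a b x *\<^sub>R v x)"
   proof (rule integral_cong_AE)
    show "AE x in lebesgue. indicator G x *\<^sub>R (u x * cnj (?phi x)) = box_test k a b x *\<^sub>R v x"
     using v' by eventually_elim (auto simp: scaleR_conv_of_real ac_simps)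
    have "(%x. (indicator G x *\<^sub>R u x) * ?phi x) : borel_measurable lebesgue"
     using b by (intro borel_measurable_times borel_measurable_integrable[OF iu] measurable_completion) simp
    then show "(%x. indicator G x *\<^sub>R (u x * cnj (?phi x))) : borel_measurable lebesgue" by simp
    show "(%x. box_test k a b x *\<^sub>R v x) : borel_measurable lebesgue"
     using v(1) continuous_borel[OF smooth_continuous[OF smooth_box_test]]
     by (intro measurable_completion) (simp add: borel_measurable_scaleR)
   qed
   also have "... = (LINT x|lborel. box_test k a b x *\<^sub>R v x)"
    using v(1) continuous_borel[OF smooth_continuous[OF smooth_box_test]]
    by (intro integral_completion) (simp add: borel_measurable_scaleR)
   finally show ?thesis by simp
  qed (simp add: box_test_zero_0)
  ultimately show "(LINT x|lborel. indicator (box a b) x *\<^sub>R v x) = 0" by (simp add: LIMSEQ_const_iff)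
 qed simp
 then have "AE x in lebesgue. x : interior G --> v x = 0" by (simp add: AE_lebesgue_iff)
 with v' show ?thesis by eventually_elim (use interior_subset in \<open>force simp: indicator_def\<close>)
qed

section \<open>Polynomials of bounded degree\<close>

text \<open>\<open>pdeg d\<close> asserts degree at most \<open>d\<close>, not equal to it. It is
  generated by the operations under which it is used, and derivatives, affine substitutions and
  restrictions to lines follow by rule induction.\<close>

inductive pdeg :: "nat => (point => real) => bool" where
 const: "pdeg 0 (%_. c)"
| lin: "bounded_linear h ==> pdeg 1 h"
| add: "pdeg d p ==> pdeg d q ==> pdeg d (%x. p x + q x)"
| mult: "pdeg d p ==> pdeg e q ==> pdeg (d + e) (%x. p x * q x)"
| mono: "pdeg d p ==> d <= e ==> pdeg e p"

lemma pdeg_const: "pdeg d (%_. c)" by (rule pdeg.mono[OF pdeg.const]) simp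

lemma pdeg_affine:
 assumes A: "bounded_linear A"
 shows "pdeg d p ==> pdeg d (%x. p (c + A x))"
proof (induction rule: pdeg.induct)
 case (lin h)
 have "pdeg 1 (%x. h c + (h \<circ> A) x)" by (intro pdeg.add pdeg_const pdeg.lin)
   (use bounded_linear_compose[OF lin A] in \<open>simp add: o_def\<close>)
 then show ?case by (simp add: linear_add[OF bounded_linear.linear[OF lin]])
qed (auto intro: pdeg.intros)

lemma real_polynomial_pdeg: "real_polynomial_function p ==> EX d. pdeg d p"
proof (induction rule: real_polynomial_function.induct)
 case (add f g)
 then obtain d e where "pdeg d f" "pdeg e g" by auto
 then have "pdeg (max d e) (%x. f x + g x)" by (intro pdeg.add) (auto intro: pdeg.mono)
 then show ?case by blast
qed (auto intro: pdeg.intros)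

lemma smooth_pdeg: "pdeg d p ==> smooth p"
 by (induction rule: pdeg.induct) (auto intro: smooth_bounded_linear smooth_add smooth_mult)

lemma pdeg_partial: "pdeg d p ==> pdeg d (partial i p)"
proof (induction rule: pdeg.induct)
 case (const c)
 have "partial i (%_. c) = (%_. 0)" by auto
 then show ?case by (simp add: pdeg.const)
next
 case (lin h)
 have "partial i h = (%_. h (axis i 1))" using lin by (intro ext partial_eq) (rule bounded_linear_imp_has_derivative)
 then show ?case by (simp only: pdeg_const)
next
 case (add d p q)
 then have "partial i (%x. p x + q x) = (%x. partial i p x + partial i q x)" by (intro ext partial_add smooth_pdeg)
 then show ?case using add by (simp add: pdeg.add)
next
 case (mult d p e q)
 then have "partial i (%x. p x * q x) = (%x. p x * partial i q x + partial i p x * q x)"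
  by (intro ext partial_mult smooth_pdeg)
 then show ?case using mult by (simp add: pdeg.add pdeg.mult)
qed (auto intro: pdeg.mono)

section \<open>Interpolation along lines and comparison of norms of polynomials\<close>

lemma pdeg_line:
 "pdeg d p ==> EX P. degree P <= d & (ALL t. p (x + t *\<^sub>R v) = poly P t)"
proof (induction rule: pdeg.induct)
 case (const c)
 show ?case by (rule exI[of _ "[:c:]"]) simp
next
 case (lin h)
 note l = bounded_linear.linear[OF lin]
 show ?case by (rule exI[of _ "[:h x, h v:]"]) (simp add: linear_add[OF l] linear_scale[OF l])
next
 case (add d p q)
 then obtain P Q where "degree P <= d" "ALL t. p (x + t *\<^sub>R v) = poly P t"
  "degree Q <= d" "ALL t. q (x + t *\<^sub>R v) = poly Q t" by blast
 then show ?case by (intro exI[of _ "P + Q"]) (auto intro: degree_add_le)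
next
 case (mult d p e q)
 then obtain P Q where "degree P <= d" "ALL t. p (x + t *\<^sub>R v) = poly P t"
  "degree Q <= e" "ALL t. q (x + t *\<^sub>R v) = poly Q t" by blast
 then show ?case by (intro exI[of _ "P * Q"]) (auto intro: order_trans[OF degree_mult_le])
qed (use order_trans in blast)

text \<open>Induction on the nodes: write P = P(n0) + (X - n0) Q with Q of smaller degree and apply
  the hypothesis to the functional that sends Q to the value at (X - n0) Q. The weights do not
  depend on \<open>P\<close>, which makes the resulting bounds uniform. It is applied to evaluation
  and to the derivative at a point.\<close>

lemma poly_functional_nodes:
 fixes \<Lambda> :: "real poly => real"
 assumes "finite N" "!!P Q. \<Lambda> (P + Q) = \<Lambda> P + \<Lambda> Q" "!!c P. \<Lambda> (smult c P) = c * \<Lambda> P"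
 shows "EX l. ALL P. degree P < card N --> \<Lambda> P = (SUM n:N. l n * poly P n)"
 using assms
proof (induction N arbitrary: \<Lambda> rule: finite_induct)
 case (insert n0 N)
 define M where "M Q = \<Lambda> ([:- n0, 1:] * Q)" for Q
 have "M (P + Q) = M P + M Q" "M (smult c P) = c * M P" for P Q c
  using insert.prems by (simp_all only: M_def ring_distribs mult_smult_right)
 from insert.IH[of M, OF this]
 obtain l where l: "!!Q. degree Q < card N ==> M Q = (SUM n:N. l n * poly Q n)" by blast
 \<comment> \<open>Since Q(n) = (P(n) - P(n0)) / (n - n0), the old weights are divided by n - n0,
   and their contributions to P(n0) collect at the new node.\<close>
 define l' where "l' n = (if n = n0 then \<Lambda> 1 - (SUM n:N. l n / (n - n0)) else l n / (n - n0))" for n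
 have L0: "\<Lambda> 0 = 0" using insert.prems(2)[of 0 0] by simp
 have "\<Lambda> P = (SUM n:insert n0 N. l' n * poly P n)" if P: "degree P < card (insert n0 N)" for P
 proof -
  define Q where "Q = synthetic_div P n0"
  have PQ: "P = smult (poly P n0) 1 + [:- n0, 1:] * Q"
   using synthetic_div_correct'[of n0 P] by (simp add: Q_def add.commute one_pCons)
  have MQ: "M Q = (SUM n:N. l n * poly Q n)"
  proof (cases "N = {}")
   case True
   then have "Q = 0" using P by (simp add: Q_def synthetic_div_eq_0_iff)
   then show ?thesis using True L0 by (simp add: M_def)
  next
   case False
   then have "card N > 0" using insert.hyps by (simp add: card_gt_0_iff)
   then show ?thesis using P insert.hyps by (intro l) (simp add: Q_def degree_synthetic_div)
  qed
  have Qn: "poly Q n = (poly P n - poly P n0) / (n - n0)" if "n : N" for n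
  proof -
   have "n ~= n0" using that insert.hyps by auto
   moreover have "poly P n = poly P n0 + (n - n0) * poly Q n" by (subst PQ) (simp add: algebra_simps)
   ultimately show ?thesis by simp
  qed
  have "\<Lambda> P = poly P n0 * \<Lambda> 1 + M Q" by (subst PQ) (simp only: insert.prems M_def)
  also have "M Q = (SUM n:N. l n / (n - n0) * poly P n - l n / (n - n0) * poly P n0)"
   unfolding MQ by (intro sum.cong) (auto simp: Qn diff_divide_distrib right_diff_distrib)
  also have "... = (SUM n:N. l' n * poly P n) - (SUM n:N. l n / (n - n0)) * poly P n0"
  proof -
   have "(SUM n:N. l n / (n - n0) * poly P n) = (SUM n:N. l' n * poly P n)"
    using insert.hyps by (intro sum.cong) (auto simp: l'_def)
   then show ?thesis by (simp add: sum_subtractf sum_distrib_right)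
  qed
  also have "poly P n0 * \<Lambda> 1 + ... = l' n0 * poly P n0 + (SUM n:N. l' n * poly P n)"
   by (simp add: l'_def left_diff_distrib)
  finally show ?thesis using insert.hyps by simp
 qed
 then show ?case by blast
qed simp

lemma poly_eval_nodes:
 assumes "finite N"
 shows "EX l. ALL P::real poly. degree P < card N --> poly P c = (SUM n:N. l n * poly P n)"
 using assms by (intro poly_functional_nodes) auto

lemma poly_deriv_nodes:
 assumes "finite N"
 shows "EX l. ALL P::real poly. degree P < card N --> poly (pderiv P) c = (SUM n:N. l n * poly P n)"
 using assms by (intro poly_functional_nodes) (auto simp: pderiv_add pderiv_smult)

lemma LINT_affine:
 fixes g :: "point => 'b::{banach,second_countable_topology}"
 assumes "c ~= 0" "g : borel_measurable borel"
 shows "(LINT x|lborel. g x) = \<bar>c\<bar> ^ 3 *\<^sub>R (LINT x|lborel. g (t + c *\<^sub>R x))"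
proof -
 have "(LINT x|lborel. g x) = (LINT x|density (distr lborel borel (%x. t + c *\<^sub>R x)) (%_. \<bar>c\<bar> ^ DIM(point)). g x)"
  using lborel_affine[OF assms(1), of t] by simp
 also have "... = (LINT x|lborel. \<bar>c\<bar> ^ 3 *\<^sub>R g (t + c *\<^sub>R x))"
  using assms(2) by (subst integral_density) (auto simp: integral_distr)
 finally show ?thesis by simp
qed

lemma integrable_affine:
 fixes g :: "point => 'b::{banach,second_countable_topology}"
 assumes "c ~= 0" "integrable lborel g"
 shows "integrable lborel (%x. g (t + c *\<^sub>R x))"
proof -
 have "integrable (density (distr lborel borel (%x. t + c *\<^sub>R x)) (%_. \<bar>c\<bar> ^ DIM(point))) g"
  using assms lborel_affine[OF assms(1), of t] by simp
 then have "integrable lborel (%x. \<bar>c\<bar> ^ 3 *\<^sub>R g (t + c *\<^sub>R x))"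
  using assms(2) borel_measurable_integrable[OF assms(2)]
  by (subst (asm) integrable_density) (auto simp: integrable_distr_eq)
 from integrable_scaleR_right[OF this, of "inverse (\<bar>c\<bar> ^ 3)"] show ?thesis using assms(1) by simp
qed

text \<open>For \<open>y\<close> in the ball of radius 1/4, the value at \<open>x\<close> is
  interpolated from points on the segment from \<open>y\<close> to \<open>x\<close> that lie close
  to \<open>y\<close>. Cauchy-Schwarz and averaging over \<open>y\<close> turn this into an integral
  over the ball of radius 1/2. The constant is explicit in the interpolation weights, so it depends
  on \<open>d\<close> and \<open>K\<close> only.\<close>

lemma pdeg_sup_bound:
 assumes "K \<ge> 1"
 shows "EX C>0. ALL p. pdeg d p -->
  (ALL x:cball 0 K. (p x)\<^sup>2 <= C * (LINT u|lborel. indicator (ball 0 (1/2)) u * (p u)\<^sup>2))"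
proof -
 \<comment> \<open>With this spacing every node satisfies n (K + 1) <= 1/4, so n x + (1 - n) y stays
   in the ball of radius 1/2. It also gives n <= 1/8, so the map from y to n x + (1 - n) y has
   Jacobian at least 1/8; this is the factor 8 below.\<close>
 define \<delta> where "\<delta> = 1 / (4 * (real d + 1) * (K + 1))"
 have d0: "\<delta> > 0" using assms by (simp add: \<delta>_def)
 define N where "N = (%j. \<delta> * real j) ` {..d}"
 have cN: "card N = Suc d" "finite N" unfolding N_def using d0 by (auto simp: card_image inj_on_def)
 have Nb: "0 <= n" "n * (K + 1) <= 1/4" "n <= 1/8" if nN: "n : N" for n
 proof -
  obtain j where j: "n = \<delta> * real j" "j <= d" using nN by (auto simp: N_def)
  show "0 <= n" using j d0 by simp
  have nz: "real d + 1 ~= 0" "K + 1 ~= 0" using assms by linarith+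
  have "n <= \<delta> * (real d + 1)" unfolding j using j d0 by (intro mult_left_mono) auto
  also have "... = 1 / (4 * (K + 1))"
  proof -
   have "1 / (4 * e * k) * e = 1 / (4 * k)" if "e ~= 0" for e k :: real using that by simp
   from this[OF nz(1), of "K + 1"] show ?thesis by (simp only: \<delta>_def)
  qed
  finally have n: "n <= 1 / (4 * (K + 1))" .
  then show "n * (K + 1) <= 1/4" using assms by (simp add: field_simps)
  have "1 / (4 * (K + 1)) <= 1 / 8" using assms by (simp add: field_simps)
  with n show "n <= 1/8" by linarith
 qed
 obtain l where l: "!!P::real poly. degree P < Suc d ==> poly P 1 = (SUM n:N. l n * poly P n)"
  using poly_eval_nodes[OF cN(2), of 1] cN by auto
 define L where "L = (SUM n:N. (l n)\<^sup>2)"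
 have L0: "L \<ge> 0" by (simp add: L_def sum_nonneg)
 define V where "V = measure lborel (ball (0::point) (1/4))"
 have V0: "V > 0" by (simp add: V_def content_ball_pos)
 define C where "C = L * (8 * (real d + 1)) / V + 1"
 have "(p x)\<^sup>2 <= C * (LINT u|lborel. indicator (ball 0 (1/2)) u * (p u)\<^sup>2)"
  if p: "pdeg d p" and x: "x : cball 0 K" for p x
 proof -
  have cp: "continuous_on UNIV p" by (rule smooth_continuous[OF smooth_pdeg[OF p]])
  have mp: "p : borel_measurable borel" by (rule continuous_borel[OF cp])
  define g where "g u = indicator (ball 0 (1/2)) u * (p u)\<^sup>2" for u :: point
  have mg: "g : borel_measurable borel" unfolding g_def
   by (intro borel_measurable_times borel_measurable_indicator borel_measurable_power mp) auto
  have ig: "integrable lborel g"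
  proof (rule Bochner_Integration.integrable_bound)
   show "integrable lborel (%u. indicator (cball 0 (1/2)) u *\<^sub>R (p u)\<^sup>2)"
    by (rule borel_integrable_compact) (auto intro!: continuous_intros continuous_on_subset[OF cp])
  qed (use mg in \<open>auto simp: g_def indicator_def\<close>)
  define I where "I = (LINT u|lborel. g u)"
  have I0: "I \<ge> 0" unfolding I_def g_def by (rule integral_nonneg_AE) auto
  have px: "p x = (SUM n:N. l n * p ((n *\<^sub>R x) + (1 - n) *\<^sub>R y))" for y
  proof -
   obtain P where P: "degree P <= d" "!!t. p (y + t *\<^sub>R (x - y)) = poly P t"
    using pdeg_line[OF p, of y "x - y"] by blast
   have "p x = poly P 1" using P(2)[of 1] by simp
   also have "... = (SUM n:N. l n * p (y + n *\<^sub>R (x - y)))" using l[of P] P by simp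
   finally show ?thesis by (simp add: algebra_simps)
  qed
  have bnd: "indicator (ball 0 (1/4)) y * (p x)\<^sup>2 <= L * (SUM n:N. g (n *\<^sub>R x + (1 - n) *\<^sub>R y))" for y
  proof (cases "y : ball 0 (1/4)")
   case True
   have gp: "g (n *\<^sub>R x + (1 - n) *\<^sub>R y) = (p (n *\<^sub>R x + (1 - n) *\<^sub>R y))\<^sup>2" if n: "n : N" for n
   proof -
    have "norm (n *\<^sub>R x + (1 - n) *\<^sub>R y) <= norm (n *\<^sub>R x) + norm ((1 - n) *\<^sub>R y)" by (rule norm_triangle_ineq)
    also have "... <= n * K + 1 * norm y" using Nb[OF n] x by (simp add: mult_left_mono mult_left_le_one_le add_mono)
    also have "n * K <= 1/4" using Nb[OF n] by (simp add: distrib_left)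
    also have "norm y < 1/4" using True by simp
    finally show ?thesis by (simp add: g_def)
   qed
   have "(p x)\<^sup>2 <= L * (SUM n:N. (p (n *\<^sub>R x + (1 - n) *\<^sub>R y))\<^sup>2)"
    unfolding px[of y] L_def by (rule Cauchy_Schwarz_ineq_sum)
   then show ?thesis using True by (simp add: gp)
  next
   case False
   then show ?thesis using L0 by (auto simp: g_def intro!: mult_nonneg_nonneg sum_nonneg)
  qed
  have int_n: "integrable lborel (%y. g (n *\<^sub>R x + (1 - n) *\<^sub>R y))" if "n : N" for n
   using Nb[OF that] by (intro integrable_affine ig) auto
  have le_n: "(LINT y|lborel. g (n *\<^sub>R x + (1 - n) *\<^sub>R y)) <= 8 * I" if n: "n : N" for n
  proof -
   let ?J = "LINT y|lborel. g (n *\<^sub>R x + (1 - n) *\<^sub>R y)"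
   have J0: "?J \<ge> 0" unfolding g_def by (rule integral_nonneg_AE) auto
   have "I = \<bar>1 - n\<bar> ^ 3 *\<^sub>R ?J" unfolding I_def using Nb[OF n] by (intro LINT_affine mg) auto
   moreover have "(1/2) ^ 3 <= \<bar>1 - n\<bar> ^ 3" using Nb[OF n] by (intro power_mono) auto
   ultimately have "(1/2) ^ 3 * ?J <= I" using J0 by (simp add: mult_right_mono)
   then show ?thesis by (simp add: power3_eq_cube)
  qed
  have "V * (p x)\<^sup>2 = (LINT y|lborel. indicator (ball (0::point) (1/4)) y * (p x)\<^sup>2)" by (simp add: V_def)
  also have "... <= (LINT y|lborel. L * (SUM n:N. g (n *\<^sub>R x + (1 - n) *\<^sub>R y)))"
   using int_n bnd by (intro integral_mono) (auto intro!: integrable_real_indicator emeasure_bounded_finite)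
  also have "... = L * (SUM n:N. LINT y|lborel. g (n *\<^sub>R x + (1 - n) *\<^sub>R y))" using int_n by simp
  also have "... <= L * (SUM n:N. 8 * I)" using L0 le_n by (intro mult_left_mono sum_mono) auto
  also have "... = L * (8 * (real d + 1)) * I" using cN by simp
  finally have "(p x)\<^sup>2 <= L * (8 * (real d + 1)) / V * I" using V0 by (simp add: field_simps)
  also have "... <= C * I" using I0 by (intro mult_right_mono) (auto simp: C_def)
  finally show ?thesis by (simp add: I_def g_def)
 qed
 moreover have "C > 0" using L0 V0 by (auto simp: C_def intro!: add_nonneg_pos)
 ultimately show ?thesis by blast
qed

section \<open>Bubble functions\<close>

definition bump :: "point => real => point => real" where
 "bump m rho x = flat (1 - (x - m) \<bullet> (x - m) / rho\<^sup>2)"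

lemma bump_bounds: "0 <= bump m rho x" "bump m rho x <= 1" by (auto simp: bump_def flat_bounds)

lemma bump_pos_iff: "rho > 0 ==> bump m rho x > 0 \<longleftrightarrow> x : ball m rho"
proof -
 assume r: "rho > 0"
 have "bump m rho x > 0 \<longleftrightarrow> (norm (x - m))\<^sup>2 < rho\<^sup>2"
  using r by (simp add: bump_def flat_bounds power2_norm_eq_inner)
 also have "... \<longleftrightarrow> norm (x - m) < rho"
  using r by (meson less_imp_le norm_ge_zero power2_less_imp_less power_strict_mono zero_less_numeral)
 finally show ?thesis by (simp add: dist_norm norm_minus_commute)
qed

lemma bump_zero: "rho > 0 ==> x ~: ball m rho ==> bump m rho x = 0"
 using bump_pos_iff[of rho m x] bump_bounds(1)[of m rho x] by linarith

lemma smooth_sq: "smooth (%x::point. 1 - (x - m) \<bullet> (x - m) / c)"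
proof -
 have "smooth (%x::point. x - m)" by (intro smooth_diff smooth_const smooth_bounded_linear bounded_linear_ident)
 then have "smooth (%x::point. (x - m) \<bullet> (x - m))" by (rule smooth_bilinear[OF bounded_bilinear_inner]) fact
 then show ?thesis unfolding divide_inverse by (intro smooth_diff smooth_mult smooth_const)
qed

lemma smooth_bump: "smooth (bump m rho)" unfolding bump_def[abs_def] by (rule smooth_comp[OF smooth1_flat smooth_sq])

lemma flat_exp_2_bound: "0 <= flat_exp 2 s" "flat_exp 2 s <= 2"
proof -
 have "u\<^sup>2 * exp (- u) <= 2" if "u > 0" for u :: real
 proof -
  have "1 + u + u\<^sup>2 / 2 <= exp u" using that by (intro exp_lower_Taylor_quadratic) auto
  then have "u\<^sup>2 <= 2 * exp u" using that by linarith
  then show ?thesis by (simp add: exp_minus divide_inverse[symmetric] pos_divide_le_eq)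
 qed
 then show "flat_exp 2 s <= 2" "0 <= flat_exp 2 s" by (auto simp: flat_exp_def)
qed

text \<open>The derivative of \<open>flat\<close> is \<open>flat_exp 2\<close>, at most 2 because
  exp u >= u^2 / 2, and the quadratic argument has slope at most 2 / rho on the ball.\<close>

lemma partial_bump_bound:
 assumes "rho > 0"
 shows "\<bar>partial i (bump m rho) x\<bar> <= 4 / rho"
proof (cases "x : cball m rho")
 case True
 have n: "\<bar>(x - m) $ i\<bar> <= rho"
  using True component_le_norm_cart[of "x - m" i] by (simp add: dist_norm norm_minus_commute)
 have D: "((%x. 1 - (x - m) \<bullet> (x - m) / rho\<^sup>2) has_derivative (%h. - (2 * ((x - m) \<bullet> h)) / rho\<^sup>2)) (at x)"
  using assms by (auto intro!: derivative_eq_intros simp: inner_commute field_simps)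
 have "partial i (bump m rho) x = flat_exp 2 (1 - (x - m) \<bullet> (x - m) / rho\<^sup>2) * partial i (%x. 1 - (x - m) \<bullet> (x - m) / rho\<^sup>2) x"
  unfolding bump_def[abs_def] using flat_exp_DERIV[of 0] D
  by (intro partial_comp) (auto simp: differentiable_def numeral_2_eq_2)
 also have "\<bar>...\<bar> = flat_exp 2 (1 - (x - m) \<bullet> (x - m) / rho\<^sup>2) * (2 * \<bar>(x - m) $ i\<bar> / rho\<^sup>2)"
 proof -
  have "partial i (%x. 1 - (x - m) \<bullet> (x - m) / rho\<^sup>2) x = - (2 * (x - m) $ i) / rho\<^sup>2"
   by (subst partial_eq[OF D]) (simp only: inner_axis, simp)
  moreover have "\<bar>- (2 * (x - m) $ i) / rho\<^sup>2\<bar> = 2 * \<bar>(x - m) $ i\<bar> / rho\<^sup>2"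
   by (simp only: abs_divide abs_minus_cancel abs_mult) simp
  ultimately show ?thesis by (simp only: abs_mult) (simp only: flat_exp_2_bound abs_of_nonneg)
 qed
 also have "... <= 2 * (2 * rho / rho\<^sup>2)"
  using n assms flat_exp_2_bound by (intro mult_mono divide_right_mono) auto
 finally show ?thesis using assms by (simp add: power2_eq_square)
next
 case False
 then have "partial i (bump m rho) x = 0" using assms by (intro partial_zero_outside[of "cball m rho"] bump_zero) auto
 then show ?thesis using assms by simp
qed

lemma bump_lower:
 assumes "rho > 0" "x : ball m (rho / 2)"
 shows "flat (3/4) <= bump m rho x"
proof -
 have "norm (x - m) <= rho / 2" using assms(2) by (simp add: dist_norm norm_minus_commute)
 then have "(norm (x - m))\<^sup>2 <= (rho / 2)\<^sup>2" by (intro power_mono) auto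
 then have "(x - m) \<bullet> (x - m) / rho\<^sup>2 <= 1/4"
  using assms(1) by (simp add: power2_norm_eq_inner power_divide field_simps)
 then show ?thesis unfolding bump_def by (intro flat_mono) simp
qed

text \<open>Components are taken in the real basis, so the same notion covers complex scalars and
  complex fields.\<close>

definition pdegv :: "nat => (point => 'b::euclidean_space) => bool" where
 "pdegv d p \<longleftrightarrow> (ALL b:Basis. pdeg d (%x. p x \<bullet> b))"

lemma smooth_pdegv:
 assumes "pdegv d p" shows "smooth p"
proof -
 have "p = (%x. SUM b:Basis. (p x \<bullet> b) *\<^sub>R b)" by (simp add: euclidean_representation)
 moreover have "smooth (%x. SUM b:Basis. (p x \<bullet> b) *\<^sub>R b)"
  using assms by (intro smooth_sum smooth_scaleR smooth_const smooth_pdeg[of d]) (auto simp: pdegv_def)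
 ultimately show ?thesis by simp
qed

lemma integrable_bump_poly:
 fixes p :: "point => 'b::real_normed_vector"
 assumes "rho > 0" "continuous_on UNIV p"
 shows "integrable lborel (%y. (norm (p y))\<^sup>2 * bump m rho y)"
 using assms smooth_continuous[OF smooth_bump] bump_zero
 by (intro integrable_compact_support[where K = "cball m rho"] continuous_intros) (auto simp: not_le)

text \<open>Dilation to the unit ball; the factor rho^(-3) is the Jacobian. On the concentric ball
  of half the radius the bump is at least \<open>flat (3/4)\<close>, so the weight can be inserted
  at the price of a constant.\<close>

lemma pdeg_bump_bound:
 assumes "K \<ge> 1"
 shows "EX C>0. \<forall>rho>0. ALL m p. pdeg d p -->
  (ALL x:cball m (K * rho). (p x)\<^sup>2 <= C / rho ^ 3 * (LINT y|lborel. (p y)\<^sup>2 * bump m rho y))"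
proof -
 obtain C where C: "C > 0" "!!p x. pdeg d p ==> x : cball 0 K ==>
   (p x)\<^sup>2 <= C * (LINT u|lborel. indicator (ball 0 (1/2)) u * (p u)\<^sup>2)"
  using pdeg_sup_bound[OF assms, of d] by blast
 have f0: "flat (3/4) > 0" by (simp add: flat_bounds)
 have "(p x)\<^sup>2 <= C / flat (3/4) / rho ^ 3 * (LINT y|lborel. (p y)\<^sup>2 * bump m rho y)"
  if r: "rho > 0" and p: "pdeg d p" and x: "x : cball m (K * rho)" for rho m p x
 proof -
  define q where "q u = p (m + rho *\<^sub>R u)" for u
  have q: "pdeg d q" unfolding q_def by (rule pdeg_affine[OF bounded_linear_scaleR_right p])
  have cp: "continuous_on UNIV p" by (rule smooth_continuous[OF smooth_pdeg[OF p]])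
  have mp: "p : borel_measurable borel" by (rule continuous_borel[OF cp])
  have mb: "bump m rho : borel_measurable borel" by (rule continuous_borel[OF smooth_continuous[OF smooth_bump]])
  define x' where "x' = (x - m) /\<^sub>R rho"
  have "x' : cball 0 K"
   using x r by (simp add: x'_def dist_norm norm_minus_commute divide_inverse_commute[symmetric] pos_divide_le_eq)
  then have "(q x')\<^sup>2 <= C * (LINT u|lborel. indicator (ball 0 (1/2)) u * (q u)\<^sup>2)" by (rule C(2)[OF q])
  moreover have "q x' = p x" using r by (simp add: q_def x'_def)
  moreover have "(LINT y|lborel. indicator (ball m (rho / 2)) y * (p y)\<^sup>2)
    = rho ^ 3 * (LINT u|lborel. indicator (ball 0 (1/2)) u * (q u)\<^sup>2)"
  proof -
   have "(LINT y|lborel. indicator (ball m (rho / 2)) y * (p y)\<^sup>2)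
    = \<bar>rho\<bar> ^ 3 *\<^sub>R (LINT u|lborel. indicator (ball m (rho / 2)) (m + rho *\<^sub>R u) * (p (m + rho *\<^sub>R u))\<^sup>2)"
    using r by (intro LINT_affine borel_measurable_times borel_measurable_indicator
      borel_measurable_power mp) auto
   moreover have "indicator (ball m (rho / 2)) (m + rho *\<^sub>R u) = (indicator (ball 0 (1/2)) u :: real)" for u
    using r by (simp add: indicator_def dist_norm field_simps)
   ultimately show ?thesis using r by (simp add: q_def)
  qed
  ultimately have 1: "(p x)\<^sup>2 <= C / rho ^ 3 * (LINT y|lborel. indicator (ball m (rho / 2)) y * (p y)\<^sup>2)"
   using r by simp
  have i2: "integrable lborel (%y. (p y)\<^sup>2 * bump m rho y)" using integrable_bump_poly[OF r cp, of m] by simp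
  have "(LINT y|lborel. flat (3/4) * (indicator (ball m (rho / 2)) y * (p y)\<^sup>2))
    <= (LINT y|lborel. (p y)\<^sup>2 * bump m rho y)"
  proof (rule integral_mono)
   have "integrable lborel (%u. indicator (cball m (rho/2)) u *\<^sub>R (p u)\<^sup>2)"
    by (rule borel_integrable_compact) (auto intro!: continuous_intros continuous_on_subset[OF cp])
   then have "integrable lborel (%u. indicator (ball m (rho/2)) u * (p u)\<^sup>2)"
    by (rule Bochner_Integration.integrable_bound) (use mp in \<open>auto simp: indicator_def\<close>)
   then show "integrable lborel (%y. flat (3/4) * (indicator (ball m (rho / 2)) y * (p y)\<^sup>2))" by simp
   show "flat (3/4) * (indicator (ball m (rho / 2)) y * (p y)\<^sup>2) <= (p y)\<^sup>2 * bump m rho y" for y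
    using bump_lower[OF r, of y m] bump_bounds[of m rho y]
     mult_left_mono[of "flat (3/4)" "bump m rho y" "(p y)\<^sup>2"]
    by (cases "y : ball m (rho / 2)") (auto simp: mult.commute)
  qed (rule i2)
  then have "(LINT y|lborel. indicator (ball m (rho / 2)) y * (p y)\<^sup>2)
    <= (LINT y|lborel. (p y)\<^sup>2 * bump m rho y) / flat (3/4)"
   unfolding integral_mult_right_zero using f0 by (simp only: pos_le_divide_eq mult.commute)
  from mult_left_mono[OF this, of "C / rho ^ 3"] 1 C r show ?thesis by (simp add: mult.commute)
 qed
 moreover have "C / flat (3/4) > 0" using C f0 by simp
 ultimately show ?thesis by blast
qed

text \<open>An inverse estimate: the derivative of a polynomial is a fixed combination of its values
  at steps of size up to rho, which costs one power of 1 / rho, and so does differentiating the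
  bump. Squared and combined with rho^(-3) this gives rho^(-5).\<close>

lemma pdegv_bubble:
 assumes "K \<ge> 1"
 shows "EX C>0. \<forall>rho>0. ALL m. ALL p :: point => 'b::euclidean_space. pdegv d p -->
  (ALL x:cball m (K * rho). (norm (p x))\<^sup>2 <= C / rho ^ 3 * (LINT y|lborel. (norm (p y))\<^sup>2 * bump m rho y)) \<and>
  (ALL x i. (norm (partial i (%y. bump m rho y *\<^sub>R p y) x))\<^sup>2
    <= C / rho ^ 5 * (LINT y|lborel. (norm (p y))\<^sup>2 * bump m rho y))"
proof -
 obtain C where C: "C > 0" "!!rho m p x. rho > 0 ==> pdeg d p ==> x : cball m ((K + 1) * rho) ==>
   (p x)\<^sup>2 <= C / rho ^ 3 * (LINT y|lborel. (p y)\<^sup>2 * bump m rho y)"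
  using pdeg_bump_bound[of "K + 1" d] assms by auto
 \<comment> \<open>Steps between 0 and rho, so the sampled points leave the ball of radius K rho by
   at most rho; this is why the supremum bound was taken with K + 1.\<close>
 define N where "N = (%j. real j / (real d + 1)) ` {..d}"
 have cN: "card N = Suc d" "finite N" unfolding N_def by (auto simp: card_image inj_on_def)
 have Nb: "0 <= n" "n <= 1" if "n : N" for n using that by (auto simp: N_def)
 obtain l where l: "!!P::real poly. degree P < Suc d ==> poly (pderiv P) 0 = (SUM n:N. l n * poly P n)"
  using poly_deriv_nodes[OF cN(2), of 0] cN by auto
 define L where "L = (SUM n:N. (l n)\<^sup>2)"
 have L0: "L \<ge> 0" by (simp add: L_def sum_nonneg)
 have vec: "(norm (p x))\<^sup>2 <= C / rho ^ 3 * (LINT y|lborel. (norm (p y))\<^sup>2 * bump m rho y)"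
  if r: "rho > 0" and p: "pdegv d p" and x: "x : cball m ((K + 1) * rho)" for rho m x and p :: "point => 'b"
 proof -
  have cp: "continuous_on UNIV p" by (rule smooth_continuous[OF smooth_pdegv[OF p]])
  have sq: "(norm (p y))\<^sup>2 = (SUM b:Basis. (p y \<bullet> b)\<^sup>2)" for y
   unfolding power2_norm_eq_inner euclidean_inner[of "p y" "p y"] by (simp add: power2_eq_square)
  have ib: "integrable lborel (%y. (p y \<bullet> b)\<^sup>2 * bump m rho y)" for b
   using integrable_bump_poly[OF r, of "%y. p y \<bullet> b" m] cp by (simp add: continuous_on_inner)
  have "(norm (p x))\<^sup>2 <= (SUM b:Basis. C / rho ^ 3 * (LINT y|lborel. (p y \<bullet> b)\<^sup>2 * bump m rho y))"
   unfolding sq using p x r by (intro sum_mono C(2)) (auto simp: pdegv_def)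
  also have "... = C / rho ^ 3 * (LINT y|lborel. (SUM b:Basis. (p y \<bullet> b)\<^sup>2 * bump m rho y))"
   using ib by (simp add: sum_distrib_left)
  finally show ?thesis by (simp add: sq sum_distrib_right)
 qed
 have der: "(norm (partial i p x))\<^sup>2 <= L * (real d + 1) * C / rho ^ 5 * (LINT y|lborel. (norm (p y))\<^sup>2 * bump m rho y)"
  if r: "rho > 0" and p: "pdegv d p" and x: "x : cball m (K * rho)" for rho m x i and p :: "point => 'b"
 proof -
  let ?I = "LINT y|lborel. (norm (p y))\<^sup>2 * bump m rho y"
  have scal: "rho * (partial i p x \<bullet> b) = (SUM n:N. l n * (p (x + n *\<^sub>R (rho *\<^sub>R axis i 1)) \<bullet> b))" if b: "b : Basis" for b
  proof -
   have pb: "pdeg d (%x. p x \<bullet> b)" using p b by (simp add: pdegv_def)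
   obtain P where P: "degree P <= d" "!!t. p (x + t *\<^sub>R (rho *\<^sub>R axis i 1)) \<bullet> b = poly P t"
    using pdeg_line[OF pb, of x "rho *\<^sub>R axis i 1"] by blast
   have "((%s. p (x + s *\<^sub>R axis i 1) \<bullet> b) has_vector_derivative partial i p x \<bullet> b) (at (0 * rho))"
    using bounded_linear.has_vector_derivative[OF bounded_linear_inner_left
      partial_vector_derivative[OF smooth_pdegv[OF p], of x i 0]] by simp
   then have "((%s. p (x + s *\<^sub>R axis i 1) \<bullet> b) has_real_derivative partial i p x \<bullet> b) (at (0 * rho))"
    by (simp only: has_real_derivative_iff_has_vector_derivative)
   from DERIV_chain2[where g = "%t. t * rho", OF this, of rho UNIV]
   have "((%t. poly P t) has_real_derivative (partial i p x \<bullet> b) * rho) (at 0)"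
    using P(2) DERIV_cmult_right[OF DERIV_ident[of "at 0"], of rho] by simp
   then have "(partial i p x \<bullet> b) * rho = poly (pderiv P) 0" using poly_DERIV[of P 0] DERIV_unique by blast
   then show ?thesis using l[of P] P by (simp add: mult.commute)
  qed
  have "rho *\<^sub>R partial i p x = (SUM n:N. l n *\<^sub>R p (x + n *\<^sub>R (rho *\<^sub>R axis i 1)))"
   by (rule euclidean_eqI) (simp add: scal inner_sum_left)
  then have "rho * norm (partial i p x) <= (SUM n:N. \<bar>l n\<bar> * norm (p (x + n *\<^sub>R (rho *\<^sub>R axis i 1))))"
   using r norm_sum[of "%n. l n *\<^sub>R p (x + n *\<^sub>R (rho *\<^sub>R axis i 1))" N]
   by (metis (no_types, lifting) abs_of_pos norm_scaleR sum.cong)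
  then have "(rho * norm (partial i p x))\<^sup>2 <= (SUM n:N. \<bar>l n\<bar> * norm (p (x + n *\<^sub>R (rho *\<^sub>R axis i 1))))\<^sup>2"
   using r by (intro power_mono) auto
  also have "... <= (SUM n:N. \<bar>l n\<bar>\<^sup>2) * (SUM n:N. (norm (p (x + n *\<^sub>R (rho *\<^sub>R axis i 1))))\<^sup>2)"
   by (rule Cauchy_Schwarz_ineq_sum)
  also have "... <= L * (SUM n:N. C / rho ^ 3 * ?I)" unfolding L_def power2_abs
  proof (intro mult_left_mono sum_mono vec r p sum_nonneg)
   fix n assume n: "n : N"
   have "dist m (x + n *\<^sub>R (rho *\<^sub>R axis i 1)) <= dist m x + norm (n *\<^sub>R (rho *\<^sub>R axis i (1::real)))"
    by (metis dist_add_cancel2 dist_norm dist_triangle2 norm_minus_commute add_diff_cancel_left' dist_triangle)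
   also have "... <= K * rho + 1 * rho" using x Nb[OF n] r by (intro add_mono) (auto intro: mult_left_le_one_le)
   finally show "x + n *\<^sub>R (rho *\<^sub>R axis i 1) : cball m ((K + 1) * rho)" by (simp add: distrib_right)
  qed auto
  finally have "rho\<^sup>2 * (norm (partial i p x))\<^sup>2 <= L * (real d + 1) * C / rho ^ 3 * ?I"
   using cN by (simp add: power_mult_distrib mult_ac add.commute)
  then have "(norm (partial i p x))\<^sup>2 <= (L * (real d + 1) * C / rho ^ 3 * ?I) / rho\<^sup>2"
   using r by (simp add: pos_le_divide_eq mult.commute)
  also have "... = L * (real d + 1) * C / rho ^ 5 * ?I" using r by (simp add: field_simps eval_nat_numeral)
  finally show ?thesis .
 qed
 \<comment> \<open>The two terms of the product rule: twice the derivative estimate, and 32 = 2 *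
   4^2 from the slope 4 / rho of the bump.\<close>
 define C' where "C' = 2 * (L * (real d + 1) * C) + 32 * C"
 have C': "C' > 0" "C <= C'" using C(1) L0 by (auto simp: C'_def intro!: add_nonneg_pos)
 show ?thesis
 proof (intro exI[of _ C'] conjI C' allI impI ballI)
  fix rho :: real and m and p :: "point => 'b" assume r: "0 < rho" and p: "pdegv d p"
  let ?I = "LINT y|lborel. (norm (p y))\<^sup>2 * bump m rho y"
  have I0: "?I \<ge> 0" by (rule integral_nonneg_AE) (simp add: bump_bounds)
  {
   fix x assume x: "x : cball m (K * rho)"
   then have "x : cball m ((K + 1) * rho)" using r assms by (auto simp: distrib_right)
   then have "(norm (p x))\<^sup>2 <= C / rho ^ 3 * ?I" by (rule vec[OF r p])
   also have "... <= C' / rho ^ 3 * ?I" using C' r I0 by (intro mult_right_mono divide_right_mono) auto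
   finally show "(norm (p x))\<^sup>2 <= C' / rho ^ 3 * ?I" .
  }
  fix x i
  show "(norm (partial i (%y. bump m rho y *\<^sub>R p y) x))\<^sup>2 <= C' / rho ^ 5 * ?I"
  proof (cases "x : cball m rho")
   case True
   have xK: "x : cball m (K * rho)" "x : cball m ((K + 1) * rho)"
    using True order_trans[of "dist m x" rho "K * rho"] mult_right_mono[OF assms, of rho] r
    by (auto simp: distrib_right)
   have "partial i (%y. bump m rho y *\<^sub>R p y) x = bump m rho x *\<^sub>R partial i p x + partial i (bump m rho) x *\<^sub>R p x"
    by (intro partial_scaleR smooth_bump smooth_pdegv[OF p])
   then have "norm (partial i (%y. bump m rho y *\<^sub>R p y) x) <= norm (bump m rho x *\<^sub>R partial i p x) + norm (partial i (bump m rho) x *\<^sub>R p x)"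
    using norm_triangle_ineq by metis
   also have "... <= 1 * norm (partial i p x) + 4 / rho * norm (p x)"
    using bump_bounds[of m rho x] partial_bump_bound[OF r, of i m x]
    unfolding norm_scaleR by (intro add_mono mult_right_mono) auto
   finally have "(norm (partial i (%y. bump m rho y *\<^sub>R p y) x))\<^sup>2 <= (norm (partial i p x) + 4 / rho * norm (p x))\<^sup>2"
    by (intro power_mono) auto
   also have "... <= 2 * (norm (partial i p x))\<^sup>2 + 2 * (4 / rho * norm (p x))\<^sup>2"
    using sum_squares_bound[of "norm (partial i p x)" "4 / rho * norm (p x)"] by (simp add: power2_sum)
   also have "... = 2 * (norm (partial i p x))\<^sup>2 + 32 / rho\<^sup>2 * (norm (p x))\<^sup>2"
    by (simp add: power_mult_distrib power_divide)
   also have "... <= 2 * (L * (real d + 1) * C / rho ^ 5 * ?I) + 32 / rho\<^sup>2 * (C / rho ^ 3 * ?I)"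
    using der[OF r p xK(1)] vec[OF r p xK(2)] by (intro add_mono mult_left_mono) auto
   also have "... = C' / rho ^ 5 * ?I" using r by (simp add: C'_def field_simps eval_nat_numeral)
   finally show ?thesis .
  next
   case False
   then have "partial i (%y. bump m rho y *\<^sub>R p y) x = 0"
    using bump_zero[OF r] by (intro partial_zero_outside[of "cball m rho"]) auto
   then show ?thesis using C' r I0 by simp
  qed
 qed
qed

section \<open>Coordinates adapted to a face\<close>

lemma cross3_cramer:
 "(a \<bullet> cross3 b c) *\<^sub>R y = (y \<bullet> cross3 b c) *\<^sub>R a + (y \<bullet> cross3 c a) *\<^sub>R b + (y \<bullet> cross3 a b) *\<^sub>R c"
 by (simp add: cross3_def inner_vec_def sum_3 vec_eq_iff forall_3 vector_def algebra_simps)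

lemma continuous_vector3:
 "continuous_on UNIV (%w::(real \<times> real) \<times> real. vector [fst (fst w), snd (fst w), snd w] :: real^3)"
proof -
 have eq: "(%w::(real \<times> real) \<times> real. vector [fst (fst w), snd (fst w), snd w] :: real^3)
   = (%w. \<chi> i. if i = 1 then fst (fst w) else if i = 2 then snd (fst w) else snd w)"
  by (auto simp: fun_eq_iff vec_eq_iff forall_3)
 have "continuous_on UNIV (%w::(real \<times> real) \<times> real. if i = 1 then fst (fst w) else if i = 2 then snd (fst w) else snd w)" for i :: 3
  by (cases "i = 1"; cases "i = 2") (auto intro!: continuous_intros)
 then show ?thesis unfolding eq by (rule continuous_on_vec_lambda)
qed

text \<open>Face coordinates come as a pair of a plane point and a height, so that product
  integration applies; this identifies the product measure with Lebesgue measure on vectors by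
  comparing boxes.\<close>

lemma lborel_distr_vector3:
 "distr lborel borel (%w::(real \<times> real) \<times> real. vector [fst (fst w), snd (fst w), snd w] :: real^3) = lborel"
 (is "distr lborel borel ?V = _")
proof (rule lborel_eqI[symmetric])
 have V: "?V : borel_measurable borel" by (rule continuous_borel[OF continuous_vector3])
 fix l u :: "real^3" assume lu: "!!b. b : Basis ==> l \<bullet> b <= u \<bullet> b"
 have le: "l $ i <= u $ i" for i using lu[of "axis i 1"] by (simp add: inner_axis axis_in_Basis_iff)
 have pre: "?V -` box l u = ({l$1<..<u$1} \<times> {l$2<..<u$2}) \<times> {l$3<..<u$3}"
  by (auto simp: mem_box_cart forall_3)
 have B: "(Basis :: (real^3) set) = range (%i. axis i 1)" by (auto simp: Basis_vec_def)
 have "emeasure (distr lborel borel ?V) (box l u) = emeasure lborel (({l$1<..<u$1} \<times> {l$2<..<u$2}) \<times> {l$3<..<u$3})"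
  using V by (subst emeasure_distr) (auto simp: pre simp del: vec_lambda_beta)
 also have "... = emeasure (lborel \<Otimes>\<^sub>M lborel) (({l$1<..<u$1} \<times> {l$2<..<u$2}) \<times> {l$3<..<u$3})"
  by (simp add: lborel_prod)
 also have "... = emeasure lborel ({l$1<..<u$1} \<times> {l$2<..<u$2}) * emeasure lborel {l$3<..<u$3}"
  by (rule lborel.emeasure_pair_measure_Times) (auto intro!: borel_open open_Times)
 also have "emeasure lborel ({l$1<..<u$1} \<times> {l$2<..<u$2}) = emeasure (lborel \<Otimes>\<^sub>M lborel) ({l$1<..<u$1} \<times> {l$2<..<u$2})"
  by (simp add: lborel_prod)
 also have "... = emeasure lborel {l$1<..<u$1} * emeasure lborel {l$2<..<u$2}"
  by (rule lborel.emeasure_pair_measure_Times) auto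
 also have "... * emeasure lborel {l$3<..<u$3} = ennreal ((u$1 - l$1) * (u$2 - l$2) * (u$3 - l$3))"
  using le by (simp add: ennreal_mult)
 also have "(u$1 - l$1) * (u$2 - l$2) * (u$3 - l$3) = (\<Prod>i\<in>UNIV. (u - l) $ i)" unfolding UNIV_3 by simp
 also have "... = (\<Prod>b\<in>Basis. (u - l) \<bullet> b)"
  unfolding B by (subst prod.reindex) (simp_all add: inj_on_def axis_eq_axis inner_axis o_def)
 finally show "emeasure (distr lborel borel ?V) (box l u) = (\<Prod>b\<in>Basis. (u - l) \<bullet> b)" .
qed simp

text \<open>Phrased as an identity of measures, so that integrals, integrability and null sets all
  transform by the same fact.\<close>

lemma lborel_linear_image:
 fixes f :: "real^3 => real^3"
 assumes f: "linear f" and d: "det (matrix f) ~= 0"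
 shows "lborel = density (distr lborel borel f) (%_. ennreal \<bar>det (matrix f)\<bar>)"
proof (rule lborel_eqI)
 have mf: "f : borel_measurable borel"
  using f by (intro continuous_borel linear_continuous_on) (simp add: linear_conv_bounded_linear)
 fix l u :: "real^3" assume lu: "!!b. b : Basis ==> l \<bullet> b <= u \<bullet> b"
 have inj: "inj f" using det_nz_iff_inj[OF f] d by simp
 then have bij: "bij f" using linear_injective_imp_surjective[OF f] by (simp add: bij_def)
 obtain h where h: "linear h" "!!x. h (f x) = x" "!!x. f (h x) = x"
  using linear_injective_isomorphism[OF f inj] by metis
 have pre: "f -` box l u = h ` box l u"
 proof (intro set_eqI iffI)
  fix x assume "x : f -` box l u"
  then have "f x : box l u" by simp
  then have "h (f x) : h ` box l u" by (rule imageI)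
  then show "x : h ` box l u" by (simp only: h)
 next
  fix x assume "x : h ` box l u"
  then show "x : f -` box l u" by (auto simp only: h vimage_eq)
 qed
 have hm: "h ` box l u : lmeasurable" by (rule measurable_linear_image[OF h(1)]) simp
 have "f ` (h ` box l u) = box l u" using h(3) by (force simp: image_iff)
 then have "measure lebesgue (box l u) = \<bar>det (matrix f)\<bar> * measure lebesgue (h ` box l u)"
  using measure_linear_image[OF f hm] by simp
 then have m: "measure lborel (box l u) = \<bar>det (matrix f)\<bar> * measure lebesgue (h ` box l u)"
  by (simp add: measure_completion)
 have pb: "f -` box l u : sets borel" using measurable_sets[OF mf, of "box l u"] by simp
 have "emeasure (density (distr lborel borel f) (%_. ennreal \<bar>det (matrix f)\<bar>)) (box l u)
   = ennreal \<bar>det (matrix f)\<bar> * emeasure lborel (f -` box l u)"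
  using mf by (simp add: emeasure_density nn_integral_cmult emeasure_distr)
 also have "emeasure lborel (f -` box l u) = emeasure lebesgue (h ` box l u)" using pb by (simp add: pre)
 also have "... = ennreal (measure lebesgue (h ` box l u))" using hm by (simp add: emeasure_eq_measure2)
 also have "ennreal \<bar>det (matrix f)\<bar> * ... = ennreal (measure lborel (box l u))"
  by (simp add: m ennreal_mult)
 also have "... = (\<Prod>b\<in>Basis. (u - l) \<bullet> b)" using lu by (simp add: measure_lborel_box_eq)
 finally show "emeasure (density (distr lborel borel f) (%_. ennreal \<bar>det (matrix f)\<bar>)) (box l u)
   = (\<Prod>b\<in>Basis. (u - l) \<bullet> b)" .
qed simp

locale face_frame =
 fixes p e1 e2 n :: "real^3"
 assumes n1: "norm n = 1" and ne: "n \<bullet> e1 = 0" "n \<bullet> e2 = 0" and cross_nz: "cross3 e1 e2 ~= 0"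
begin

definition J :: real where "J = norm (cross3 e1 e2)"

text \<open>The third coordinate is the distance travelled against \<open>n\<close>. When
  \<open>n\<close> is the outer normal of an element, small positive heights point into it, which is
  the side of the first limit in \<open>jump\<close>.\<close>

definition Ph :: "(real \<times> real) \<times> real => point" where
 "Ph w = p + fst (fst w) *\<^sub>R e1 + snd (fst w) *\<^sub>R e2 - snd w *\<^sub>R n"

text \<open>The signed Jacobian: \<open>cross3 e1 e2\<close> equals \<open>D\<close> times
  \<open>n\<close>, whence |D| = J. Cramer's rule with this determinant gives the inverse
  coordinates \<open>l1\<close>, \<open>l2\<close>, \<open>l3\<close> as explicit affine
  functions.\<close>

definition D :: real where "D = n \<bullet> cross3 e1 e2"

definition l1 :: "point => real" where "l1 x = ((x - p) \<bullet> cross3 e2 n) / D"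
definition l2 :: "point => real" where "l2 x = ((x - p) \<bullet> cross3 n e1) / D"
definition l3 :: "point => real" where "l3 x = - ((x - p) \<bullet> n)"

lemma J_pos: "J > 0" using cross_nz by (simp add: J_def)

lemma nn: "n \<bullet> n = 1" using n1 by (simp add: dot_square_norm)

lemma cross_eq: "cross3 e1 e2 = D *\<^sub>R n"
proof -
 have "cross3 n (cross3 e1 e2) = 0" by (simp add: Lagrange ne)
 then have "cross3 n (cross3 n (cross3 e1 e2)) = 0" by simp
 then show ?thesis by (simp add: Lagrange[of n n] nn D_def)
qed

lemma abs_D: "\<bar>D\<bar> = J" using n1 by (simp add: J_def cross_eq)

lemma D_nz: "D ~= 0" using abs_D J_pos by auto

lemma l_Ph: "l1 (Ph w) = fst (fst w)" "l2 (Ph w) = snd (fst w)" "l3 (Ph w) = snd w"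
proof -
 have a: "Ph w - p = fst (fst w) *\<^sub>R e1 + snd (fst w) *\<^sub>R e2 - snd w *\<^sub>R n" by (simp add: Ph_def)
 have t: "e1 \<bullet> cross3 e2 n = D" "e2 \<bullet> cross3 n e1 = D" by (simp_all add: D_def cross3_simps)
 have z: "e2 \<bullet> cross3 e2 n = 0" "n \<bullet> cross3 e2 n = 0" "e1 \<bullet> cross3 n e1 = 0" "n \<bullet> cross3 n e1 = 0"
  by (simp_all add: dot_cross_self)
 show "l1 (Ph w) = fst (fst w)" "l2 (Ph w) = snd (fst w)"
  using D_nz unfolding l1_def l2_def a by (simp_all add: inner_add_left inner_diff_left t z)
 show "l3 (Ph w) = snd w" using ne inner_commute[of n e1] inner_commute[of n e2]
  by (simp add: l3_def a inner_add_left inner_diff_left nn)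
qed

lemma Ph_l: "Ph ((l1 x, l2 x), l3 x) = x"
proof -
 have t: "e1 \<bullet> cross3 e2 n = D" by (simp add: D_def cross3_simps)
 have "D *\<^sub>R (x - p) = ((x - p) \<bullet> cross3 e2 n) *\<^sub>R e1 + ((x - p) \<bullet> cross3 n e1) *\<^sub>R e2 + ((x - p) \<bullet> (D *\<^sub>R n)) *\<^sub>R n"
  using cross3_cramer[of e1 e2 n "x - p"] by (simp add: t cross_eq)
 also have "... = D *\<^sub>R (l1 x *\<^sub>R e1 + l2 x *\<^sub>R e2 - l3 x *\<^sub>R n)"
  using D_nz by (simp add: l1_def l2_def l3_def scaleR_add_right scaleR_right_diff_distrib)
 finally have "x - p = l1 x *\<^sub>R e1 + l2 x *\<^sub>R e2 - l3 x *\<^sub>R n" using D_nz by simp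
 then show ?thesis by (simp add: Ph_def algebra_simps)
qed

lemma Ph_continuous: "continuous_on UNIV Ph" unfolding Ph_def by (intro continuous_intros)

lemma Ph_measurable [measurable]: "Ph : borel_measurable borel" by (rule continuous_borel[OF Ph_continuous])

lemma smooth_l: "smooth l1" "smooth l2" "smooth l3"
proof -
 have s: "smooth (%x. (x - p) \<bullet> v)" for v by (rule smooth_linear[OF bounded_linear_inner_left])
   (intro smooth_diff smooth_const smooth_bounded_linear bounded_linear_ident)
 show "smooth l1" "smooth l2" "smooth l3" unfolding l1_def[abs_def] l2_def[abs_def] l3_def[abs_def] divide_inverse
  by (intro smooth_mult smooth_minus s smooth_const)+
qed

lemma lborel_Ph: "lborel = density (distr lborel borel Ph) (%_. ennreal J)"
proof -
 define V :: "(real \<times> real) \<times> real => real^3" where "V w = vector [fst (fst w), snd (fst w), snd w]" for w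
 define f :: "real^3 => real^3" where "f y = y$1 *\<^sub>R e1 + y$2 *\<^sub>R e2 - y$3 *\<^sub>R n" for y
 have f: "linear f" by (rule linearI) (simp_all add: f_def algebra_simps)
 have mf: "f : borel_measurable borel"
  using f by (intro continuous_borel linear_continuous_on) (simp add: linear_conv_bounded_linear)
 have "det (matrix f) = - D"
  by (simp add: matrix_def f_def det_3 D_def cross3_def inner_vec_def sum_3 vector_def axis_def algebra_simps)
 then have d: "\<bar>det (matrix f)\<bar> = J" "det (matrix f) ~= 0" using abs_D D_nz by auto
 have mV: "V : borel_measurable lborel" using continuous_borel[OF continuous_vector3] by (simp add: V_def[abs_def])
 have dV: "distr lborel borel V = (lborel :: (real^3) measure)"
  using lborel_distr_vector3 by (simp add: V_def[abs_def])
 have "(lborel :: (real^3) measure) = distr lborel borel ((+) p)" by (simp add: lborel_distr_plus)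
 also have "... = distr (density (distr (distr lborel borel V) borel f) (%_. ennreal J)) borel ((+) p)"
  using lborel_linear_image[OF f d(2)] d(1) by (simp add: dV)
 also have "... = density (distr (distr (distr lborel borel V) borel f) borel ((+) p)) (%_. ennreal J)"
  by (rule density_distr[symmetric]) auto
 also have "distr (distr (distr lborel borel V) borel f) borel ((+) p) = distr lborel borel ((+) p \<circ> (f \<circ> V))"
  using mf mV by (simp add: distr_distr)
 also have "(+) p \<circ> (f \<circ> V) = Ph" by (auto simp: fun_eq_iff Ph_def f_def V_def)
 finally show ?thesis .
qed

lemma LINT_Ph:
 fixes F :: "point => 'b::{banach,second_countable_topology}"
 assumes "F : borel_measurable borel"
 shows "(LINT x|lborel. F x) = J *\<^sub>R (LINT w|lborel. F (Ph w))"
proof -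
 have "(LINT x|lborel. F x) = (LINT x|density (distr lborel borel Ph) (%_. ennreal J). F x)" using lborel_Ph by simp
 also have "... = (LINT w|lborel. J *\<^sub>R F (Ph w))"
  using assms J_pos by (subst integral_density) (auto simp: integral_distr)
 finally show ?thesis by simp
qed

lemma integrable_Ph:
 fixes F :: "point => 'b::{banach,second_countable_topology}"
 assumes "integrable lborel F"
 shows "integrable lborel (%w. F (Ph w))"
proof -
 have m: "F : borel_measurable borel" using borel_measurable_integrable[OF assms] by simp
 have "integrable (density (distr lborel borel Ph) (%_. ennreal J)) F" using assms lborel_Ph by simp
 then have "integrable lborel (%w. J *\<^sub>R F (Ph w))"
  using m J_pos by (subst (asm) integrable_density) (auto simp: integrable_distr_eq)
 from integrable_scaleR_right[OF this, of "inverse J"] show ?thesis using J_pos by simp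
qed

lemma AE_Ph:
 assumes "AE x in lborel. P x"
 shows "AE w in lborel. P (Ph w)"
proof -
 have "AE x in density (distr lborel borel Ph) (%_. ennreal J). P x" using assms by (simp only: lborel_Ph[symmetric])
 then have "AE x in distr lborel borel Ph. P x" using J_pos by (subst (asm) AE_density) auto
 then obtain N where N: "N : null_sets (distr lborel borel Ph)" "{x. \<not> P x} <= N"
  unfolding eventually_ae_filter by auto
 then have "AE x in distr lborel borel Ph. x ~: N" by (simp add: AE_not_in)
 then have "AE w in lborel. Ph w ~: N" using N by (subst (asm) AE_distr_iff) auto
 then show ?thesis by eventually_elim (use N in auto)
qed

lemma Fubini_Ph:
 fixes F :: "point => 'b::{banach,second_countable_topology}"
 assumes "integrable lborel F"
 shows "(LINT x|lborel. F x) = J *\<^sub>R (LINT z|lborel. LINT t|lborel. F (Ph (z, t)))"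
  and "AE z in lborel. integrable lborel (%t. F (Ph (z, t)))"
  and "integrable lborel (%z. LINT t|lborel. F (Ph (z, t)))"
proof -
 have m: "F : borel_measurable borel" using borel_measurable_integrable[OF assms] by simp
 have i: "integrable (lborel \<Otimes>\<^sub>M lborel) (%w. F (Ph w))"
  using integrable_Ph[OF assms] by (simp add: lborel_prod)
 show "(LINT x|lborel. F x) = J *\<^sub>R (LINT z|lborel. LINT t|lborel. F (Ph (z, t)))"
  unfolding LINT_Ph[OF m] lborel_pair.integral_fst'[OF i] by (simp add: lborel_prod)
 show "AE z in lborel. integrable lborel (%t. F (Ph (z, t)))" using lborel_pair.AE_integrable_fst'[OF i] .
 show "integrable lborel (%z. LINT t|lborel. F (Ph (z, t)))" using lborel_pair.integrable_fst'[OF i] .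
qed

lemma AE_Ph_lines:
 assumes "AE x in lborel. P x"
 shows "AE z in lborel. AE t in lborel. P (Ph (z, t))"
proof -
 have "AE w in lborel \<Otimes>\<^sub>M lborel. P (Ph w)" using AE_Ph[OF assms] by (simp only: lborel_prod)
 from lborel_pair.AE_pair[OF this] show ?thesis .
qed

end

section \<open>Traces on a face and Green's formula\<close>

lemma eventually_ess_at_right_0:
 assumes "\<delta> > 0" "AE t in lborel. 0 < t & t < \<delta> --> P t"
 shows "eventually P ess_at_right_0"
 unfolding ess_at_right_0_def eventually_inf
proof (intro exI conjI)
 show "eventually (%t. 0 < t & t < \<delta>) (at_right (0::real))"
  using assms(1) by (auto simp: eventually_at_right_field)
 show "AE t in lborel. 0 < t & t < \<delta> --> P t" by fact
qed auto

text \<open>Every interval to the right of 0 has positive measure; hence essential limits are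
  unique.\<close>

lemma ess_at_right_0_nontrivial: "ess_at_right_0 ~= bot"
proof
 assume "ess_at_right_0 = bot"
 then have "eventually (%_. False) (inf (at_right (0::real)) (ae_filter lborel))"
  by (simp add: ess_at_right_0_def trivial_limit_def)
 then obtain P Q where PQ: "eventually P (at_right (0::real))" "AE t in lborel. Q t" "!!t. P t ==> Q t ==> False"
  unfolding eventually_inf by blast
 then obtain b where b: "b > 0" "!!t. 0 < t ==> t < b ==> P t" by (auto simp: eventually_at_right_field)
 have "AE t in lborel. t ~: {0<..<b}" using PQ(2) by eventually_elim (use PQ(3) b in auto)
 then have "{0<..<b} : null_sets lborel" by (subst (asm) AE_iff_null_sets[symmetric]) auto
 then show False using b by (simp add: null_sets_def)
qed

lemma tendsto_ess_at_right_0: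
 "(f \<longlongrightarrow> l) (at_right (0::real)) ==> (f \<longlongrightarrow> l) ess_at_right_0"
 unfolding ess_at_right_0_def by (rule tendsto_mono[OF inf_le1])

text \<open>Differentiating along a line is easier than taking partial derivatives when the function
  is written in face coordinates, which are affine along lines.\<close>

lemma sum_partial_line:
 assumes c: "smooth ct"
  and d: "((%s. ct (x + s *\<^sub>R v)) has_vector_derivative D) (at 0)"
 shows "(SUM i:UNIV. v $ i *\<^sub>R partial i ct x) = D"
proof -
 let ?F = "frechet_derivative ct (at x)"
 have F: "(ct has_derivative ?F) (at x)" using smooth_differentiable[OF c] by (simp add: frechet_derivative_works)
 note lin = has_derivative_linear[OF F]
 have "((%s. x + s *\<^sub>R v) has_derivative (%s. s *\<^sub>R v)) (at 0)" by (auto intro!: derivative_eq_intros)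
 from has_derivative_compose[OF this, of ct ?F] F
 have "((%s. ct (x + s *\<^sub>R v)) has_derivative (%s. ?F (s *\<^sub>R v))) (at 0)" by simp
 then have "((%s. ct (x + s *\<^sub>R v)) has_vector_derivative ?F v) (at 0)"
  by (simp add: has_vector_derivative_def linear_scale[OF lin])
 then have "D = ?F v" using d vector_derivative_unique_at by blast
 also have "v = (SUM i:UNIV. v $ i *\<^sub>R axis i 1)"
  using basis_expansion[of v] by (simp add: scalar_mult_eq_scaleR)
 also have "?F ... = (SUM i:UNIV. v $ i *\<^sub>R partial i ct x)"
  by (simp add: linear_sum[OF lin] linear_scale[OF lin] partial_def)
 finally show ?thesis by simp
qed

text \<open>Two descriptions of one antiderivative: as a smooth function it enters a test function,
  as an integral over a half line it enters Fubini's theorem.\<close>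

lemma box_bump_antiderivative:
 "EX B. smooth1 B & (ALL t. (B has_real_derivative box_bump k a b t) (at t)) \<and>
  (ALL t. B t = (LINT r|lborel. box_bump k a b r * indicator {..<t} r))"
proof -
 let ?b = "box_bump k a b"
 have cb: "continuous_on UNIV ?b" by (rule smooth1_continuous[OF smooth1_box_bump])
 then have ib: "isCont ?b x" for x by (simp add: continuous_on_eq_continuous_at)
 obtain F where F: "!!x. (F has_vector_derivative ?b x) (at x)"
  using einterval_antiderivative[of "-\<infinity>" "\<infinity>" ?b] ib by auto
 then have F': "(F has_real_derivative ?b x) (at x)" for x
  by (simp add: has_real_derivative_iff_has_vector_derivative)
 define B where "B t = F t - F a" for t
 have B': "(B has_real_derivative ?b x) (at x)" for x unfolding B_def using F' by (auto intro!: derivative_eq_intros)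
 have mb: "?b : borel_measurable borel" by (rule continuous_borel[OF cb])
 have "B t = (LINT r|lborel. ?b r * indicator {..<t} r)" for t
 proof (cases "a <= t")
  case True
  have "(LINT r|lborel. ?b r * indicator {a..t} r) = B t"
   unfolding B_def using True F' ib by (intro integral_FTC_Icc_real) auto
  moreover have "(LINT r|lborel. ?b r * indicator {a..t} r) = (LINT r|lborel. ?b r * indicator {..<t} r)"
  proof (rule integral_cong_AE)
   show "AE r in lborel. ?b r * indicator {a..t} r = ?b r * indicator {..<t} r" using AE_lborel_singleton[of t]
   proof eventually_elim
    case (elim r)
    then show ?case by (cases "r < a") (auto simp: indicator_def box_bump_zero')
   qed
  qed (use mb in measurable)
  ultimately show ?thesis by simp
 next
  case False
  have "(LINT r|lborel. ?b r * indicator {t..a} r) = - B t"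
   using False F' ib integral_FTC_Icc_real[of t a F ?b] by (simp add: B_def)
  moreover have "?b r * indicator {t..a} r = 0" "?b r * indicator {..<t} r = 0" for r
   using False by (auto simp: indicator_def box_bump_zero')
  ultimately show ?thesis by (simp only: integral_zero)
 qed
 then show ?thesis using B' smooth1_antideriv[of B ?b] smooth1_box_bump by blast
qed

lemma bounded_compact_support:
 fixes F :: "'a::euclidean_space => 'b::real_normed_vector"
 assumes "continuous_on UNIV F" "compact K" "!!x. x ~: K ==> F x = 0"
 obtains B where "!!x. norm (F x) <= B" "B \<ge> 0"
proof -
 have "compact (F ` K)" by (intro compact_continuous_image continuous_on_subset[OF assms(1)] assms) auto
 then obtain B where B: "!!x. x : K ==> norm (F x) <= B" using compact_imp_bounded by (force simp: bounded_iff)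
 have "norm (F x) <= max B 0" for x using B assms(3) by (cases "x : K") (auto simp: le_max_iff_disj)
 then show thesis using that[of "max B 0"] by simp
qed

lemma integrable_mult_bounded:
 fixes f w :: "'a => complex"
 assumes f: "integrable M f" and w: "w : borel_measurable M" "!!x. norm (w x) <= B"
 shows "integrable M (%x. f x * w x)"
proof (rule Bochner_Integration.integrable_bound)
 show "integrable M (%x. B * norm (f x))" using f by simp
 have "norm (f x * w x) <= norm (B * norm (f x))" for x
 proof -
  have "norm (f x * w x) <= norm (f x) * B" unfolding norm_mult by (intro mult_left_mono w) simp
  also have "... <= norm (B * norm (f x))" by (metis abs_ge_self mult.commute real_norm_def)
  finally show ?thesis .
 qed
 then show "AE x in M. norm (f x * w x) <= norm (B * norm (f x))" by simp
qed (use f w in simp)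

lemma continuous_measurable_lebesgue:
 "continuous_on UNIV F ==> F : borel_measurable (lebesgue :: 'a::euclidean_space measure)"
 by (intro measurable_completion) (simp add: continuous_borel)

lemma integrable_pair_mult:
 fixes f :: "'a::euclidean_space => complex" and g :: "'b::euclidean_space => complex"
 assumes f: "integrable lborel f" and g: "integrable lborel g"
 shows "integrable (lborel \<Otimes>\<^sub>M lborel) (%(x, y). f x * g y)"
proof (rule lborel_pair.Fubini_integrable)
 have [measurable]: "f : borel_measurable borel" "g : borel_measurable borel"
  using f g by (auto dest: borel_measurable_integrable)
 show "(%(x, y). f x * g y) : borel_measurable (lborel \<Otimes>\<^sub>M lborel)" by measurable
qed (use f g in \<open>auto simp: norm_mult\<close>)

text \<open>The cutoff \<open>phi\<close> may be nonzero on the plane l3 = 0; the part of its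
  support strictly above the plane has to lie inside \<open>T\<close>. Multiplied by a smooth
  function that vanishes for l3 < \<delta> it becomes an admissible test function.\<close>

locale trace_setup = face_frame +
 fixes T :: "point set" and g :: "point => complex" and G :: "3 => point => complex"
  and phi :: "point => complex" and K :: "point set"
 assumes T: "T : sets lebesgue"
  and g: "integrable (lebesgue_on T) g" and G: "!!i. integrable (lebesgue_on T) (G i)"
  and weak: "!!i psi. test_fun T psi ==> sprod T (G i) psi = - sprod T g (partial i psi)"
  and phi: "smooth phi" and K: "compact K" "!!x. x ~: K ==> phi x = 0"
   "!!x. x : K ==> l3 x > 0 ==> x : interior T"
begin

text \<open>The weak derivative of the product of \<open>g\<close> and \<open>phi\<close> on the
  upper half space, continued by zero; \<open>u\<close> is the product itself.\<close>

definition k :: "3 => point => complex" where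
 "k i x = (if l3 x > 0 then G i x * phi x + g x * partial i phi x else 0)"

definition u :: "point => complex" where
 "u x = (if l3 x > 0 then g x * phi x else 0)"

lemma l3_continuous: "continuous_on UNIV l3" by (rule smooth_continuous[OF smooth_l(3)])

lemma closedK: "closed K" using K(1) by (rule compact_imp_closed)

lemma partial_phi_zero: "x ~: K ==> partial i phi x = 0" by (rule partial_zero_outside[OF closedK K(2)])

lemma H_borel: "{x. l3 x > 0} : sets borel"
 using l3_continuous by (intro borel_open open_Collect_less) (auto intro: continuous_intros)

lemma half_measurable:
 fixes F :: "point => complex"
 assumes "F : borel_measurable borel"
 shows "(%x. if l3 x > 0 then F x else 0) : borel_measurable borel"
 by (rule measurable_If) (use assms H_borel in auto)

lemma integrable_half:
 assumes f: "integrable (lebesgue_on T) f" and F: "continuous_on UNIV F" "!!x. x ~: K ==> F x = (0::complex)"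
 shows "integrable lebesgue (%x. if l3 x > 0 then f x * F x else 0)"
proof -
 obtain B where B: "!!x. norm (F x) <= B" "B \<ge> 0" using bounded_compact_support[OF F(1) K(1) F(2)] by auto
 define w where "w x = (if l3 x > 0 then F x else 0)" for x
 have "integrable lebesgue (%x. (indicator T x *\<^sub>R f x) * w x)"
 proof (rule integrable_mult_bounded)
  show "integrable lebesgue (%x. indicator T x *\<^sub>R f x)" using f T by (simp add: integrable_lebesgue_on_iff)
  have "w : borel_measurable borel" unfolding w_def by (rule half_measurable[OF continuous_borel[OF F(1)]])
  then show "w : borel_measurable lebesgue" by (intro measurable_completion) simp
  show "norm (w x) <= B" for x using B by (simp add: w_def)
 qed
 moreover have "(indicator T x *\<^sub>R f x) * w x = (if l3 x > 0 then f x * F x else 0)" for x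
  using F(2)[of x] K(3)[of x] interior_subset[of T] by (auto simp: w_def indicator_def)
 ultimately show ?thesis by simp
qed

lemma cont_phi: "continuous_on UNIV phi" "continuous_on UNIV (partial i phi)"
 by (intro smooth_continuous smooth_partial phi)+

lemma integrable_u: "integrable lebesgue u" unfolding u_def by (rule integrable_half[OF g cont_phi(1) K(2)])

lemma integrable_k: "integrable lebesgue (k i)"
proof -
 have "integrable lebesgue (%x. (if l3 x > 0 then G i x * phi x else 0) + (if l3 x > 0 then g x * partial i phi x else 0))"
  by (intro Bochner_Integration.integrable_add integrable_half G g cont_phi K(2) partial_phi_zero)
 moreover have "k i = (%x. (if l3 x > 0 then G i x * phi x else 0) + (if l3 x > 0 then g x * partial i phi x else 0))"
  by (auto simp: k_def)
 ultimately show ?thesis by simp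
qed

text \<open>The test function is the conjugate of \<open>phi\<close> times \<open>ct\<close>,
  supported in the compact part of \<open>K\<close> at heights at least \<delta>. The term in which
  the derivative falls on \<open>phi\<close> moves to the left side, where it completes
  \<open>k\<close>.\<close>

lemma weak_half:
 assumes c: "smooth ct" and d: "\<delta> > 0" "!!x. l3 x < \<delta> ==> ct x = 0"
 shows "(LINT x|lebesgue. k i x * ct x) = - (LINT x|lebesgue. u x * partial i ct x)"
  and "integrable lebesgue (%x. k i x * ct x)" "integrable lebesgue (%x. u x * partial i ct x)"
proof -
 define psi where "psi x = cnj (phi x * ct x)" for x
 define K' where "K' = K Int {x. \<delta> <= l3 x}"
 have clo: "closed {x. \<delta> <= l3 x}"
  using l3_continuous by (intro closed_Collect_le) (auto intro: continuous_intros)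
 have dchi: "partial i ct x = 0" if "l3 x < \<delta>" for i x
  using that d by (intro partial_zero_outside[OF clo]) auto
 have sp: "smooth (%x. phi x * ct x)" by (intro smooth_mult phi c)
 have t: "test_fun T psi"
 proof (rule test_funI)
  show "smooth psi" unfolding psi_def[abs_def] by (rule smooth_linear[OF bounded_linear_cnj sp])
  show "compact K'" unfolding K'_def using K(1) clo by (rule compact_Int_closed)
  show "K' <= interior T" using K(3) d(1) by (force simp: K'_def)
  show "psi x = 0" if "x ~: K'" for x using that K(2)[of x] d(2)[of x] by (auto simp: psi_def K'_def not_le)
 qed
 have dpsi: "cnj (partial i psi x) = phi x * partial i ct x + partial i phi x * ct x" for x
 proof -
  have "partial i psi x = cnj (partial i (%x. phi x * ct x) x)"
   unfolding psi_def[abs_def] by (rule partial_linear[OF bounded_linear_cnj smooth_differentiable[OF sp]])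
  then show ?thesis by (simp add: partial_mult[OF phi c])
 qed
 have cc: "continuous_on UNIV ct" "continuous_on UNIV (partial i ct)" by (intro smooth_continuous smooth_partial c)+
 have iA: "integrable lebesgue (%x. if l3 x > 0 then G i x * (phi x * ct x) else 0)"
  by (rule integrable_half[OF G]) (auto intro!: continuous_on_mult cont_phi cc simp: K(2))
 have iB: "integrable lebesgue (%x. if l3 x > 0 then g x * (partial i phi x * ct x) else 0)"
  by (rule integrable_half[OF g]) (auto intro!: continuous_on_mult cont_phi cc simp: partial_phi_zero)
 have iC: "integrable lebesgue (%x. if l3 x > 0 then g x * (phi x * partial i ct x) else 0)"
  by (rule integrable_half[OF g]) (auto intro!: continuous_on_mult cont_phi cc simp: K(2))
 have e1: "k i x * ct x = (if l3 x > 0 then G i x * (phi x * ct x) else 0) + (if l3 x > 0 then g x * (partial i phi x * ct x) else 0)" for x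
  by (simp add: k_def algebra_simps)
 have e2: "u x * partial i ct x = (if l3 x > 0 then g x * (phi x * partial i ct x) else 0)" for x by (simp add: u_def)
 show i1: "integrable lebesgue (%x. k i x * ct x)" unfolding e1 by (rule Bochner_Integration.integrable_add[OF iA iB])
 show i2: "integrable lebesgue (%x. u x * partial i ct x)" unfolding e2 by (rule iC)
 have z: "indicator T x *\<^sub>R (G i x * cnj (psi x)) = (if l3 x > 0 then G i x * (phi x * ct x) else 0)" for x
  using K(2)[of x] K(3)[of x] d(2)[of x] d(1) subsetD[OF interior_subset, of x T]
  by (auto simp: psi_def indicator_def)
 have z2: "indicator T x *\<^sub>R (g x * cnj (partial i psi x))
   = (if l3 x > 0 then g x * (phi x * partial i ct x) else 0) + (if l3 x > 0 then g x * (partial i phi x * ct x) else 0)" for x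
  unfolding dpsi using K(2)[of x] partial_phi_zero[of x i] K(3)[of x] d(2)[of x] dchi[of x] d(1) subsetD[OF interior_subset, of x T]
  by (cases "x : K") (auto simp: indicator_def algebra_simps)
 have "(LINT x|lebesgue. (if l3 x > 0 then G i x * (phi x * ct x) else 0))
   = - (LINT x|lebesgue. (if l3 x > 0 then g x * (phi x * partial i ct x) else 0) + (if l3 x > 0 then g x * (partial i phi x * ct x) else 0))"
  using weak[OF t, of i] T by (simp add: sprod_def LINT_lebesgue_on z z2)
 then show "(LINT x|lebesgue. k i x * ct x) = - (LINT x|lebesgue. u x * partial i ct x)"
  unfolding e1 e2 using iA iB iC by (simp add: eq_neg_iff_add_eq_0 algebra_simps)
qed

lemma weak_half_dir:
 assumes c: "smooth ct" and d: "\<delta> > 0" "!!x. l3 x < \<delta> ==> ct x = 0"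
  and Dc: "!!x. (SUM i:UNIV. v $ i *\<^sub>R partial i ct x) = Dc x"
 shows "(LINT x|lebesgue. (SUM i:UNIV. v $ i *\<^sub>R k i x) * ct x) = - (LINT x|lebesgue. u x * Dc x)"
proof -
 note w = weak_half[OF c d]
 have "(LINT x|lebesgue. (SUM i:UNIV. v $ i *\<^sub>R k i x) * ct x) = (SUM i:UNIV. v $ i *\<^sub>R (LINT x|lebesgue. k i x * ct x))"
  using w(2) by (simp add: sum_distrib_right)
 also have "... = - (SUM i:UNIV. v $ i *\<^sub>R (LINT x|lebesgue. u x * partial i ct x))"
  using w(1) by (simp add: sum_negf)
 also have "(SUM i:UNIV. v $ i *\<^sub>R (LINT x|lebesgue. u x * partial i ct x)) = (LINT x|lebesgue. u x * Dc x)"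
  using w(3) by (simp add: Dc[symmetric] sum_distrib_left)
 finally show ?thesis .
qed

lemma l3_line: "l3 (x + s *\<^sub>R v) = l3 x - s * (v \<bullet> n)"
 by (simp add: l3_def inner_add_left inner_diff_left)

text \<open>A cutoff depending on the height alone has zero derivative along \<open>v\<close>, so
  the weak formula gives 0 for each cutoff; the cutoffs tend to 1 above the plane.\<close>

lemma tangential_zero:
 assumes v: "v \<bullet> n = 0"
 shows "(SUM i:UNIV. v $ i *\<^sub>R (LINT x|lebesgue. k i x)) = 0"
proof -
 define ct where "ct j x = complex_of_real (flat (real j * l3 x - 1))" for j :: nat and x
 have sm: "smooth (ct j)" for j unfolding ct_def[abs_def]
  by (intro smooth_linear[OF bounded_linear_of_real] smooth_comp[OF smooth1_flat] smooth_diff smooth_mult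
    smooth_const smooth_l)
 define kv where "kv x = (SUM i:UNIV. v $ i *\<^sub>R k i x)" for x
 have ikv: "integrable lebesgue kv" unfolding kv_def using integrable_k by simp
 have z: "(LINT x|lebesgue. kv x * ct (Suc j) x) = 0" for j
 proof -
  have "(LINT x|lebesgue. kv x * ct (Suc j) x) = - (LINT x|lebesgue. u x * 0)" unfolding kv_def
  proof (rule weak_half_dir[OF sm])
   show "1 / real (Suc j) > 0" by simp
   show "ct (Suc j) x = 0" if "l3 x < 1 / real (Suc j)" for x using that by (simp add: ct_def flat_bounds field_simps)
   show "(SUM i:UNIV. v $ i *\<^sub>R partial i (ct (Suc j)) x) = 0" for x
    by (rule sum_partial_line[OF sm]) (simp add: ct_def l3_line v)
  qed
  then show ?thesis by simp
 qed
 have "(%j. LINT x|lebesgue. kv x * ct (Suc j) x) \<longlonglongrightarrow> (LINT x|lebesgue. kv x)"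
 proof (rule integral_dominated_convergence[where w = "%x. norm (kv x)"])
  show "(%x. kv x * ct (Suc j) x) : borel_measurable lebesgue" for j
   using ikv continuous_measurable_lebesgue[OF smooth_continuous[OF sm]] by (intro borel_measurable_times) auto
  show "AE x in lebesgue. (%j. kv x * ct (Suc j) x) \<longlonglongrightarrow> kv x"
  proof (rule AE_I2)
   fix x
   show "(%j. kv x * ct (Suc j) x) \<longlonglongrightarrow> kv x"
   proof (cases "l3 x > 0")
    case True
    have "(%j. flat (real (Suc j) * l3 x - 1)) \<longlonglongrightarrow> 1"
     using flat_scaled_LIMSEQ[OF True] by (rule LIMSEQ_Suc)
    then have "(%j. kv x * ct (Suc j) x) \<longlonglongrightarrow> kv x * complex_of_real 1"
     unfolding ct_def by (intro tendsto_intros)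
    then show ?thesis by simp
   next
    case False
    then show ?thesis by (simp add: kv_def k_def)
   qed
  qed
  show "AE x in lebesgue. norm (kv x * ct (Suc j) x) <= norm (kv x)" for j
   using flat_bounds by (intro AE_I2) (auto simp: norm_mult ct_def intro!: mult_right_le_one_le)
 qed (use ikv in auto)
 then have "(LINT x|lebesgue. kv x) = 0" using z by (simp add: LIMSEQ_const_iff)
 then show ?thesis unfolding kv_def using integrable_k by simp
qed

text \<open>Along almost every normal line the product has a continuous version, obtained by
  integrating the normal derivative from infinity. Its value at height 0 is the trace, and Fubini
  turns the integral of the normal derivative into the integral of the trace. Tangential derivatives
  integrate to zero, which explains the factor n_i.\<close>

lemma trace_green:
 obtains h where "integrable lborel h"
  "AE z in lborel. ((%t. g (Ph (z, t)) * phi (Ph (z, t))) \<longlongrightarrow> h z) ess_at_right_0"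
  "!!i. (LINT x|lebesgue. k i x) = n $ i *\<^sub>R (J *\<^sub>R (LINT z|lborel. h z))"
proof -
 define kn where "kn x = (SUM i:UNIV. (- n) $ i *\<^sub>R k i x)" for x
 have ikn: "integrable lebesgue kn" unfolding kn_def using integrable_k by simp
 obtain kn0 where kn0: "kn0 : borel_measurable borel" "AE x in lborel. kn x = kn0 x"
  using lebesgue_borel_representative[OF borel_measurable_integrable[OF ikn]] .
 define kn' where "kn' x = (if l3 x > 0 then kn0 x else 0)" for x
 have kn'_m: "kn' : borel_measurable borel" unfolding kn'_def by (rule half_measurable[OF kn0(1)])
 have kn'_eq: "AE x in lborel. kn x = kn' x" using kn0(2) by eventually_elim (auto simp: kn'_def kn_def k_def)
 obtain u' where u': "u' : borel_measurable borel" "AE x in lborel. u x = u' x"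
  using lebesgue_borel_representative[OF borel_measurable_integrable[OF integrable_u]] .
 have transfer: "integrable lborel f'" if "integrable lebesgue f" "f' : borel_measurable borel" "AE x in lborel. f x = f' x"
  for f f' :: "point => complex"
 proof -
  have "integrable lebesgue f'"
  proof (rule integrable_cong_AE_imp[OF that(1)])
   show "f' : borel_measurable lebesgue" using that(2) by (intro measurable_completion) simp
   show "AE x in lebesgue. f x = f' x" using that(3) by (simp add: AE_lebesgue_iff)
  qed
  then show ?thesis using that(2) by (simp add: integrable_completion)
 qed
 have ikn': "integrable lborel kn'" by (rule transfer[OF ikn kn'_m kn'_eq])
 have iu': "integrable lborel u'" by (rule transfer[OF integrable_u u'])
 define U where "U w = u' (Ph w)" for w
 define Kk where "Kk w = kn' (Ph w)" for w
 have mK[measurable]: "Kk : borel_measurable borel" and mU[measurable]: "U : borel_measurable borel"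
  unfolding Kk_def U_def using kn'_m u'(1) by measurable
 have iK: "integrable lborel Kk" and iU: "integrable lborel U"
  unfolding Kk_def U_def by (intro integrable_Ph ikn' iu')+
 have Kz: "AE z in lborel. integrable lborel (%t. Kk (z, t))" unfolding Kk_def by (rule Fubini_Ph(2)[OF ikn'])
 have Kneg: "Kk (z, t) = 0" if "t <= 0" for z t using that by (simp add: Kk_def kn'_def l_Ph)
 \<comment> \<open>The candidate version: minus the integral of the normal derivative above the
   given height. \<open>Kk\<close> vanishes at nonpositive heights, so the value at height 0 is
   minus the integral over the whole line.\<close>
 define Hf where "Hf w = - (LINT s|lborel. (if snd w < s then Kk (fst w, s) else 0))" for w :: "(real \<times> real) \<times> real"
 have mH[measurable]: "Hf : borel_measurable borel"
 proof -
  have "(%w. LINT s|lborel. (if snd w < s then Kk (fst w, s) else 0)) : borel_measurable (borel :: ((real \<times> real) \<times> real) measure)"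
  proof (rule lborel.borel_measurable_lebesgue_integral)
   have "(%x. if snd (fst x) < snd x then Kk (fst (fst x), snd x) else 0) : borel_measurable (borel :: (((real \<times> real) \<times> real) \<times> real) measure)"
   proof (rule measurable_If)
    have "{x :: ((real \<times> real) \<times> real) \<times> real. snd (fst x) < snd x} : sets borel"
     by (intro borel_open open_Collect_less continuous_intros)
    then show "{x : space (borel :: (((real \<times> real) \<times> real) \<times> real) measure). snd (fst x) < snd x} : sets borel" by simp
    have "(%x :: ((real \<times> real) \<times> real) \<times> real. (fst (fst x), snd x)) : borel \<rightarrow>\<^sub>M borel"
     by (intro continuous_borel continuous_intros)
    from measurable_compose[OF this mK]
    show "(%x. Kk (fst (fst x), snd x)) : borel_measurable (borel :: (((real \<times> real) \<times> real) \<times> real) measure)" .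
   qed simp
   then show "(%(w, s). if snd w < s then Kk (fst w, s) else 0) : borel_measurable ((borel :: ((real \<times> real) \<times> real) measure) \<Otimes>\<^sub>M lborel)"
   proof -
    have S: "sets ((borel :: ((real \<times> real) \<times> real) measure) \<Otimes>\<^sub>M (lborel :: real measure)) = sets borel"
     unfolding borel_prod[symmetric] by (rule sets_pair_measure_cong) simp_all
    assume "(%x. if snd (fst x) < snd x then Kk (fst (fst x), snd x) else 0) : borel_measurable (borel :: (((real \<times> real) \<times> real) \<times> real) measure)"
    then show ?thesis by (simp add: case_prod_beta measurable_cong_sets[OF S refl])
   qed
  qed
  then show ?thesis unfolding Hf_def by (rule borel_measurable_uminus)
 qed
 \<comment> \<open>Height 1 is arbitrary: only the behaviour near the plane matters, and a bounded
   range of heights makes \<open>Hf\<close> integrable.\<close>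
 define Gs where "Gs = (UNIV :: (real \<times> real) set) \<times> {0<..<1::real}"
 let ?V = "%w. indicator Gs w *\<^sub>R (U w - Hf w)" and ?W = "%w. indicator Gs w *\<^sub>R Hf w"
 have oG: "open Gs" unfolding Gs_def by (intro open_Times) auto
 have Hbound: "norm (Hf (z, t)) <= (LINT s|lborel. norm (Kk (z, s)))" if "integrable lborel (%t. Kk (z, t))" for z t
 proof -
  have "norm (Hf (z, t)) <= (LINT s|lborel. norm (if t < s then Kk (z, s) else 0))"
   unfolding Hf_def norm_minus_cancel fst_conv snd_conv by (rule integral_norm_bound)
  also have "... <= (LINT s|lborel. norm (Kk (z, s)))" using that by (intro integral_mono_AE') auto
  finally show ?thesis .
 qed
 have iN: "integrable lborel (%z. LINT s|lborel. norm (Kk (z, s)))"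
  using lborel_pair.integrable_fst'[of "%w. norm (Kk w)"] iK by (simp add: lborel_prod)
 have iHG: "integrable lborel ?W"
 proof -
  have sG: "Gs : sets borel" using oG by simp
  have m: "?W : borel_measurable (lborel \<Otimes>\<^sub>M lborel)" using sG by (simp add: lborel_prod)
  have inner: "AE z in lborel. integrable lborel (%t. indicator Gs (z, t) *\<^sub>R Hf (z, t)) \<and>
    (LINT t|lborel. norm (indicator Gs (z, t) *\<^sub>R Hf (z, t))) <= (LINT s|lborel. norm (Kk (z, s)))" using Kz
  proof eventually_elim
   case (elim z)
   let ?N = "LINT s|lborel. norm (Kk (z, s))"
   have ii: "integrable lborel (%t::real. indicator {0<..<1} t * ?N)"
    by (intro integrable_mult_left integrable_real_indicator) auto
   have mm: "(%t. indicator Gs (z, t) *\<^sub>R Hf (z, t)) : borel_measurable lborel" using m by measurable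
   have bb: "norm (indicator Gs (z, t) *\<^sub>R Hf (z, t)) <= indicator {0<..<1} t * ?N" for t
    using Hbound[OF elim, of t] by (auto simp: Gs_def indicator_def)
   have i: "integrable lborel (%t. indicator Gs (z, t) *\<^sub>R Hf (z, t))"
    by (rule Bochner_Integration.integrable_bound[OF ii mm]) (use bb in \<open>auto intro: order_trans[OF _ abs_ge_self]\<close>)
   have "(LINT t|lborel. norm (indicator Gs (z, t) *\<^sub>R Hf (z, t))) <= (LINT t|lborel. indicator {0<..<1::real} t * ?N)"
    by (rule integral_mono[OF integrable_norm[OF i] ii]) (rule bb)
   then show ?case using i by simp
  qed
  have "integrable (lborel \<Otimes>\<^sub>M lborel) ?W"
  proof (rule lborel_pair.Fubini_integrable[OF m])
   show "integrable lborel (%z. LINT t|lborel. norm (indicator Gs (z, t) *\<^sub>R Hf (z, t)))"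
   proof (rule Bochner_Integration.integrable_bound[OF iN])
    show "(%z. LINT t|lborel. norm (indicator Gs (z, t) *\<^sub>R Hf (z, t))) : borel_measurable lborel"
     using m by measurable
    show "AE z in lborel. norm (LINT t|lborel. norm (indicator Gs (z, t) *\<^sub>R Hf (z, t))) <= norm (LINT s|lborel. norm (Kk (z, s)))"
     using inner by eventually_elim (auto intro!: order_trans[OF _ abs_ge_self])
   qed
   show "AE z in lborel. integrable lborel (%t. indicator Gs (z, t) *\<^sub>R Hf (z, t))"
    using inner by eventually_elim auto
  qed
  then show ?thesis by (simp add: lborel_prod)
 qed
 have iUG: "integrable lborel (%w. indicator Gs w *\<^sub>R U w)"
  using oG iU by (intro integrable_mult_indicator) auto
 \<comment> \<open>It suffices to integrate against smooth approximations of box indicators, taken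
   as products of a bump in the plane and a bump in the height.\<close>
 have UH: "AE w in lborel. w : Gs --> U w - Hf w = 0"
 proof (rule AE_zero_open[OF oG])
  show iUH: "integrable lborel ?V"
   using Bochner_Integration.integrable_diff[OF iUG iHG] by (simp add: scaleR_diff_right)
  fix a b :: "(real \<times> real) \<times> real" assume ab: "box a b <= Gs"
  show "(LINT w|lborel. indicator (box a b) w *\<^sub>R (U w - Hf w)) = 0"
  proof (cases "box a b = {}")
   case False
   obtain a1 a2 t1 b1 b2 t2 where abe: "a = ((a1, a2), t1)" "b = ((b1, b2), t2)" by (metis surj_pair)
   have mb: "w : box a b \<longleftrightarrow> a1 < fst (fst w) & fst (fst w) < b1 & a2 < snd (fst w) & snd (fst w) < b2 & t1 < snd w & snd w < t2" for w
    by (cases w; cases "fst w") (auto simp: abe mem_box Basis_prod_def)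
   have t01: "0 <= t1" "t2 <= 1"
   proof -
    obtain w where w: "w : box a b" using False by auto
    show "0 <= t1"
    proof (rule ccontr)
     assume "\<not> 0 <= t1"
     moreover obtain s where "t1 < s" "s < 0" "s < snd w"
      using w \<open>\<not> 0 <= t1\<close> dense[of t1 "min (snd w) 0"] unfolding mb by auto
     ultimately have "(fst w, s) : box a b" using w unfolding mb by auto
     then show False using ab \<open>s < 0\<close> by (auto simp: Gs_def)
    qed
    show "t2 <= 1"
    proof (rule ccontr)
     assume "\<not> t2 <= 1"
     moreover obtain s where "s < t2" "1 < s" "snd w < s"
      using w \<open>\<not> t2 <= 1\<close> dense[of "max (snd w) 1" t2] unfolding mb by auto
     ultimately have "(fst w, s) : box a b" using w unfolding mb by auto
     then show False using ab \<open>1 < s\<close> by (auto simp: Gs_def)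
    qed
   qed
   define A where "A j z = box_bump j a1 b1 (fst z) * box_bump j a2 b2 (snd z)" for j and z :: "real \<times> real"
   define bf where "bf j = box_bump j t1 t2" for j
   have cA: "continuous_on UNIV (A j)" for j unfolding A_def using smooth1_continuous[OF smooth1_box_bump]
    by (intro continuous_on_mult continuous_on_compose2[of UNIV "box_bump j a1 b1" UNIV fst]
      continuous_on_compose2[of UNIV "box_bump j a2 b2" UNIV snd] continuous_on_fst continuous_on_snd continuous_on_id) simp_all
   have cbf: "continuous_on UNIV (bf j)" for j unfolding bf_def by (rule smooth1_continuous[OF smooth1_box_bump])
   have mA[measurable]: "A j : borel_measurable borel" and mbf[measurable]: "bf j : borel_measurable borel" for j
    using cA cbf by (auto intro: continuous_borel)
   have A01: "0 <= A j z" "A j z <= 1" for j z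
    by (auto simp: A_def box_bump_bounds intro!: mult_le_one mult_nonneg_nonneg)
   have b01: "0 <= bf j t" "bf j t <= 1" for j t by (auto simp: bf_def box_bump_bounds)
   have ibf: "integrable lborel (bf j)" for j by (rule integrable_compact_support[OF cbf, where K = "{t1..t2}"])
     (auto simp: bf_def box_bump_zero' greaterThanLessThan_iff)
   \<comment> \<open>The weak formula is tested with a bump \<open>A\<close> in the plane times the
     antiderivative \<open>B\<close> of a bump in the height. \<open>B\<close> vanishes below 1 / j
     because the box lies above the plane; at large heights the support of \<open>phi\<close> keeps
     the test function compactly supported.\<close>
   have zero: "(LINT w|lborel. (A j (fst w) * bf j (snd w)) *\<^sub>R (?V w)) = 0" if j: "j > 0" for j
   proof -
    obtain B where B: "smooth1 B" "!!t. (B has_real_derivative bf j t) (at t)"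
     "!!t. B t = (LINT r|lborel. bf j r * indicator {..<t} r)"
     using box_bump_antiderivative[of j t1 t2] unfolding bf_def by blast
    have B0: "B t = 0" if "t < 1 / real j" for t
    proof -
     have "bf j r * indicator {..<t} r = 0" for r
      using that t01 by (auto simp: bf_def indicator_def intro!: box_bump_zero)
     then show ?thesis by (simp only: B(3) integral_zero)
    qed
    define ct where "ct x = complex_of_real (A j (l1 x, l2 x) * B (l3 x))" for x
    have sm: "smooth ct" unfolding ct_def[abs_def] A_def fst_conv snd_conv
     by (intro smooth_linear[OF bounded_linear_of_real] smooth_mult
       smooth_comp[OF smooth1_box_bump] smooth_comp[OF B(1)] smooth_l)
    define D' where "D' x = complex_of_real (A j (l1 x, l2 x) * bf j (l3 x))" for x
    have w: "(LINT x|lebesgue. kn x * ct x) = - (LINT x|lebesgue. u x * D' x)" unfolding kn_def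
    proof (rule weak_half_dir[OF sm])
     show "1 / real j > 0" using j by simp
     show "ct x = 0" if "l3 x < 1 / real j" for x using B0[OF that] by (simp add: ct_def)
     fix x
     have l: "l1 (x + s *\<^sub>R - n) = l1 x" "l2 (x + s *\<^sub>R - n) = l2 x" "l3 (x + s *\<^sub>R - n) = l3 x + s" for s
      by (simp_all add: l1_def l2_def l3_def inner_diff_left inner_add_left dot_cross_self nn algebra_simps)
     have "((%s. A j (l1 x, l2 x) * B (l3 x + s)) has_real_derivative A j (l1 x, l2 x) * bf j (l3 x + 0)) (at 0)"
      by (intro DERIV_cmult) (use DERIV_shift[of B "bf j (l3 x)" 0 "l3 x"] B(2)[of "l3 x"] in \<open>simp add: add.commute\<close>)
     then have "((%s. complex_of_real (A j (l1 x, l2 x) * B (l3 x + s))) has_vector_derivative complex_of_real (A j (l1 x, l2 x) * bf j (l3 x + 0))) (at 0)"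
      unfolding has_real_derivative_iff_has_vector_derivative
      by (rule bounded_linear.has_vector_derivative[OF bounded_linear_of_real])
     then show "(SUM i:UNIV. (- n) $ i *\<^sub>R partial i ct x) = D' x"
      by (intro sum_partial_line[OF sm]) (simp add: ct_def l D'_def del: scaleR_minus_right)
    qed
    let ?c = "%w. complex_of_real (A j (fst w) * bf j (snd w))" and ?C = "%w. complex_of_real (A j (fst w) * B (snd w))"
    have mchi: "ct : borel_measurable borel" by (rule continuous_borel[OF smooth_continuous[OF sm]])
    have cD: "continuous_on UNIV D'" unfolding D'_def A_def bf_def fst_conv snd_conv
     by (intro smooth_continuous smooth_linear[OF bounded_linear_of_real] smooth_mult
       smooth_comp[OF smooth1_box_bump] smooth_l)
    have mD: "D' : borel_measurable borel" by (rule continuous_borel[OF cD])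
    have to_borel: "(LINT x|lebesgue. f x * F x) = (LINT x|lborel. f' x * F x)"
     if "integrable lebesgue f" "f' : borel_measurable borel" "AE x in lborel. f x = f' x" "F : borel_measurable borel"
     for f f' F :: "point => complex"
    proof -
     have "(LINT x|lebesgue. f x * F x) = (LINT x|lebesgue. f' x * F x)"
     proof (rule integral_cong_AE)
      show "AE x in lebesgue. f x * F x = f' x * F x"
       using that(3) unfolding AE_lebesgue_iff[symmetric] by eventually_elim simp
      have "F : borel_measurable lebesgue" "f' : borel_measurable lebesgue"
       using that by (auto intro: measurable_completion)
      then show "(%x. f x * F x) : borel_measurable lebesgue" "(%x. f' x * F x) : borel_measurable lebesgue"
       using that(1) by (auto intro!: borel_measurable_times)
     qed
     also have "... = (LINT x|lborel. f' x * F x)" using that by (intro integral_completion) simp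
     finally show ?thesis .
    qed
    have w': "(LINT x|lborel. kn' x * ct x) = - (LINT x|lborel. u' x * D' x)"
     using w to_borel[OF ikn kn'_m kn'_eq mchi] to_borel[OF integrable_u u' mD] by simp
    have w2: "(LINT w|lborel. Kk w * ?C w)
      = - (LINT w|lborel. U w * ?c w)"
    proof -
     have "(LINT x|lborel. kn' x * ct x) = J *\<^sub>R (LINT w|lborel. kn' (Ph w) * ct (Ph w))"
      using kn'_m mchi by (intro LINT_Ph) measurable
     moreover have "(LINT x|lborel. u' x * D' x) = J *\<^sub>R (LINT w|lborel. u' (Ph w) * D' (Ph w))"
      using u'(1) mD by (intro LINT_Ph) measurable
     ultimately have "J *\<^sub>R (LINT w|lborel. kn' (Ph w) * ct (Ph w)) = J *\<^sub>R (- (LINT w|lborel. u' (Ph w) * D' (Ph w)))"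
      using w' by simp
     then have "(LINT w|lborel. kn' (Ph w) * ct (Ph w)) = - (LINT w|lborel. u' (Ph w) * D' (Ph w))"
      using J_pos by (simp only: scaleR_cancel_left) simp
     then show ?thesis by (simp add: Kk_def U_def ct_def D'_def l_Ph)
    qed
    have Bb: "\<bar>B t\<bar> <= (LINT r|lborel. bf j r)" for t
    proof -
     have "0 <= B t" unfolding B(3) by (rule integral_nonneg_AE) (auto simp: b01)
     moreover have "B t <= (LINT r|lborel. bf j r)" unfolding B(3)
      using ibf b01 by (intro integral_mono_AE') (auto simp: indicator_def)
     ultimately show ?thesis by simp
    qed
    have cB: "continuous_on UNIV B" by (rule smooth1_continuous[OF B(1)])
    have mB[measurable]: "B : borel_measurable borel" by (rule continuous_borel[OF cB])
    have iKB: "integrable lborel (%w. Kk w * ?C w)"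
    proof (rule integrable_mult_bounded[OF iK])
     have "continuous_on UNIV ?C"
      by (intro continuous_intros continuous_on_compose2[OF cA] continuous_on_compose2[OF cB]) auto
     from continuous_borel[OF this]
     show "?C : borel_measurable lborel" by simp
     show "norm (?C w) <= 1 * (LINT r|lborel. bf j r)" for w
      unfolding norm_of_real abs_mult using A01 Bb by (intro mult_mono) auto
    qed
    have cAb: "continuous_on UNIV ?c"
     by (intro continuous_intros continuous_on_compose2[OF cA] continuous_on_compose2[OF cbf]) auto
    have mAb: "?c : borel_measurable lborel" using continuous_borel[OF cAb] by simp
    have nAb: "norm (?c w) <= 1" for w unfolding norm_of_real abs_mult using A01 b01 by (intro mult_le_one) auto
    have iUA: "integrable lborel (%w. U w * ?c w)" by (rule integrable_mult_bounded[OF iU mAb nAb])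
    have iHA: "integrable lborel (%w. (?W w) * ?c w)" by (rule integrable_mult_bounded[OF iHG mAb nAb])
    have bfG: "bf j t = 0" if "t ~: {0<..<1}" for t
     using that t01 by (intro box_bump_zero'[of t t1 t2 j, folded bf_def]) auto
    \<comment> \<open>Fubini on the region r < s: integrating the tail \<open>Hf\<close> against the
      bump equals, up to sign, integrating \<open>Kk\<close> against the antiderivative of the
      bump.\<close>
    have eqH: "(LINT w|lborel. (?W w) * ?c w)
      = - (LINT w|lborel. Kk w * ?C w)"
    proof -
     have "(LINT w|lborel. (?W w) * ?c w)
      = (LINT z|lborel. LINT t|lborel. (indicator Gs (z, t) *\<^sub>R Hf (z, t)) * complex_of_real (A j z * bf j t))"
      using lborel_pair.integral_fst'[of "%w. (?W w) * ?c w"] iHA by (simp add: lborel_prod)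
     also have "... = (LINT z|lborel. - (LINT t|lborel. Kk (z, t) * complex_of_real (A j z * B t)))"
     proof (rule integral_cong_AE)
      show "AE z in lborel. (LINT t|lborel. (indicator Gs (z, t) *\<^sub>R Hf (z, t)) * complex_of_real (A j z * bf j t))
        = - (LINT t|lborel. Kk (z, t) * complex_of_real (A j z * B t))" using Kz
      proof eventually_elim
       case (elim z)
       let ?f = "%s r. if r < s then Kk (z, s) * complex_of_real (bf j r) else 0"
       have ip: "integrable (lborel \<Otimes>\<^sub>M lborel) (%(s, r). ?f s r)"
       proof (rule Bochner_Integration.integrable_bound)
        show "integrable (lborel \<Otimes>\<^sub>M lborel) (%(s, r). Kk (z, s) * complex_of_real (bf j r))"
         using elim ibf[of j] by (intro integrable_pair_mult) auto
        have [measurable]: "(%s. Kk (z, s)) : borel_measurable borel"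
         using borel_measurable_integrable[OF elim] by simp
        show "(%(s, r). ?f s r) : borel_measurable (lborel \<Otimes>\<^sub>M lborel)" by measurable
       qed auto
       have "(LINT t|lborel. (indicator Gs (z, t) *\<^sub>R Hf (z, t)) * complex_of_real (A j z * bf j t))
         = (LINT r|lborel. - complex_of_real (A j z) * (LINT s|lborel. ?f s r))"
       proof (rule Bochner_Integration.integral_cong[OF refl])
        fix r
        have "(LINT s|lborel. ?f s r) = (LINT s|lborel. (if r < s then Kk (z, s) else 0) * complex_of_real (bf j r))"
         by (intro Bochner_Integration.integral_cong) auto
        also have "... = - Hf (z, r) * complex_of_real (bf j r)" unfolding Hf_def fst_conv snd_conv by simp
        finally show "(indicator Gs (z, r) *\<^sub>R Hf (z, r)) * complex_of_real (A j z * bf j r)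
          = - complex_of_real (A j z) * (LINT s|lborel. ?f s r)" using bfG[of r] by (auto simp: Gs_def indicator_def)
       qed
       also have "... = - complex_of_real (A j z) * (LINT r|lborel. LINT s|lborel. ?f s r)" by simp
       also have "(LINT r|lborel. LINT s|lborel. ?f s r) = (LINT s|lborel. LINT r|lborel. ?f s r)"
        by (rule lborel_pair.Fubini_integral[OF ip])
       also have "... = (LINT s|lborel. Kk (z, s) * complex_of_real (B s))"
       proof (rule Bochner_Integration.integral_cong[OF refl])
        fix s
        have "(LINT r|lborel. ?f s r) = (LINT r|lborel. Kk (z, s) * complex_of_real (bf j r * indicator {..<s} r))"
         by (intro Bochner_Integration.integral_cong) auto
        then show "(LINT r|lborel. ?f s r) = Kk (z, s) * complex_of_real (B s)" by (simp add: B(3) del: of_real_mult)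
       qed
       also have "- complex_of_real (A j z) * ... = - (LINT s|lborel. complex_of_real (A j z) * (Kk (z, s) * complex_of_real (B s)))"
        by simp
       finally show ?case by (simp add: mult_ac)
      qed
      show "(%z. LINT t|lborel. (indicator Gs (z, t) *\<^sub>R Hf (z, t)) * complex_of_real (A j z * bf j t)) : borel_measurable lborel"
       using lborel_pair.integrable_fst'[of "%w. (?W w) * ?c w"] iHA
       by (intro borel_measurable_integrable) (simp add: lborel_prod)
      show "(%z. - (LINT t|lborel. Kk (z, t) * complex_of_real (A j z * B t))) : borel_measurable lborel"
       using lborel_pair.integrable_fst'[of "%w. Kk w * ?C w"] iKB
       by (intro borel_measurable_uminus borel_measurable_integrable) (simp add: lborel_prod)
     qed
     also have "... = - (LINT w|lborel. Kk w * ?C w)" using lborel_pair.integral_fst'[of "%w. Kk w * ?C w"] iKB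
      by (simp add: lborel_prod)
     finally show ?thesis .
    qed
    have "(A j (fst w) * bf j (snd w)) *\<^sub>R (?V w)
      = U w * ?c w - (?W w) * ?c w" for w
     using bfG[of "snd w"] by (cases w) (auto simp: Gs_def indicator_def scaleR_conv_of_real algebra_simps)
    then show ?thesis using iUA iHA eqH w2 by simp
   qed
   have "(%j. LINT w|lborel. (A (Suc j) (fst w) * bf (Suc j) (snd w)) *\<^sub>R (?V w))
     \<longlonglongrightarrow> (LINT w|lborel. indicator (box a b) w *\<^sub>R (?V w))"
   proof (rule integral_dominated_convergence[where w = "%w. norm (?V w)"])
    have m1: "(%w. A j (fst w) * bf j (snd w)) : borel_measurable borel" for j
     by (intro continuous_borel continuous_intros continuous_on_compose2[OF cA] continuous_on_compose2[OF cbf]) auto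
    have m2: "?V : borel_measurable borel" using borel_measurable_integrable[OF iUH] by simp
    show "(%w. indicator (box a b) w *\<^sub>R (?V w)) : borel_measurable lborel"
     unfolding measurable_lborel2 by (rule borel_measurable_scaleR[OF _ m2]) simp
    show "(%w. (A (Suc j) (fst w) * bf (Suc j) (snd w)) *\<^sub>R (?V w)) : borel_measurable lborel" for j
     unfolding measurable_lborel2 by (rule borel_measurable_scaleR[OF m1 m2])
    show "AE w in lborel. (%j. (A (Suc j) (fst w) * bf (Suc j) (snd w)) *\<^sub>R (?V w))
      \<longlonglongrightarrow> indicator (box a b) w *\<^sub>R (?V w)"
    proof (intro AE_I2 tendsto_scaleR tendsto_const)
     fix w
     have "(%j. A (Suc j) (fst w) * bf (Suc j) (snd w)) \<longlonglongrightarrow>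
       indicator {a1<..<b1} (fst (fst w)) * indicator {a2<..<b2} (snd (fst w)) * indicator {t1<..<t2} (snd w)"
      unfolding A_def bf_def by (intro tendsto_mult LIMSEQ_Suc[OF box_bump_LIMSEQ])
     moreover have "indicator {a1<..<b1} (fst (fst w)) * indicator {a2<..<b2} (snd (fst w)) * indicator {t1<..<t2} (snd w) = (indicator (box a b) w :: real)"
      using mb[of w] by (auto simp: indicator_def)
     ultimately show "(%j. A (Suc j) (fst w) * bf (Suc j) (snd w)) \<longlonglongrightarrow> indicator (box a b) w" by simp
    qed
    show "AE w in lborel. norm ((A (Suc j) (fst w) * bf (Suc j) (snd w)) *\<^sub>R (?V w))
      <= norm (?V w)" for j
    proof (rule AE_I2)
     fix w
     have "\<bar>A (Suc j) (fst w) * bf (Suc j) (snd w)\<bar> <= 1"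
      unfolding abs_mult using A01 b01 by (intro mult_le_one) auto
     then show "norm ((A (Suc j) (fst w) * bf (Suc j) (snd w)) *\<^sub>R (?V w))
      <= norm (?V w)" unfolding norm_scaleR[of "A (Suc j) (fst w) * bf (Suc j) (snd w)"]
      by (intro mult_left_le_one_le) auto
    qed
   qed (rule integrable_norm[OF iUH])
   then have "(LINT w|lborel. indicator (box a b) w *\<^sub>R (?V w)) = 0" using zero by (simp add: LIMSEQ_const_iff)
   moreover have "indicator (box a b) w *\<^sub>R (?V w) = indicator (box a b) w *\<^sub>R (U w - Hf w)" for w
    using ab by (auto simp: indicator_def)
   ultimately show ?thesis by (simp only:)
  qed simp
 qed
 define h where "h z = Hf (z, 0)" for z
 have h_eq: "h z = - (LINT s|lborel. Kk (z, s))" for z unfolding h_def Hf_def using Kneg[of _ z]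
  by (auto intro!: arg_cong[where f = uminus] Bochner_Integration.integral_cong)
 have ih: "integrable lborel h" unfolding h_eq Kk_def using Fubini_Ph(3)[OF ikn'] by simp
 have "AE z in lborel. AE t in lborel. (z, t) : Gs --> U (z, t) - Hf (z, t) = 0"
  using lborel_pair.AE_pair[of "%w. w : Gs --> U w - Hf w = 0"] UH by (simp only: lborel_prod)
 moreover have "AE z in lborel. AE t in lborel. u (Ph (z, t)) = U (z, t)"
  unfolding U_def by (rule AE_Ph_lines[OF u'(2)])
 ultimately have "AE z in lborel. ((%t. g (Ph (z, t)) * phi (Ph (z, t))) \<longlongrightarrow> h z) ess_at_right_0"
  using Kz
 proof eventually_elim
  case (elim z)
  have "((%t. Hf (z, t)) \<longlongrightarrow> h z) (at_right 0)" unfolding tendsto_at_iff_sequentially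
  proof (intro allI impI)
   fix X :: "nat => real" assume X: "ALL i. X i : {0<..} - {0}" "X \<longlonglongrightarrow> 0"
   have [measurable]: "(%s. Kk (z, s)) : borel_measurable borel" using borel_measurable_integrable[OF elim(3)] by simp
   have "(%i. LINT s|lborel. (if X i < s then Kk (z, s) else 0)) \<longlonglongrightarrow> (LINT s|lborel. (if 0 < s then Kk (z, s) else 0))"
   proof (rule integral_dominated_convergence[where w = "%s. norm (Kk (z, s))"])
    show "AE s in lborel. (%i. if X i < s then Kk (z, s) else 0) \<longlonglongrightarrow> (if 0 < s then Kk (z, s) else 0)"
    proof (rule AE_I2)
     fix s :: real
     show "(%i. if X i < s then Kk (z, s) else 0) \<longlonglongrightarrow> (if 0 < s then Kk (z, s) else 0)"
     proof (cases "0 < s")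
      case True
      then have "\<forall>\<^sub>F i in sequentially. X i < s" using X(2) by (simp add: order_tendsto_iff)
      then have "\<forall>\<^sub>F i in sequentially. Kk (z, s) = (if X i < s then Kk (z, s) else 0)"
       by eventually_elim simp
      from Lim_transform_eventually[OF tendsto_const this] True show ?thesis by simp
     next
      case False
      then have "\<not> X i < s" for i using X(1) by (smt (verit) DiffD1 greaterThan_iff)
      then show ?thesis using False by simp
     qed
    qed
   qed (use elim(3) in auto)
   from tendsto_minus[OF this] show "((%t. Hf (z, t)) \<circ> X) \<longlonglongrightarrow> h z"
    unfolding o_def Hf_def h_def fst_conv snd_conv .
  qed
  then have l: "((%t. Hf (z, t)) \<longlongrightarrow> h z) ess_at_right_0" by (rule tendsto_ess_at_right_0)
  have "AE t in lborel. 0 < t & t < 1 --> Hf (z, t) = g (Ph (z, t)) * phi (Ph (z, t))"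
   using elim(1,2) by eventually_elim (auto simp: Gs_def u_def l_Ph)
  then have "\<forall>\<^sub>F t in ess_at_right_0. Hf (z, t) = g (Ph (z, t)) * phi (Ph (z, t))"
   by (rule eventually_ess_at_right_0[OF zero_less_one])
  with l show ?case by (rule Lim_transform_eventually)
 qed
 moreover have "(LINT x|lebesgue. k i x) = n $ i *\<^sub>R (J *\<^sub>R (LINT z|lborel. h z))" for i
 proof -
  have "J *\<^sub>R (LINT z|lborel. h z) = - (LINT x|lborel. kn' x)"
   unfolding h_eq Kk_def using Fubini_Ph(1)[OF ikn'] by simp
  also have "(LINT x|lborel. kn' x) = (LINT x|lebesgue. kn x)"
  proof -
   have "(LINT x|lborel. kn' x) = (LINT x|lebesgue. kn' x)" using kn'_m by (intro integral_completion[symmetric]) simp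
   also have "... = (LINT x|lebesgue. kn x)" using kn'_eq ikn kn'_m unfolding AE_lebesgue_iff[symmetric]
    by (intro integral_cong_AE) (auto intro: measurable_completion)
   finally show ?thesis .
  qed
  also have "... = (SUM i:UNIV. (- n) $ i *\<^sub>R (LINT x|lebesgue. k i x))"
   unfolding kn_def using integrable_k by simp
  finally have Jn: "J *\<^sub>R (LINT z|lborel. h z) = (SUM j:UNIV. n $ j *\<^sub>R (LINT x|lebesgue. k j x))"
   by (simp add: sum_negf)
  \<comment> \<open>The coordinate vector \<open>axis i 1\<close> differs from n_i \<open>n\<close>
    by a tangential vector, so the i-th component of the integral is n_i times the normal
    one.\<close>
  have "(axis i 1 - n $ i *\<^sub>R n) \<bullet> n = 0"
   by (subst inner_commute) (simp add: inner_diff_right inner_axis nn)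
  from tangential_zero[OF this]
  have "(SUM j:UNIV. axis i (1::real) $ j *\<^sub>R (LINT x|lebesgue. k j x)) = n $ i *\<^sub>R (SUM j:UNIV. n $ j *\<^sub>R (LINT x|lebesgue. k j x))"
   by (simp add: scaleR_diff_left sum_subtractf scaleR_sum_right)
  moreover have "(SUM j:UNIV. axis i (1::real) $ j *\<^sub>R (LINT x|lebesgue. k j x)) = (LINT x|lebesgue. k i x)"
   by (simp add: axis_def if_distrib[of "%c. c *\<^sub>R _"] cong: if_cong)
  ultimately show ?thesis using Jn by simp
 qed
 ultimately show thesis using that[OF ih] by blast
qed

end

section \<open>Geometry of simplices\<close>

text \<open>An element seen from one of its faces: \<open>p\<close>, \<open>q\<close>,
  \<open>r\<close> span the face, \<open>v\<close> is the opposite vertex, and the sign condition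
  makes \<open>n\<close> point outwards.\<close>

locale tet = face_frame p "q - p" "r - p" n for p q r n :: "real^3" +
 fixes v :: "real^3"
 assumes nv: "n \<bullet> (v - p) < 0"
begin

definition T where "T = convex hull {v, p, q, r}"
definition S where "S = convex hull {p, q, r}"
definition m where "m = (1/3) *\<^sub>R (p + q + r)"

text \<open>With \<open>gq\<close>, \<open>gr\<close> and \<open>gp\<close>, the gradients of the
  four barycentric coordinates. The face coordinates \<open>l1\<close>, \<open>l2\<close> are
  corrected by a multiple of the height so that they vanish at \<open>v\<close>.\<close>

definition gv where "gv = (- 1 / l3 v) *\<^sub>R n"
definition gq where "gq = (1 / D) *\<^sub>R cross3 (r - p) n - l1 v *\<^sub>R gv"
definition gr where "gr = (1 / D) *\<^sub>R cross3 n (q - p) - l2 v *\<^sub>R gv"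
definition gp where "gp = - (gv + gq + gr)"

definition lv where "lv y = (y - p) \<bullet> gv"
definition lq where "lq y = (y - p) \<bullet> gq"
definition lr where "lr y = (y - p) \<bullet> gr"
definition lp where "lp y = 1 + (y - p) \<bullet> gp"

lemma l3v: "l3 v > 0" using nv by (simp add: l3_def inner_commute)

lemma lv_eq: "lv y = l3 y / l3 v" by (simp add: lv_def gv_def l3_def)

lemma lq_eq: "lq y = l1 y - l1 v * lv y" by (simp add: lq_def gq_def lv_def inner_diff_right l1_def)

lemma lr_eq: "lr y = l2 y - l2 v * lv y" by (simp add: lr_def gr_def lv_def inner_diff_right l2_def)

lemma lp_eq: "lp y = 1 - lv y - lq y - lr y"
 by (simp add: lp_def gp_def lv_def lq_def lr_def inner_add_right inner_diff_right)

lemma bary_rep: "y = lp y *\<^sub>R p + lq y *\<^sub>R q + lr y *\<^sub>R r + lv y *\<^sub>R v"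
proof -
 have y: "y - p = l1 y *\<^sub>R (q - p) + l2 y *\<^sub>R (r - p) - l3 y *\<^sub>R n" for y
 proof -
  have "y - p = Ph ((l1 y, l2 y), l3 y) - p" by (simp only: Ph_l)
  then show ?thesis by (simp add: Ph_def)
 qed
 have "l3 v *\<^sub>R n = l1 v *\<^sub>R (q - p) + l2 v *\<^sub>R (r - p) - (v - p)" unfolding y[of v] by simp
 then have "lv y *\<^sub>R (l3 v *\<^sub>R n) = lv y *\<^sub>R (l1 v *\<^sub>R (q - p) + l2 v *\<^sub>R (r - p) - (v - p))"
  by simp
 moreover have "lv y * l3 v = l3 y" using l3v by (simp add: lv_eq)
 ultimately have X: "l3 y *\<^sub>R n = lv y *\<^sub>R (l1 v *\<^sub>R (q - p) + l2 v *\<^sub>R (r - p) - (v - p))"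
  by simp
 have "y - p = lq y *\<^sub>R (q - p) + lr y *\<^sub>R (r - p) + lv y *\<^sub>R (v - p)"
  unfolding y[of y] X lq_eq lr_eq by (simp add: algebra_simps)
 then show ?thesis by (simp add: lp_eq algebra_simps)
qed

lemma l_vertices:
 "l1 p = 0" "l2 p = 0" "l3 p = 0" "l1 q = 1" "l2 q = 0" "l3 q = 0" "l1 r = 0" "l2 r = 1" "l3 r = 0"
 using l_Ph[of "((0, 0), 0)"] l_Ph[of "((1, 0), 0)"] l_Ph[of "((0, 1), 0)"] by (simp_all add: Ph_def)

lemma l_mean: "l1 m = 1/3" "l2 m = 1/3" "l3 m = 0"
proof -
 have "m = Ph ((1/3, 1/3), 0)" by (simp add: Ph_def m_def vec_eq_iff field_simps)
 then show "l1 m = 1/3" "l2 m = 1/3" "l3 m = 0" by (simp_all add: l_Ph)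
qed

lemma convex_aff: "convex {y. 0 <= c + (y - p) \<bullet> w}"
proof -
 have "{y. 0 <= c + (y - p) \<bullet> w} = {y. w \<bullet> y \<ge> p \<bullet> w - c}"
  by (auto simp: inner_diff_left inner_diff_right inner_commute)
 then show ?thesis by (simp add: convex_halfspace_ge)
qed

lemma T_eq: "T = {y. 0 <= lv y & 0 <= lp y & 0 <= lq y & 0 <= lr y}"
proof
 have "convex ({y. 0 <= 0 + (y - p) \<bullet> gv} Int {y. 0 <= 1 + (y - p) \<bullet> gp} Int {y. 0 <= 0 + (y - p) \<bullet> gq} Int {y. 0 <= 0 + (y - p) \<bullet> gr})"
  by (intro convex_Int convex_aff)
 moreover have "({y. 0 <= 0 + (y - p) \<bullet> gv} Int {y. 0 <= 1 + (y - p) \<bullet> gp} Int {y. 0 <= 0 + (y - p) \<bullet> gq} Int {y. 0 <= 0 + (y - p) \<bullet> gr})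
   = {y. 0 <= lv y & 0 <= lp y & 0 <= lq y & 0 <= lr y}" by (auto simp: lv_def lp_def lq_def lr_def)
 ultimately show "T <= {y. 0 <= lv y & 0 <= lp y & 0 <= lq y & 0 <= lr y}" unfolding T_def using l3v
  by (intro hull_minimal) (simp_all add: lp_eq lq_eq lr_eq lv_eq l_vertices)
next
 have "y : T" if "0 <= lv y" "0 <= lp y" "0 <= lq y" "0 <= lr y" for y
 proof -
  define a where "a i = [lp y, lq y, lr y, lv y] ! i" for i :: nat
  define b where "b i = [p, q, r, v] ! i" for i :: nat
  have "(SUM i:{..<4::nat}. a i *\<^sub>R b i) : T"
  proof (rule convex_sum)
   show "convex T" by (simp add: T_def)
   show "sum a {..<4} = 1" by (simp add: a_def eval_nat_numeral lp_eq)
   show "0 <= a i" if "i : {..<4}" for i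
    using that \<open>0 <= lv y\<close> \<open>0 <= lp y\<close> \<open>0 <= lq y\<close> \<open>0 <= lr y\<close>
    by (auto simp: a_def eval_nat_numeral less_Suc_eq)
   show "b i : T" if "i : {..<4}" for i using that hull_inc[of _ "{v, p, q, r}" convex]
    by (auto simp: b_def T_def eval_nat_numeral less_Suc_eq)
  qed simp
  moreover have "(SUM i:{..<4::nat}. a i *\<^sub>R b i) = y"
   by (subst bary_rep[of y]) (simp add: a_def b_def eval_nat_numeral)
  ultimately show ?thesis by simp
 qed
 then show "{y. 0 <= lv y & 0 <= lp y & 0 <= lq y & 0 <= lr y} <= T" by auto
qed

lemma T_l3: "y : T ==> 0 <= l3 y" using l3v by (simp add: T_eq lv_eq zero_le_divide_iff)

lemma S_subset_T: "S <= T" unfolding S_def T_def by (rule hull_mono) auto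

lemma S_mem:
 assumes "l3 y = 0" "0 <= l1 y" "0 <= l2 y" "l1 y + l2 y <= 1"
 shows "y : S"
proof -
 have "y = (1 - l1 y - l2 y) *\<^sub>R p + l1 y *\<^sub>R q + l2 y *\<^sub>R r"
  using bary_rep[of y] assms by (simp add: lp_eq lq_eq lr_eq lv_eq)
 then show ?thesis unfolding S_def convex_hull_3
  using assms by (intro CollectI exI[of _ "1 - l1 y - l2 y"] exI[of _ "l1 y"] exI[of _ "l2 y"]) auto
qed

lemma S_l:
 assumes "y : S"
 shows "l3 y = 0" "0 <= l1 y" "0 <= l2 y" "l1 y + l2 y <= 1"
proof -
 obtain a b c where abc: "0 <= a" "0 <= b" "0 <= c" "a + b + c = 1" "y = a *\<^sub>R p + b *\<^sub>R q + c *\<^sub>R r"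
  using assms by (auto simp: S_def convex_hull_3)
 have "y = Ph ((b, c), 0)"
  using abc by (simp add: Ph_def algebra_simps) (metis add.assoc add.commute scaleR_left.add scaleR_one)
 then show "l3 y = 0" "0 <= l1 y" "0 <= l2 y" "l1 y + l2 y <= 1" using abc by (simp_all add: l_Ph)
qed

lemma l3_cont: "continuous_on UNIV l1" "continuous_on UNIV l2" "continuous_on UNIV l3"
 using smooth_l by (auto intro: smooth_continuous)

lemma bary_cont: "continuous_on UNIV lv" "continuous_on UNIV lp" "continuous_on UNIV lq" "continuous_on UNIV lr"
 unfolding lv_def[abs_def] lp_def[abs_def] lq_def[abs_def] lr_def[abs_def] by (intro continuous_intros)+

lemma interior_T:
 assumes "0 < l3 y" "0 < lp y" "0 < lq y" "0 < lr y"
 shows "y : interior T"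
proof -
 have "open ({y. 0 < lv y} Int {y. 0 < lp y} Int {y. 0 < lq y} Int {y. 0 < lr y})"
  using bary_cont by (intro open_Int open_Collect_less continuous_on_const) auto
 moreover have "{y. 0 < lv y} Int {y. 0 < lp y} Int {y. 0 < lq y} Int {y. 0 < lr y} <= T" by (auto simp: T_eq)
 ultimately have "{y. 0 < lv y} Int {y. 0 < lp y} Int {y. 0 < lq y} Int {y. 0 < lr y} <= interior T"
  by (rule interior_maximal[rotated])
 then show ?thesis using assms l3v by (auto simp: lv_eq)
qed

lemma local_half_ball:
 assumes "l3 y = 0" "0 < l1 y" "0 < l2 y" "l1 y + l2 y < 1"
 obtains d where "d > 0" "!!x. x : cball y d ==> 0 < l3 x ==> x : interior T"
proof -
 have "open ({y. 0 < lp y} Int {y. 0 < lq y} Int {y. 0 < lr y})"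
  using bary_cont by (intro open_Int open_Collect_less continuous_on_const) auto
 moreover have "y : {y. 0 < lp y} Int {y. 0 < lq y} Int {y. 0 < lr y}"
  using assms by (simp add: lp_eq lq_eq lr_eq lv_eq)
 ultimately obtain d where "d > 0" "cball y d <= {y. 0 < lp y} Int {y. 0 < lq y} Int {y. 0 < lr y}"
  unfolding open_contains_cball by blast
 then show thesis using that[of d] interior_T by blast
qed

context
 fixes x0 :: point and r0 :: real
 assumes r0: "r0 > 0" and ball: "cball x0 r0 <= T"
begin

text \<open>Across the inscribed ball, in the direction of its gradient, an affine function changes
  by 2 r0 times the norm of the gradient, which cannot exceed the range 1.\<close>

lemma grad_bound:
 assumes "!!y. y : T ==> 0 <= c + (y - p) \<bullet> w" "!!y. y : T ==> c + (y - p) \<bullet> w <= 1"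
 shows "norm w <= 1 / (2 * r0)"
proof (cases "w = 0")
 case False
 define e where "e = (r0 / norm w) *\<^sub>R w"
 have ne: "norm e = r0" using False r0 by (simp add: e_def)
 have "x0 + e : T" "x0 - e : T" using ball ne by (auto simp: subset_iff dist_norm)
 from assms(2)[OF this(1)] assms(1)[OF this(2)] have "(x0 + e - p) \<bullet> w - (x0 - e - p) \<bullet> w <= 1" by linarith
 then have "2 * (e \<bullet> w) <= 1" by (simp add: inner_diff_left inner_add_left)
 moreover have "e \<bullet> w = r0 * norm w" using False by (simp add: e_def dot_square_norm power2_eq_square)
 ultimately show ?thesis using r0 by (simp add: field_simps)
qed (use r0 in simp)

lemma bary_T_le: "y : T ==> lv y <= 1 & lp y <= 1 & lq y <= 1 & lr y <= 1" by (simp add: T_eq) (smt (verit) lp_eq)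

lemma grad_bounds: "norm gp <= 1 / (2 * r0)" "norm gq <= 1 / (2 * r0)" "norm gr <= 1 / (2 * r0)"
proof -
 show "norm gp <= 1 / (2 * r0)" by (rule grad_bound[of 1]) (use bary_T_le in \<open>auto simp: T_eq lp_def\<close>)
 show "norm gq <= 1 / (2 * r0)" by (rule grad_bound[of 0]) (use bary_T_le in \<open>auto simp: T_eq lq_def\<close>)
 show "norm gr <= 1 / (2 * r0)" by (rule grad_bound[of 0]) (use bary_T_le in \<open>auto simp: T_eq lr_def\<close>)
qed

text \<open>The three coordinates equal 1/3 at the centroid of the face and change by less than 1/3
  within distance 2 r0 / 3, by the gradient bound. This is the origin of the radius 2 r0 / 3 in all
  face arguments.\<close>

lemma bary_pos:
 assumes "dist m y < 2 * r0 / 3"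
 shows "0 < lp y" "0 < lq y" "0 < lr y"
proof -
 have "\<bar>(y - m) \<bullet> w\<bar> < 1/3" if "norm w <= 1 / (2 * r0)" for w
 proof -
  have "\<bar>(y - m) \<bullet> w\<bar> <= norm (y - m) * norm w" by (rule Cauchy_Schwarz_ineq2)
  also have "... <= norm (y - m) * (1 / (2 * r0))" using that by (intro mult_left_mono) auto
  also have "... < 1/3" using assms r0 by (simp add: dist_norm norm_minus_commute field_simps)
  finally show ?thesis .
 qed
 from this[OF grad_bounds(1)] this[OF grad_bounds(2)] this[OF grad_bounds(3)]
 have "\<bar>lp y - lp m\<bar> < 1/3" "\<bar>lq y - lq m\<bar> < 1/3" "\<bar>lr y - lr m\<bar> < 1/3"
  by (simp_all add: lp_def lq_def lr_def inner_diff_left)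
 moreover have "lp m = 1/3" "lq m = 1/3" "lr m = 1/3" by (simp_all add: lp_eq lq_eq lr_eq lv_eq l_mean)
 ultimately show "0 < lp y" "0 < lq y" "0 < lr y" by linarith+
qed

lemma half_ball: "dist m y < 2 * r0 / 3 ==> 0 < l3 y ==> y : interior T" using bary_pos interior_T by blast

lemma half_ball_T: "dist m y < 2 * r0 / 3 ==> 0 <= l3 y ==> y : T" using bary_pos[of y] l3v by (auto simp: T_eq lv_eq)

lemma plane_ball:
 assumes "dist m y < 2 * r0 / 3" "l3 y = 0"
 shows "0 < l1 y" "0 < l2 y" "l1 y + l2 y < 1"
 using bary_pos[OF assms(1)] assms(2) by (simp_all add: lp_eq lq_eq lr_eq lv_eq)

text \<open>The face contains a segment of length r0 centred at its centroid. Since both neighbours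
  contain the face, their sizes become comparable through it.\<close>

lemma diameter_S: "r0 <= diameter S"
proof -
 have e: "q - p ~= 0" using cross_nz by auto
 define e where "e = (r0 / (2 * norm (q - p))) *\<^sub>R (q - p)"
 have ne: "norm e = r0 / 2" using e r0 by (simp add: e_def)
 have en: "e \<bullet> n = 0" using face_frame_axioms by (simp add: e_def face_frame_def inner_commute)
 have "l3 (m + s *\<^sub>R e) = 0" for s using en l_mean(3) by (simp add: l3_def inner_add_left inner_diff_left)
 then have l: "l3 (m + e) = 0" "l3 (m - e) = 0" by (metis scaleR_one, metis add_uminus_conv_diff scaleR_minus1_left)
 have d: "dist m (m + e) < 2 * r0 / 3" "dist m (m - e) < 2 * r0 / 3" using ne r0 by (simp_all add: dist_norm)
 have "m + e : S" "m - e : S" using plane_ball[OF d(1) l(1)] plane_ball[OF d(2) l(2)] l by (auto intro!: S_mem)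
 then have "dist (m + e) (m - e) <= diameter S"
  by (intro diameter_bounded_bound) (simp add: S_def compact_imp_bounded compact_convex_hull finite_imp_compact)
 moreover have "dist (m + e) (m - e) = norm (2 *\<^sub>R e)" by (simp add: dist_norm scaleR_2)
 ultimately show ?thesis using ne by simp
qed

end

lemma compact_T: "compact T" by (simp add: T_def compact_convex_hull finite_imp_compact)

lemma m_in_S: "m : S" using l_mean by (intro S_mem) auto

lemma T_subset_ball: "T <= cball m (diameter T)"
proof
 fix y assume "y : T"
 then show "y : cball m (diameter T)"
  using diameter_bounded_bound[OF compact_imp_bounded[OF compact_T], of m y] m_in_S S_subset_T by auto
qed

lemma J_bound: "J <= (diameter T)\<^sup>2"
proof -
 have vert: "p : T" "q : T" "r : T" by (auto simp: T_def hull_inc)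
 have "norm (q - p) <= diameter T" "norm (r - p) <= diameter T"
  using diameter_bounded_bound[OF compact_imp_bounded[OF compact_T]] vert by (metis dist_norm)+
 moreover have "J <= norm (q - p) * norm (r - p)"
 proof -
  have "J\<^sup>2 <= (norm (q - p) * norm (r - p))\<^sup>2" unfolding J_def norm_cross power_mult_distrib by simp
  then show ?thesis by (rule power2_le_imp_le) simp
 qed
 ultimately show ?thesis unfolding power2_eq_square by (meson mult_mono norm_ge_zero order_trans)
qed

lemma S_facet: "S <= T & (ALL x:S. ALL y:T. n \<bullet> (y - x) <= 0)"
proof (intro conjI ballI S_subset_T)
 fix x y assume "x : S" "y : T"
 then have "l3 x = 0" "0 <= l3 y" using S_l(1) T_l3 by auto
 then have "0 <= l3 y - l3 x" by simp
 also have "l3 y - l3 x = - (n \<bullet> (y - x))" by (simp add: l3_def inner_diff_left inner_diff_right inner_commute)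
 finally show "n \<bullet> (y - x) <= 0" by simp
qed

text \<open>A competitor is nonpositive on differences of face vertices in both orders, hence
  orthogonal to the face and a multiple of \<open>n\<close>; the vertex \<open>v\<close> fixes the
  sign.\<close>

lemma outer_normal_eq: "outer_normal T S = n" unfolding outer_normal_def
proof (rule the_equality)
 show "norm n = 1 & (ALL x:S. ALL y:T. n \<bullet> (y - x) <= 0)" using n1 S_facet by auto
 fix k assume k: "norm k = 1 & (ALL x:S. ALL y:T. k \<bullet> (y - x) <= 0)"
 have vert: "p : S" "q : S" "r : S" "v : T" "p : T" "q : T" "r : T" by (auto simp: S_def T_def hull_inc)
 have "k \<bullet> (q - p) <= 0" "k \<bullet> (p - q) <= 0" "k \<bullet> (r - p) <= 0" "k \<bullet> (p - r) <= 0" "k \<bullet> (v - p) <= 0"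
  using k vert by blast+
 then have kk: "k \<bullet> (q - p) = 0" "k \<bullet> (r - p) = 0" "k \<bullet> (v - p) <= 0"
  by (simp_all add: inner_diff_right)
 have "cross3 k (cross3 (q - p) (r - p)) = 0" by (simp add: Lagrange kk)
 then have "cross3 n k = 0"
  using D_nz by (simp add: cross_eq cross_mult_right) (metis cross_skew neg_equal_0_iff_equal)
 then have "cross3 n (cross3 n k) = 0" by simp
 then have kn: "k = (n \<bullet> k) *\<^sub>R n" by (simp add: Lagrange[of n n] nn)
 then have "\<bar>n \<bullet> k\<bar> = 1" using k n1 by (metis mult.right_neutral norm_scaleR)
 moreover have "k \<bullet> (v - p) = (n \<bullet> k) * (n \<bullet> (v - p))" by (subst kn) simp
 ultimately have "n \<bullet> k = 1" using kk(3) nv by (auto simp: abs_if mult_le_0_iff split: if_splits)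
 then show "k = n" using kn by simp
qed

end

text \<open>\<open>face_integral\<close> picks some triple of points spanning the face, so the
  second conclusion covers every such triple: the vertices are extreme points and must occur among
  the generators, and there are three of them.\<close>

lemma simplex_facet_vertices:
 assumes T: "3 simplex (T :: point set)" and S: "S facet_of T"
 obtains p q r where "S = convex hull {p, q, r}"
  and "!!p q r. S = convex hull {p, q, r} ==>
   \<not> collinear {p, q, r} & \<not> affine_dependent {p, q, r} & card {p, q, r} = 3 & (EX v. T = convex hull {v, p, q, r})"
proof -
 obtain C where C: "\<not> affine_dependent C" "card C = 4" "T = convex hull C" using T by (auto simp: simplex_def)
 obtain u where u: "u : C" "S = convex hull (C - {u})"
  using S C facet_of_convex_hull_affine_independent[OF C(1)] by auto
 have fC: "finite C" using C(2) by (simp add: card_ge_0_finite)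
 have ind: "\<not> affine_dependent (C - {u})" using C(1) affine_independent_Diff by blast
 have c3: "card (C - {u}) = 3" using C(2) u(1) fC by simp
 then obtain p q r where pqr: "C - {u} = {p, q, r}" by (metis card_3_iff)
 show thesis
 proof (rule that[of p q r])
  show "S = convex hull {p, q, r}" using u(2) pqr by simp
  fix p q r assume S': "S = convex hull {p, q, r}"
  have "C - {u} <= {p, q, r}"
  proof
   fix x assume "x : C - {u}"
   then have "x extreme_point_of (convex hull (C - {u}))"
    using extreme_point_of_convex_hull_affine_independent[OF ind] by blast
   then have "x extreme_point_of (convex hull {p, q, r})" using u(2) S' by simp
   then show "x : {p, q, r}" by (rule extreme_point_of_convex_hull)
  qed
  moreover have "card {p, q, r} <= card (C - {u})" unfolding c3 by (auto simp: card_insert_if)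
  ultimately have eq: "C - {u} = {p, q, r}" by (intro card_seteq) auto
  then have "C = {u, p, q, r}" using u(1) by auto
  then have "T = convex hull {u, p, q, r}" using C(3) by simp
  moreover have i3: "\<not> affine_dependent {p, q, r}" "card {p, q, r} = 3" using ind c3 eq by auto
  moreover have "\<not> collinear {p, q, r}"
   using i3 collinear_3_eq_affine_dependent[of p q r] by (auto simp: card_insert_if split: if_splits)
  ultimately show "\<not> collinear {p, q, r} & \<not> affine_dependent {p, q, r} & card {p, q, r} = 3 & (EX v. T = convex hull {v, p, q, r})"
   by blast
 qed
qed

lemma cross_nz_of_noncollinear:
 assumes "\<not> collinear {p, q, r :: point}"
 shows "cross3 (q - p) (r - p) ~= 0"
proof
 assume "cross3 (q - p) (r - p) = 0"
 then have "collinear {0, q - p, r - p}" by (simp add: cross_eq_0)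
 then have "collinear {q, p, r}" by (subst collinear_3) simp
 then show False using assms by (simp add: insert_commute)
qed

text \<open>The normalised cross product is a unit normal up to sign. The opposite vertex cannot lie
  in the plane of the face, since then the element would be flat and contain no ball; the side on
  which it lies decides the sign.\<close>

lemma tet_exists:
 assumes c: "cross3 (q - p) (r - p) ~= 0" and T: "T = convex hull {v, p, q, r}"
  and b: "cball x0 r0 <= T" "r0 > 0"
 shows "EX n. (n = (1 / norm (cross3 (q - p) (r - p))) *\<^sub>R cross3 (q - p) (r - p)
   \<or> n = - ((1 / norm (cross3 (q - p) (r - p))) *\<^sub>R cross3 (q - p) (r - p))) & tet p q r n v"
proof -
 define w where "w = cross3 (q - p) (r - p)"
 define n0 where "n0 = (1 / norm w) *\<^sub>R w"
 have w0: "w ~= 0" using c by (simp add: w_def)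
 have w1: "w \<bullet> (q - p) = 0" "w \<bullet> (r - p) = 0" by (simp_all add: w_def dot_cross_self)
 have wv: "w \<bullet> (v - p) ~= 0"
 proof
  assume wv: "w \<bullet> (v - p) = 0"
  have "T <= {y. w \<bullet> y = w \<bullet> p}"
   unfolding T using w1 wv by (intro hull_minimal) (auto simp: inner_diff_right convex_hyperplane)
  moreover have "x0 : T" "x0 + (r0 / norm w) *\<^sub>R w : T" using b w0 by (auto simp: subset_iff dist_norm)
  ultimately have "w \<bullet> x0 = w \<bullet> p" "w \<bullet> (x0 + (r0 / norm w) *\<^sub>R w) = w \<bullet> p" by auto
  then have "(r0 / norm w) * (w \<bullet> w) = 0" by (simp add: inner_add_right)
  then show False using w0 b(2) by simp
 qed
 have fr: "face_frame (q - p) (r - p) n0" "face_frame (q - p) (r - p) (- n0)"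
  using w0 w1 c by (auto simp: face_frame_def n0_def)
 show ?thesis
 proof (cases "w \<bullet> (v - p) < 0")
  case True
  then have "n0 \<bullet> (v - p) < 0" using w0 by (simp add: n0_def divide_less_0_iff)
  then show ?thesis using fr by (intro exI[of _ n0]) (auto simp: tet_def tet_axioms_def n0_def w_def)
 next
  case False
  then have "- n0 \<bullet> (v - p) < 0" using w0 wv by (simp add: n0_def)
  then show ?thesis using fr by (intro exI[of _ "- n0"]) (auto simp: tet_def tet_axioms_def n0_def w_def)
 qed
qed

lemma faces_card:
 assumes T: "3 simplex (T :: point set)"
 shows "finite (faces T)" "card (faces T) <= 4"
proof -
 obtain C where C: "\<not> affine_dependent C" "card C = 4" "T = convex hull C" using T by (auto simp: simplex_def)
 have fC: "finite C" using C(2) by (simp add: card_ge_0_finite)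
 have sub: "faces T <= (%u. convex hull (C - {u})) ` C"
  using C facet_of_convex_hull_affine_independent[OF C(1)] by (auto simp: faces_def)
 show "finite (faces T)" using sub fC finite_surj by blast
 have "card (faces T) <= card ((%u. convex hull (C - {u})) ` C)" using sub fC by (intro card_mono) auto
 also have "... <= card C" by (rule card_image_le[OF fC])
 finally show "card (faces T) <= 4" using C(2) by simp
qed

text \<open>Moving from a point of the relative interior of the face in the direction \<open>n\<close> one stays in
 the domain and meets another element; conformity forces it to have the whole face.\<close>

lemma neighbour_exists:
 assumes mesh: "conforming_mesh Om \<T>" and Om: "open Om" and T: "T : \<T>"
  and S: "S : interior_faces Om T" and Spqr: "S = convex hull {p, q, r}"
  and tet: "tet p q r n v" "T = convex hull {v, p, q, r}" and ind: "\<not> affine_dependent {p, q, r}" "card {p, q, r} = 3"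
  and balls: "!!T'. T' : \<T> ==> EX x r. 0 < r & cball x r <= T'"
 obtains T' v' where "T' : \<T>" "S facet_of T'" "T' = convex hull {v', p, q, r}" "tet p q r (- n) v'"
proof -
 interpret t: tet p q r n v by (rule tet(1))
 have TT: "t.T = T" "t.S = S" using tet(2) Spqr by (simp_all add: t.T_def t.S_def)
 have tri: "finite \<T>" "!!A B. A : \<T> ==> B : \<T> ==> (A Int B) face_of A" "!!A. A : \<T> ==> 3 simplex A"
  "\<Union>\<T> = closure Om" using mesh by (auto simp: conforming_mesh_def triangulation_def)
 have facet: "S facet_of T" "\<not> S <= frontier Om" using S by (auto simp: interior_faces_def faces_def)
 obtain x1 where x1: "x1 : S" "x1 ~: frontier Om" using facet(2) by auto
 have "x1 : closure Om" using x1(1) T tri(4) t.S_subset_T TT by blast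
 then have x1Om: "x1 : Om" using x1(2) Om by (simp add: frontier_def interior_open)
 obtain \<eta>1 where \<eta>1: "\<eta>1 > 0" "ball x1 \<eta>1 <= Om" using Om x1Om open_contains_ball by blast
 \<comment> \<open>A small step from \<open>x1\<close> towards the centroid: the new point stays in
   \<open>Om\<close>, where \<open>x1\<close> lies, and belongs to the relative interior of the face
   even if \<open>x1\<close> is on an edge.\<close>
 define s where "s = min (1/2) (\<eta>1 / (2 * (norm (t.m - x1) + 1)))"
 have s: "0 < s" "s < 1" using \<eta>1 by (auto simp: s_def min_less_iff_disj intro!: divide_pos_pos add_nonneg_pos)
 define y where "y = (1 - s) *\<^sub>R x1 + s *\<^sub>R t.m"
 have "dist x1 y = s * norm (t.m - x1)"
 proof -
  have "x1 - y = - (s *\<^sub>R (t.m - x1))" by (simp add: y_def algebra_simps)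
  then show ?thesis using s by (simp add: dist_norm)
 qed
 also have "... <= \<eta>1 / (2 * (norm (t.m - x1) + 1)) * norm (t.m - x1)"
  by (intro mult_right_mono) (auto simp: s_def)
 also have "... < \<eta>1" using \<eta>1(1)
  by (simp add: divide_less_eq) (smt (verit) mult_less_cancel_left_pos norm_ge_zero zero_less_mult_iff mult_nonneg_nonneg)
 finally have yOm: "y : Om" using \<eta>1(2) by auto
 have l1s: "t.l1 ((1 - s) *\<^sub>R a + s *\<^sub>R b) = (1 - s) * t.l1 a + s * t.l1 b"
   "t.l2 ((1 - s) *\<^sub>R a + s *\<^sub>R b) = (1 - s) * t.l2 a + s * t.l2 b"
   "t.l3 ((1 - s) *\<^sub>R a + s *\<^sub>R b) = (1 - s) * t.l3 a + s * t.l3 b" for a b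
 proof -
  have e: "(1 - s) *\<^sub>R a + s *\<^sub>R b - p = (1 - s) *\<^sub>R (a - p) + s *\<^sub>R (b - p)" by (simp add: algebra_simps)
  show "t.l1 ((1 - s) *\<^sub>R a + s *\<^sub>R b) = (1 - s) * t.l1 a + s * t.l1 b"
   "t.l2 ((1 - s) *\<^sub>R a + s *\<^sub>R b) = (1 - s) * t.l2 a + s * t.l2 b"
   "t.l3 ((1 - s) *\<^sub>R a + s *\<^sub>R b) = (1 - s) * t.l3 a + s * t.l3 b"
   unfolding t.l1_def t.l2_def t.l3_def e inner_add_left inner_scaleR_left by (simp_all add: add_divide_distrib)
 qed
 have x1l: "t.l3 x1 = 0" "0 <= t.l1 x1" "0 <= t.l2 x1" "t.l1 x1 + t.l2 x1 <= 1" using t.S_l[of x1] x1(1) TT by auto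
 have yl: "t.l3 y = 0" "0 < t.l1 y" "0 < t.l2 y" "t.l1 y + t.l2 y < 1"
 proof -
  have a: "(1 - s) * t.l1 x1 \<ge> 0" "(1 - s) * t.l2 x1 \<ge> 0" "(1 - s) * (1 - t.l1 x1 - t.l2 x1) \<ge> 0"
   using x1l s by (auto intro!: mult_nonneg_nonneg)
  show "t.l3 y = 0" "0 < t.l1 y" "0 < t.l2 y"
   unfolding y_def l1s t.l_mean using a s x1l by (auto intro: add_nonneg_pos)
  have "1 - (t.l1 y + t.l2 y) = (1 - s) * (1 - t.l1 x1 - t.l2 x1) + s * (1/3)"
   unfolding y_def l1s t.l_mean by (simp add: algebra_simps)
  then show "t.l1 y + t.l2 y < 1" using a(3) s(1) by linarith
 qed
 have yS: "y : S" using t.S_mem[of y] yl TT by auto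
 have yrel: "y : rel_interior S"
 proof -
  have dist: "p ~= q" "p ~= r" "q ~= r" using ind(2) by (auto simp: card_insert_if split: if_splits)
  have "y = (1 - t.l1 y - t.l2 y) *\<^sub>R p + t.l1 y *\<^sub>R q + t.l2 y *\<^sub>R r"
   using t.bary_rep[of y] yl by (simp add: t.lp_eq t.lq_eq t.lr_eq t.lv_eq)
  then show ?thesis unfolding Spqr rel_interior_convex_hull_explicit[OF ind(1)]
   using yl dist by (intro CollectI exI[of _ "%x. if x = p then 1 - t.l1 y - t.l2 y else if x = q then t.l1 y else t.l2 y"]) (auto simp: add.assoc)
 qed
 obtain \<eta> where \<eta>: "\<eta> > 0" "ball y \<eta> <= Om" using Om yOm open_contains_ball by blast
 \<comment> \<open>The points of this open segment accumulate at \<open>y\<close>, and finitely many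
   closed elements cover it, so one of them contains \<open>y\<close> together with points beyond
   the face.\<close>
 define Rr where "Rr = (%t. y + t *\<^sub>R n) ` {0<..<\<eta>}"
 have yc: "y : closure Rr"
 proof -
  have "y + 0 *\<^sub>R n : (%t. y + t *\<^sub>R n) ` closure {0<..<\<eta>}" using \<eta>(1) by (intro imageI) auto
  also have "... <= closure Rr" unfolding Rr_def by (intro image_closure_subset continuous_intros closure_subset) auto
  finally show ?thesis by simp
 qed
 have "Rr <= Om" using \<eta> t.n1 by (auto simp: Rr_def subset_iff dist_norm)
 then have "Rr <= (\<Union>A\<in>\<T>. A Int Rr)" using tri(4) closure_subset[of Om] by blast
 then have "y : closure (\<Union>A\<in>\<T>. A Int Rr)" using yc closure_mono by blast
 also have "closure (\<Union>A\<in>\<T>. A Int Rr) <= (\<Union>A\<in>\<T>. closure (A Int Rr))"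
  using tri(1) closure_subset by (intro closure_minimal closed_UN) (fast, auto)
 finally obtain T' where T': "T' : \<T>" "y : closure (T' Int Rr)" by auto
 have clT': "closed T'" using tri(3)[OF T'(1)] closed_simplex by blast
 have yT': "y : T'" using T'(2) clT' closure_mono[of "T' Int Rr" T'] by auto
 have "T' Int Rr ~= {}" using T'(2) by auto
 then obtain t0 where t0: "t0 > 0" "y + t0 *\<^sub>R n : T'" by (auto simp: Rr_def)
 have l3t: "t.l3 (y + t0 *\<^sub>R n) < 0"
  using yl(1) t0(1) t.nn by (simp add: t.l3_def inner_add_left inner_diff_left)
 then have "y + t0 *\<^sub>R n ~: T" using t.T_l3 TT(1) by force
 then have ne: "T' ~= T" using t0(2) by auto
 define F where "F = T Int T'"
 have F: "F face_of T" "F face_of T'" using tri(2)[OF T T'(1)] tri(2)[OF T'(1) T] by (auto simp: F_def Int_commute)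
 have SF: "S <= F"
 proof (rule subset_of_face_of[OF F(1)])
  show "S <= T" using t.S_subset_T TT by simp
  have "y : F" using yS yT' t.S_subset_T TT by (auto simp: F_def)
  then show "F Int rel_interior S ~= {}" using yrel by auto
 qed
 have dimT: "aff_dim T = 3" "aff_dim T' = 3" using tri(3) T T'(1) aff_dim_simplex by blast+
 have cT: "convex T" "convex T'" using tri(3) T T'(1) convex_simplex by blast+
 have FT: "F ~= T" "F ~= T'"
 proof -
  show "F ~= T"
  proof
   assume "F = T"
   then have "T face_of T'" using F(2) by simp
   then show False using face_of_aff_dim_lt[OF cT(2), of T] ne dimT by auto
  qed
  show "F ~= T'"
  proof
   assume "F = T'"
   then have "T' face_of T" using F(1) by simp
   then show False using face_of_aff_dim_lt[OF cT(1), of T'] ne dimT by auto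
  qed
 qed
 have dF: "aff_dim F < 3" using face_of_aff_dim_lt[OF cT(1) F(1) FT(1)] dimT by simp
 have dS: "aff_dim S = 2" "S face_of T" using facet(1) dimT by (auto simp: facet_of_def)
 have "S = F"
 proof (rule ccontr)
  assume "S ~= F"
  moreover have "S face_of F" using dS(2) SF F(1) face_of_subset face_of_imp_subset by blast
  moreover have "convex F" using F(1) face_of_imp_convex by blast
  ultimately have "aff_dim S < aff_dim F" by (intro face_of_aff_dim_lt)
  then show False using dF dS by simp
 qed
 then have facet': "S facet_of T'" using F(2) dS dimT yS by (auto simp: facet_of_def)
 obtain v' where v': "T' = convex hull {v', p, q, r}"
  using simplex_facet_vertices[OF tri(3)[OF T'(1)] facet'] Spqr by metis
 obtain x r' where xr: "0 < r'" "cball x r' <= T'" using balls[OF T'(1)] by auto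
 have "tet p q r (- n) v'"
 proof -
  obtain k where k: "k = (1 / norm (cross3 (q - p) (r - p))) *\<^sub>R cross3 (q - p) (r - p)
   \<or> k = - ((1 / norm (cross3 (q - p) (r - p))) *\<^sub>R cross3 (q - p) (r - p))" "tet p q r k v'"
   using tet_exists[OF t.cross_nz v' xr(2) xr(1)] by auto
  have "(1 / norm (cross3 (q - p) (r - p))) *\<^sub>R cross3 (q - p) (r - p) = n \<or>
    (1 / norm (cross3 (q - p) (r - p))) *\<^sub>R cross3 (q - p) (r - p) = - n"
   using t.D_nz t.n1 by (cases "t.D > 0") (auto simp: t.cross_eq)
  then have "k = n \<or> k = - n" using k(1) by auto
  moreover have "k ~= n"
  proof
   assume "k = n"
   then interpret t': tet p q r n v' using k(2) by simp
   have "0 <= t.l3 (y + t0 *\<^sub>R n)" using t0(2) v' by (intro t'.T_l3) (simp add: t'.T_def)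
   then show False using l3t by simp
  qed
  ultimately show ?thesis using k(2) by auto
 qed
 then show thesis using that T'(1) facet' v' by blast
qed

section \<open>Traces on the faces of a simplex\<close>

text \<open>Countably many neighbourhoods suffice, and the least index of one containing the point
  glues the Borel representatives measurably.\<close>

lemma measurable_local:
 fixes f :: "'a::euclidean_space => 'b::real_normed_vector"
 assumes U: "open U"
  and loc: "!!z. z : U ==> EX V h. open V & z : V & h : borel_measurable borel & (AE y in lborel. y : V --> f y = h y)"
 shows "(%y. if y : U then f y else 0) : borel_measurable lebesgue"
proof (cases "U = {}")
 case False
 define F where "F = {V. open V & (EX h. h : borel_measurable borel & (AE y in lborel. y : V --> f y = h y))}"
 obtain F' where F': "F' <= F" "countable F'" "\<Union>F' = \<Union>F" using Lindelof[of F] by (auto simp: F_def)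
 have UF: "U <= \<Union>F'" unfolding F'(3) using loc by (fastforce simp: F_def)
 then have ne: "F' ~= {}" using False by auto
 define V where "V = from_nat_into F'"
 have Vr: "range V = F'" unfolding V_def by (rule range_from_nat_into[OF ne F'(2)])
 have "ALL n. EX h. h : borel_measurable borel & (AE y in lborel. y : V n --> f y = h y)"
  using Vr F'(1) by (auto simp: F_def)
 then obtain h where h: "!!n. h n : borel_measurable borel" "!!n. AE y in lborel. y : V n --> f y = h n y" by metis
 have oV: "open (V n)" for n using Vr F'(1) by (auto simp: F_def)
 define N where "N y = (LEAST n. y : V n)" for y
 have mN: "N : borel \<rightarrow>\<^sub>M count_space UNIV" unfolding N_def
 proof (rule measurable_Least)
  show "Measurable.pred borel (%y. y : V n)" for n using oV[of n] by (simp add: pred_def)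
 qed
 have "(%y. h (N y) y) : borel_measurable borel" by (rule measurable_compose_countable[OF h(1) mN])
 then have "(%y. if y : U then h (N y) y else 0) : borel_measurable borel" using U by (intro measurable_If) auto
 then have m: "(%y. if y : U then h (N y) y else 0) : borel_measurable lebesgue" by (intro measurable_completion) simp
 have "AE y in lborel. ALL n. y : V n --> f y = h n y" using h(2) by (simp add: AE_all_countable)
 then have "AE y in lebesgue. (if y : U then h (N y) y else 0) = (if y : U then f y else 0)" unfolding AE_lebesgue_iff
 proof eventually_elim
  case (elim y)
  show ?case
  proof (cases "y : U")
   case True
   then obtain n where "y : V n" using UF Vr by (metis UnionE rangeE subsetD)
   then have "y : V (N y)" unfolding N_def by (rule LeastI)
   then show ?thesis using elim by simp
  qed simp
 qed
 then show ?thesis by (rule borel_measurable_AE_eq[OF m])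
qed simp

definition tri_open :: "(real \<times> real) set" where
 "tri_open = {z. 0 < fst z & 0 < snd z & fst z + snd z < 1}"

definition tri :: "(real \<times> real) set" where
 "tri = {z. 0 <= fst z & 0 <= snd z & fst z + snd z <= 1}"

lemma open_tri_open: "open tri_open" unfolding tri_open_def Collect_conj_eq
 by (intro open_Int open_Collect_less continuous_intros)

lemma tri_AE: "AE z in lebesgue. z : tri --> z : tri_open"
proof -
 have "negligible ({z. (1, 0) \<bullet> z = 0} Un {z. (0, 1) \<bullet> z = 0} Un {z. (1, 1) \<bullet> z = 1} :: (real \<times> real) set)"
  by (intro negligible_Un negligible_hyperplane) (auto simp: zero_prod_def)
 then have "({z. (1, 0) \<bullet> z = 0} Un {z. (0, 1) \<bullet> z = 0} Un {z. (1, 1) \<bullet> z = 1} :: (real \<times> real) set) : null_sets lebesgue"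
  by (simp add: negligible_iff_null_sets)
 then have "AE z in lebesgue. z ~: ({z. (1, 0) \<bullet> z = 0} Un {z. (0, 1) \<bullet> z = 0} Un {z. (1, 1) \<bullet> z = 1} :: (real \<times> real) set)"
  by (rule AE_not_in)
 then show ?thesis by eventually_elim (auto simp: tri_def tri_open_def inner_prod_def)
qed

lemma tri_open_subset: "tri_open <= tri" by (auto simp: tri_def tri_open_def)

lemma compact_tri: "compact tri"
proof -
 have "closed tri" unfolding tri_def Collect_conj_eq by (intro closed_Int closed_Collect_le continuous_intros)
 moreover have "tri <= cbox (0, 0) (1, 1)" by (auto simp: tri_def cbox_Pair_eq)
 ultimately show ?thesis using compact_Int_closed[OF compact_cbox, of tri "(0,0)" "(1,1)"] by (simp add: Int_absorb1)
qed

lemma tri_lebesgue: "tri : sets lebesgue" using compact_tri by (simp add: borel_compact)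

text \<open>A scalar function with weak partial derivatives, all integrable on \<open>T\<close>;
  this is the form in which the trace results are applied to the components of a field.\<close>

definition tdata :: "point set => (point => complex) => (3 => point => complex) => bool" where
 "tdata T g G \<longleftrightarrow> integrable (lebesgue_on T) g & (ALL i. integrable (lebesgue_on T) (G i)) \<and>
  (ALL i psi. test_fun T psi --> sprod T (G i) psi = - sprod T g (partial i psi))"

context tet
begin

definition tr :: "(point => 'b::t2_space) => real \<times> real => 'b" where
 "tr g z = Lim ess_at_right_0 (%t. g (Ph (z, t)))"

lemma trI: "((%t. g (Ph (z, t))) \<longlongrightarrow> l) ess_at_right_0 ==> tr g z = l"
 unfolding tr_def by (rule tendsto_Lim[OF ess_at_right_0_nontrivial])

lemma T_sets: "T : sets lebesgue" using compact_T by (simp add: borel_compact)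

lemma Ph_line_cont: "continuous_on UNIV F ==> ((%t. F (Ph (z, t))) \<longlongrightarrow> F (Ph (z, 0))) ess_at_right_0"
proof (rule tendsto_ess_at_right_0)
 assume F: "continuous_on UNIV F"
 have "continuous_on UNIV (%t. F (Ph (z, t)))"
  by (rule continuous_on_compose2[OF F]) (auto simp: Ph_def intro!: continuous_intros)
 then have "((%t. F (Ph (z, t))) \<longlongrightarrow> F (Ph (z, 0))) (at 0)"
  by (simp add: continuous_on_eq_continuous_at continuous_at)
 then show "((%t. F (Ph (z, t))) \<longlongrightarrow> F (Ph (z, 0))) (at_right 0)" by (simp add: filterlim_at_split)
qed

lemma tri_open_l: "z : tri_open \<longleftrightarrow> 0 < l1 (Ph (z, 0)) & 0 < l2 (Ph (z, 0)) & l1 (Ph (z, 0)) + l2 (Ph (z, 0)) < 1"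
 by (simp add: tri_open_def l_Ph)

lemma eventually_interior:
 assumes z: "z : tri_open"
 obtains d where "d > 0" "!!t. 0 < t ==> t < d ==> Ph (z, t) : interior T"
proof -
 obtain d where d: "d > 0" "!!x. x : cball (Ph (z, 0)) d ==> 0 < l3 x ==> x : interior T"
  using local_half_ball[of "Ph (z, 0)"] z unfolding tri_open_l by (auto simp: l_Ph)
 have "Ph (z, t) : interior T" if "0 < t" "t < d" for t
 proof (rule d(2))
  have "Ph (z, 0) - Ph (z, t) = t *\<^sub>R n" by (simp add: Ph_def)
  then show "Ph (z, t) : cball (Ph (z, 0)) d" using that n1 by (simp add: dist_norm)
  show "0 < l3 (Ph (z, t))" using that by (simp add: l_Ph)
 qed
 then show thesis using that d(1) by blast
qed

lemma AE_face_lines: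
 assumes "AE x in lebesgue. x : T --> Q x"
 shows "AE z in lborel. z : tri_open --> (\<forall>\<^sub>F t in ess_at_right_0. Q (Ph (z, t)))"
proof -
 have "AE z in lborel. AE t in lborel. Ph (z, t) : T --> Q (Ph (z, t))"
  using assms by (intro AE_Ph_lines) (simp add: AE_lebesgue_iff)
 then show ?thesis
 proof eventually_elim
  case (elim z)
  show ?case
  proof
   assume "z : tri_open"
   then obtain d where d: "d > 0" "!!t. 0 < t ==> t < d ==> Ph (z, t) : interior T" using eventually_interior by blast
   show "\<forall>\<^sub>F t in ess_at_right_0. Q (Ph (z, t))" by (rule eventually_ess_at_right_0[OF d(1)])
     (use elim in eventually_elim, use d(2) interior_subset in blast)
  qed
 qed
qed

text \<open>The trace of \<open>g\<close> times a bump centred at the point exists by integration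
  along normals; dividing by the bump, which is positive near the point, gives the trace of
  \<open>g\<close>.\<close>

lemma trace_local:
 assumes g: "tdata T g G" and z0: "z0 : tri_open"
 shows "EX V h. open V & z0 : V & h : borel_measurable borel \<and>
  (AE z in lborel. z : V --> ((%t. g (Ph (z, t))) \<longlongrightarrow> h z) ess_at_right_0)"
proof -
 define y where "y = Ph (z0, 0)"
 obtain d where d: "d > 0" "!!x. x : cball y d ==> 0 < l3 x ==> x : interior T"
  using local_half_ball[of y] z0 unfolding tri_open_l y_def by (auto simp: l_Ph)
 define phi where "phi x = complex_of_real (bump y d x)" for x
 have sphi: "smooth phi" unfolding phi_def[abs_def] by (rule smooth_linear[OF bounded_linear_of_real smooth_bump])
 interpret ts: trace_setup p "q - p" "r - p" n T g G phi "cball y d"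
 proof
  show "phi x = 0" if "x ~: cball y d" for x using that d(1) by (auto simp: phi_def intro!: bump_zero)
 qed (use g T_sets sphi d in \<open>auto simp: tdata_def\<close>)
 obtain h where h: "integrable lborel h"
  "AE z in lborel. ((%t. g (Ph (z, t)) * phi (Ph (z, t))) \<longlongrightarrow> h z) ess_at_right_0"
  using ts.trace_green by blast
 define V where "V = (%z. Ph (z, 0)) -` ball y d"
 have cP: "continuous_on UNIV (%z. Ph (z, 0))" unfolding Ph_def by (auto intro!: continuous_intros)
 have oV: "open V" unfolding V_def by (rule open_vimage[OF open_ball cP])
 have zV: "z0 : V" using d(1) by (simp add: V_def y_def)
 have m: "(%z. h z / phi (Ph (z, 0))) : borel_measurable borel" using borel_measurable_integrable[OF h(1)]
  by (intro borel_measurable_divide continuous_borel[OF continuous_on_compose2[OF smooth_continuous[OF sphi] cP]]) auto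
 have "AE z in lborel. z : V --> ((%t. g (Ph (z, t))) \<longlongrightarrow> h z / phi (Ph (z, 0))) ess_at_right_0"
  using h(2)
 proof eventually_elim
  case (elim z)
  show ?case
  proof
   assume "z : V"
   then have nz: "phi (Ph (z, 0)) ~= 0" using bump_pos_iff[OF d(1), of y "Ph (z, 0)"] by (simp add: V_def phi_def)
   have lphi: "((%t. phi (Ph (z, t))) \<longlongrightarrow> phi (Ph (z, 0))) ess_at_right_0"
    by (rule Ph_line_cont[OF smooth_continuous[OF sphi]])
   have "\<forall>\<^sub>F t in ess_at_right_0. phi (Ph (z, t)) ~= 0" by (rule tendsto_imp_eventually_ne[OF lphi nz])
   then have "\<forall>\<^sub>F t in ess_at_right_0. (g (Ph (z, t)) * phi (Ph (z, t))) / phi (Ph (z, t)) = g (Ph (z, t))"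
    by eventually_elim simp
   with tendsto_divide[OF elim lphi nz] show "((%t. g (Ph (z, t))) \<longlongrightarrow> h z / phi (Ph (z, 0))) ess_at_right_0"
    by (rule Lim_transform_eventually)
  qed
 qed
 then show ?thesis using oV zV m by blast
qed

lemma trace_AE:
 assumes g: "tdata T g G"
 shows "AE z in lborel. z : tri_open --> ((%t. g (Ph (z, t))) \<longlongrightarrow> tr g z) ess_at_right_0"
proof (rule AE_open_local)
 fix z0 assume "z0 : tri_open"
 from trace_local[OF g this] obtain V h where V: "open V" "z0 : V"
  "AE z in lborel. z : V --> ((%t. g (Ph (z, t))) \<longlongrightarrow> h z) ess_at_right_0" by blast
 from V(3) have "AE z in lborel. z : V --> ((%t. g (Ph (z, t))) \<longlongrightarrow> tr g z) ess_at_right_0"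
  by eventually_elim (metis trI)
 then show "EX V. open V & z0 : V & (AE z in lborel. z : V --> ((%t. g (Ph (z, t))) \<longlongrightarrow> tr g z) ess_at_right_0)"
  using V by blast
qed

lemma trace_measurable:
 assumes g: "tdata T g G"
 shows "(%z. if z : tri_open then tr g z else 0) : borel_measurable lebesgue"
proof (rule measurable_local[OF open_tri_open])
 fix z0 assume "z0 : tri_open"
 from trace_local[OF g this] obtain V h where V: "open V" "z0 : V" "h : borel_measurable borel"
  "AE z in lborel. z : V --> ((%t. g (Ph (z, t))) \<longlongrightarrow> h z) ess_at_right_0" by blast
 from V(4) have "AE z in lborel. z : V --> tr g z = h z" by eventually_elim (metis trI)
 then show "EX V h. open V & z0 : V & h : borel_measurable borel & (AE y in lborel. y : V --> tr g y = h y)"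
  using V by blast
qed

lemma plane_AE: "AE x in lborel. l3 x ~= 0"
proof -
 have "negligible {x. n \<bullet> x = n \<bullet> p}" using n1 by (intro negligible_hyperplane) auto
 then have "AE x in lebesgue. x ~: {x. n \<bullet> x = n \<bullet> p}"
  by (intro AE_not_in) (simp add: negligible_iff_null_sets)
 then show ?thesis unfolding AE_lebesgue_iff
 proof eventually_elim
  case (elim x)
  have "l3 x = - (n \<bullet> x - n \<bullet> p)" by (simp add: l3_def inner_diff_right inner_commute)
  then show ?case using elim by auto
 qed
qed

text \<open>The cutoff may be nonzero on this face, but its support avoids the other faces: within 2
  r0 / 3 of the centroid the remaining barycentric coordinates are positive. Hence a single boundary
  integral appears, and it may be taken over the open triangle.\<close>

lemma green_face:
 assumes g: "tdata T g G" and b: "r0 > 0" "cball x0 r0 <= T"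
  and phi: "smooth phi" "0 < rho" "rho < 2 * r0 / 3" "!!x. x ~: cball m rho ==> phi x = 0"
 shows "integrable lebesgue (%z. indicator tri_open z *\<^sub>R (tr g z * phi (Ph (z, 0))))"
  and "(LINT x|lebesgue_on T. G i x * phi x + g x * partial i phi x)
   = n $ i *\<^sub>R (J *\<^sub>R (LINT z|lebesgue. indicator tri_open z *\<^sub>R (tr g z * phi (Ph (z, 0)))))"
proof -
 interpret ts: trace_setup p "q - p" "r - p" n T g G phi "cball m rho"
 proof
  show "x : interior T" if "x : cball m rho" "0 < l3 x" for x using that phi(3) by (intro half_ball[OF b]) auto
 qed (use g T_sets phi in \<open>auto simp: tdata_def\<close>)
 obtain h where h: "integrable lborel h"
  "AE z in lborel. ((%t. g (Ph (z, t)) * phi (Ph (z, t))) \<longlongrightarrow> h z) ess_at_right_0"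
  "!!i. (LINT x|lebesgue. ts.k i x) = n $ i *\<^sub>R (J *\<^sub>R (LINT z|lborel. h z))"
  using ts.trace_green by blast
 have eq: "AE z in lborel. h z = indicator tri_open z *\<^sub>R (tr g z * phi (Ph (z, 0)))" using h(2) trace_AE[OF g]
 proof eventually_elim
  case (elim z)
  show ?case
  proof (cases "z : tri_open")
   case True
   have "((%t. g (Ph (z, t)) * phi (Ph (z, t))) \<longlongrightarrow> tr g z * phi (Ph (z, 0))) ess_at_right_0"
    using elim(2) True by (intro tendsto_mult Ph_line_cont[OF smooth_continuous[OF phi(1)]]) auto
   then have "h z = tr g z * phi (Ph (z, 0))" by (rule tendsto_unique[OF ess_at_right_0_nontrivial elim(1)])
   then show ?thesis using True by simp
  next
   \<comment> \<open>The foot of the normal line lies in the plane outside the open triangle, hence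
     at distance at least 2 r0 / 3 from the centroid. It is the point of the line nearest to the
     centroid, so \<open>phi\<close> vanishes along all of the line.\<close>
   case False
   have "phi (Ph (z, t)) = 0" for t
   proof (rule phi(4))
    have "dist m (Ph (z, 0)) \<ge> 2 * r0 / 3"
    proof (rule ccontr)
     assume "\<not> dist m (Ph (z, 0)) \<ge> 2 * r0 / 3"
     then have "z : tri_open" using plane_ball[OF b, of "Ph (z, 0)"] by (simp add: tri_open_l l_Ph)
     then show False using False by simp
    qed
    moreover have "dist m (Ph (z, 0)) <= dist m (Ph (z, t))"
    proof -
     have "m - Ph (z, t) = (m - Ph (z, 0)) + t *\<^sub>R n" by (simp add: Ph_def)
     moreover have "(m - Ph (z, 0)) \<bullet> n = 0"
      using l_mean(3) l_Ph(3)[of "(z, 0)"] by (simp add: l3_def inner_diff_left)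
     ultimately have "(norm (m - Ph (z, t)))\<^sup>2 = (norm (m - Ph (z, 0)))\<^sup>2 + t\<^sup>2"
      by (simp only: power2_norm_eq_inner) (simp add: inner_add_left inner_add_right inner_commute nn power2_eq_square)
     then have "(norm (m - Ph (z, 0)))\<^sup>2 <= (norm (m - Ph (z, t)))\<^sup>2" by simp
     then show ?thesis unfolding dist_norm by (rule power2_le_imp_le) simp
    qed
    ultimately show "Ph (z, t) ~: cball m rho" using phi(3) by auto
   qed
   then have "h z = 0" using tendsto_unique[OF ess_at_right_0_nontrivial elim(1)] by (simp add: tendsto_const)
   then show ?thesis using False by simp
  qed
 qed
 have ih: "integrable lebesgue h" using h(1) by (simp add: integrable_completion)
 have m: "(%z. indicator tri_open z *\<^sub>R (tr g z * phi (Ph (z, 0)))) : borel_measurable lebesgue"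
  by (rule borel_measurable_AE_eq[OF borel_measurable_integrable[OF ih]]) (use eq in \<open>simp add: AE_lebesgue_iff\<close>)
 show i: "integrable lebesgue (%z. indicator tri_open z *\<^sub>R (tr g z * phi (Ph (z, 0))))"
  by (rule integrable_cong_AE_imp[OF ih m]) (use eq in \<open>simp add: AE_lebesgue_iff\<close>)
 have hh: "(LINT z|lborel. h z) = (LINT z|lebesgue. indicator tri_open z *\<^sub>R (tr g z * phi (Ph (z, 0))))"
 proof -
  have "(LINT z|lborel. h z) = (LINT z|lebesgue. h z)" using h(1) by (intro integral_completion[symmetric]) auto
  also have "... = (LINT z|lebesgue. indicator tri_open z *\<^sub>R (tr g z * phi (Ph (z, 0))))"
   using ih m by (intro integral_cong_AE) (use eq in \<open>auto simp: AE_lebesgue_iff\<close>)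
  finally show ?thesis .
 qed
 \<comment> \<open>Off the plane, which is a null set, the integrand on the half space and the one
   on \<open>T\<close> agree: within the support, positive height forces a point into
   \<open>T\<close>, and \<open>T\<close> has no points of negative height.\<close>
 have c: "AE x in lebesgue. indicator T x *\<^sub>R (G i x * phi x + g x * partial i phi x) = ts.k i x"
  using plane_AE unfolding AE_lebesgue_iff
 proof eventually_elim
  case (elim x)
  have "l3 x > 0 ==> x ~: T ==> x ~: cball m rho"
   using half_ball[OF b, of x] subsetD[OF interior_subset, of x T] phi(3) by force
  moreover have "x ~: cball m rho ==> phi x = 0 & partial i phi x = 0" using phi(4) ts.partial_phi_zero by blast
  ultimately show ?case using elim T_l3[of x] by (cases "x : T") (auto simp: ts.k_def)
 qed
 have "(LINT x|lebesgue_on T. G i x * phi x + g x * partial i phi x)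
   = (LINT x|lebesgue. indicator T x *\<^sub>R (G i x * phi x + g x * partial i phi x))"
  by (rule LINT_lebesgue_on[OF T_sets])
 also have "... = (LINT x|lebesgue. ts.k i x)"
 proof (rule integral_cong_AE[OF _ _ c])
  show "ts.k i : borel_measurable lebesgue" by (rule borel_measurable_integrable[OF ts.integrable_k])
  then show "(%x. indicator T x *\<^sub>R (G i x * phi x + g x * partial i phi x)) : borel_measurable lebesgue"
   by (rule borel_measurable_AE_eq) (use c in \<open>auto elim: eventually_mono\<close>)
 qed
 finally show "(LINT x|lebesgue_on T. G i x * phi x + g x * partial i phi x)
   = n $ i *\<^sub>R (J *\<^sub>R (LINT z|lebesgue. indicator tri_open z *\<^sub>R (tr g z * phi (Ph (z, 0)))))"
  by (simp add: h(3) hh)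
qed

end

section \<open>Square integrable functions\<close>

text \<open>Weighted arithmetic-geometric mean, 2 |f g| <= s f^2 + g^2 / s, with the optimal
  \<open>s\<close>; the cases where an integral vanishes use other values of
  \<open>s\<close>.\<close>

lemma Cauchy_Schwarz_integral:
 fixes f g :: "'a => real"
 assumes m: "f : borel_measurable M" "g : borel_measurable M"
  and i: "integrable M (%x. (f x)\<^sup>2)" "integrable M (%x. (g x)\<^sup>2)"
 shows "integrable M (%x. f x * g x)"
  and "(LINT x|M. \<bar>f x * g x\<bar>) <= sqrt (LINT x|M. (f x)\<^sup>2) * sqrt (LINT x|M. (g x)\<^sup>2)"
proof -
 let ?A = "LINT x|M. (f x)\<^sup>2" and ?B = "LINT x|M. (g x)\<^sup>2"
 have am: "\<bar>f x * g x\<bar> <= (s * (f x)\<^sup>2 + (g x)\<^sup>2 / s) / 2" if "s > 0" for s x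
 proof -
  have "0 <= (s * \<bar>f x\<bar> - \<bar>g x\<bar>)\<^sup>2" by simp
  then have "2 * s * \<bar>f x * g x\<bar> <= s\<^sup>2 * (f x)\<^sup>2 + (g x)\<^sup>2"
   by (simp add: power2_diff power_mult_distrib abs_mult algebra_simps)
  then show ?thesis using that by (simp add: field_simps power2_eq_square)
 qed
 have int: "integrable M (%x. (s * (f x)\<^sup>2 + (g x)\<^sup>2 / s) / 2)" for s using i by simp
 show fg: "integrable M (%x. f x * g x)" by (rule Bochner_Integration.integrable_bound[OF int[of 1]])
   (use m am[of 1] in \<open>auto intro!: AE_I2 order_trans[OF _ abs_ge_self]\<close>)
 let ?X = "LINT x|M. \<bar>f x * g x\<bar>"
 have X: "2 * ?X <= s * ?A + ?B / s" if "s > 0" for s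
 proof -
  have "?X <= (LINT x|M. (s * (f x)\<^sup>2 + (g x)\<^sup>2 / s) / 2)"
   using fg int am[OF that] by (intro integral_mono) auto
  then show ?thesis using i by simp
 qed
 have AB: "0 <= ?A" "0 <= ?B" "0 <= ?X" by simp_all
 consider "?X = 0" | "?A = 0" "?X > 0" | "?B = 0" "?A > 0" "?X > 0" | "?A > 0" "?B > 0" using AB by linarith
 then show "?X <= sqrt ?A * sqrt ?B"
 proof cases
  case 2
  \<comment> \<open>Here s = (B + 1) / X, with B and X the integrals of g^2 and |f g|; adding 1
    keeps \<open>s\<close> positive when B = 0.\<close>
  have B1: "?B + 1 > 0" using AB by linarith
  have "2 * ?X <= ?B / ((?B + 1) / ?X)" using X[OF divide_pos_pos[OF B1 2(2)]] 2(1) by simp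
  also have "... = ?X * (?B / (?B + 1))" by simp
  also have "... <= ?X * 1" using AB B1 by (intro mult_left_mono) (simp_all add: divide_le_eq_1)
  finally show ?thesis using 2 by simp
 next
  case 3
  have "2 * ?X <= ?X" using X[of "?X / ?A"] 3 by simp
  then show ?thesis using 3 by simp
 next
  case 4
  have "2 * ?X <= sqrt (?B / ?A) * ?A + ?B / sqrt (?B / ?A)" using 4 by (intro X) simp
  also have "sqrt (?B / ?A) * ?A = sqrt ?A * sqrt ?B"
  proof -
   have "sqrt (?B / ?A) * ?A = sqrt ?B * (?A / sqrt ?A)" by (simp add: real_sqrt_divide)
   then show ?thesis using 4 by (simp add: real_div_sqrt)
  qed
  also have "?B / sqrt (?B / ?A) = sqrt ?A * sqrt ?B"
  proof -
   have "?B / sqrt (?B / ?A) = sqrt ?A * (?B / sqrt ?B)" using 4 by (simp add: real_sqrt_divide)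
   then show ?thesis using 4 by (simp add: real_div_sqrt)
  qed
  finally show ?thesis by simp
 qed (use AB in auto)
qed

lemma L2_norm_sq: "(L2_norm G v)\<^sup>2 = (LINT x|lebesgue_on G. (norm (v x))\<^sup>2)"
 unfolding L2_norm_def by (rule real_sqrt_pow2) simp

lemma L2_norm_nonneg: "0 <= L2_norm G v" by (simp add: L2_norm_def)

lemma L2_prod:
 assumes "L2_on G v" "L2_on G w"
 shows "integrable (lebesgue_on G) (%x. norm (v x) * norm (w x))"
  and "(LINT x|lebesgue_on G. norm (v x) * norm (w x)) <= L2_norm G v * L2_norm G w"
 using Cauchy_Schwarz_integral[of "%x. norm (v x)" "lebesgue_on G" "%x. norm (w x)"] assms
 by (auto simp: L2_on_def L2_norm_def)

lemma L2_bounded_mult: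
 fixes v :: "point => 'b::euclidean_space" and w :: "point => 'c::euclidean_space"
 assumes v: "L2_on G v" and w: "w : borel_measurable (lebesgue_on G)"
  and b: "AE x in lebesgue_on G. norm (w x) <= c * norm (v x)" and c: "c \<ge> 0"
 shows "L2_on G w" "L2_norm G w <= c * L2_norm G v"
proof -
 have iv: "integrable (lebesgue_on G) (%x. c\<^sup>2 * (norm (v x))\<^sup>2)" using v by (simp add: L2_on_def)
 have b': "AE x in lebesgue_on G. (norm (w x))\<^sup>2 <= c\<^sup>2 * (norm (v x))\<^sup>2"
  using b by eventually_elim (metis norm_ge_zero power_mono power_mult_distrib)
 have iw: "integrable (lebesgue_on G) (%x. (norm (w x))\<^sup>2)"
  by (rule Bochner_Integration.integrable_bound[OF iv]) (use w b' in \<open>auto simp: abs_mult\<close>)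
 then show "L2_on G w" using w by (simp add: L2_on_def)
 have "(L2_norm G w)\<^sup>2 <= (LINT x|lebesgue_on G. c\<^sup>2 * (norm (v x))\<^sup>2)"
  unfolding L2_norm_sq using iw iv b' by (intro integral_mono_AE) auto
 also have "... = (c * L2_norm G v)\<^sup>2" by (simp add: L2_norm_sq power_mult_distrib)
 finally show "L2_norm G w <= c * L2_norm G v"
  by (rule power2_le_imp_le) (rule mult_nonneg_nonneg[OF c L2_norm_nonneg])
qed

lemma L2_add:
 fixes v w :: "point => 'b::euclidean_space"
 assumes v: "L2_on G v" and w: "L2_on G w"
 shows "L2_on G (%x. v x + w x)" "L2_norm G (%x. v x + w x) <= L2_norm G v + L2_norm G w"
proof -
 have m: "(%x. v x + w x) : borel_measurable (lebesgue_on G)" using v w by (auto simp: L2_on_def)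
 have b: "(norm (v x + w x))\<^sup>2 <= (norm (v x))\<^sup>2 + (norm (w x))\<^sup>2 + 2 * (norm (v x) * norm (w x))" for x
  using power_mono[OF norm_triangle_ineq[of "v x" "w x"], of 2] by (simp add: power2_sum)
 have i: "integrable (lebesgue_on G) (%x. (norm (v x))\<^sup>2 + (norm (w x))\<^sup>2 + 2 * (norm (v x) * norm (w x)))"
  using v w L2_prod(1)[OF v w] by (simp add: L2_on_def)
 have sq: "integrable (lebesgue_on G) (%x. (norm (v x + w x))\<^sup>2)"
  by (rule Bochner_Integration.integrable_bound[OF i]) (use m b in \<open>auto intro: order_trans[OF _ abs_ge_self]\<close>)
 then show "L2_on G (%x. v x + w x)" using m by (simp add: L2_on_def)
 have "(L2_norm G (%x. v x + w x))\<^sup>2 <= (LINT x|lebesgue_on G. (norm (v x))\<^sup>2 + (norm (w x))\<^sup>2 + 2 * (norm (v x) * norm (w x)))"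
  unfolding L2_norm_sq using sq i b by (intro integral_mono) auto
 also have "... = (L2_norm G v)\<^sup>2 + (L2_norm G w)\<^sup>2 + 2 * (LINT x|lebesgue_on G. norm (v x) * norm (w x))"
  using v w L2_prod(1)[OF v w] by (simp add: L2_on_def L2_norm_sq)
 also have "... <= (L2_norm G v + L2_norm G w)\<^sup>2" using L2_prod(2)[OF v w] by (simp add: power2_sum)
 finally show "L2_norm G (%x. v x + w x) <= L2_norm G v + L2_norm G w"
  by (rule power2_le_imp_le) (simp add: L2_norm_nonneg)
qed

lemma L2_scale:
 fixes v :: "point => 'b::euclidean_space"
 assumes "L2_on G v"
 shows "L2_on G (%x. c *\<^sub>R v x)" "L2_norm G (%x. c *\<^sub>R v x) <= \<bar>c\<bar> * L2_norm G v"
 using L2_bounded_mult[OF assms, of "%x. c *\<^sub>R v x" "\<bar>c\<bar>"] assms by (auto simp: L2_on_def)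

lemma L2_diff:
 fixes v w :: "point => 'b::euclidean_space"
 assumes v: "L2_on G v" and w: "L2_on G w"
 shows "L2_on G (%x. v x - w x)" "L2_norm G (%x. v x - w x) <= L2_norm G v + L2_norm G w"
 using L2_add[OF v L2_scale(1)[OF w, of "-1"]] L2_scale(2)[OF w, of "-1"] by auto

lemma lebesgue_on_measurable_subset:
 fixes f :: "point => 'b::euclidean_space"
 assumes "f : borel_measurable (lebesgue_on G)" "H <= G"
 shows "f : borel_measurable (lebesgue_on H)"
 using measurable_restrict_mono[OF assms(1) assms(2)] .

lemma L2_subset:
 fixes v :: "point => 'b::euclidean_space"
 assumes v: "L2_on G v" and H: "H <= G" "H : sets lebesgue" "G : sets lebesgue"
 shows "L2_on H v" "L2_norm H v <= L2_norm G v"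
proof -
 have iG: "integrable lebesgue (%x. indicator G x *\<^sub>R (norm (v x))\<^sup>2)"
  using v H by (simp add: L2_on_def integrable_lebesgue_on_iff)
 have m: "v : borel_measurable (lebesgue_on H)" using v H lebesgue_on_measurable_subset by (auto simp: L2_on_def)
 have iH: "integrable lebesgue (%x. indicator H x *\<^sub>R (norm (v x))\<^sup>2)"
 proof -
  have "integrable lebesgue (%x. indicator H x *\<^sub>R (indicator G x *\<^sub>R (norm (v x))\<^sup>2))"
   using H by (intro integrable_mult_indicator iG)
  moreover have "indicator H x *\<^sub>R (indicator G x *\<^sub>R (norm (v x))\<^sup>2) = indicator H x *\<^sub>R (norm (v x))\<^sup>2" for x
   using H(1) by (auto simp: indicator_def)
  ultimately show ?thesis by (simp only:)
 qed
 then show "L2_on H v" using m H by (simp add: L2_on_def integrable_lebesgue_on_iff)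
 have "(L2_norm H v)\<^sup>2 <= (L2_norm G v)\<^sup>2"
  unfolding L2_norm_sq LINT_lebesgue_on[OF H(2)] LINT_lebesgue_on[OF H(3)]
  using iH iG H(1) by (intro integral_mono) (auto simp: indicator_def)
 then show "L2_norm H v <= L2_norm G v" by (rule power2_le_imp_le) (rule L2_norm_nonneg)
qed

lemma L2_norm_cong_AE:
 fixes v w :: "point => 'b::euclidean_space"
 assumes "L2_on G v" "L2_on G w" "AE x in lebesgue_on G. v x = w x"
 shows "L2_norm G v = L2_norm G w"
 unfolding L2_norm_def using assms
 by (intro arg_cong[where f = sqrt] integral_cong_AE) (auto simp: L2_on_def elim: eventually_mono)

lemma measurable_on_AE_eq:
 fixes v w :: "point => 'b::euclidean_space"
 assumes G: "G : sets lebesgue" and v: "v : borel_measurable (lebesgue_on G)"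
  and e: "AE x in lebesgue. x : G --> v x = w x"
 shows "w : borel_measurable (lebesgue_on G)"
proof -
 have a: "(%x. if x : G then v x else 0) : borel_measurable lebesgue"
  using v borel_measurable_if_D borel_measurable_if_I[OF v G] by blast
 have "AE x in lebesgue. (if x : G then v x else 0) = (if x : G then w x else 0)" using e by eventually_elim auto
 from borel_measurable_AE_eq[OF a this] show ?thesis by (rule borel_measurable_if_D)
qed

lemma L2_cong_AE:
 fixes v w :: "point => 'b::euclidean_space"
 assumes G: "G : sets lebesgue" and v: "L2_on G v" and e: "AE x in lebesgue. x : G --> v x = w x"
 shows "L2_on G w" "L2_norm G w = L2_norm G v"
proof -
 have m: "w : borel_measurable (lebesgue_on G)" using measurable_on_AE_eq[OF G _ e] v by (simp add: L2_on_def)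
 have e': "AE x in lebesgue_on G. v x = w x" using e G by (simp add: AE_lebesgue_on_iff)
 show w: "L2_on G w" by (rule L2_bounded_mult(1)[OF v m, of 1]) (use e' in \<open>auto elim: eventually_mono\<close>)
 show "L2_norm G w = L2_norm G v" by (rule L2_norm_cong_AE[OF v w e', symmetric])
qed

lemma L2_continuous:
 fixes P :: "point => 'b::euclidean_space"
 assumes "continuous_on UNIV P" "bounded G" "G : sets lebesgue"
 shows "L2_on G P"
proof -
 obtain R where R: "G <= cball 0 R" using assms(2) by (auto simp: bounded_iff subset_iff)
 have "integrable lborel (%x. indicator (cball 0 R) x *\<^sub>R (norm (P x))\<^sup>2)"
  by (intro borel_integrable_compact continuous_intros continuous_on_subset[OF assms(1)]) auto
 moreover have "(%x. indicator (cball 0 R) x *\<^sub>R (norm (P x))\<^sup>2) : borel_measurable lborel"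
  by (rule borel_measurable_integrable) fact
 ultimately have "integrable lebesgue (%x. indicator (cball 0 R) x *\<^sub>R (norm (P x))\<^sup>2)"
  by (simp only: integrable_completion)
 moreover have "P : borel_measurable (lebesgue_on H)" for H
  using continuous_measurable_lebesgue[OF assms(1)] by (rule measurable_restrict_space1)
 ultimately have "L2_on (cball 0 R) P" by (simp add: L2_on_def integrable_lebesgue_on_iff)
 then show ?thesis by (rule L2_subset(1)[OF _ R assms(3)]) simp
qed

lemma L2_integrable:
 fixes v :: "point => 'b::euclidean_space"
 assumes "L2_on G v" "bounded G" "G : sets lebesgue"
 shows "integrable (lebesgue_on G) v"
proof (rule Bochner_Integration.integrable_bound)
 have "L2_on G (%_. 1::real)" using assms by (intro L2_continuous) auto
 from L2_prod(1)[OF assms(1) this] show "integrable (lebesgue_on G) (%x. norm (v x))" by simp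
qed (use assms in \<open>auto simp: L2_on_def\<close>)

section \<open>Vector fields\<close>

lemma measurable_vec_nth: "v : borel_measurable M ==> (%x. v x $ i) : borel_measurable (M :: 'a measure)"
 for v :: "'a => complex^3"
 by (rule measurable_compose[OF _ continuous_borel[OF linear_continuous_on[OF bounded_linear_vec_nth]]])

lemma bounded_linear_axis: "bounded_linear (axis i :: complex => complex^3)"
proof (rule bounded_linear_intro[of _ 1])
 show "axis i (x + y) = (axis i x + axis i y :: complex^3)" for x y by (auto simp: axis_def vec_eq_iff)
 show "axis i (r *\<^sub>R x) = r *\<^sub>R (axis i x :: complex^3)" for r x by (auto simp: axis_def vec_eq_iff)
 show "norm (axis i x :: complex^3) <= norm x * 1" for x
 proof -
  have "norm (axis i x :: complex^3) <= (SUM j:UNIV. norm ((axis i x :: complex^3) $ j))"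
   unfolding norm_vec_def by (rule L2_set_le_sum) simp
  also have "... = norm x" by (simp add: axis_def if_distrib[of norm] cong: if_cong)
  finally show ?thesis by simp
 qed
qed

lemma vec_axis_sum: "(v :: complex^3) = (SUM i:UNIV. axis i (v $ i))"
 by (simp add: vec_eq_iff axis_def if_distrib cong: if_cong)

lemma measurable_vecI:
 fixes v :: "'a => complex^3"
 assumes "!!i. (%x. v x $ i) : borel_measurable M"
 shows "v : borel_measurable M"
proof -
 have "(%x. SUM i:UNIV. axis i (v x $ i) :: complex^3) : borel_measurable M"
  by (intro borel_measurable_sum measurable_compose[OF assms continuous_borel[OF linear_continuous_on[OF bounded_linear_axis]]])
 then show ?thesis by (simp add: vec_axis_sum[symmetric])
qed

lemma norm_cip: "norm (SUM i:UNIV. v $ i * cnj (w $ i)) <= norm v * norm (w :: complex^3)"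
proof -
 have "norm (SUM i:UNIV. v $ i * cnj (w $ i)) <= (SUM i:UNIV. \<bar>norm (v $ i)\<bar> * \<bar>norm (w $ i)\<bar>)"
  by (rule order_trans[OF norm_sum]) (simp add: norm_mult)
 also have "... <= norm v * norm w" unfolding norm_vec_def by (rule L2_set_mult_ineq)
 finally show ?thesis .
qed

lemma norm_smult_vec: "norm (c *s v) = norm c * norm (v :: complex^3)"
 by (simp add: norm_vec_def norm_mult L2_set_right_distrib)

lemma norm_vec_nth: "norm (v $ i) <= norm (v :: complex^3)" by (rule Finite_Cartesian_Product.norm_nth_le)

lemma vprod_integrable:
 assumes "L2_on G v" "L2_on G w"
 shows "integrable (lebesgue_on G) (%x. SUM i:UNIV. v x $ i * cnj (w x $ i))"
  and "norm (vprod G v w) <= L2_norm G v * L2_norm G w"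
proof -
 have m: "(%x. SUM i:UNIV. v x $ i * cnj (w x $ i)) : borel_measurable (lebesgue_on G)"
  using assms by (intro borel_measurable_sum borel_measurable_times measurable_vec_nth
    measurable_compose[OF measurable_vec_nth continuous_borel[OF linear_continuous_on[OF bounded_linear_cnj]]])
   (auto simp: L2_on_def)
 show i: "integrable (lebesgue_on G) (%x. SUM i:UNIV. v x $ i * cnj (w x $ i))"
  by (rule Bochner_Integration.integrable_bound[OF L2_prod(1)[OF assms] m]) (use norm_cip in auto)
 have "norm (vprod G v w) <= (LINT x|lebesgue_on G. norm (SUM i:UNIV. v x $ i * cnj (w x $ i)))"
  unfolding vprod_def by (rule integral_norm_bound)
 also have "... <= (LINT x|lebesgue_on G. norm (v x) * norm (w x))"
  using i L2_prod(1)[OF assms] norm_cip by (intro integral_mono) auto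
 also have "... <= L2_norm G v * L2_norm G w" by (rule L2_prod(2)[OF assms])
 finally show "norm (vprod G v w) <= L2_norm G v * L2_norm G w" .
qed

lemma sprod_integrable:
 assumes "L2_on G v" "L2_on G w"
 shows "integrable (lebesgue_on G) (%x. v x * cnj (w x))"
  and "norm (sprod G v w) <= L2_norm G v * L2_norm G w"
proof -
 have m: "(%x. v x * cnj (w x)) : borel_measurable (lebesgue_on G)" using assms by (intro borel_measurable_times
    measurable_compose[OF _ continuous_borel[OF linear_continuous_on[OF bounded_linear_cnj]]])
   (auto simp: L2_on_def)
 show i: "integrable (lebesgue_on G) (%x. v x * cnj (w x))"
  by (rule Bochner_Integration.integrable_bound[OF L2_prod(1)[OF assms] m]) (auto simp: norm_mult)
 have "norm (sprod G v w) <= (LINT x|lebesgue_on G. norm (v x * cnj (w x)))"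
  unfolding sprod_def by (rule integral_norm_bound)
 also have "... <= L2_norm G v * L2_norm G w" using L2_prod(2)[OF assms] by (simp add: norm_mult)
 finally show "norm (sprod G v w) <= L2_norm G v * L2_norm G w" .
qed

lemma vprod_add: "L2_on G v ==> L2_on G v' ==> L2_on G w ==>
  vprod G (%x. v x + v' x) w = vprod G v w + vprod G v' w"
 unfolding vprod_def vector_add_component ring_distribs sum.distrib
 by (rule Bochner_Integration.integral_add) (rule vprod_integrable; assumption)+

lemma vprod_diff: "L2_on G v ==> L2_on G v' ==> L2_on G w ==>
  vprod G (%x. v x - v' x) w = vprod G v w - vprod G v' w"
 unfolding vprod_def vector_minus_component left_diff_distrib sum_subtractf
 by (rule Bochner_Integration.integral_diff) (rule vprod_integrable; assumption)+

lemma vprod_cmult: "vprod G (%x. c *s v x) w = c * vprod G v w"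
 unfolding vprod_def vector_smult_component mult.assoc sum_distrib_left[symmetric] by simp

lemma vprod_cong_AE:
 assumes G: "G : sets lebesgue" and "L2_on G v" "L2_on G w" "L2_on G v'" "L2_on G w'"
  and "AE x in lebesgue. x : G --> v x = v' x" "AE x in lebesgue. x : G --> w x = w' x"
 shows "vprod G v w = vprod G v' w'"
 unfolding vprod_def
proof (rule integral_cong_AE)
 show "AE x in lebesgue_on G. (SUM i:UNIV. v x $ i * cnj (w x $ i)) = (SUM i:UNIV. v' x $ i * cnj (w' x $ i))"
  unfolding AE_lebesgue_on_iff[OF G] using assms(6,7) by eventually_elim auto
qed (use vprod_integrable(1) assms in auto)

lemma vprod_restrict:
 assumes "H <= G" "H : sets lebesgue" "G : sets lebesgue" "!!x. x ~: H ==> w x = 0"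
 shows "vprod G v w = vprod H v w"
proof -
 have "indicator G x *\<^sub>R (SUM i:UNIV. v x $ i * cnj (w x $ i)) = indicator H x *\<^sub>R (SUM i:UNIV. v x $ i * cnj (w x $ i))" for x
  using assms(1) assms(4)[of x] by (auto simp: indicator_def)
 then show ?thesis using assms(2,3) by (simp only: vprod_def LINT_lebesgue_on)
qed

lemma L2_norm_restrict:
 fixes w :: "point => 'b::euclidean_space"
 assumes "H <= G" "H : sets lebesgue" "G : sets lebesgue" "!!x. x ~: H ==> w x = 0"
 shows "L2_norm G w = L2_norm H w"
proof -
 have "indicator G x *\<^sub>R (norm (w x))\<^sup>2 = indicator H x *\<^sub>R (norm (w x))\<^sup>2" for x
  using assms(1) assms(4)[of x] by (auto simp: indicator_def)
 then show ?thesis using assms by (simp only: L2_norm_def LINT_lebesgue_on)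
qed

lemma partial_nth: "smooth w ==> partial i (%x. w x $ k) x = partial i w x $ k" for w :: cfield
 by (rule partial_linear[OF bounded_linear_vec_nth smooth_differentiable])

lemma smooth_nth: "smooth w ==> smooth (%x. w x $ k)" for w :: cfield
 by (rule smooth_linear[OF bounded_linear_vec_nth])

lemma smooth_vecI:
 fixes w :: cfield
 assumes "!!k. smooth (%x. w x $ k)"
 shows "smooth w"
proof -
 have "smooth (%x. SUM i:UNIV. axis i (w x $ i))" by (intro smooth_sum smooth_linear[OF bounded_linear_axis] assms)
 then show ?thesis by (simp add: vec_axis_sum[symmetric])
qed

lemma classical_curl_nth:
 "classical_curl w x $ 1 = partial 2 w x $ 3 - partial 3 w x $ 2"
 "classical_curl w x $ 2 = partial 3 w x $ 1 - partial 1 w x $ 3"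
 "classical_curl w x $ 3 = partial 1 w x $ 2 - partial 2 w x $ 1" by (simp_all add: classical_curl_def)

lemma smooth_classical_curl: "smooth w ==> smooth (classical_curl w)"
proof (rule smooth_vecI)
 fix k :: 3 assume w: "smooth w"
 have "k = 1 \<or> k = 2 \<or> k = 3" by (rule exhaust_3)
 then show "smooth (%x. classical_curl w x $ k)"
  by (elim disjE) (simp_all add: classical_curl_nth smooth_diff smooth_nth smooth_partial w)
qed

lemma smooth_classical_grad: "smooth phi ==> smooth (classical_grad phi)"
 by (rule smooth_vecI) (simp add: classical_grad_def smooth_partial)

lemma classical_curl_zero:
 assumes "closed K" "!!x. x ~: K ==> w x = 0" "x ~: K"
 shows "classical_curl w x = 0"
 using partial_zero_outside[OF assms] by (simp add: classical_curl_def vec_eq_iff forall_3)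

lemma classical_grad_zero:
 assumes "closed K" "!!x. x ~: K ==> phi x = 0" "x ~: K"
 shows "classical_grad phi x = 0"
 using partial_zero_outside[OF assms] by (simp add: classical_grad_def vec_eq_iff)

lemma norm_curl_bound: "norm (classical_curl w x) <= 2 * (SUM i:UNIV. norm (partial i w x))"
proof -
 have "norm (classical_curl w x) <= (SUM k:UNIV. norm (classical_curl w x $ k))"
  unfolding norm_vec_def by (rule L2_set_le_sum) simp
 also have "... = norm (classical_curl w x $ 1) + norm (classical_curl w x $ 2) + norm (classical_curl w x $ 3)"
  by (simp add: sum_3)
 also have "... <= (norm (partial 2 w x) + norm (partial 3 w x)) + (norm (partial 3 w x) + norm (partial 1 w x)) + (norm (partial 1 w x) + norm (partial 2 w x))"
  unfolding classical_curl_nth by (intro add_mono order_trans[OF norm_triangle_ineq4] norm_vec_nth)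
 finally show ?thesis by (simp add: sum_3)
qed

lemma norm_grad_bound: "norm (classical_grad phi x) <= (SUM i:UNIV. norm (partial i phi x))"
 unfolding norm_vec_def classical_grad_def by (simp add: L2_set_le_sum)

section \<open>Green's formula for curls and uniqueness of weak derivatives\<close>

lemma integral_by_parts_curl:
 fixes u phi :: cfield
 assumes u: "smooth u" and phi: "smooth phi" and K: "compact K" "!!x. x ~: K ==> u x = 0"
 shows "(LINT x|lborel. (SUM i:UNIV. classical_curl u x $ i * cnj (phi x $ i)))
   = (LINT x|lborel. (SUM i:UNIV. u x $ i * cnj (classical_curl phi x $ i)))"
proof -
 define psi where "psi k x = cnj (phi x $ k)" for k x
 have spsi: "smooth (psi k)" for k
  unfolding psi_def[abs_def] by (intro smooth_linear[OF bounded_linear_cnj] smooth_nth phi)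
 have dpsi: "partial i (psi k) x = cnj (partial i phi x $ k)" for i k x unfolding psi_def[abs_def]
  using partial_linear[OF bounded_linear_cnj smooth_differentiable[OF smooth_nth[OF phi, of k]], of i x]
  by (simp add: partial_nth[OF phi])
 have ibp: "(LINT x|lborel. u x $ j * cnj (partial i phi x $ k)) = - (LINT x|lborel. partial i u x $ j * cnj (phi x $ k))" for i j k
  using integral_by_parts[OF smooth_nth[OF u, of j] spsi[of k] K(1), of i] K(2)
  by (simp add: dpsi partial_nth[OF u]) (simp add: psi_def)
 have z: "partial i u x = 0" if "x ~: K" for i x
  using K that by (intro partial_zero_outside[of K]) (auto intro: compact_imp_closed)
 have i1: "integrable lborel (%x. u x $ j * cnj (partial i phi x $ k))" for i j k
  by (rule integrable_compact_support[OF _ K(1)])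
   (auto simp: K(2) intro!: smooth_continuous smooth_mult smooth_nth[OF u] smooth_linear[OF bounded_linear_cnj] smooth_nth smooth_partial phi)
 have i2: "integrable lborel (%x. partial i u x $ j * cnj (phi x $ k))" for i j k
  by (rule integrable_compact_support[OF _ K(1)])
   (auto simp: z intro!: smooth_continuous smooth_mult smooth_nth smooth_linear[OF bounded_linear_cnj] smooth_partial phi u)
 show ?thesis unfolding sum_3 classical_curl_nth complex_cnj_diff left_diff_distrib right_diff_distrib
  by (simp add: i1 i2 ibp)
qed

lemma LINT_lborel_of_support:
 fixes F :: "point => 'b::euclidean_space"
 assumes "G : sets lebesgue" "continuous_on UNIV F" "!!x. x ~: G ==> F x = 0"
 shows "(LINT x|lebesgue_on G. F x) = (LINT x|lborel. F x)"
proof -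
 have "indicator G x *\<^sub>R F x = F x" for x using assms(3)[of x] by (auto simp: indicator_def)
 then have "(LINT x|lebesgue_on G. F x) = (LINT x|lebesgue. F x)" using assms(1) by (simp add: LINT_lebesgue_on)
 also have "... = (LINT x|lborel. F x)" using continuous_borel[OF assms(2)] by (intro integral_completion) simp
 finally show ?thesis .
qed

lemma L2_test:
 fixes w :: "point => 'b::euclidean_space"
 shows "smooth w ==> bounded G ==> G : sets lebesgue ==> L2_on G w"
 by (intro L2_continuous smooth_continuous)

lemma test_curl_green:
 assumes w: "test_fun G w" and G: "G : sets lebesgue" and phi: "smooth phi"
 shows "vprod G (classical_curl w) phi = vprod G w (classical_curl phi)"
proof -
 obtain K where K: "smooth w" "compact K" "K <= interior G" "!!x. x ~: K ==> w x = 0" using test_funE[OF w] by blast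
 have KG: "K <= G" using K(3) interior_subset by blast
 have cz: "classical_curl w x = 0" if "x ~: K" for x
  using K that by (intro classical_curl_zero[of K]) (auto intro: compact_imp_closed)
 have zz: "classical_curl w x = 0" "w x = 0" if "x ~: G" for x using cz[of x] K(4)[of x] KG that by auto
 have c: "continuous_on UNIV (%x. SUM i:UNIV. v x $ i * cnj (v' x $ i))" if "smooth v" "smooth v'" for v v' :: cfield
  using that by (intro smooth_continuous smooth_sum smooth_mult smooth_nth smooth_linear[OF bounded_linear_cnj])
 have "vprod G (classical_curl w) phi = (LINT x|lborel. (SUM i:UNIV. classical_curl w x $ i * cnj (phi x $ i)))"
  unfolding vprod_def by (intro LINT_lborel_of_support[OF G c[OF smooth_classical_curl[OF K(1)] phi]]) (simp add: zz)
 also have "... = (LINT x|lborel. (SUM i:UNIV. w x $ i * cnj (classical_curl phi x $ i)))"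
  by (rule integral_by_parts_curl[OF K(1) phi K(2,4)])
 also have "... = vprod G w (classical_curl phi)" unfolding vprod_def
  by (intro LINT_lborel_of_support[OF G c[OF K(1) smooth_classical_curl[OF phi]], symmetric]) (simp add: zz)
 finally show ?thesis .
qed

lemma test_weak_curl:
 assumes "test_fun G w" "G : sets lebesgue" "bounded G"
 shows "has_weak_curl G w (classical_curl w)"
proof -
 have "smooth w" using assms(1) by (elim test_funE)
 then have "L2_on G (classical_curl w)" using assms by (intro L2_test smooth_classical_curl)
 moreover have "smooth phi" if "test_fun G phi" for phi :: cfield using that by (elim test_funE)
 ultimately show ?thesis unfolding has_weak_curl_def using test_curl_green[OF assms(1,2)] by blast
qed

lemma vprod_axis:
 assumes "!!x. w x = axis j (psi x)"
 shows "vprod G v w = sprod G (%x. v x $ j) psi"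
 unfolding vprod_def sprod_def assms
 by (intro Bochner_Integration.integral_cong refl) (simp add: axis_def if_distrib cong: if_cong)

lemma test_fun_axis:
 assumes "test_fun G psi" shows "test_fun G (%x. axis j (psi x) :: complex^3)"
proof -
 obtain K where K: "smooth psi" "compact K" "K <= interior G" "!!x. x ~: K ==> psi x = 0"
  using test_funE[OF assms] by blast
 show ?thesis
 proof (rule test_funI[OF _ K(2,3)])
  show "smooth (%x. axis j (psi x) :: complex^3)" by (rule smooth_linear[OF bounded_linear_axis K(1)])
  show "axis j (psi x) = (0 :: complex^3)" if "x ~: K" for x using K(4)[OF that] by (simp add: vec_eq_iff axis_def)
 qed
qed

lemma L2_nth: "L2_on G v ==> L2_on G (%x. v x $ j)" for v :: cfield
 by (rule L2_bounded_mult(1)[of G v _ 1]) (auto simp: L2_on_def norm_vec_nth intro: measurable_vec_nth)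

text \<open>A component is isolated by test fields with a single nonzero entry. Equality is obtained
  on the interior, where test functions live.\<close>

lemma weak_curl_unique:
 assumes c: "has_weak_curl G w c" "has_weak_curl G w c'" and G: "G : sets lebesgue" "bounded G"
 shows "AE x in lebesgue. x : interior G --> c x = c' x"
proof -
 have L: "L2_on G c" "L2_on G c'" using c by (auto simp: has_weak_curl_def)
 have "AE x in lebesgue. x : interior G --> c x $ j - c' x $ j = 0" for j
 proof (rule weak_zero[OF G(1)])
  show "integrable (lebesgue_on G) (%x. c x $ j - c' x $ j)" using L by (intro L2_integrable L2_diff L2_nth G)
  fix psi :: "point => complex" assume t: "test_fun G psi"
  let ?w = "%x. axis j (psi x) :: complex^3"
  have tw: "test_fun G ?w" by (rule test_fun_axis[OF t])
  have sw: "smooth ?w" using tw by (elim test_funE)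
  have "vprod G c ?w = vprod G c' ?w" using c tw by (simp add: has_weak_curl_def)
  then have "vprod G (%x. c x - c' x) ?w = 0" using vprod_diff[OF L L2_test[OF sw G(2,1)]] by simp
  then show "sprod G (%x. c x $ j - c' x $ j) psi = 0" using vprod_axis[of ?w j psi G "%x. c x - c' x"] by simp
 qed
 then have "AE x in lebesgue. ALL j:UNIV. x : interior G --> c x $ j - c' x $ j = 0" by (intro AE_finite_allI) auto
 then show ?thesis by eventually_elim (simp add: vec_eq_iff)
qed

lemma weak_div_unique:
 assumes d: "has_weak_div G w d" "has_weak_div G w d'" and G: "G : sets lebesgue" "bounded G"
 shows "AE x in lebesgue. x : interior G --> d x = d' x"
proof -
 have L: "L2_on G d" "L2_on G d'" using d by (auto simp: has_weak_div_def)
 have "AE x in lebesgue. x : interior G --> d x - d' x = 0"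
 proof (rule weak_zero[OF G(1)])
  show "integrable (lebesgue_on G) (%x. d x - d' x)" using L by (intro L2_integrable L2_diff G)
  fix psi :: "point => complex" assume t: "test_fun G psi"
  have s: "smooth psi" using t by (elim test_funE)
  have "sprod G d psi = sprod G d' psi" using d t by (simp add: has_weak_div_def)
  then show "sprod G (%x. d x - d' x) psi = 0"
   using sprod_integrable(1)[OF L(1) L2_test[OF s G(2,1)]] sprod_integrable(1)[OF L(2) L2_test[OF s G(2,1)]]
   by (simp add: sprod_def left_diff_distrib)
 qed
 then show ?thesis by eventually_elim simp
qed

lemma wcurl_weak: "has_weak_curl G w c ==> has_weak_curl G w (wcurl G w)"
 unfolding wcurl_def by (rule someI[of "has_weak_curl G w"])

lemma wdiv_weak: "has_weak_div G w d ==> has_weak_div G w (wdiv G w)"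
 unfolding wdiv_def by (rule someI[of "has_weak_div G w"])

lemma test_fun_mono: "test_fun H phi ==> interior H <= interior G ==> test_fun G phi"
 unfolding test_fun_def by (meson subset_trans)

text \<open>\<open>H\<close> may stick out of \<open>G\<close> along its boundary: the compact
  support of \<open>w\<close> lies in both.\<close>

lemma vprod_test_restrict:
 assumes w: "test_fun H w" and H: "H : sets lebesgue" "G : sets lebesgue" "interior H <= G"
 shows "vprod G v w = vprod H v w"
proof -
 obtain K where K0: "smooth w" "compact K" "K <= interior H" "!!x. x ~: K ==> w x = 0" using test_funE[OF w] by blast
 note K = K0(2-4)
 have KL: "K : sets lebesgue" using K(1) by (simp add: borel_compact)
 have "vprod G v w = vprod K v w" using K H KL by (intro vprod_restrict) auto
 also have "... = vprod H v w" using K H KL interior_subset[of H] by (intro vprod_restrict[symmetric]) auto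
 finally show ?thesis .
qed

lemma test_fun_curl: "test_fun G w ==> test_fun G (classical_curl w)"
proof -
 assume "test_fun G w"
 then obtain K where K: "smooth w" "compact K" "K <= interior G" "!!x. x ~: K ==> w x = 0" using test_funE by blast
 then show ?thesis
  by (intro test_funI[OF smooth_classical_curl[OF K(1)] K(2,3)] classical_curl_zero[of K]) (auto intro: compact_imp_closed)
qed

lemma test_fun_grad: "test_fun G phi ==> test_fun G (classical_grad phi)"
proof -
 assume "test_fun G phi"
 then obtain K where K: "smooth phi" "compact K" "K <= interior G" "!!x. x ~: K ==> phi x = 0"
  using test_funE by blast
 then show ?thesis
  by (intro test_funI[OF smooth_classical_grad[OF K(1)] K(2,3)] classical_grad_zero[of K]) (auto intro: compact_imp_closed)
qed

text \<open>Restriction to a patch; \<open>H\<close> may be closed and may touch the boundary of \<open>G\<close>.\<close>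

lemma weak_curl_restrict:
 assumes c: "has_weak_curl G w c" and cH: "L2_on H c"
  and H: "H : sets lebesgue" "G : sets lebesgue" "interior H <= interior G"
 shows "has_weak_curl H w c"
 unfolding has_weak_curl_def
proof (intro conjI cH allI impI)
 fix phi :: cfield assume t: "test_fun H phi"
 have HG: "interior H <= G" using H(3) interior_subset by blast
 have "vprod G c phi = vprod G w (classical_curl phi)"
  using c test_fun_mono[OF t H(3)] by (simp add: has_weak_curl_def)
 then show "vprod H c phi = vprod H w (classical_curl phi)"
  using vprod_test_restrict[OF t H(1,2) HG, of c] vprod_test_restrict[OF test_fun_curl[OF t] H(1,2) HG, of w] by simp
qed

section \<open>Functions with commuting second partial derivatives\<close>

text \<open>Symmetry of second derivatives is only needed for bumps times polynomials, hence carried as a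
 property instead of being proved in general.\<close>

definition symm :: "(point => 'b::real_normed_vector) => bool" where
 "symm phi \<longleftrightarrow> smooth phi & (ALL i j x. partial i (partial j phi) x = partial j (partial i phi) x)"

lemma symm_const: "symm (%_. c)"
proof -
 have "partial j (%_. c) = (%_. 0)" for j by auto
 then show ?thesis by (simp add: symm_def)
qed

lemma symm_linear: "bounded_linear h ==> symm h"
proof -
 assume h: "bounded_linear h"
 have "partial i h = (%_. h (axis i 1))" for i
  by (intro ext partial_eq) (rule bounded_linear_imp_has_derivative[OF h])
 then show ?thesis by (simp add: symm_def smooth_bounded_linear h)
qed

lemma symm_add: "symm f ==> symm g ==> symm (%x. f x + g x)"
proof -
 assume f: "symm f" and g: "symm g"
 then have s: "smooth f" "smooth g" by (auto simp: symm_def)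
 have "partial j (%x. f x + g x) = (%x. partial j f x + partial j g x)" for j using s by (intro ext partial_add)
 then show ?thesis using f g s by (simp add: symm_def smooth_add partial_add smooth_partial)
qed

lemma symm_scaleR:
 assumes f: "symm f" and g: "symm g" shows "symm (%x. f x *\<^sub>R g x)"
proof -
 have s: "smooth f" "smooth g" using f g by (auto simp: symm_def)
 have d: "partial j (%x. f x *\<^sub>R g x) = (%x. f x *\<^sub>R partial j g x + partial j f x *\<^sub>R g x)" for j
  using s by (intro ext partial_scaleR)
 have "partial i (partial j (%x. f x *\<^sub>R g x)) x = (f x *\<^sub>R partial i (partial j g) x + partial i f x *\<^sub>R partial j g x)
   + (partial j f x *\<^sub>R partial i g x + partial i (partial j f) x *\<^sub>R g x)" for i j x
  unfolding d using s by (simp add: partial_add smooth_scaleR smooth_partial partial_scaleR)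
 then show ?thesis using f g s by (simp add: symm_def smooth_scaleR algebra_simps)
qed

lemma symm_mult: "symm f ==> symm g ==> symm (%x. f x * g x :: real)" using symm_scaleR[of f g] by simp

lemma symm_pdeg: "pdeg d p ==> symm p"
 by (induction rule: pdeg.induct) (auto intro: symm_const symm_linear symm_add symm_mult)

lemma symm_pdegv:
 assumes "pdegv d p" shows "symm p"
proof -
 have "symm (%x. SUM b:B. (p x \<bullet> b) *\<^sub>R b)" if "B <= Basis" "finite B" for B using that(2,1)
 proof (induction B rule: finite_induct)
  case (insert b B)
  then have "symm (%x. (p x \<bullet> b) *\<^sub>R b)"
   using assms by (intro symm_scaleR symm_const symm_pdeg[of d]) (auto simp: pdegv_def)
  then show ?case using insert by (simp add: symm_add)
 qed (simp add: symm_const)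
 from this[of Basis] show ?thesis by (simp add: euclidean_representation)
qed

text \<open>Second derivatives of the bump are expressed through \<open>flat_exp\<close> and
  derivatives of its quadratic argument, in a formula whose symmetry reduces to that of the Hessian
  of the quadratic.\<close>

lemma symm_bump: "symm (bump m rho)"
proof -
 define s where "s x = 1 - (x - m) \<bullet> (x - m) / rho\<^sup>2" for x :: point
 have ss: "smooth s" unfolding s_def[abs_def] by (rule smooth_sq)
 have ds: "partial i s = (%x. - 2 * (x - m) $ i / rho\<^sup>2)" for i
 proof
  fix x
  have D: "(s has_derivative (%h. - (2 * ((x - m) \<bullet> h)) / rho\<^sup>2)) (at x)"
   unfolding s_def by (cases "rho = 0") (auto intro!: derivative_eq_intros simp: inner_commute field_simps)
  show "partial i s x = - 2 * (x - m) $ i / rho\<^sup>2" by (subst partial_eq[OF D]) (simp only: inner_axis, simp)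
 qed
 have sy: "partial i (partial j s) x = partial j (partial i s) x" for i j x
 proof -
  have D: "((%x::point. - 2 * (x - m) $ j / rho\<^sup>2) has_derivative (%h. - 2 * h $ j / rho\<^sup>2)) (at x)" for j
  proof -
   have "((%x::point. x $ j) has_derivative (%h. h $ j)) (at x)"
    by (rule bounded_linear_imp_has_derivative[OF bounded_linear_vec_nth])
   then have "((%x::point. c * (x $ j - m $ j)) has_derivative (%h. c * (h $ j))) (at x)" for c
    by (auto intro!: derivative_eq_intros)
   note this[of "- 2 / rho\<^sup>2"]
   moreover have "(%x::point. (- 2 / rho\<^sup>2) * (x $ j - m $ j)) = (%x. - 2 * (x - m) $ j / rho\<^sup>2)"
    "(%h::point. (- 2 / rho\<^sup>2) * (h $ j)) = (%h. - 2 * h $ j / rho\<^sup>2)"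
    by (simp_all only: times_divide_eq_left vector_minus_component)
   ultimately show ?thesis by (simp only:)
  qed
  show ?thesis unfolding ds partial_eq[OF D] by (simp add: axis_def)
 qed
 have f1: "(flat_exp n has_real_derivative (- real n * flat_exp (Suc n) t + flat_exp (Suc (Suc n)) t)) (at t)" for n t
  by (rule flat_exp_DERIV)
 have g1: "partial j (%x. flat_exp n (s x)) = (%x. (- real n * flat_exp (Suc n) (s x) + flat_exp (Suc (Suc n)) (s x)) * partial j s x)" for n j
  by (intro ext partial_comp f1 smooth_differentiable ss)
 have sf: "smooth (%x. flat_exp n (s x))" for n by (rule smooth_comp[OF _ ss]) (simp add: smooth1_def C1k_flat_exp)
 have b: "bump m rho = (%x. flat_exp 0 (s x))" by (simp add: bump_def[abs_def] s_def)
 have F: "partial i (partial j (bump m rho)) x = flat_exp 2 (s x) * partial i (partial j s) x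
   + (- 2 * flat_exp 3 (s x) + flat_exp 4 (s x)) * partial i s x * partial j s x" for i j x unfolding b g1[of _ 0]
  using partial_mult[OF sf[of 2] smooth_partial[OF ss, of j], of i x] g1[of i 2] by (simp add: eval_nat_numeral)
 have "partial i (partial j (bump m rho)) x = partial j (partial i (bump m rho)) x" for i j x
  unfolding F[of i j x] F[of j i x] sy[of i j x] by (simp only: mult_ac)
 then show ?thesis using smooth_bump unfolding symm_def by blast
qed

lemma curl_grad: "symm phi ==> classical_curl (classical_grad phi) x = 0"
proof -
 assume s: "symm phi"
 then have sg: "smooth (classical_grad phi)" by (simp add: symm_def smooth_classical_grad)
 have "partial i (classical_grad phi) x $ j = partial i (partial j phi) x" for i j
  using partial_nth[OF sg, of i j x] by (simp add: classical_grad_def)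
 moreover have "partial i (partial j phi) x = partial j (partial i phi) x" for i j using s by (auto simp: symm_def)
 note this[of 2 3] this[of 3 1] this[of 1 2]
 ultimately show ?thesis by (simp add: vec_eq_iff forall_3 classical_curl_nth)
qed

section \<open>The residual of the discrete state\<close>

text \<open>Closed elements and patches may leave the open domain in a null set, on which the data
  are arbitrary; completeness of Lebesgue measure extends measurability across it.\<close>

lemma L2_null_ext:
 fixes v :: "point => 'b::euclidean_space"
 assumes v: "L2_on H v" and H: "H <= G" "H : sets lebesgue" "G : sets lebesgue" "negligible (G - H)"
 shows "L2_on G v"
proof -
 have ae: "AE x in lebesgue. x ~: G - H" using H(4) by (intro AE_not_in) (simp add: negligible_iff_null_sets)
 have "(%x. if x : H then v x else 0) : borel_measurable lebesgue"
  using v borel_measurable_if_I[OF _ H(2)] by (auto simp: L2_on_def)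
 moreover have "AE x in lebesgue. (if x : H then v x else 0) = (if x : G then v x else 0)"
  using ae by eventually_elim (use H(1) in auto)
 ultimately have "(%x. if x : G then v x else 0) : borel_measurable lebesgue" by (rule borel_measurable_AE_eq)
 then have m: "v : borel_measurable (lebesgue_on G)" by (rule borel_measurable_if_D)
 have iH: "integrable lebesgue (%x. indicator H x *\<^sub>R (norm (v x))\<^sup>2)"
  using v H by (simp add: L2_on_def integrable_lebesgue_on_iff)
 have aeq: "AE x in lebesgue. indicator H x *\<^sub>R (norm (v x))\<^sup>2 = indicator G x *\<^sub>R (norm (v x))\<^sup>2"
  using ae by eventually_elim (use H(1) in \<open>auto simp: indicator_def\<close>)
 have "integrable lebesgue (%x. indicator G x *\<^sub>R (norm (v x))\<^sup>2)"
  by (rule integrable_cong_AE_imp[OF iH borel_measurable_AE_eq[OF borel_measurable_integrable[OF iH] aeq] aeq])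
 then show ?thesis using m H by (simp add: L2_on_def integrable_lebesgue_on_iff)
qed

lemma weak_curl_diff:
 assumes "has_weak_curl G v c" "has_weak_curl G v' c'" "L2_on G v" "L2_on G v'"
  and G: "G : sets lebesgue" "bounded G"
 shows "has_weak_curl G (%x. v x - v' x) (%x. c x - c' x)"
 unfolding has_weak_curl_def
proof (intro conjI allI impI)
 have L: "L2_on G c" "L2_on G c'" using assms by (auto simp: has_weak_curl_def)
 show "L2_on G (%x. c x - c' x)" using L by (rule L2_diff)
 fix phi :: cfield assume t: "test_fun G phi"
 then have s: "smooth phi" by (elim test_funE)
 note L2phi = L2_test[OF s G(2,1)] L2_test[OF smooth_classical_curl[OF s] G(2,1)]
 show "vprod G (%x. c x - c' x) phi = vprod G (%x. v x - v' x) (classical_curl phi)"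
  using vprod_diff[OF L L2phi(1)] vprod_diff[OF assms(3,4) L2phi(2)] assms(1,2) t by (simp add: has_weak_curl_def)
qed

text \<open>Suppose \<open>x\<close> is interior to the closure but not in \<open>Om\<close>. A
  small move from \<open>x\<close> in the graph direction leads strictly above the graph, where a
  whole neighbourhood misses \<open>Om\<close>, although the point reached is still in the
  closure.\<close>

lemma lipschitz_interior_closure:
 assumes Om: "open Om" and lip: "lipschitz_boundary Om"
 shows "interior (closure Om) = Om"
proof
 show "Om <= interior (closure Om)" using Om closure_subset by (rule interior_maximal[rotated])
 show "interior (closure Om) <= Om"
 proof
  fix x assume x: "x : interior (closure Om)"
  show "x : Om"
  proof (rule ccontr)
   assume xn: "x ~: Om"
   then have "x : frontier Om" using x Om interior_subset by (auto simp: frontier_def interior_open)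
   then obtain e r L and \<gamma> :: "point => real" where g: "norm e = 1" "r > 0" "L-lipschitz_on UNIV \<gamma>"
    "ALL y:ball x r. y : Om \<longleftrightarrow> y \<bullet> e < \<gamma> (y - (y \<bullet> e) *\<^sub>R e)"
    using lip unfolding lipschitz_boundary_def by blast
   obtain \<eta> where \<eta>: "\<eta> > 0" "ball x \<eta> <= closure Om" using x by (meson mem_interior)
   define s where "s = min \<eta> r / 2"
   have s: "s > 0" "s < \<eta>" "s < r" using \<eta> g(2) by (auto simp: s_def min_def)
   define y where "y = x + s *\<^sub>R e"
   have yb: "y : ball x \<eta>" "y : ball x r" using s g(1) by (auto simp: y_def dist_norm)
   have ee: "e \<bullet> e = 1" using g(1) by (simp add: dot_square_norm)
   have yp: "y - (y \<bullet> e) *\<^sub>R e = x - (x \<bullet> e) *\<^sub>R e" "y \<bullet> e = x \<bullet> e + s"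
    by (simp_all add: y_def inner_add_left ee algebra_simps)
   have "\<not> x \<bullet> e < \<gamma> (x - (x \<bullet> e) *\<^sub>R e)" using g(2,4) xn by (metis centre_in_ball)
   then have yW: "\<gamma> (y - (y \<bullet> e) *\<^sub>R e) < y \<bullet> e" using s(1) yp by simp
   have "continuous_on UNIV \<gamma>" using g(3) by (rule lipschitz_on_continuous_on)
   then have "continuous_on UNIV (%y. \<gamma> (y - (y \<bullet> e) *\<^sub>R e))"
    by (rule continuous_on_compose2) (auto intro!: continuous_intros)
   then have "open {y. \<gamma> (y - (y \<bullet> e) *\<^sub>R e) < y \<bullet> e}"
    by (intro open_Collect_less continuous_intros)
   then have oW: "open ({y. \<gamma> (y - (y \<bullet> e) *\<^sub>R e) < y \<bullet> e} Int ball x r)" by (rule open_Int) simp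
   have "({y. \<gamma> (y - (y \<bullet> e) *\<^sub>R e) < y \<bullet> e} Int ball x r) Int Om = {}"
    using g(4) by force
   then have "({y. \<gamma> (y - (y \<bullet> e) *\<^sub>R e) < y \<bullet> e} Int ball x r) Int closure Om = {}"
    using oW by (simp add: open_Int_closure_eq_empty)
   moreover have "y : {y. \<gamma> (y - (y \<bullet> e) *\<^sub>R e) < y \<bullet> e} Int ball x r" using yW yb by simp
   moreover have "y : closure Om" using yb(1) \<eta>(2) by (rule subsetD[rotated])
   ultimately show False by blast
  qed
 qed
qed

lemma norm_sq_cip: "(SUM i:UNIV. v $ i * cnj (v $ i)) = complex_of_real ((norm v)\<^sup>2)" for v :: "complex^3"
proof -
 have "(norm v)\<^sup>2 = (SUM i:UNIV. (norm (v $ i))\<^sup>2)" by (simp add: norm_vec_def L2_set_def sum_nonneg)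
 then show ?thesis by (simp only: of_real_sum complex_norm_square)
qed

section \<open>Uniform bounds for coefficients, states and residuals\<close>

locale problem =
 fixes Om :: "point set" and P :: "'l::finite => point set"
  and \<omega> \<mu>0 \<epsilon>lo \<epsilon>up \<sigma>lo \<sigma>up :: real and \<mu> \<epsilon> \<sigma> :: "point => real" and f :: cfield
  and a b :: "real^'l"
 assumes Om: "open Om" "bounded Om" "lipschitz_boundary Om"
  and part: "is_partition Om P"
  and omega: "\<omega> > 0"
  and mu: "Linf_on Om \<mu>" "\<mu>0 > 0" "AE x in lebesgue_on Om. \<mu>0 <= \<mu> x"
  and eps: "Linf_on Om \<epsilon>" "0 < \<epsilon>lo" "AE x in lebesgue_on Om. \<epsilon>lo <= \<epsilon> x & \<epsilon> x <= \<epsilon>up"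
  and sigma: "Linf_on Om \<sigma>" "0 < \<sigma>lo" "AE x in lebesgue_on Om. \<sigma>lo <= \<sigma> x & \<sigma> x <= \<sigma>up"
  and fL2: "L2_on Om f"
  and ab: "!!k. 0 < a $ k" "!!k. a $ k < b $ k"
begin

definition es :: "point => complex" where "es = eps_sig \<omega> \<epsilon> \<sigma>"
definition E0 :: real where "E0 = \<bar>\<epsilon>up\<bar> + \<bar>\<sigma>up\<bar> / \<omega>"

lemma OmL: "Om : sets lebesgue" using Om(1) by (simp add: borel_open)

lemma AE_Om: "(AE x in lebesgue_on Om. Q x) \<longleftrightarrow> (AE x in lebesgue. x : Om --> Q x)"
 by (rule AE_lebesgue_on_iff[OF OmL])

lemma AE_P: "AE x in lebesgue. x : Om --> (EX k. x : P k)"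
proof -
 have "AE x in lebesgue. x ~: Om - (\<Union>k. P k)"
  using part by (intro AE_not_in) (simp add: is_partition_def negligible_iff_null_sets)
 then show ?thesis by eventually_elim auto
qed

lemma ctrl_P: "x : P k ==> ctrl_coeff P g u x = complex_of_real (u $ k) * g x"
proof -
 assume x: "x : P k"
 have "x ~: P j" if "j ~= k" for j using part x that unfolding is_partition_def by blast
 then have "ctrl_coeff P g u x = (SUM j:UNIV. if j = k then complex_of_real (u $ k) * g x else 0)"
  unfolding ctrl_coeff_def using x by (intro sum.cong) auto
 then show ?thesis by simp
qed

lemma ctrl_diff: "ctrl_coeff P g u x - ctrl_coeff P g u' x = ctrl_coeff P g (u - u') x"
 unfolding ctrl_coeff_def sum_subtractf[symmetric] by (intro sum.cong) (auto simp: left_diff_distrib)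

lemma E0_nonneg: "0 <= E0" using omega by (simp add: E0_def)

lemma es_bound: "AE x in lebesgue. x : Om --> norm (es x) <= E0" using eps(3) sigma(3) unfolding AE_Om
proof eventually_elim
 case (elim x)
 show ?case
 proof
  assume "x : Om"
  with elim have b: "\<epsilon>lo <= \<epsilon> x" "\<epsilon> x <= \<epsilon>up" "\<sigma>lo <= \<sigma> x" "\<sigma> x <= \<sigma>up" by auto
  have "norm (es x) <= \<bar>\<epsilon> x\<bar> + \<bar>\<sigma> x\<bar> / \<omega>"
   unfolding es_def eps_sig_def using omega
   by (intro order_trans[OF norm_triangle_ineq]) (simp add: norm_mult norm_inverse divide_inverse)
  also have "... <= E0" unfolding E0_def using b eps(2) sigma(2) omega by (intro add_mono divide_right_mono) auto
  finally show "norm (es x) <= E0" .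
 qed
qed

lemma ctrl_bound: "AE x in lebesgue. x : Om --> (ALL u. norm (ctrl_coeff P es u x) <= E0 * norm u)"
 using es_bound AE_P
proof eventually_elim
 case (elim x)
 show ?case
 proof (intro impI allI)
  fix u assume "x : Om"
  then obtain k where k: "x : P k" using elim by auto
  have "norm (ctrl_coeff P es u x) = \<bar>u $ k\<bar> * norm (es x)" by (simp add: ctrl_P[OF k] norm_mult)
  also have "... <= norm u * E0" using elim \<open>x : Om\<close> component_le_norm_cart[of u k]
   by (intro mult_mono) auto
  finally show "norm (ctrl_coeff P es u x) <= E0 * norm u" by (simp add: mult.commute)
 qed
qed

lemma es_measurable: "es : borel_measurable (lebesgue_on Om)"
proof -
 have "\<epsilon> : borel_measurable (lebesgue_on Om)" "\<sigma> : borel_measurable (lebesgue_on Om)"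
  using eps(1) sigma(1) by (auto simp: Linf_on_def)
 then show ?thesis unfolding es_def eps_sig_def by measurable
qed

lemma ctrl_measurable: "ctrl_coeff P es u : borel_measurable (lebesgue_on Om)"
proof -
 have oP: "P k : sets borel" for k using part by (auto simp: is_partition_def)
 have "{x : space (lebesgue_on Om). x : P k} : sets (lebesgue_on Om)" for k
 proof -
  have "{x : space (lebesgue_on Om). x : P k} = P k Int Om" by auto
  moreover have "P k : sets lebesgue" using oP[of k] by simp
  ultimately show ?thesis using OmL by (auto simp: sets_restrict_space)
 qed
 then show ?thesis unfolding ctrl_coeff_def[abs_def] using es_measurable
  by (intro borel_measurable_sum measurable_If borel_measurable_times) auto
qed

lemma smult_measurable:
 fixes c :: "point => complex" and v :: cfield
 assumes "c : borel_measurable (lebesgue_on G)" "v : borel_measurable (lebesgue_on G)"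
 shows "(%x. c x *s v x) : borel_measurable (lebesgue_on G)"
 using assms by (intro measurable_vecI) (simp only: vector_smult_component, intro borel_measurable_times measurable_vec_nth)

lemma ctrl_L2:
 fixes v :: cfield
 assumes v: "L2_on H v" and H: "H <= Om" "H : sets lebesgue"
 shows "L2_on H (%x. ctrl_coeff P es u x *s v x)"
  and "L2_norm H (%x. ctrl_coeff P es u x *s v x) <= (E0 * norm u) * L2_norm H v"
proof -
 have m: "(%x. ctrl_coeff P es u x *s v x) : borel_measurable (lebesgue_on H)"
  using v by (intro smult_measurable lebesgue_on_measurable_subset[OF ctrl_measurable H(1)]) (simp add: L2_on_def)
 have ae: "AE x in lebesgue_on H. norm (ctrl_coeff P es u x *s v x) <= (E0 * norm u) * norm (v x)"
  unfolding AE_lebesgue_on_iff[OF H(2)] using ctrl_bound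
  by eventually_elim (use H(1) in \<open>auto simp: norm_smult_vec intro!: mult_right_mono\<close>)
 have c: "0 <= E0 * norm u" using E0_nonneg by simp
 show "L2_on H (%x. ctrl_coeff P es u x *s v x)"
  "L2_norm H (%x. ctrl_coeff P es u x *s v x) <= (E0 * norm u) * L2_norm H v" by (rule L2_bounded_mult[OF v m ae c])+
qed

lemma mu_inv: "AE x in lebesgue. x : Om --> \<bar>inverse (\<mu> x)\<bar> <= 1 / \<mu>0" using mu(3) unfolding AE_Om
 by eventually_elim (use mu(2) in \<open>auto simp: divide_inverse intro!: le_imp_inverse_le\<close>)

lemma mu_L2:
 fixes v :: cfield
 assumes v: "L2_on H v" and H: "H <= Om" "H : sets lebesgue"
 shows "L2_on H (%x. inverse (\<mu> x) *\<^sub>R v x)"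
  and "L2_norm H (%x. inverse (\<mu> x) *\<^sub>R v x) <= (1 / \<mu>0) * L2_norm H v"
proof -
 have "\<mu> : borel_measurable (lebesgue_on H)"
  using mu(1) by (intro lebesgue_on_measurable_subset[OF _ H(1)]) (simp add: Linf_on_def)
 then have m: "(%x. inverse (\<mu> x) *\<^sub>R v x) : borel_measurable (lebesgue_on H)"
  using v by (intro borel_measurable_scaleR borel_measurable_inverse) (auto simp: L2_on_def)
 have ae: "AE x in lebesgue_on H. norm (inverse (\<mu> x) *\<^sub>R v x) <= (1 / \<mu>0) * norm (v x)"
  unfolding AE_lebesgue_on_iff[OF H(2)] using mu_inv
  by eventually_elim (use H(1) in \<open>auto intro!: mult_right_mono simp: divide_inverse\<close>)
 have c: "0 <= 1 / \<mu>0" using mu(2) by simp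
 show "L2_on H (%x. inverse (\<mu> x) *\<^sub>R v x)"
  "L2_norm H (%x. inverse (\<mu> x) *\<^sub>R v x) <= (1 / \<mu>0) * L2_norm H v"
  by (rule L2_bounded_mult[OF v m ae c])+
qed

lemma H0curl_facts:
 assumes "H0curl Om y"
 shows "L2_on Om y" "has_weak_curl Om y (wcurl Om y)" "L2_on Om (wcurl Om y)"
 using assms wcurl_weak by (auto simp: H0curl_def Hcurl_def has_weak_curl_def)

lemma test_H0curl:
 assumes t: "test_fun Om w"
 shows "H0curl Om w" "AE x in lebesgue. x : Om --> wcurl Om w x = classical_curl w x"
proof -
 have s: "smooth w" using t by (elim test_funE)
 have wc: "has_weak_curl Om w (classical_curl w)" by (rule test_weak_curl[OF t OmL Om(2)])
 note wc' = wcurl_weak[OF wc]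
 show ae: "AE x in lebesgue. x : Om --> wcurl Om w x = classical_curl w x"
  using weak_curl_unique[OF wc' wc OmL Om(2)] Om(1) by (simp add: interior_open)
 have "vprod Om (wcurl Om w) phi - vprod Om w (classical_curl phi) = 0" if "smooth phi" for phi
 proof -
  have "vprod Om (wcurl Om w) phi = vprod Om (classical_curl w) phi"
   using ae wc wc' L2_test[OF that Om(2) OmL] by (intro vprod_cong_AE[OF OmL]) (auto simp: has_weak_curl_def)
  then show ?thesis using test_curl_green[OF t OmL that] by simp
 qed
 then show "H0curl Om w" using wc L2_test[OF s Om(2) OmL] by (auto simp: H0curl_def Hcurl_def)
qed

definition a0 :: real where "a0 = Min (range (%k. a $ k))"
definition B0 :: real where "B0 = L2_norm Om f / (\<omega> * a0 * \<sigma>lo)"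
definition B1 :: real where "B1 = (SUM k:UNIV. \<bar>b $ k\<bar>)"

lemma a0: "0 < a0" "a0 <= a $ k" unfolding a0_def using ab(1) by auto

lemma admissible_norm: "u : admissible a b ==> norm u <= B1"
proof -
 assume u: "u : admissible a b"
 have "norm u <= (SUM k:UNIV. \<bar>u $ k\<bar>)" by (rule norm_le_l1_cart)
 also have "... <= B1"
 proof -
  have "0 <= u $ k & u $ k <= b $ k" for k
   using u ab(1)[of k] unfolding admissible_def by (auto intro: order_trans[OF less_imp_le])
  then have "\<bar>u $ k\<bar> <= \<bar>b $ k\<bar>" for k by (metis abs_of_nonneg order_trans)
  then show ?thesis unfolding B1_def by (intro sum_mono) auto
 qed
 finally show ?thesis .
qed

text \<open>Test with the state itself. The curl term is real, so the imaginary part leaves the zero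
  order term, whose coefficient has imaginary part at least a0 \<sigma>lo / \<omega>; multiplied by
  \<omega>^2 this gives the denominator of \<open>B0\<close>.\<close>

lemma state_bound:
 assumes u: "u : admissible a b" and y: "is_state Om P \<omega> \<mu> es f u y"
 shows "L2_norm Om y <= B0"
proof -
 have H: "H0curl Om y" and st: "state_form Om P \<omega> \<mu> es u y y = vprod Om f y"
  using y by (auto simp: is_state_def)
 note Hy = H0curl_facts[OF H]
 define I2 where "I2 = vprod Om (%x. ctrl_coeff P es u x *s y x) y"
 have Im1: "Im (vprod Om (%x. inverse (\<mu> x) *\<^sub>R wcurl Om y x) (wcurl Om y)) = 0"
 proof -
  have e: "(SUM i:UNIV. (inverse (\<mu> x) *\<^sub>R wcurl Om y x) $ i * cnj (wcurl Om y x $ i))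
    = complex_of_real (inverse (\<mu> x) * (norm (wcurl Om y x))\<^sup>2)" for x
  proof -
   have "(SUM i:UNIV. (inverse (\<mu> x) *\<^sub>R wcurl Om y x) $ i * cnj (wcurl Om y x $ i))
    = inverse (\<mu> x) *\<^sub>R (SUM i:UNIV. wcurl Om y x $ i * cnj (wcurl Om y x $ i))"
    by (simp only: vector_scaleR_component scaleR_sum_right mult_scaleR_left)
   then show ?thesis by (simp only: norm_sq_cip scaleR_conv_of_real of_real_mult)
  qed
  show ?thesis unfolding vprod_def e by (simp only: integral_complex_of_real Im_complex_of_real)
 qed
 have e2: "(SUM i:UNIV. (ctrl_coeff P es u x *s y x) $ i * cnj (y x $ i)) = ctrl_coeff P es u x * complex_of_real ((norm (y x))\<^sup>2)" for x
  by (simp only: vector_smult_component mult.assoc sum_distrib_left[symmetric] norm_sq_cip)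
 have i2: "integrable (lebesgue_on Om) (%x. ctrl_coeff P es u x * complex_of_real ((norm (y x))\<^sup>2))"
  using vprod_integrable(1)[OF ctrl_L2(1)[OF Hy(1) order_refl OmL, of u] Hy(1)] unfolding e2 .
 have "Im I2 = (LINT x|lebesgue_on Om. Im (ctrl_coeff P es u x * complex_of_real ((norm (y x))\<^sup>2)))"
  unfolding I2_def vprod_def e2 using i2 by (rule integral_Im[symmetric])
 also have "... \<ge> (LINT x|lebesgue_on Om. (a0 * \<sigma>lo / \<omega>) * (norm (y x))\<^sup>2)"
 proof (rule integral_mono_AE)
  show "integrable (lebesgue_on Om) (%x. (a0 * \<sigma>lo / \<omega>) * (norm (y x))\<^sup>2)"
   using Hy(1) by (simp add: L2_on_def)
  show "integrable (lebesgue_on Om) (%x. Im (ctrl_coeff P es u x * complex_of_real ((norm (y x))\<^sup>2)))"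
   using i2 by (rule integrable_Im)
  show "AE x in lebesgue_on Om. (a0 * \<sigma>lo / \<omega>) * (norm (y x))\<^sup>2 <= Im (ctrl_coeff P es u x * complex_of_real ((norm (y x))\<^sup>2))"
   unfolding AE_Om using AE_P sigma(3)[unfolded AE_Om]
  proof eventually_elim
   case (elim x)
   show ?case
   proof
    assume x: "x : Om"
    then obtain k where k: "x : P k" using elim by auto
    have "a0 * \<sigma>lo <= u $ k * \<sigma> x" using elim x u a0 sigma(2) order_trans[OF a0(2)[of k], of "u $ k"]
     by (intro mult_mono) (auto simp: admissible_def)
    then have "a0 * \<sigma>lo / \<omega> <= u $ k * \<sigma> x / \<omega>" using omega by (intro divide_right_mono) auto
    then have "(a0 * \<sigma>lo / \<omega>) * (norm (y x))\<^sup>2 <= (u $ k * \<sigma> x / \<omega>) * (norm (y x))\<^sup>2"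
     by (rule mult_right_mono) simp
    moreover have "Im (ctrl_coeff P es u x) = u $ k * \<sigma> x / \<omega>"
     by (simp add: ctrl_P[OF k] es_def eps_sig_def of_real_inverse[symmetric] divide_inverse del: of_real_inverse)
    ultimately show "(a0 * \<sigma>lo / \<omega>) * (norm (y x))\<^sup>2 <= Im (ctrl_coeff P es u x * complex_of_real ((norm (y x))\<^sup>2))"
     by simp
   qed
  qed
 qed
 also have "(LINT x|lebesgue_on Om. (a0 * \<sigma>lo / \<omega>) * (norm (y x))\<^sup>2) = (a0 * \<sigma>lo / \<omega>) * (L2_norm Om y)\<^sup>2"
  by (simp add: L2_norm_sq)
 finally have low: "(a0 * \<sigma>lo / \<omega>) * (L2_norm Om y)\<^sup>2 <= Im I2" .
 have "vprod Om f y = vprod Om (%x. inverse (\<mu> x) *\<^sub>R wcurl Om y x) (wcurl Om y) - complex_of_real (\<omega>\<^sup>2) * I2"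
  using st by (simp add: state_form_def I2_def)
 then have "Im (vprod Om f y) = - (\<omega>\<^sup>2 * Im I2)"
  using Im1 by (simp only: minus_complex.simps Im_complex_of_real times_complex.simps Re_complex_of_real)
 then have "\<omega>\<^sup>2 * Im I2 <= norm (vprod Om f y)" using abs_Im_le_cmod[of "vprod Om f y"] by linarith
 also have "... <= L2_norm Om f * L2_norm Om y" by (rule vprod_integrable(2)[OF fL2 Hy(1)])
 finally have "\<omega>\<^sup>2 * Im I2 <= L2_norm Om f * L2_norm Om y" .
 moreover have "\<omega>\<^sup>2 * ((a0 * \<sigma>lo / \<omega>) * (L2_norm Om y)\<^sup>2) <= \<omega>\<^sup>2 * Im I2" using low by (rule mult_left_mono) simp
 moreover have "\<omega>\<^sup>2 * ((a0 * \<sigma>lo / \<omega>) * (L2_norm Om y)\<^sup>2) = (\<omega> * a0 * \<sigma>lo) * (L2_norm Om y)\<^sup>2"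
  using omega by (simp add: power2_eq_square)
 ultimately have fin: "(\<omega> * a0 * \<sigma>lo) * L2_norm Om y * L2_norm Om y <= L2_norm Om f * L2_norm Om y"
  by (simp add: power2_eq_square mult.assoc)
 have c: "\<omega> * a0 * \<sigma>lo > 0" using omega a0 sigma(2) by simp
 show ?thesis
 proof (cases "L2_norm Om y = 0")
  case False
  then have "L2_norm Om y > 0" using L2_norm_nonneg[of Om y] by simp
  then have "(\<omega> * a0 * \<sigma>lo) * L2_norm Om y <= L2_norm Om f" using fin by simp
  then show ?thesis unfolding B0_def using c by (simp add: pos_le_divide_eq mult.commute)
 qed (use c L2_norm_nonneg[of Om f] in \<open>simp add: B0_def\<close>)
qed

text \<open>The first summand belongs to the zero order terms: \<open>E0\<close> bounds the
  coefficient, \<open>B0\<close> the exact state and \<open>B1\<close> the controls. The second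
  bounds the weight of the curl error.\<close>

definition C1 :: real where "C1 = \<omega>\<^sup>2 * E0 * (\<bar>B0\<bar> + B1) + 1 / \<mu>0"

lemma C1_pos: "C1 > 0" unfolding C1_def B1_def using E0_nonneg mu(2)
 by (intro add_nonneg_pos mult_nonneg_nonneg) (auto intro: sum_nonneg add_nonneg_nonneg)

text \<open>With \<open>zf\<close>, the two fields from which the indicators are formed: the
  argument of the divergence in the first one, and the argument of the curl in the second.\<close>

definition qf :: "real^'l => cfield => cfield" where
 "qf uh yh = (%x. f x + (complex_of_real (\<omega>\<^sup>2) * ctrl_coeff P es uh x) *s yh x)"

definition zf :: "cfield => cfield" where
 "zf yh = (%x. inverse (\<mu> x) *\<^sub>R wcurl Om yh x)"

text \<open>Subtracting the exact equation leaves the weighted curl error against curl w and the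
  difference of the zero order terms against \<open>w\<close>. For a gradient the first part drops
  out, so the bound contains a single norm; this is the scaling that the divergence indicator
  requires. Test fields vanish outside \<open>N\<close>, which makes the error local.\<close>

lemma residual:
 assumes u: "us : admissible a b" "uh : admissible a b"
  and ys: "is_state Om P \<omega> \<mu> es f us ys" and yh: "H0curl Om yh"
  and N: "compact N" "interior N <= Om" "negligible (N - interior N)"
 defines "e \<equiv> norm (us - uh) + Hcurl_norm N (%x. ys x - yh x)"
 shows "!!w. test_fun Om w ==> (!!x. x ~: N ==> w x = 0) ==>
   norm (vprod Om (qf uh yh) w - vprod Om (zf yh) (classical_curl w))
    <= C1 * e * (L2_norm Om w + L2_norm Om (classical_curl w))"
  and "!!phi. test_fun Om phi ==> symm phi ==> (!!x. x ~: N ==> phi x = 0) ==>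
   norm (vprod Om (qf uh yh) (classical_grad phi)) <= C1 * e * L2_norm Om (classical_grad phi)"
  and "L2_on Om (qf uh yh)" "L2_on Om (zf yh)"
proof -
 have Hs: "H0curl Om ys" using ys by (simp add: is_state_def)
 note Ys = H0curl_facts[OF Hs] and Yh = H0curl_facts[OF yh]
 have NL: "N : sets lebesgue" "bounded N" using N(1) by (auto simp: borel_compact compact_imp_bounded)
 \<comment> \<open>The equation lives on \<open>Om\<close>, the error norm on the closed set
   \<open>N\<close> with its own weak curl. The two curls are identified on the intersection, which
   exhausts \<open>N\<close> up to a null set.\<close>
 define N' where "N' = N Int Om"
 have N'L: "N' : sets lebesgue" "N' <= Om" "N' <= N" using NL OmL by (auto simp: N'_def)
 have nN': "negligible (N - N')" by (rule negligible_subset[OF N(3)]) (use N(2) in \<open>auto simp: N'_def\<close>)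
 define d where "d x = ys x - yh x" for x
 define c where "c x = wcurl Om ys x - wcurl Om yh x" for x
 have L2N: "L2_on N v" if "L2_on Om v" for v :: cfield
  using L2_null_ext[OF L2_subset(1)[OF that N'L(2,1) OmL] N'L(3,1) NL(1) nN'] .
 have dN: "L2_on N d" unfolding d_def by (intro L2_diff L2N Ys Yh)
 have iN: "interior N <= interior Om" using N(2) Om(1) by (simp add: interior_open)
 have wc: "has_weak_curl N d c" unfolding d_def c_def
  by (intro weak_curl_diff weak_curl_restrict[OF Ys(2)] weak_curl_restrict[OF Yh(2)] L2N Ys Yh NL OmL iN)
 note wc' = wcurl_weak[OF wc]
 have "AE x in lebesgue. x : interior N --> wcurl N d x = c x" by (rule weak_curl_unique[OF wc' wc NL])
 moreover have "AE x in lebesgue. x ~: N - interior N"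
  using N(3) by (intro AE_not_in) (simp add: negligible_iff_null_sets)
 ultimately have ae: "AE x in lebesgue. x : N' --> wcurl N d x = c x" by eventually_elim (auto simp: N'_def)
 have wL: "L2_on N (wcurl N d)" using wc' by (simp add: has_weak_curl_def)
 have cN': "L2_norm N' c <= L2_norm N (wcurl N d)"
  using L2_cong_AE(2)[OF N'L(1) L2_subset(1)[OF wL N'L(3,1) NL(1)] ae] L2_subset(2)[OF wL N'L(3,1) NL(1)] by simp
 have Hn: "L2_norm N d <= Hcurl_norm N d" "L2_norm N (wcurl N d) <= Hcurl_norm N d"
  unfolding Hcurl_norm_def by (auto intro!: real_le_rsqrt)
 have dN': "L2_norm N' d <= L2_norm N d" by (rule L2_subset(2)[OF dN N'L(3,1) NL(1)])
 have ee: "e = norm (us - uh) + Hcurl_norm N d" unfolding e_def d_def by simp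
 have Hn0: "0 <= Hcurl_norm N d" by (simp add: Hcurl_norm_def)
 define mc where "mc x = inverse (\<mu> x) *\<^sub>R c x" for x
 define E where "E x = ctrl_coeff P es us x *s ys x - ctrl_coeff P es uh x *s yh x" for x
 have cOm: "L2_on Om c" unfolding c_def by (intro L2_diff Ys Yh)
 have EOm: "L2_on Om E" unfolding E_def by (intro L2_diff ctrl_L2 Ys Yh order_refl OmL)
 have mcOm: "L2_on Om mc" unfolding mc_def by (intro mu_L2 cOm order_refl OmL)
 have "L2_norm N' mc <= (1 / \<mu>0) * L2_norm N' c"
  unfolding mc_def by (intro mu_L2(2) L2_subset(1)[OF cOm N'L(2,1) OmL] N'L)
 also have "... <= (1 / \<mu>0) * e" using cN' Hn ee mu(2) by (intro mult_left_mono) (auto intro: add_increasing)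
 finally have mcb: "L2_norm N' mc <= (1 / \<mu>0) * e" .
 have de: "L2_norm N' d <= e" using dN' Hn(1) ee norm_ge_zero[of "us - uh"] by linarith
 have Eb: "L2_norm N' E <= E0 * (\<bar>B0\<bar> + B1) * e"
 proof -
  \<comment> \<open>The control error is paired with the exact state, which \<open>B0\<close> bounds
    uniformly; the state error keeps the discrete control, bounded by admissibility.\<close>
  have "E = (%x. ctrl_coeff P es (us - uh) x *s ys x + ctrl_coeff P es uh x *s d x)"
   by (auto simp: fun_eq_iff E_def d_def ctrl_diff[symmetric] vec_eq_iff algebra_simps)
  moreover have ysN': "L2_on N' ys" by (rule L2_subset(1)[OF Ys(1) N'L(2,1) OmL])
  moreover have dN'L: "L2_on N' d" by (rule L2_subset(1)[OF dN N'L(3,1) NL(1)])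
  ultimately have "L2_norm N' E <= L2_norm N' (%x. ctrl_coeff P es (us - uh) x *s ys x) + L2_norm N' (%x. ctrl_coeff P es uh x *s d x)"
   using L2_add(2)[OF ctrl_L2(1)[OF ysN' N'L(2,1), of "us - uh"] ctrl_L2(1)[OF dN'L N'L(2,1), of uh]] by simp
  also have "... <= E0 * norm (us - uh) * L2_norm N' ys + E0 * norm uh * L2_norm N' d"
   by (intro add_mono ctrl_L2 ysN' dN'L N'L)
  also have "... <= E0 * e * \<bar>B0\<bar> + E0 * B1 * e"
  proof (intro add_mono mult_mono)
   have "L2_norm N' ys <= L2_norm Om ys" by (rule L2_subset(2)[OF Ys(1) N'L(2,1) OmL])
   also have "... <= \<bar>B0\<bar>" using state_bound[OF u(1) ys] by simp
   finally show "L2_norm N' ys <= \<bar>B0\<bar>" .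
   show "norm uh <= B1" by (rule admissible_norm[OF u(2)])
   then show "0 <= E0 * B1" using E0_nonneg norm_ge_zero[of uh] by (intro mult_nonneg_nonneg) linarith+
  qed (use E0_nonneg Hn0 de ee L2_norm_nonneg in \<open>auto intro!: mult_nonneg_nonneg add_nonneg_nonneg\<close>)
  finally show ?thesis by (simp add: algebra_simps)
 qed
 have qL: "L2_on Om (%x. complex_of_real (\<omega>\<^sup>2) *s (ctrl_coeff P es uh x *s yh x))"
  using L2_scale(1)[OF ctrl_L2(1)[OF Yh(1) order_refl OmL, of uh], of "\<omega>\<^sup>2"]
  by (simp add: vec_eq_iff scaleR_conv_of_real vector_smult_assoc[symmetric] scaleR_vec_def vector_scalar_mult_def)
 have q_eq: "qf uh yh = (%x. f x + complex_of_real (\<omega>\<^sup>2) *s (ctrl_coeff P es uh x *s yh x))"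
  by (simp add: qf_def vector_smult_assoc)
 show qOm: "L2_on Om (qf uh yh)" unfolding q_eq by (rule L2_add(1)[OF fL2 qL])
 show zOm: "L2_on Om (zf yh)" unfolding zf_def by (intro mu_L2 Yh order_refl OmL)
 have zsOm: "L2_on Om (zf ys)" unfolding zf_def by (intro mu_L2 Ys order_refl OmL)
 have key: "vprod Om (qf uh yh) w - vprod Om (zf yh) cw = vprod Om mc cw - complex_of_real (\<omega>\<^sup>2) * vprod Om E w"
  if w: "test_fun Om w" and cwL: "L2_on Om cw" and cw: "AE x in lebesgue. x : Om --> wcurl Om w x = cw x" for w cw
 proof -
  have sw: "smooth w" using w by (elim test_funE)
  have wOm: "L2_on Om w" by (rule L2_test[OF sw Om(2) OmL])
  have wcw: "L2_on Om (wcurl Om w)" using H0curl_facts[OF test_H0curl(1)[OF w]] by simp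
  have "state_form Om P \<omega> \<mu> es us ys w = vprod Om f w"
   using ys test_H0curl(1)[OF w] by (simp add: is_state_def)
  then have 1: "vprod Om f w = vprod Om (zf ys) (wcurl Om w) - complex_of_real (\<omega>\<^sup>2) * vprod Om (%x. ctrl_coeff P es us x *s ys x) w"
   by (simp add: state_form_def zf_def)
  have 2: "vprod Om (zf ys) (wcurl Om w) = vprod Om (zf ys) cw"
   using cw by (intro vprod_cong_AE[OF OmL zsOm wcw zsOm cwL]) auto
  have 3: "vprod Om (qf uh yh) w = vprod Om f w + complex_of_real (\<omega>\<^sup>2) * vprod Om (%x. ctrl_coeff P es uh x *s yh x) w"
   unfolding q_eq vprod_add[OF fL2 qL wOm] vprod_cmult by simp
  have 4: "vprod Om E w = vprod Om (%x. ctrl_coeff P es us x *s ys x) w - vprod Om (%x. ctrl_coeff P es uh x *s yh x) w"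
   unfolding E_def by (intro vprod_diff ctrl_L2 Ys Yh order_refl OmL wOm)
  have "mc = (%x. zf ys x - zf yh x)" by (auto simp: mc_def zf_def c_def scaleR_diff_right)
  then have 5: "vprod Om mc cw = vprod Om (zf ys) cw - vprod Om (zf yh) cw" using vprod_diff[OF zsOm zOm cwL] by simp
  show ?thesis unfolding 3 1 2 4 5 by (simp add: algebra_simps)
 qed
 have loc: "norm (vprod Om v w) <= L2_norm N' v * L2_norm Om w"
  if "L2_on Om v" "test_fun Om w" "!!x. x ~: N ==> w x = 0" for v w
 proof -
  have sw: "smooth w" using that(2) by (elim test_funE)
  have wz: "w x = 0" if "x ~: N'" for x
  proof (cases "x : Om")
   case False
   obtain K where "K <= interior Om" "!!x. x ~: K ==> w x = 0" using test_funE[OF \<open>test_fun Om w\<close>] by metis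
   then show ?thesis using False interior_subset[of Om] by blast
  qed (use that \<open>!!x. x ~: N ==> w x = 0\<close> in \<open>auto simp: N'_def\<close>)
  have "vprod Om v w = vprod N' v w" by (rule vprod_restrict[OF N'L(2,1) OmL wz])
  also have "norm ... <= L2_norm N' v * L2_norm N' w"
   by (intro vprod_integrable(2) L2_subset(1)[OF that(1) N'L(2,1) OmL] L2_subset(1)[OF L2_test[OF sw Om(2) OmL] N'L(2,1) OmL])
  also have "L2_norm N' w = L2_norm Om w" using L2_norm_restrict[OF N'L(2,1) OmL wz] by simp
  finally show ?thesis .
 qed
 have e0: "0 <= e" using ee Hn0 by simp
 have B10: "0 <= B1" by (simp add: B1_def sum_nonneg)
 have c1: "\<omega>\<^sup>2 * (E0 * (\<bar>B0\<bar> + B1) * e) <= C1 * e" "(1 / \<mu>0) * e <= C1 * e"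
 proof -
  have "\<omega>\<^sup>2 * E0 * (\<bar>B0\<bar> + B1) <= C1" using mu(2) by (simp add: C1_def)
  from mult_right_mono[OF this e0] show "\<omega>\<^sup>2 * (E0 * (\<bar>B0\<bar> + B1) * e) <= C1 * e" by (simp add: mult.assoc)
  have "0 <= \<omega>\<^sup>2 * E0 * (\<bar>B0\<bar> + B1)" using E0_nonneg B10 by (intro mult_nonneg_nonneg) auto
  then have "1 / \<mu>0 <= C1" by (simp add: C1_def)
  from mult_right_mono[OF this e0] show "(1 / \<mu>0) * e <= C1 * e" .
 qed
 have Ebound: "norm (complex_of_real (\<omega>\<^sup>2) * vprod Om E w) <= C1 * e * L2_norm Om w"
  if "test_fun Om w" "!!x. x ~: N ==> w x = 0" for w
 proof -
  have "norm (complex_of_real (\<omega>\<^sup>2) * vprod Om E w) = \<omega>\<^sup>2 * norm (vprod Om E w)"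
   by (simp only: norm_mult norm_of_real) simp
  also have "... <= \<omega>\<^sup>2 * ((E0 * (\<bar>B0\<bar> + B1) * e) * L2_norm Om w)"
   by (intro mult_left_mono order_trans[OF loc[OF EOm that]] mult_right_mono Eb L2_norm_nonneg) auto
  also have "... <= C1 * e * L2_norm Om w"
   using mult_right_mono[OF c1(1) L2_norm_nonneg[of Om w]] by (simp add: mult.assoc)
  finally show ?thesis .
 qed
 show "norm (vprod Om (qf uh yh) w - vprod Om (zf yh) (classical_curl w))
    <= C1 * e * (L2_norm Om w + L2_norm Om (classical_curl w))"
  if w: "test_fun Om w" "!!x. x ~: N ==> w x = 0" for w
 proof -
  have sw: "smooth w" using w(1) by (elim test_funE)
  have cz: "classical_curl w x = 0" if "x ~: N" for x
   using w(2) that N(1) by (intro classical_curl_zero[of N]) (auto intro: compact_imp_closed)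
  have "norm (vprod Om mc (classical_curl w)) <= L2_norm N' mc * L2_norm Om (classical_curl w)"
   by (rule loc[OF mcOm test_fun_curl[OF w(1)] cz])
  also have "... <= C1 * e * L2_norm Om (classical_curl w)"
   using mcb c1(2) by (intro mult_right_mono L2_norm_nonneg) linarith
  finally have "norm (vprod Om mc (classical_curl w)) <= C1 * e * L2_norm Om (classical_curl w)" .
  moreover have "vprod Om (qf uh yh) w - vprod Om (zf yh) (classical_curl w) = vprod Om mc (classical_curl w) - complex_of_real (\<omega>\<^sup>2) * vprod Om E w"
   by (rule key[OF w(1) L2_test[OF smooth_classical_curl[OF sw] Om(2) OmL] test_H0curl(2)[OF w(1)]])
  ultimately show ?thesis
   using Ebound[OF w] norm_triangle_ineq4[of "vprod Om mc (classical_curl w)" "complex_of_real (\<omega>\<^sup>2) * vprod Om E w"]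
   by (simp add: distrib_left)
 qed
 show "norm (vprod Om (qf uh yh) (classical_grad phi)) <= C1 * e * L2_norm Om (classical_grad phi)"
  if p: "test_fun Om phi" "symm phi" "!!x. x ~: N ==> phi x = 0" for phi
 proof -
  let ?w = "classical_grad phi"
  have w: "test_fun Om ?w" by (rule test_fun_grad[OF p(1)])
  have wz: "?w x = 0" if "x ~: N" for x
   using p(3) that N(1) by (intro classical_grad_zero[of N]) (auto intro: compact_imp_closed)
  have "AE x in lebesgue. x : Om --> wcurl Om ?w x = 0"
   using test_H0curl(2)[OF w] by eventually_elim (simp add: curl_grad[OF p(2)])
  from key[OF w L2_test[OF smooth_const Om(2) OmL] this]
  have "vprod Om (qf uh yh) ?w = - (complex_of_real (\<omega>\<^sup>2) * vprod Om E ?w)" by (simp add: vprod_def)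
  then show ?thesis using Ebound[OF w wz] by simp
 qed
qed

end

section \<open>Polynomial vector fields\<close>

lemma pdeg_sum: "(!!i. i : I ==> pdeg d (p i)) ==> pdeg d (%x. SUM i:I. p i x)"
 by (induction I rule: infinite_finite_induct) (auto intro: pdeg_const pdeg.add)

lemma pdeg_cmult: "pdeg d p ==> pdeg d (%x. p x * c)" using pdeg.mult[OF _ pdeg.const, of d p c] by simp

lemma pdegv_const: "pdegv d (%_. c)" by (simp add: pdegv_def pdeg_const)

lemma pdegv_add: "pdegv d p ==> pdegv d q ==> pdegv d (%x. p x + q x)"
 by (simp add: pdegv_def inner_add_left pdeg.add)

lemma pdegv_mono: "pdegv d p ==> d <= e ==> pdegv e p" by (auto simp: pdegv_def intro: pdeg.mono)

lemma pdegv_linear: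
 fixes h :: "'b::euclidean_space => 'c::euclidean_space"
 assumes h: "bounded_linear h" and p: "pdegv d p"
 shows "pdegv d (%x. h (p x))"
 unfolding pdegv_def
proof
 fix c :: 'c assume "c : Basis"
 have "h (p x) \<bullet> c = (SUM b:Basis. (p x \<bullet> b) * (h b \<bullet> c))" for x
 proof -
  have "h (p x) = h (SUM b:Basis. (p x \<bullet> b) *\<^sub>R b)" by (simp add: euclidean_representation)
  also have "... = (SUM b:Basis. (p x \<bullet> b) *\<^sub>R h b)"
   using bounded_linear.linear[OF h] by (simp add: linear_sum linear_scale)
  finally show ?thesis by (simp add: inner_sum_left)
 qed
 then show "pdeg d (%x. h (p x) \<bullet> c)" using p by (simp add: pdegv_def pdeg_sum pdeg_cmult)
qed

lemma pdegv_minus: "pdegv d p ==> pdegv d (%x. - p x)"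
 by (rule pdegv_linear[OF bounded_linear_minus[OF bounded_linear_ident]])

lemma pdegv_diff: "pdegv d p ==> pdegv d q ==> pdegv d (%x. p x - q x)"
 unfolding diff_conv_add_uminus by (intro pdegv_add pdegv_minus)

lemma pdegv_sum: "(!!i. i : I ==> pdegv d (p i)) ==> pdegv d (%x. SUM i:I. p i x)"
 by (induction I rule: infinite_finite_induct) (auto intro: pdegv_const pdegv_add)

lemma pdegv_scale_bilinear:
 fixes pr :: "'a::euclidean_space => 'b::euclidean_space => 'c::euclidean_space"
 assumes pr: "bounded_bilinear pr" and p: "pdegv d p" and q: "pdegv e q"
 shows "pdegv (d + e) (%x. pr (p x) (q x))"
proof -
 interpret bounded_bilinear pr by (rule pr)
 have "pr (p x) (q x) = (SUM b:Basis. SUM c:Basis. ((p x \<bullet> b) * (q x \<bullet> c)) *\<^sub>R pr b c)" for x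
 proof -
  have "pr (p x) (q x) = pr (SUM b:Basis. (p x \<bullet> b) *\<^sub>R b) (SUM c:Basis. (q x \<bullet> c) *\<^sub>R c)"
   by (simp add: euclidean_representation)
  also have "... = (SUM b:Basis. pr ((p x \<bullet> b) *\<^sub>R b) (SUM c:Basis. (q x \<bullet> c) *\<^sub>R c))"
   by (rule sum_left)
  also have "... = (SUM b:Basis. SUM c:Basis. pr ((p x \<bullet> b) *\<^sub>R b) ((q x \<bullet> c) *\<^sub>R c))"
   by (simp only: sum_right)
  also have "... = (SUM b:Basis. SUM c:Basis. ((p x \<bullet> b) * (q x \<bullet> c)) *\<^sub>R pr b c)"
   by (simp only: scaleR_left scaleR_right scaleR_scaleR mult.commute)
  finally show ?thesis .
 qed
 moreover have "pdegv (d + e) (%x. ((p x \<bullet> b) * (q x \<bullet> c)) *\<^sub>R pr b c)" if "b : Basis" "c : Basis" for b c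
  unfolding pdegv_def using p q that by (auto simp: pdegv_def intro!: pdeg_cmult pdeg.mult)
 ultimately show ?thesis by (simp add: pdegv_sum)
qed

lemma pdegv_partial: "pdegv d p ==> pdegv d (partial i p)"
proof -
 assume p: "pdegv d p"
 have "(%x. partial i p x \<bullet> b) = partial i (%x. p x \<bullet> b)" for b
  using partial_linear[OF bounded_linear_inner_left smooth_differentiable[OF smooth_pdegv[OF p]]]
  by (auto simp: fun_eq_iff)
 then show ?thesis using p by (simp add: pdegv_def pdeg_partial)
qed

lemma pdegv_affine: "bounded_linear A ==> pdegv d p ==> pdegv d (%x. p (c + A x))"
 unfolding pdegv_def by (intro ballI pdeg_affine[where p = "%x. p x \<bullet> _"]) auto

lemma pdegv_id_linear: "bounded_linear h ==> pdegv 1 h" unfolding pdegv_def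
 by (intro ballI pdeg.lin bounded_linear_compose[OF bounded_linear_inner_left])

lemma pdegv_nth: "pdegv d p ==> pdegv d (%x. p x $ j)" for p :: cfield
 by (rule pdegv_linear[OF bounded_linear_vec_nth])

lemma pdegv_vecI:
 fixes p :: cfield
 assumes "!!j. pdegv d (%x. p x $ j)" shows "pdegv d p"
proof -
 have "pdegv d (%x. SUM j:UNIV. axis j (p x $ j) :: complex^3)"
  by (intro pdegv_sum pdegv_linear[OF bounded_linear_axis] assms)
 then show ?thesis by (simp add: vec_axis_sum[symmetric])
qed

lemma pdegv_curl: "pdegv d p ==> pdegv d (classical_curl p)"
proof (rule pdegv_vecI)
 fix j :: 3 assume p: "pdegv d p"
 have "j = 1 \<or> j = 2 \<or> j = 3" by (rule exhaust_3)
 then show "pdegv d (%x. classical_curl p x $ j)"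
  by (elim disjE) (simp_all add: classical_curl_nth pdegv_diff pdegv_nth pdegv_partial p)
qed

lemma bounded_bilinear_smult: "bounded_bilinear (%(c::complex) (v::complex^3). c *s v)"
proof (rule bounded_bilinear.intro)
 show "EX K. ALL (a::complex) (b::complex^3). norm (a *s b) <= norm a * norm b * K"
  by (rule exI[of _ 1]) (simp add: norm_smult_vec)
qed (auto simp: vec_eq_iff algebra_simps)

lemma bounded_linear_ccross: "bounded_linear (%x::point. ccross (of_real_vec x) b)"
 unfolding linear_conv_bounded_linear[symmetric]
 by (rule linearI) (auto simp: ccross_def of_real_vec_def vec_eq_iff forall_3 algebra_simps scaleR_conv_of_real[where 'a = complex])

lemma bounded_linear_ccross_left: "bounded_linear (%v::complex^3. ccross v w)"
 unfolding linear_conv_bounded_linear[symmetric]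
 by (rule linearI) (auto simp: ccross_def vec_eq_iff forall_3 algebra_simps)

lemma polynomial_pdegv:
 assumes "polynomial_function p" shows "EX d. pdegv d (p :: point => 'b::euclidean_space)"
proof -
 have "EX d. pdeg d (%x. p x \<bullet> b)" for b using assms bounded_linear_inner_left[of b] real_polynomial_pdeg
  by (fastforce simp: polynomial_function_def o_def)
 then obtain d where d: "!!b. pdeg (d b) (%x. p x \<bullet> b)" by metis
 have "pdegv (Max (d ` Basis)) p" unfolding pdegv_def by (auto intro!: pdeg.mono[OF d] Max_ge)
 then show ?thesis by blast
qed

section \<open>Norms of bubbles\<close>

lemma L2_norm_sup_bound:
 fixes F :: "point => 'b::euclidean_space"
 assumes F: "continuous_on UNIV F" and G: "G : sets lebesgue" and R: "R \<ge> 0"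
  and b: "!!x. x : cball m R ==> (norm (F x))\<^sup>2 <= M" and z: "!!x. x : G ==> x ~: cball m R ==> F x = 0"
 shows "(L2_norm G F)\<^sup>2 <= M * (unit_ball_vol 3 * R ^ 3)"
proof -
 have M: "0 <= M" using b[of m] R by (auto intro: order_trans[OF zero_le_power2])
 have "(L2_norm G F)\<^sup>2 = (LINT x|lebesgue. indicator G x *\<^sub>R (norm (F x))\<^sup>2)"
  using G by (simp only: L2_norm_sq LINT_lebesgue_on)
 also have "... <= (LINT x|lebesgue. M * indicator (cball m R) x)"
 proof (rule integral_mono_AE')
  show "integrable lebesgue (%x. M * indicator (cball m R) x)"
   by (intro integrable_mult_right integrable_real_indicator) (use emeasure_lborel_cball_finite[of m R] in \<open>auto simp: infinity_ennreal_def\<close>)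
  show "AE x in lebesgue. indicator G x *\<^sub>R (norm (F x))\<^sup>2 <= M * indicator (cball m R) x"
  proof (rule AE_I2)
   fix x show "indicator G x *\<^sub>R (norm (F x))\<^sup>2 <= M * indicator (cball m R) x"
    using b[of x] z[of x] M by (cases "x : cball m R"; cases "x : G") auto
  qed
  show "AE x in lebesgue. 0 <= M * indicator (cball m R) x" using M by simp
 qed
 also have "... = M * (unit_ball_vol 3 * R ^ 3)" using content_cball[OF R, of m] by (simp add: measure_completion)
 finally show ?thesis .
qed

text \<open>A predicate on the constant, so that it can be fixed before mesh, element and polynomial
  are known; the \<open>itself\<close> argument records the value type, since scalars and vectors
  get separate constants. \<open>I\<close> is the squared norm of \<open>p\<close> weighted by the
  bump, and every estimate is relative to it.\<close>

definition bubble_const :: "real => nat => 'b::euclidean_space itself => real => bool" where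
 "bubble_const K d _ C \<longleftrightarrow> C > 0 & (\<forall>rho>0. ALL m. ALL p :: point => 'b. pdegv d p -->
  (let I = (LINT y|lborel. (norm (p y))\<^sup>2 * bump m rho y) in
   (ALL x:cball m (K * rho). (norm (p x))\<^sup>2 <= C / rho ^ 3 * I) \<and>
   (ALL G:sets lebesgue. G <= cball m (K * rho) --> (L2_norm G p)\<^sup>2 <= C * I) \<and>
   (ALL G:sets lebesgue. (L2_norm G (%x. bump m rho x *\<^sub>R p x))\<^sup>2 <= C * I) \<and>
   (ALL G:sets lebesgue. ALL i. (L2_norm G (partial i (%x. bump m rho x *\<^sub>R p x)))\<^sup>2 <= C * I / rho\<^sup>2)))"

lemma bubble_const_exists:
 assumes "K \<ge> 1"
 shows "EX C. bubble_const K d TYPE('b::euclidean_space) C"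
proof -
 obtain C where C: "C > 0" "!!rho m x i p. rho > 0 ==> pdegv d (p :: point => 'b) ==>
  (x : cball m (K * rho) --> (norm (p x))\<^sup>2 <= C / rho ^ 3 * (LINT y|lborel. (norm (p y))\<^sup>2 * bump m rho y)) \<and>
  (norm (partial i (%y. bump m rho y *\<^sub>R p y) x))\<^sup>2 <= C / rho ^ 5 * (LINT y|lborel. (norm (p y))\<^sup>2 * bump m rho y)"
  using pdegv_bubble[OF assms, of d, where 'b = 'b] by blast
 define V where "V = unit_ball_vol 3 * K ^ 3"
 have V: "V \<ge> 0" using assms by (simp add: V_def)
 define C' where "C' = C * (V + 1)"
 have "C * V \<ge> 0" using C(1) V by simp
 then have C': "C' > 0" "C <= C'" "C * V <= C'" unfolding C'_def distrib_left using C(1) by linarith+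
 show ?thesis unfolding bubble_const_def Let_def
 proof (intro exI[of _ C'] conjI allI impI ballI C'(1))
  fix rho :: real and m and p :: "point => 'b" assume r: "rho > 0" and p: "pdegv d p"
  let ?I = "LINT y|lborel. (norm (p y))\<^sup>2 * bump m rho y"
  have I0: "?I \<ge> 0" by (rule integral_nonneg_AE) (simp add: bump_bounds)
  have cp: "continuous_on UNIV p" by (rule smooth_continuous[OF smooth_pdegv[OF p]])
  have sw: "smooth (%x. bump m rho x *\<^sub>R p x)" by (intro smooth_scaleR smooth_bump smooth_pdegv[OF p])
  have Kr: "0 <= K * rho" "rho <= K * rho" using assms r by auto
  have b1: "(norm (p x))\<^sup>2 <= C / rho ^ 3 * ?I" if "x : cball m (K * rho)" for x
   using C(2)[OF r p, of x m] that by blast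
  have b2: "(norm (partial i (%y. bump m rho y *\<^sub>R p y) x))\<^sup>2 <= C / rho ^ 5 * ?I" for x i
   using C(2)[OF r p, of x m i] by blast
  have b3: "(norm (bump m rho x *\<^sub>R p x))\<^sup>2 <= C / rho ^ 3 * ?I" if "x : cball m (K * rho)" for x
  proof -
   have "norm (bump m rho x *\<^sub>R p x) <= norm (p x)"
    using bump_bounds[of m rho x] by (simp add: mult_left_le_one_le)
   then have "(norm (bump m rho x *\<^sub>R p x))\<^sup>2 <= (norm (p x))\<^sup>2" by (rule power_mono) simp
   then show ?thesis using b1[OF that] by linarith
  qed
  have wz: "bump m rho x *\<^sub>R p x = 0" if "x ~: cball m (K * rho)" for x
  proof -
   have "x ~: ball m rho" using that Kr(2) unfolding mem_ball mem_cball by linarith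
   then show ?thesis using bump_zero[OF r] by simp
  qed
  have pz: "partial i (%x. bump m rho x *\<^sub>R p x) x = 0" if "x ~: cball m (K * rho)" for i x
   by (rule partial_zero_outside[OF closed_cball wz that])
  have v1: "C / rho ^ 3 * ?I * (unit_ball_vol 3 * (K * rho) ^ 3) = C * V * ?I"
   using r by (simp add: V_def power_mult_distrib)
  have v2: "C / rho ^ 5 * ?I * (unit_ball_vol 3 * (K * rho) ^ 3) = C * V * ?I / rho\<^sup>2"
   using r by (simp add: V_def power_mult_distrib field_simps eval_nat_numeral)
  have CV: "C * V * ?I <= C' * ?I" using C'(3) I0 by (rule mult_right_mono)
  show "(norm (p x))\<^sup>2 <= C' / rho ^ 3 * ?I" if "x : cball m (K * rho)" for x
  proof -
   have "C / rho ^ 3 * ?I <= C' / rho ^ 3 * ?I" using C'(2) r I0 by (intro mult_right_mono divide_right_mono) auto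
   then show ?thesis using b1[OF that] by linarith
  qed
  fix G :: "point set" assume G: "G : sets lebesgue"
  show "(L2_norm G p)\<^sup>2 <= C' * ?I" if "G <= cball m (K * rho)"
   using L2_norm_sup_bound[where m = m, OF cp G Kr(1) b1] that CV unfolding v1 by force
  show "(L2_norm G (%x. bump m rho x *\<^sub>R p x))\<^sup>2 <= C' * ?I"
   using L2_norm_sup_bound[where m = m, OF smooth_continuous[OF sw] G Kr(1) b3 wz] CV unfolding v1 by linarith
  fix i
  have "(L2_norm G (partial i (%x. bump m rho x *\<^sub>R p x)))\<^sup>2 <= C * V * ?I / rho\<^sup>2"
   using L2_norm_sup_bound[where m = m, OF smooth_continuous[OF smooth_partial[OF sw]] G Kr(1) b2 pz] unfolding v2 .
  also have "... <= C' * ?I / rho\<^sup>2" using CV by (rule divide_right_mono) simp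
  finally show "(L2_norm G (partial i (%x. bump m rho x *\<^sub>R p x)))\<^sup>2 <= C' * ?I / rho\<^sup>2" .
 qed
qed

lemma L2_norm_mono_bound:
 fixes v :: "point => 'b::euclidean_space" and w :: "3 => point => 'c::euclidean_space"
 assumes v: "v : borel_measurable (lebesgue_on G)" and w: "!!i. L2_on G (w i)" and c: "c \<ge> 0"
  and b: "!!x. norm (v x) <= c * (SUM i:UNIV. norm (w i x))"
 shows "L2_norm G v <= c * (SUM i:UNIV. L2_norm G (w i))"
proof -
 have n: "L2_on G (%x. norm (w i x))" "L2_norm G (%x. norm (w i x)) = L2_norm G (w i)" for i
  using w[of i] by (auto simp: L2_on_def L2_norm_def)
 note a1 = L2_add[OF n(1)[of 1] n(1)[of 2]]
 note a2 = L2_add[OF a1(1) n(1)[of 3]]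
 have "L2_norm G v <= c * L2_norm G (%x. norm (w 1 x) + norm (w 2 x) + norm (w 3 x))"
  using b c by (intro L2_bounded_mult(2)[OF a2(1) v]) (auto simp: sum_3)
 also have "... <= c * (L2_norm G (w 1) + L2_norm G (w 2) + L2_norm G (w 3))"
  using a1(2) a2(2) c by (intro mult_left_mono) (auto simp: n(2))
 finally show ?thesis by (simp add: sum_3)
qed

lemma smooth_measurable_on: "smooth w ==> w : borel_measurable (lebesgue_on G)"
 for w :: "point => 'b::euclidean_space"
 by (rule measurable_restrict_space1[OF continuous_measurable_lebesgue[OF smooth_continuous]])

lemma L2_norm_curl:
 assumes "smooth w" "G : sets lebesgue" "bounded G" "!!i. L2_norm G (partial i w) <= s"
 shows "L2_norm G (classical_curl w) <= 6 * s"
proof -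
 have "L2_norm G (classical_curl w) <= 2 * (SUM i:UNIV. L2_norm G (partial i w))"
  using assms by (intro L2_norm_mono_bound norm_curl_bound smooth_measurable_on smooth_classical_curl L2_test smooth_partial) auto
 also have "... <= 2 * (SUM i:(UNIV :: 3 set). s)" using assms(4) by (intro mult_left_mono sum_mono) auto
 finally show ?thesis by simp
qed

lemma L2_norm_grad:
 assumes "smooth w" "G : sets lebesgue" "bounded G" "!!i. L2_norm G (partial i w) <= s"
 shows "L2_norm G (classical_grad w) <= 3 * s"
proof -
 have "L2_norm G (classical_grad w) <= 1 * (SUM i:UNIV. L2_norm G (partial i w))"
  using assms by (intro L2_norm_mono_bound smooth_measurable_on smooth_classical_grad L2_test smooth_partial)
   (auto simp: norm_grad_bound)
 also have "... <= 1 * (SUM i:(UNIV :: 3 set). s)" using assms(4) by (intro mult_left_mono sum_mono) auto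
 finally show ?thesis by simp
qed

text \<open>Cancels one factor sqrt I from an energy estimate; the division is possible when I is
  positive, and I = 0 is trivial.\<close>

lemma sqrt_absorb:
 assumes "0 <= I" "I <= X * sqrt I" "0 <= X" shows "sqrt I <= (X :: real)"
proof (cases "I = 0")
 case False
 then have "sqrt I > 0" using assms(1) by simp
 moreover have "sqrt I * sqrt I <= X * sqrt I" using assms by simp
 ultimately show ?thesis by (rule mult_right_le_imp_le[rotated])
qed (use assms in simp)

section \<open>Estimates on an element\<close>

lemma vprod_cnj: "vprod G v w = cnj (vprod G w v)"
proof -
 have "cnj (vprod G w v) = (LINT x|lebesgue_on G. cnj (SUM i:UNIV. w x $ i * cnj (v x $ i)))"
  unfolding vprod_def by (simp only: Bochner_Integration.integral_cnj)
 then show ?thesis by (simp add: vprod_def mult.commute)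
qed

lemma test_bump:
 fixes p :: "point => 'b::euclidean_space"
 assumes "rho > 0" "cball m rho <= interior G" "smooth p"
 shows "test_fun G (%x. bump m rho x *\<^sub>R p x)"
 using assms by (intro test_funI[where K = "cball m rho"] smooth_scaleR smooth_bump) (auto simp: bump_zero)

lemma smult_square: "(SUM i:UNIV. v $ i * cnj ((c *\<^sub>R v) $ i)) = complex_of_real ((norm v)\<^sup>2 * c)" for v :: "complex^3"
proof -
 have "(SUM i:UNIV. v $ i * cnj ((c *\<^sub>R v) $ i)) = complex_of_real c * (SUM i:UNIV. v $ i * cnj (v $ i))"
  by (simp add: sum_distrib_left scaleR_conv_of_real[where 'a = complex] mult_ac)
 then show ?thesis by (simp add: norm_sq_cip)
qed

text \<open>\<open>A\<close> stands for the residual bound of the state, and \<open>c0\<close>,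
  \<open>c1\<close> for arbitrary constants, later the means of the data. The divergence estimate
  has \<open>A\<close> alone, the curl estimate (1 + r0) A, since its test field is measured
  together with its curl and only the latter carries 1 / r0.\<close>

definition element_const :: "real => nat => real => bool" where
 "element_const kappa d C \<longleftrightarrow> C > 0 & (ALL Om T x0 r0 q z f pT zT df A c0 c1.
  open Om --> bounded Om --> T : sets lebesgue --> bounded T --> interior T <= Om -->
  r0 > 0 --> cball x0 r0 <= T --> T <= cball x0 (kappa * r0) --> A \<ge> 0 -->
  L2_on Om q --> L2_on Om z --> L2_on T f --> L2_on T df --> pdegv d pT --> pdegv d zT -->
  (AE x in lebesgue. x : T --> x : Om & q x = f x + pT x & z x = zT x) -->
  has_weak_div T f df -->
  (ALL w. test_fun T w --> norm (vprod Om q w - vprod Om z (classical_curl w))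
     <= A * (L2_norm Om w + L2_norm Om (classical_curl w))) -->
  (\<forall>phi. test_fun T phi --> symm phi --> norm (vprod Om q (classical_grad phi)) <= A * L2_norm Om (classical_grad phi)) -->
  r0 * L2_norm T (%x. df x + (SUM i:UNIV. partial i pT x $ i)) <= C * (A + r0 * L2_norm T (%x. df x - c0)) \<and>
  r0 * L2_norm T (%x. f x + pT x - classical_curl zT x) <= C * ((1 + r0) * A + r0 * L2_norm T (%x. f x - c1)))"

text \<open>The distance \<delta> of the datum from the constant enters twice: when the polynomial
  residual is tested, and when it is exchanged for the true one. In both parts the energy
  \<open>I\<close> is bounded by a multiple of its own square root, and the bubble estimates convert
  this into a norm on all of \<open>T\<close>.\<close>

lemma element_const_exists:
 assumes K: "kappa \<ge> 1"
 shows "EX C. element_const kappa d C"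
proof -
 \<comment> \<open>The bump will have radius r0 / 2 to stay inside the open ball, so
   \<open>T\<close> lies within 2 kappa bump radii.\<close>
 have K2: "2 * kappa \<ge> 1" using K by simp
 obtain Ca where "bubble_const (2 * kappa) d TYPE(complex) Ca" using bubble_const_exists[OF K2] by blast
 note Ca = this[unfolded bubble_const_def, THEN conjunct1] this[unfolded bubble_const_def, THEN conjunct2, rule_format]
 obtain Cb where "bubble_const (2 * kappa) d TYPE(complex^3) Cb" using bubble_const_exists[OF K2] by blast
 note Cb = this[unfolded bubble_const_def, THEN conjunct1] this[unfolded bubble_const_def, THEN conjunct2, rule_format]
 \<comment> \<open>12 = 2 * 6: passing from partial derivatives to the curl costs a factor 6, and 1
   / rho = 2 / r0. The gradient costs 3, which is covered as well.\<close>
 define C where "C = 12 * (Ca + Cb) + 2"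
 have C: "C > 0" "12 * Ca <= C" "12 * Cb <= C" "1 + Ca <= C" "1 + Cb <= C" "Ca <= C" "Cb <= C"
  using Ca(1) Cb(1) by (auto simp: C_def)
 have fin: "r0 * (Ck * (k * A / (r0 / 2) + D) + D) <= C * (A' + r0 * D)"
  if "r0 > 0" "Ck > 0" "2 * k * Ck * A <= C * A'" "1 + Ck <= C" "D \<ge> 0" for r0 Ck k A A' D :: real
 proof -
  have "r0 * (Ck * (k * A / (r0 / 2) + D) + D) = 2 * k * Ck * A + (1 + Ck) * (r0 * D)"
   using that by (simp add: field_simps)
  also have "... <= C * A' + C * (r0 * D)" using that by (intro add_mono mult_right_mono) auto
  finally show ?thesis by (simp add: distrib_left)
 qed
 show ?thesis unfolding element_const_def
 proof (intro exI[of _ C] conjI C(1) allI impI)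
  fix Om T :: "point set" and x0 r0 and q z f pT zT :: cfield and df :: "point => complex" and A :: real and c0 c1
  assume Om: "open Om" "bounded Om" and T: "T : sets lebesgue" "bounded T" "interior T <= Om"
   and r0: "r0 > 0" "cball x0 r0 <= T" "T <= cball x0 (kappa * r0)" and A: "A \<ge> 0"
   and L: "L2_on Om q" "L2_on Om z" "L2_on T f" "L2_on T df" and p: "pdegv d pT" "pdegv d zT"
   and ae: "AE x in lebesgue. x : T --> x : Om & q x = f x + pT x & z x = zT x"
   and div: "has_weak_div T f df"
   and H1: "ALL w. test_fun T w --> norm (vprod Om q w - vprod Om z (classical_curl w))
     <= A * (L2_norm Om w + L2_norm Om (classical_curl w))"
   and H0: "\<forall>phi. test_fun T phi --> symm phi --> norm (vprod Om q (classical_grad phi)) <= A * L2_norm Om (classical_grad phi)"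
  define rho where "rho = r0 / 2"
  have r: "rho > 0" using r0 by (simp add: rho_def)
  have TK: "T <= cball x0 (2 * kappa * rho)" using r0(3) by (simp add: rho_def)
  have bi: "cball x0 rho <= interior T"
  proof -
   have "ball x0 r0 <= T" using r0(2) ball_subset_cball by blast
   then have "ball x0 r0 <= interior T" by (rule interior_maximal) simp
   moreover have "cball x0 rho <= ball x0 r0" using r0(1) by (auto simp: rho_def)
   ultimately show ?thesis by blast
  qed
  have OmL: "Om : sets lebesgue" using Om(1) by (simp add: borel_open)
  have sp: "smooth pT" "smooth zT" using p by (auto intro: smooth_pdegv)
  define T' where "T' = T Int Om"
  have T': "T' : sets lebesgue" "T' <= Om" "T' <= T" "interior T <= T'" using T OmL interior_subset[of T] by (auto simp: T'_def)
  have aeT: "AE x in lebesgue. x : T --> f x + pT x = q x" using ae by eventually_elim auto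
  have aeT': "AE x in lebesgue. x : T --> zT x = z x" using ae by eventually_elim auto
  have fpL: "L2_on T (%x. f x + pT x)" by (intro L2_add L L2_test sp T)
  have qT: "L2_on T q" by (rule L2_cong_AE(1)[OF T(1) fpL aeT])
  have zTL: "L2_on T zT" by (rule L2_test[OF sp(2) T(2,1)])
  have zL: "L2_on T z" by (rule L2_cong_AE(1)[OF T(1) zTL aeT'])
  have qOT: "vprod Om q w = vprod T (%x. f x + pT x) w" if "test_fun T w" for w
  proof -
   have sw: "smooth w" using that by (elim test_funE)
   have "vprod Om q w = vprod T q w" by (rule vprod_test_restrict[OF that T(1) OmL T(3)])
   also have "... = vprod T (%x. f x + pT x) w"
    by (rule vprod_cong_AE[OF T(1) qT L2_test[OF sw T(2,1)] fpL L2_test[OF sw T(2,1)]]) (use aeT in \<open>auto elim: eventually_mono\<close>)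
   finally show ?thesis .
  qed
  have zOT: "vprod Om z w = vprod T zT w" if "test_fun T w" for w
  proof -
   have sw: "smooth w" using that by (elim test_funE)
   have "vprod Om z w = vprod T z w" by (rule vprod_test_restrict[OF that T(1) OmL T(3)])
   also have "... = vprod T zT w"
    by (rule vprod_cong_AE[OF T(1) zL L2_test[OF sw T(2,1)] zTL L2_test[OF sw T(2,1)]]) (use aeT' in \<open>auto elim: eventually_mono\<close>)
   finally show ?thesis .
  qed
  show "r0 * L2_norm T (%x. df x + (SUM i:UNIV. partial i pT x $ i)) <= C * (A + r0 * L2_norm T (%x. df x - c0))"
  proof -
   define dp where "dp x = (SUM i:UNIV. partial i pT x $ i)" for x
   define Dh where "Dh x = dp x + c0" for x
   have pdp: "pdegv d dp" unfolding dp_def[abs_def] by (intro pdegv_sum pdegv_nth pdegv_partial p)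
   have pDh: "pdegv d Dh" unfolding Dh_def[abs_def] by (intro pdegv_add pdp pdegv_const)
   define I where "I = (LINT y|lborel. (norm (Dh y))\<^sup>2 * bump x0 rho y)"
   have I0: "I \<ge> 0" unfolding I_def by (rule integral_nonneg_AE) (simp add: bump_bounds)
   define w where "w x = bump x0 rho x *\<^sub>R Dh x" for x
   have sw: "smooth w" unfolding w_def[abs_def] by (intro smooth_scaleR smooth_bump smooth_pdegv[OF pDh])
   have tw: "test_fun T w" unfolding w_def[abs_def] by (rule test_bump[OF r bi smooth_pdegv[OF pDh]])
   have sy: "symm w" unfolding w_def[abs_def] by (intro symm_scaleR symm_bump symm_pdegv[OF pDh])
   have n1: "(L2_norm T Dh)\<^sup>2 <= Ca * I" "!!G. G : sets lebesgue ==> (L2_norm G w)\<^sup>2 <= Ca * I"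
    "!!G i. G : sets lebesgue ==> (L2_norm G (partial i w))\<^sup>2 <= Ca * I / rho\<^sup>2"
    using Ca(2)[OF r pDh, of x0] T(1) TK by (auto simp: Let_def I_def w_def[abs_def])
   have nw: "L2_norm T w <= sqrt Ca * sqrt I" using real_le_rsqrt[OF n1(2)[OF T(1)]] by (simp add: real_sqrt_mult)
   have nD: "L2_norm T Dh <= sqrt Ca * sqrt I" using real_le_rsqrt[OF n1(1)] by (simp add: real_sqrt_mult)
   have npi: "L2_norm Om (partial i w) <= sqrt Ca * sqrt I / rho" for i
    using real_le_rsqrt[OF n1(3)[OF OmL, of i]] r by (simp add: real_sqrt_mult real_sqrt_divide)
   have ng: "L2_norm Om (classical_grad w) <= 3 * (sqrt Ca * sqrt I / rho)"
    by (rule L2_norm_grad[OF sw OmL Om(2) npi])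
   define \<delta> where "\<delta> x = df x - c0" for x
   have \<delta>L: "L2_on T \<delta>" unfolding \<delta>_def by (intro L2_diff L L2_continuous T continuous_on_const)
   have dpL: "L2_on T dp" "L2_on T Dh" using pdp pDh by (auto intro!: L2_test smooth_pdegv T)
   have wL: "L2_on T w" by (rule L2_test[OF sw T(2,1)])
   have gw: "test_fun T (classical_grad w)" by (rule test_fun_grad[OF tw])
   have sgw: "smooth (classical_grad w)" using gw by (elim test_funE)
   have gwL: "L2_on T (classical_grad w)" by (rule L2_test[OF sgw T(2,1)])
   have dpw: "sprod T dp w = - vprod T pT (classical_grad w)"
   proof -
    obtain K where Kk: "compact K" "K <= interior T" "!!x. x ~: K ==> w x = 0" using test_funE[OF tw] by metis
    have KT: "K <= T" using Kk(2) interior_subset by blast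
    have dw: "partial i (%x. cnj (w x)) x = cnj (partial i w x)" for i x
     by (rule partial_linear[OF bounded_linear_cnj smooth_differentiable[OF sw]])
    have sc: "smooth (%x. cnj (w x))" by (rule smooth_linear[OF bounded_linear_cnj sw])
    have pz: "partial i w x = 0" if "x ~: K" for i x
     using Kk that by (intro partial_zero_outside[of K]) (auto intro: compact_imp_closed)
    have i1: "integrable lborel (%x. partial i pT x $ i * cnj (w x))" for i
     by (rule integrable_compact_support[OF _ Kk(1)])
      (auto simp: Kk(3) intro!: smooth_continuous smooth_mult smooth_nth smooth_partial sp sc)
    have i2: "integrable lborel (%x. pT x $ i * cnj (partial i w x))" for i
     by (rule integrable_compact_support[OF _ Kk(1)])
      (auto simp: pz intro!: smooth_continuous smooth_mult smooth_nth smooth_linear[OF bounded_linear_cnj] smooth_partial sp sw)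
    have ibp: "(LINT x|lborel. partial i pT x $ i * cnj (w x)) = - (LINT x|lborel. pT x $ i * cnj (partial i w x))" for i
     using integral_by_parts[OF sc smooth_nth[OF sp(1), of i] Kk(1), of i] Kk(3)
     by (simp add: dw partial_nth[OF sp(1)] mult.commute)
    have "sprod T dp w = (LINT x|lborel. dp x * cnj (w x))" unfolding sprod_def
     by (rule LINT_lborel_of_support[OF T(1)])
      (use Kk(3) KT in \<open>auto intro!: smooth_continuous smooth_mult smooth_pdegv[OF pdp] sc\<close>)
    also have "... = (SUM i:UNIV. LINT x|lborel. partial i pT x $ i * cnj (w x))"
     unfolding dp_def sum_distrib_right using i1 by simp
    also have "... = - (SUM i:UNIV. LINT x|lborel. pT x $ i * cnj (partial i w x))" unfolding ibp sum_negf ..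
    also have "(SUM i:UNIV. LINT x|lborel. pT x $ i * cnj (partial i w x)) = (LINT x|lborel. (SUM i:UNIV. pT x $ i * cnj (classical_grad w x $ i)))"
     using i2 by (simp add: classical_grad_def)
    also have "... = vprod T pT (classical_grad w)" unfolding vprod_def
    proof (rule LINT_lborel_of_support[OF T(1), symmetric])
     show "continuous_on UNIV (%x. SUM i:UNIV. pT x $ i * cnj (classical_grad w x $ i))"
      by (intro smooth_continuous smooth_sum smooth_mult smooth_nth smooth_linear[OF bounded_linear_cnj] sp sgw)
     show "(SUM i:UNIV. pT x $ i * cnj (classical_grad w x $ i)) = 0" if "x ~: T" for x
     proof -
      have "x ~: K" using KT that by blast
      then have "classical_grad w x $ i = 0" for i using pz[of x i] by (simp add: classical_grad_def)
      then show ?thesis by simp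
     qed
    qed
    finally show ?thesis .
   qed
   have sI: "sprod T Dh w = complex_of_real I"
   proof -
    obtain K where Kk: "K <= interior T" "!!x. x ~: K ==> w x = 0" using test_funE[OF tw] by metis
    have wz: "w x = 0" if "x ~: T" for x using Kk(1) Kk(2)[of x] that interior_subset[of T] by blast
    have "sprod T Dh w = (LINT x|lborel. Dh x * cnj (w x))" unfolding sprod_def
     by (rule LINT_lborel_of_support[OF T(1)])
      (auto simp: wz intro!: smooth_continuous smooth_mult smooth_pdegv[OF pDh] smooth_linear[OF bounded_linear_cnj sw])
    also have "... = (LINT x|lborel. complex_of_real ((norm (Dh x))\<^sup>2 * bump x0 rho x))"
     by (intro Bochner_Integration.integral_cong refl)
      (simp add: w_def scaleR_conv_of_real complex_norm_square del: of_real_power)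
    finally show ?thesis by (simp only: I_def integral_complex_of_real)
   qed
   \<comment> \<open>The weak divergence of the datum and the classical one of the polynomial part
     add up to the divergence of \<open>q\<close>, so the residual for gradients tests it.\<close>
   have "sprod T df w + sprod T dp w = - vprod Om q (classical_grad w)"
   proof -
    have "sprod T df w = - vprod T f (classical_grad w)" using div tw by (simp add: has_weak_div_def)
    then show ?thesis unfolding qOT[OF gw] dpw vprod_add[OF L(3) L2_test[OF sp(1) T(2,1)] gwL] by simp
   qed
   moreover have "sprod T Dh w = (sprod T df w + sprod T dp w) - sprod T \<delta> w"
   proof -
    note i = sprod_integrable(1)[OF L(4) wL] sprod_integrable(1)[OF dpL(1) wL] sprod_integrable(1)[OF \<delta>L wL]
    have "(%x. Dh x * cnj (w x)) = (%x. (df x * cnj (w x) + dp x * cnj (w x)) - \<delta> x * cnj (w x))"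
     by (auto simp: Dh_def \<delta>_def algebra_simps)
    then show ?thesis unfolding sprod_def
     by (simp only: Bochner_Integration.integral_diff[OF Bochner_Integration.integrable_add[OF i(1,2)] i(3)]
       Bochner_Integration.integral_add[OF i(1,2)])
   qed
   ultimately have "complex_of_real I = - vprod Om q (classical_grad w) - sprod T \<delta> w" using sI by simp
   then have "norm (complex_of_real I) <= norm (vprod Om q (classical_grad w)) + norm (sprod T \<delta> w)"
    by (metis norm_minus_cancel norm_triangle_ineq4)
   then have "I <= norm (vprod Om q (classical_grad w)) + norm (sprod T \<delta> w)" using I0 by simp
   also have "... <= A * (3 * (sqrt Ca * sqrt I / rho)) + L2_norm T \<delta> * (sqrt Ca * sqrt I)"
   proof (rule add_mono)
    show "norm (vprod Om q (classical_grad w)) <= A * (3 * (sqrt Ca * sqrt I / rho))"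
     using H0[rule_format, OF tw sy] mult_left_mono[OF ng A] by linarith
    show "norm (sprod T \<delta> w) <= L2_norm T \<delta> * (sqrt Ca * sqrt I)"
     using sprod_integrable(2)[OF \<delta>L wL] mult_left_mono[OF nw L2_norm_nonneg[of T \<delta>]] by linarith
   qed
   also have "... = (sqrt Ca * (3 * A / rho + L2_norm T \<delta>)) * sqrt I" by (simp add: algebra_simps)
   finally have "sqrt I <= sqrt Ca * (3 * A / rho + L2_norm T \<delta>)"
    using A r Ca(1) L2_norm_nonneg[of T \<delta>] I0 by (intro sqrt_absorb) (auto intro!: mult_nonneg_nonneg add_nonneg_nonneg)
   from mult_left_mono[OF this, of "sqrt Ca"] have "sqrt Ca * sqrt I <= Ca * (3 * A / rho + L2_norm T \<delta>)"
    using Ca(1) by (simp add: mult.assoc[symmetric])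
   with nD have nD': "L2_norm T Dh <= Ca * (3 * A / rho + L2_norm T \<delta>)" by linarith
   have "(%x. df x + (SUM i:UNIV. partial i pT x $ i)) = (%x. Dh x + \<delta> x)" by (auto simp: Dh_def \<delta>_def dp_def)
   then have "L2_norm T (%x. df x + (SUM i:UNIV. partial i pT x $ i)) <= Ca * (3 * A / rho + L2_norm T \<delta>) + L2_norm T \<delta>"
    using L2_add(2)[OF dpL(2) \<delta>L] nD' by simp
   then have "r0 * L2_norm T (%x. df x + (SUM i:UNIV. partial i pT x $ i)) <= r0 * (Ca * (3 * A / (r0 / 2) + L2_norm T \<delta>) + L2_norm T \<delta>)"
    using r0(1) by (intro mult_left_mono) (auto simp: rho_def)
   also have "... <= C * (A + r0 * L2_norm T \<delta>)"
    using C Ca(1) A r0(1) L2_norm_nonneg[of T \<delta>] mult_right_mono[OF C(2) A]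
    by (intro fin) (auto simp: mult.assoc intro: order_trans[rotated])
   finally show ?thesis by (simp add: \<delta>_def[abs_def])
  qed
  show "r0 * L2_norm T (%x. f x + pT x - classical_curl zT x) <= C * ((1 + r0) * A + r0 * L2_norm T (%x. f x - c1))"
  proof -
   define Rh where "Rh x = c1 + pT x - classical_curl zT x" for x
   have pRh: "pdegv d Rh" unfolding Rh_def[abs_def] by (intro pdegv_add pdegv_diff pdegv_curl p pdegv_const)
   define I where "I = (LINT y|lborel. (norm (Rh y))\<^sup>2 * bump x0 rho y)"
   have I0: "I \<ge> 0" unfolding I_def by (rule integral_nonneg_AE) (simp add: bump_bounds)
   define w where "w x = bump x0 rho x *\<^sub>R Rh x" for x
   have sw: "smooth w" unfolding w_def[abs_def] by (intro smooth_scaleR smooth_bump smooth_pdegv[OF pRh])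
   have tw: "test_fun T w" unfolding w_def[abs_def] by (rule test_bump[OF r bi smooth_pdegv[OF pRh]])
   have n1: "(L2_norm T Rh)\<^sup>2 <= Cb * I" "!!G. G : sets lebesgue ==> (L2_norm G w)\<^sup>2 <= Cb * I"
    "!!G i. G : sets lebesgue ==> (L2_norm G (partial i w))\<^sup>2 <= Cb * I / rho\<^sup>2"
    using Cb(2)[OF r pRh, of x0] T(1) TK by (auto simp: Let_def I_def w_def[abs_def])
   have nw: "L2_norm G w <= sqrt Cb * sqrt I" if "G : sets lebesgue" for G
    using real_le_rsqrt[OF n1(2)[OF that]] by (simp add: real_sqrt_mult)
   have nD: "L2_norm T Rh <= sqrt Cb * sqrt I" using real_le_rsqrt[OF n1(1)] by (simp add: real_sqrt_mult)
   have npi: "L2_norm Om (partial i w) <= sqrt Cb * sqrt I / rho" for i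
    using real_le_rsqrt[OF n1(3)[OF OmL, of i]] r by (simp add: real_sqrt_mult real_sqrt_divide)
   have nc: "L2_norm Om (classical_curl w) <= 6 * (sqrt Cb * sqrt I / rho)"
    by (rule L2_norm_curl[OF sw OmL Om(2) npi])
   define \<delta> where "\<delta> x = f x - c1" for x
   have \<delta>L: "L2_on T \<delta>" unfolding \<delta>_def by (intro L2_diff L L2_continuous T continuous_on_const)
   have RhL: "L2_on T Rh" using pRh by (auto intro!: L2_test smooth_pdegv T)
   have wL: "L2_on T w" by (rule L2_test[OF sw T(2,1)])
   have cw: "test_fun T (classical_curl w)" by (rule test_fun_curl[OF tw])
   have czL: "L2_on T (classical_curl zT)" by (intro L2_test smooth_classical_curl sp T)
   have green: "vprod T (classical_curl zT) w = vprod T zT (classical_curl w)"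
    using test_curl_green[OF tw T(1) sp(2)] vprod_cnj by metis
   have sI: "vprod T Rh w = complex_of_real I"
   proof -
    obtain K where Kk: "K <= interior T" "!!x. x ~: K ==> w x = 0" using test_funE[OF tw] by metis
    have wz: "w x = 0" if "x ~: T" for x using Kk(1) Kk(2)[of x] that interior_subset[of T] by blast
    have "vprod T Rh w = (LINT x|lborel. (SUM i:UNIV. Rh x $ i * cnj (w x $ i)))" unfolding vprod_def
    proof (rule LINT_lborel_of_support[OF T(1)])
     show "continuous_on UNIV (%x. SUM i:UNIV. Rh x $ i * cnj (w x $ i))"
      by (intro smooth_continuous smooth_sum smooth_mult smooth_nth smooth_linear[OF bounded_linear_cnj] sw smooth_pdegv[OF pRh])
    qed (simp add: wz)
    also have "... = (LINT x|lborel. complex_of_real ((norm (Rh x))\<^sup>2 * bump x0 rho x))"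
     unfolding w_def smult_square ..
    finally show ?thesis by (simp only: I_def integral_complex_of_real)
   qed
   have "vprod T Rh w = vprod T (%x. (f x + pT x) - classical_curl zT x) w - vprod T \<delta> w"
   proof -
    have "Rh = (%x. ((f x + pT x) - classical_curl zT x) - \<delta> x)" by (auto simp: Rh_def \<delta>_def)
    then show ?thesis using vprod_diff[OF L2_diff(1)[OF fpL czL] \<delta>L wL] by simp
   qed
   also have "vprod T (%x. (f x + pT x) - classical_curl zT x) w = vprod Om q w - vprod Om z (classical_curl w)"
    unfolding vprod_diff[OF fpL czL wL] qOT[OF tw] zOT[OF cw] green ..
   finally have "complex_of_real I = (vprod Om q w - vprod Om z (classical_curl w)) - vprod T \<delta> w" using sI by simp
   then have "norm (complex_of_real I) <= norm (vprod Om q w - vprod Om z (classical_curl w)) + norm (vprod T \<delta> w)"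
    by (metis norm_triangle_ineq4)
   then have "I <= norm (vprod Om q w - vprod Om z (classical_curl w)) + norm (vprod T \<delta> w)" using I0 by simp
   also have "... <= A * (sqrt Cb * sqrt I + 6 * (sqrt Cb * sqrt I / rho)) + L2_norm T \<delta> * (sqrt Cb * sqrt I)"
   proof (rule add_mono)
    show "norm (vprod Om q w - vprod Om z (classical_curl w)) <= A * (sqrt Cb * sqrt I + 6 * (sqrt Cb * sqrt I / rho))"
     using H1[rule_format, OF tw] mult_left_mono[OF add_mono[OF nw[OF OmL] nc] A] by linarith
    show "norm (vprod T \<delta> w) <= L2_norm T \<delta> * (sqrt Cb * sqrt I)"
     using vprod_integrable(2)[OF \<delta>L wL] mult_left_mono[OF nw[OF T(1)] L2_norm_nonneg[of T \<delta>]] by linarith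
   qed
   also have "... = (sqrt Cb * ((rho + 6) * A / rho + L2_norm T \<delta>)) * sqrt I" using r by (simp add: field_simps)
   finally have "sqrt I <= sqrt Cb * ((rho + 6) * A / rho + L2_norm T \<delta>)"
    using A r Cb(1) L2_norm_nonneg[of T \<delta>] I0 by (intro sqrt_absorb) (auto intro!: mult_nonneg_nonneg add_nonneg_nonneg)
   from mult_left_mono[OF this, of "sqrt Cb"] have "sqrt Cb * sqrt I <= Cb * ((rho + 6) * A / rho + L2_norm T \<delta>)"
    using Cb(1) by (simp add: mult.assoc[symmetric])
   with nD have nD': "L2_norm T Rh <= Cb * ((rho + 6) * A / rho + L2_norm T \<delta>)" by linarith
   have "(%x. f x + pT x - classical_curl zT x) = (%x. Rh x + \<delta> x)" by (auto simp: Rh_def \<delta>_def)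
   then have "L2_norm T (%x. f x + pT x - classical_curl zT x) <= Cb * ((rho + 6) * A / rho + L2_norm T \<delta>) + L2_norm T \<delta>"
    using L2_add(2)[OF RhL \<delta>L] nD' by simp
   then have "r0 * L2_norm T (%x. f x + pT x - classical_curl zT x) <= r0 * (Cb * ((r0 / 2 + 6) * A / (r0 / 2) + L2_norm T \<delta>) + L2_norm T \<delta>)"
    using r0(1) by (intro mult_left_mono) (auto simp: rho_def)
   also have "... <= C * ((1 + r0) * A + r0 * L2_norm T \<delta>)"
   proof (rule fin)
    have "2 * (r0 / 2 + 6) * Cb * A = (Cb * (r0 + 12)) * A" by (simp add: algebra_simps)
    also have "... <= (C * (1 + r0)) * A"
    proof (rule mult_right_mono[OF _ A])
     have "Cb * (r0 + 12) = Cb * r0 + 12 * Cb" by (simp add: algebra_simps)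
     also have "... <= C * r0 + C" using C r0(1) by (intro add_mono mult_right_mono) auto
     finally show "Cb * (r0 + 12) <= C * (1 + r0)" by (simp add: algebra_simps)
    qed
    finally show "2 * (r0 / 2 + 6) * Cb * A <= C * ((1 + r0) * A)" by (simp add: mult.assoc)
   qed (use r0 Cb C L2_norm_nonneg in auto)
   finally show ?thesis by (simp add: \<delta>_def[abs_def])
  qed
 qed
qed

section \<open>Estimates on a face\<close>

lemma tdata_smooth:
 assumes g: "smooth g" and T: "T : sets lebesgue" "bounded T"
 shows "tdata T g (%i. partial i g)"
 unfolding tdata_def
proof (intro conjI allI impI)
 show "integrable (lebesgue_on T) g" "!!i. integrable (lebesgue_on T) (partial i g)"
  using g T by (auto intro!: L2_integrable L2_test smooth_partial)
 fix i and psi :: "point => complex" assume t: "test_fun T psi"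
 obtain K where Kk: "smooth psi" "compact K" "K <= interior T" "!!x. x ~: K ==> psi x = 0"
  using test_funE[OF t] by blast
 have KT: "x ~: K" if "x ~: T" for x using Kk(3) interior_subset that by blast
 have pz: "partial i psi x = 0" if "x ~: K" for x
  using Kk that by (intro partial_zero_outside[of K]) (auto intro: compact_imp_closed)
 have sc: "smooth (%x. cnj (psi x))" by (rule smooth_linear[OF bounded_linear_cnj Kk(1)])
 have dc: "partial i (%x. cnj (psi x)) x = cnj (partial i psi x)" for x
  by (rule partial_linear[OF bounded_linear_cnj smooth_differentiable[OF Kk(1)]])
 have "sprod T (partial i g) psi = (LINT x|lborel. partial i g x * cnj (psi x))" unfolding sprod_def using Kk KT
  by (intro LINT_lborel_of_support[OF T(1)]) (auto intro!: smooth_continuous smooth_mult smooth_partial g sc)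
 also have "... = - (LINT x|lborel. g x * cnj (partial i psi x))"
  using integral_by_parts[OF sc g Kk(2), of i] Kk(4) by (simp add: dc mult.commute)
 also have "(LINT x|lborel. g x * cnj (partial i psi x)) = sprod T g (partial i psi)" unfolding sprod_def using pz KT
  by (intro LINT_lborel_of_support[OF T(1), symmetric])
   (auto intro!: smooth_continuous smooth_mult smooth_linear[OF bounded_linear_cnj] smooth_partial Kk(1) g)
 finally show "sprod T (partial i g) psi = - sprod T g (partial i psi)" .
qed

text \<open>Traces are controlled on the open triangle, so measurability is stated for the function
  cut off there; the boundary of the triangle is a null set.\<close>

definition cut :: "(real \<times> real => 'b::zero) => real \<times> real => 'b" where
 "cut F z = (if z : tri_open then F z else 0)"

lemma tri_integral:
 fixes F :: "real \<times> real => 'b::euclidean_space"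
 assumes F: "cut F : borel_measurable lebesgue"
 shows "(LINT z|lebesgue_on tri. (norm (F z))\<^sup>2) = (LINT z|lebesgue. (norm (cut F z))\<^sup>2)"
proof -
 have m: "(%z. (norm (cut F z))\<^sup>2) : borel_measurable lebesgue" using F by measurable
 have ae: "AE z in lebesgue. (norm (cut F z))\<^sup>2 = indicator tri z *\<^sub>R (norm (F z))\<^sup>2"
  using tri_AE by eventually_elim (use tri_open_subset in \<open>auto simp: cut_def\<close>)
 have "(LINT z|lebesgue_on tri. (norm (F z))\<^sup>2) = (LINT z|lebesgue. indicator tri z *\<^sub>R (norm (F z))\<^sup>2)"
  by (rule LINT_lebesgue_on[OF tri_lebesgue])
 also have "... = (LINT z|lebesgue. (norm (cut F z))\<^sup>2)"
  using ae by (intro integral_cong_AE borel_measurable_AE_eq[OF m ae] m) (auto elim: eventually_mono)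
 finally show ?thesis .
qed

lemma tri_measure_le: "measure lebesgue tri <= 1" "emeasure lebesgue tri < \<infinity>"
proof -
 have sub: "tri <= cbox (0, 0) (1, 1)" by (auto simp: tri_def cbox_Pair_eq)
 have "measure lebesgue tri <= measure lebesgue (cbox (0, 0) (1, 1) :: (real \<times> real) set)"
  using sub tri_lebesgue by (intro measure_mono_fmeasurable) auto
 also have "... = 1" by (subst measure_completion) (auto simp only: content_Pair content_real, auto)
 finally show "measure lebesgue tri <= 1" .
 show "emeasure lebesgue tri < \<infinity>"
  using emeasure_bounded_finite[OF compact_imp_bounded[OF compact_tri]] compact_tri by (simp add: borel_compact)
qed

context tet
begin

lemma Ph_tri: "z : tri ==> Ph (z, 0) : S" by (rule S_mem) (auto simp: l_Ph tri_def)

lemma continuous_Ph0: "continuous_on UNIV F ==> continuous_on UNIV (%z. F (Ph (z, 0)))"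
 by (rule continuous_on_compose2) (auto simp: Ph_def intro!: continuous_intros)

lemma cut_continuous:
 fixes F :: "point => 'b::euclidean_space"
 assumes "continuous_on UNIV F"
 shows "cut (%z. F (Ph (z, 0))) : borel_measurable lebesgue"
  and "integrable lebesgue (cut (%z. F (Ph (z, 0))))"
  and "integrable lebesgue (%z. (norm (cut (%z. F (Ph (z, 0))) z))\<^sup>2)"
proof -
 note c = continuous_Ph0[OF assms]
 have i: "integrable lborel (%z. indicator tri z *\<^sub>R G z)" if "continuous_on UNIV G" for G :: "real \<times> real => 'c::euclidean_space"
  by (rule borel_integrable_compact[OF compact_tri continuous_on_subset[OF that]]) simp
 have i': "integrable lebesgue (cut G)" if G: "continuous_on UNIV G" for G :: "real \<times> real => 'c::euclidean_space"
 proof -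
  have "integrable lborel (%z. indicator tri_open z *\<^sub>R (indicator tri z *\<^sub>R G z))"
   by (rule integrable_mult_indicator[OF _ i[OF G]]) (simp add: open_tri_open borel_open)
  moreover have "(%z. indicator tri_open z *\<^sub>R (indicator tri z *\<^sub>R G z)) = cut G"
   using tri_open_subset by (auto simp: cut_def fun_eq_iff)
  ultimately have "integrable lborel (cut G)" by simp
  then show ?thesis by (simp add: integrable_completion)
 qed
 show "integrable lebesgue (cut (%z. F (Ph (z, 0))))" by (rule i'[OF c])
 then show "cut (%z. F (Ph (z, 0))) : borel_measurable lebesgue" by simp
 have "integrable lebesgue (cut (%z. (norm (F (Ph (z, 0))))\<^sup>2))" by (rule i') (intro continuous_intros c)
 moreover have "cut (%z. (norm (F (Ph (z, 0))))\<^sup>2) = (%z. (norm (cut (%z. F (Ph (z, 0))) z))\<^sup>2)"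
  by (auto simp: cut_def)
 ultimately show "integrable lebesgue (%z. (norm (cut (%z. F (Ph (z, 0))) z))\<^sup>2)" by simp
qed

text \<open>The norm on the face in its coordinates, with \<open>J\<close> as surface element; it
  coincides with \<open>face_L2_norm\<close> for the vertex numbering chosen there.\<close>

definition fnorm :: "(real \<times> real => 'b::euclidean_space) => real" where
 "fnorm F = sqrt (J * (LINT z|lebesgue_on tri. (norm (F z))\<^sup>2))"

lemma fnorm_nonneg: "0 <= fnorm F" using J_pos by (simp add: fnorm_def)

text \<open>The polynomial on the face is extended constantly in the normal direction, so that a
 one-dimensional integral relates the bubble norms on the ball and on the face.\<close>

lemma face_bubble:
 fixes Jp :: "point => 'b::euclidean_space"
 assumes bc: "bubble_const K d TYPE('b) C" and K: "K \<ge> 1" "diameter T <= K * rho"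
  and p: "pdegv d Jp" and b: "r0 > 0" "cball x0 r0 <= T" and r: "rho > 0" "rho < 2 * r0 / 3"
 defines "w \<equiv> %x. bump m rho x *\<^sub>R Jp (Ph ((l1 x, l2 x), 0))"
  and "I \<equiv> J * (LINT z|lebesgue. (norm (Jp (Ph (z, 0))))\<^sup>2 * bump m rho (Ph (z, 0)))"
 shows "symm w" "!!x. x ~: cball m rho ==> w x = 0"
  "!!z. w (Ph (z, 0)) = bump m rho (Ph (z, 0)) *\<^sub>R Jp (Ph (z, 0))" "0 <= I"
  "!!G. G : sets lebesgue ==> L2_norm G w <= sqrt (2 * C) * sqrt I * sqrt rho"
  "!!G i. G : sets lebesgue ==> L2_norm G (partial i w) <= sqrt (2 * C) * sqrt I / sqrt rho"
  "fnorm (%z. Jp (Ph (z, 0))) <= K * sqrt (2 * C) * sqrt I"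
  "J * (LINT z|lebesgue. (norm (cut (%z. w (Ph (z, 0))) z))\<^sup>2) <= I"
  "!!z. z ~: tri_open ==> bump m rho (Ph (z, 0)) = 0"
proof -
 define Q where "Q x = Jp (Ph ((l1 x, l2 x), 0))" for x
 \<comment> \<open>Constant extension along \<open>n\<close> is composition with an affine
   projection onto the plane, so the degree bound is preserved.\<close>
 have Q_eq: "Q = (%x. Jp ((m \<bullet> n) *\<^sub>R n + (x - (x \<bullet> n) *\<^sub>R n)))"
 proof
  fix x
  have e: "Ph ((l1 x, l2 x), 0) = x + l3 x *\<^sub>R n" using Ph_l[of x] by (simp add: Ph_def algebra_simps)
  have "l3 x = (m \<bullet> n) - x \<bullet> n" using l_mean(3) by (simp add: l3_def inner_diff_left)
  then show "Q x = Jp ((m \<bullet> n) *\<^sub>R n + (x - (x \<bullet> n) *\<^sub>R n))"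
   unfolding Q_def e \<open>l3 x = _\<close> by (simp add: algebra_simps)
 qed
 have bl: "bounded_linear (%x. x - (x \<bullet> n) *\<^sub>R n)"
  by (intro bounded_linear_sub bounded_linear_ident bounded_linear_compose[OF bounded_linear_scaleR_left]
    bounded_linear_inner_left)
 have pQ: "pdegv d Q" unfolding Q_eq by (rule pdegv_affine[OF bl p])
 have wQ: "w = (%x. bump m rho x *\<^sub>R Q x)" by (simp add: w_def Q_def)
 show sw: "symm w" unfolding wQ by (intro symm_scaleR symm_bump symm_pdegv[OF pQ])
 show wz: "w x = 0" if "x ~: cball m rho" for x using that r by (simp add: w_def bump_zero)
 show wPh: "w (Ph (z, 0)) = bump m rho (Ph (z, 0)) *\<^sub>R Jp (Ph (z, 0))" for z by (simp add: w_def l_Ph)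
 show bz: "bump m rho (Ph (z, 0)) = 0" if "z ~: tri_open" for z
 proof (rule bump_zero[OF r(1)], rule notI)
  assume "Ph (z, 0) : ball m rho"
  then have "dist m (Ph (z, 0)) < 2 * r0 / 3" using r by simp
  from plane_ball[OF b this] have "z : tri_open" by (simp add: l_Ph tri_open_def)
  then show False using that by simp
 qed
 have C: "C > 0" using bc by (simp add: bubble_const_def)
 define I3 where "I3 = (LINT y|lborel. (norm (Q y))\<^sup>2 * bump m rho y)"
 have bQ: "!!x. x : cball m (K * rho) ==> (norm (Q x))\<^sup>2 <= C / rho ^ 3 * I3"
  "!!G. G : sets lebesgue ==> (L2_norm G w)\<^sup>2 <= C * I3"
  "!!G i. G : sets lebesgue ==> (L2_norm G (partial i w))\<^sup>2 <= C * I3 / rho\<^sup>2"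
  using bc r(1) pQ unfolding bubble_const_def wQ I3_def Let_def by blast+
 define F where "F z = (norm (Jp (Ph (z, 0))))\<^sup>2 * bump m rho (Ph (z, 0))" for z
 have F0: "0 <= F z" for z by (simp add: F_def bump_bounds)
 have cJ: "continuous_on UNIV Jp" by (rule smooth_continuous[OF smooth_pdegv[OF p]])
 have cF: "continuous_on UNIV F"
  unfolding F_def by (intro continuous_intros continuous_Ph0 cJ smooth_continuous[OF smooth_bump])
 have Fz: "F z = 0" if "z ~: tri" for z using bz[of z] that tri_open_subset by (auto simp: F_def)
 have iF: "integrable lborel F" by (rule integrable_compact_support[OF cF compact_tri Fz])
 have I_eq: "I = J * (LINT z|lborel. F z)" using iF by (simp add: I_def F_def[abs_def] integral_completion)
 show I0: "0 <= I" unfolding I_eq using J_pos F0 by simp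
 \<comment> \<open>On a normal line the bump is largest at its foot and vanishes beyond height rho,
   so the line integral is at most 2 rho times the value on the face. One power of rho is gained
   over the element estimates.\<close>
 have I3: "I3 <= 2 * rho * I"
 proof -
  have iQ: "integrable lborel (%y. (norm (Q y))\<^sup>2 * bump m rho y)"
   by (rule integrable_bump_poly[OF r(1) smooth_continuous[OF smooth_pdegv[OF pQ]]])
  have inner: "(LINT t|lborel. (norm (Q (Ph (z, t))))\<^sup>2 * bump m rho (Ph (z, t))) <= 2 * rho * F z" for z
  proof -
   have QP: "Q (Ph (z, t)) = Jp (Ph (z, 0))" for t by (simp add: Q_def l_Ph)
   have nt: "(Ph (z, t) - m) \<bullet> (Ph (z, t) - m) = (Ph (z, 0) - m) \<bullet> (Ph (z, 0) - m) + t\<^sup>2" for t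
   proof -
    have "(Ph (z, 0) - m) \<bullet> n = - l3 (Ph (z, 0)) + l3 m" by (simp add: l3_def inner_diff_left)
    then have o: "(Ph (z, 0) - m) \<bullet> n = 0" by (simp add: l_Ph l_mean)
    have "Ph (z, t) - m = (Ph (z, 0) - m) - t *\<^sub>R n" by (simp add: Ph_def)
    then show ?thesis using o nn by (simp add: inner_diff_left inner_diff_right inner_commute power2_eq_square)
   qed
   have bt: "bump m rho (Ph (z, t)) <= indicator {-rho..rho} t * bump m rho (Ph (z, 0))" for t
   proof (cases "t : {-rho..rho}")
    case True
    have "bump m rho (Ph (z, t)) <= bump m rho (Ph (z, 0))"
     unfolding bump_def nt[of t] by (intro flat_mono diff_mono divide_right_mono) auto
    with True show ?thesis by simp
   next
    case False
    then have "rho <= \<bar>t\<bar>" by auto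
    then have "rho\<^sup>2 <= t\<^sup>2" using power_mono[of rho "\<bar>t\<bar>" 2] r(1) by simp
    then have "rho\<^sup>2 <= (Ph (z, t) - m) \<bullet> (Ph (z, t) - m)" unfolding nt[of t] by (intro add_increasing) auto
    then have "rho\<^sup>2 <= (norm (Ph (z, t) - m))\<^sup>2" by (simp only: power2_norm_eq_inner)
    then have "rho <= norm (Ph (z, t) - m)" by (rule power2_le_imp_le) simp
    then have "bump m rho (Ph (z, t)) = 0" by (intro bump_zero[OF r(1)]) (simp add: dist_norm norm_minus_commute)
    with False show ?thesis by simp
   qed
   have ind: "integrable lborel (%t::real. indicator {-rho..rho} t :: real)" by (rule integrable_real_indicator) (auto simp: emeasure_lborel_Icc_eq)
   have "(LINT t|lborel. (norm (Q (Ph (z, t))))\<^sup>2 * bump m rho (Ph (z, t))) <= (LINT t|lborel. indicator {-rho..rho} t * F z)"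
   proof (rule integral_mono_AE')
    show "AE t in lborel. (norm (Q (Ph (z, t))))\<^sup>2 * bump m rho (Ph (z, t)) <= indicator {-rho..rho} t * F z"
    proof (rule AE_I2)
     fix t
     show "(norm (Q (Ph (z, t))))\<^sup>2 * bump m rho (Ph (z, t)) <= indicator {-rho..rho} t * F z"
      using mult_left_mono[OF bt[of t], of "(norm (Jp (Ph (z, 0))))\<^sup>2"] by (simp add: QP F_def mult_ac)
    qed
   qed (auto simp: F0 ind)
   also have "... = 2 * rho * F z" using r(1) by simp
   finally show ?thesis .
  qed
  have "I3 = J *\<^sub>R (LINT z|lborel. LINT t|lborel. (norm (Q (Ph (z, t))))\<^sup>2 * bump m rho (Ph (z, t)))"
   unfolding I3_def by (rule Fubini_Ph(1)[OF iQ])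
  also have "... <= J *\<^sub>R (LINT z|lborel. 2 * rho * F z)"
   using J_pos inner by (intro scaleR_left_mono integral_mono Fubini_Ph(3)[OF iQ] integrable_mult_right iF) auto
  finally show ?thesis by (simp add: I_eq mult_ac)
 qed
 have CI: "C * I3 <= (2 * C) * I * rho" using mult_left_mono[OF I3, of C] C by (simp add: mult_ac)
 show "L2_norm G w <= sqrt (2 * C) * sqrt I * sqrt rho" if "G : sets lebesgue" for G
  using real_le_rsqrt[OF order_trans[OF bQ(2)[OF that] CI]] by (simp add: real_sqrt_mult)
 show "L2_norm G (partial i w) <= sqrt (2 * C) * sqrt I / sqrt rho" if "G : sets lebesgue" for G i
 proof -
  have "C * I3 / rho\<^sup>2 <= (2 * C) * I * rho / rho\<^sup>2" using CI by (rule divide_right_mono) simp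
  also have "... = (2 * C) * I / rho" using r(1) by (simp add: power2_eq_square)
  finally have "(L2_norm G (partial i w))\<^sup>2 <= (2 * C) * I / rho" using bQ(3)[OF that, of i] by linarith
  from real_le_rsqrt[OF this] show ?thesis by (simp add: real_sqrt_mult real_sqrt_divide)
 qed
 show "fnorm (%z. Jp (Ph (z, 0))) <= K * sqrt (2 * C) * sqrt I"
 proof -
  \<comment> \<open>The supremum bound C rho^(-3) times \<open>I3\<close>, with \<open>I3\<close>
    replaced by 2 rho I. The area factor J <= (K rho)^2 cancels the remaining powers of rho.\<close>
  define B where "B = C / rho ^ 3 * (2 * rho * I)"
  have B0: "0 <= B" using C r(1) I0 by (simp add: B_def)
  have pt: "(norm (Jp (Ph (z, 0))))\<^sup>2 <= B" if z: "z : tri" for z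
  proof -
   have "Ph (z, 0) : T" using Ph_tri[OF z] S_subset_T by blast
   then have "Ph (z, 0) : cball m (K * rho)" using T_subset_ball K(2) by force
   from bQ(1)[OF this] have "(norm (Jp (Ph (z, 0))))\<^sup>2 <= C / rho ^ 3 * I3" by (simp add: Q_def l_Ph)
   also have "... <= B" unfolding B_def using C r(1) I3 by (intro mult_left_mono) auto
   finally show ?thesis .
  qed
  have "(LINT z|lebesgue_on tri. (norm (Jp (Ph (z, 0))))\<^sup>2) <= (LINT z|lebesgue. B * indicator tri z)"
   unfolding LINT_lebesgue_on[OF tri_lebesgue]
  proof (rule integral_mono_AE')
   show "integrable lebesgue (%z. B * indicator tri z)"
    using tri_measure_le(2) tri_lebesgue by (intro integrable_mult_right integrable_real_indicator) auto
   show "AE z in lebesgue. indicator tri z *\<^sub>R (norm (Jp (Ph (z, 0))))\<^sup>2 <= B * indicator tri z"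
    using pt by (intro AE_I2) (auto simp: indicator_def)
  qed (use B0 in auto)
  also have "... <= B" using tri_measure_le(1) B0 by (simp add: mult_left_le)
  finally have l: "(LINT z|lebesgue_on tri. (norm (Jp (Ph (z, 0))))\<^sup>2) <= B" .
  have "J <= (K * rho)\<^sup>2"
  proof -
   have "0 <= diameter T" using diameter_ge_0[OF compact_imp_bounded[OF compact_T]] .
   then show ?thesis using power_mono[OF K(2), of 2] J_bound by linarith
  qed
  then have "J * (LINT z|lebesgue_on tri. (norm (Jp (Ph (z, 0))))\<^sup>2) <= (K * rho)\<^sup>2 * B"
   using l by (intro mult_mono) auto
  also have "... = K\<^sup>2 * (2 * C) * I"
   using r(1) by (simp add: B_def power_mult_distrib field_simps eval_nat_numeral)
  finally have "J * (LINT z|lebesgue_on tri. (norm (Jp (Ph (z, 0))))\<^sup>2) <= K\<^sup>2 * (2 * C) * I" .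
  then have "fnorm (%z. Jp (Ph (z, 0))) <= sqrt (K\<^sup>2 * (2 * C) * I)" unfolding fnorm_def by (rule real_sqrt_le_mono)
  then show ?thesis using K(1) by (simp add: real_sqrt_mult)
 qed
 show "J * (LINT z|lebesgue. (norm (cut (%z. w (Ph (z, 0))) z))\<^sup>2) <= I"
 proof -
  have "(LINT z|lebesgue. (norm (cut (%z. w (Ph (z, 0))) z))\<^sup>2) <= (LINT z|lebesgue. F z)"
  proof (rule integral_mono_AE')
   show "integrable lebesgue F" using iF by (simp add: integrable_completion)
   show "AE z in lebesgue. (norm (cut (%z. w (Ph (z, 0))) z))\<^sup>2 <= F z"
   proof (rule AE_I2)
    fix z
    have "(bump m rho (Ph (z, 0)))\<^sup>2 <= bump m rho (Ph (z, 0))"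
     using bump_bounds[of m rho "Ph (z, 0)"] by (simp add: power2_eq_square mult_left_le)
    from mult_left_mono[OF this zero_le_power2[of "norm (Jp (Ph (z, 0)))"]]
    show "(norm (cut (%z. w (Ph (z, 0))) z))\<^sup>2 <= F z"
     using F0[of z] by (auto simp: cut_def wPh F_def power_mult_distrib mult.commute)
   qed
  qed (auto simp: F0)
  then show ?thesis unfolding I_def F_def[abs_def] using J_pos by (intro mult_left_mono) auto
 qed
qed

lemma green_div:
 assumes td: "!!i. tdata T (%x. g x $ i) (Gd i)" and L: "L2_on T g" "!!i. L2_on T (Gd i i)"
  and b: "r0 > 0" "cball x0 r0 <= T" "rho > 0" "rho < 2 * r0 / 3"
  and w: "smooth w" "!!x. x ~: cball m rho ==> w x = 0"
 defines "t \<equiv> %z. SUM i:UNIV. n $ i *\<^sub>R tr (%x. g x $ i) z"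
 shows "sprod T (%x. SUM i:UNIV. Gd i i x) w + vprod T g (classical_grad w)
   = J *\<^sub>R (LINT z|lebesgue. cut t z * cnj (w (Ph (z, 0))))"
  and "integrable lebesgue (%z. cut t z * cnj (w (Ph (z, 0))))"
  and "cut t : borel_measurable lebesgue"
proof -
 note bT = compact_imp_bounded[OF compact_T]
 have sc: "smooth (%x. cnj (w x))" by (rule smooth_linear[OF bounded_linear_cnj w(1)])
 have cz: "cnj (w x) = 0" if "x ~: cball m rho" for x using w(2)[OF that] by simp
 have dc: "partial i (%x. cnj (w x)) x = cnj (partial i w x)" for i x
  by (rule partial_linear[OF bounded_linear_cnj smooth_differentiable[OF w(1)]])
 have wL: "L2_on T w" "L2_on T (partial i w)" for i using w(1) bT T_sets by (auto intro!: L2_test smooth_partial)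
 note gf = green_face[OF td b(1,2) sc b(3,4) cz, unfolded dc]
 define k where "k i z = indicator tri_open z *\<^sub>R (tr (%x. g x $ i) z * cnj (w (Ph (z, 0))))" for i z
 have eq: "cut t z * cnj (w (Ph (z, 0))) = (SUM i:UNIV. n $ i *\<^sub>R k i z)" for z
  by (simp add: cut_def t_def k_def sum_distrib_right)
 have ik: "integrable lebesgue (k i)" for i using gf(1)[of i] by (simp add: k_def[abs_def])
 show "integrable lebesgue (%z. cut t z * cnj (w (Ph (z, 0))))"
  unfolding eq by (intro Bochner_Integration.integrable_sum integrable_scaleR_right ik)
 have "cut t = (%z. SUM i:UNIV. n $ i *\<^sub>R (if z : tri_open then tr (%x. g x $ i) z else 0))"
  by (auto simp: cut_def t_def fun_eq_iff)
 then show "cut t : borel_measurable lebesgue"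
  using trace_measurable[OF td] by (simp add: borel_measurable_sum borel_measurable_scaleR)
 have i1: "integrable (lebesgue_on T) (%x. Gd i i x * cnj (w x))"
  "integrable (lebesgue_on T) (%x. g x $ i * cnj (partial i w x))" for i
  by (rule sprod_integrable(1)[OF L(2) wL(1)], rule sprod_integrable(1)[OF L2_nth[OF L(1)] wL(2)])
 have "sprod T (%x. SUM i:UNIV. Gd i i x) w = (SUM i:UNIV. LINT x|lebesgue_on T. Gd i i x * cnj (w x))"
  unfolding sprod_def sum_distrib_right using i1 by simp
 moreover have "vprod T g (classical_grad w) = (SUM i:UNIV. LINT x|lebesgue_on T. g x $ i * cnj (partial i w x))"
  unfolding vprod_def using i1 by (simp add: classical_grad_def)
 moreover have "(LINT x|lebesgue_on T. Gd i i x * cnj (w x)) + (LINT x|lebesgue_on T. g x $ i * cnj (partial i w x))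
   = n $ i *\<^sub>R (J *\<^sub>R (LINT z|lebesgue. k i z))" for i using gf(2)[of i i] i1 by (simp add: k_def)
 ultimately have "sprod T (%x. SUM i:UNIV. Gd i i x) w + vprod T g (classical_grad w)
   = (SUM i:UNIV. n $ i *\<^sub>R (J *\<^sub>R (LINT z|lebesgue. k i z)))" by (simp add: sum.distrib[symmetric])
 also have "... = J *\<^sub>R (LINT z|lebesgue. cut t z * cnj (w (Ph (z, 0))))"
  unfolding eq using ik by (simp add: scaleR_sum_right mult.commute)
 finally show "sprod T (%x. SUM i:UNIV. Gd i i x) w + vprod T g (classical_grad w)
   = J *\<^sub>R (LINT z|lebesgue. cut t z * cnj (w (Ph (z, 0))))" .
qed

text \<open>Each product of one component with a derivative of another obeys the scalar formula
  \<open>E\<close>; the six index combinations of the curl assemble to the boundary term. The minus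
  sign is due to \<open>ccross\<close> having the normal as its second factor.\<close>

lemma green_curl:
 assumes z: "smooth zT" and b: "r0 > 0" "cball x0 r0 <= T" "rho > 0" "rho < 2 * r0 / 3"
  and w: "smooth w" "!!x. x ~: cball m rho ==> w x = 0"
 defines "t \<equiv> %z. SUM k:UNIV. ccross (zT (Ph (z, 0))) (of_real_vec n) $ k * cnj (w (Ph (z, 0)) $ k)"
 shows "vprod T (classical_curl zT) w - vprod T zT (classical_curl w) = - (J *\<^sub>R (LINT z|lebesgue. cut t z))"
  and "integrable lebesgue (cut t)"
proof -
 note bT = compact_imp_bounded[OF compact_T]
 have sw: "smooth (%x. w x $ j)" and sz: "smooth (%x. zT x $ j)" for j using w(1) z by (auto intro: smooth_nth)
 have sc: "smooth (%x. cnj (w x $ j))" for j by (rule smooth_linear[OF bounded_linear_cnj sw])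
 have cz: "cnj (w x $ j) = 0" if "x ~: cball m rho" for x j using w(2)[OF that] by simp
 have dc: "partial i (%x. cnj (w x $ j)) x = cnj (partial i w x $ j)" for i j x
  using partial_linear[OF bounded_linear_cnj smooth_differentiable[OF sw]] partial_nth[OF w(1)] by metis
 have dz: "partial i (%x. zT x $ j) x = partial i zT x $ j" for i j x by (rule partial_nth[OF z])
 have tz: "tr (%x. zT x $ k) y = zT (Ph (y, 0)) $ k" for k y
  by (rule trI[OF Ph_line_cont[OF smooth_continuous[OF sz]]])
 note gf = green_face[OF tdata_smooth[OF sz T_sets bT] b(1,2) sc b(3,4) cz, unfolded dc dz tz]
 define Q where "Q k j = (LINT y|lebesgue. indicator tri_open y *\<^sub>R (zT (Ph (y, 0)) $ k * cnj (w (Ph (y, 0)) $ j)))" for k j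
 have iQ: "integrable lebesgue (%y. indicator tri_open y *\<^sub>R (zT (Ph (y, 0)) $ k * cnj (w (Ph (y, 0)) $ j)))" for k j
  using gf(1)[of k j] by simp
 define D where "D i k j = (LINT x|lebesgue_on T. partial i zT x $ k * cnj (w x $ j))" for i k j
 define F where "F i k j = (LINT x|lebesgue_on T. zT x $ k * cnj (partial i w x $ j))" for i k j
 have wL: "L2_on T (%x. w x $ j)" "L2_on T (%x. partial i w x $ j)" "L2_on T (%x. zT x $ j)" "L2_on T (%x. partial i zT x $ j)" for i j
  using w(1) z bT T_sets by (auto intro!: L2_test smooth_partial smooth_nth)
 note iD = sprod_integrable(1)[OF wL(4) wL(1)]
 note iF = sprod_integrable(1)[OF wL(3) wL(2)]
 have E: "D i k j + F i k j = n $ i *\<^sub>R (J *\<^sub>R Q k j)" for i k j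
  using gf(2)[of i k j] iD iF by (simp add: D_def F_def Q_def)
 have c1: "vprod T (classical_curl zT) w = D 2 3 1 - D 3 2 1 + (D 3 1 2 - D 1 3 2) + (D 1 2 3 - D 2 1 3)"
  unfolding vprod_def sum_3 classical_curl_nth left_diff_distrib D_def using iD by simp
 have c2: "vprod T zT (classical_curl w) = F 2 1 3 - F 3 1 2 + (F 3 2 1 - F 1 2 3) + (F 1 3 2 - F 2 3 1)"
  unfolding vprod_def sum_3 classical_curl_nth complex_cnj_diff right_diff_distrib F_def using iF by simp
 have te: "cut t = (%y.
   (n $ 3 *\<^sub>R (indicator tri_open y *\<^sub>R (zT (Ph (y, 0)) $ 2 * cnj (w (Ph (y, 0)) $ 1)))
   - n $ 2 *\<^sub>R (indicator tri_open y *\<^sub>R (zT (Ph (y, 0)) $ 3 * cnj (w (Ph (y, 0)) $ 1))))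
   + (n $ 1 *\<^sub>R (indicator tri_open y *\<^sub>R (zT (Ph (y, 0)) $ 3 * cnj (w (Ph (y, 0)) $ 2)))
   - n $ 3 *\<^sub>R (indicator tri_open y *\<^sub>R (zT (Ph (y, 0)) $ 1 * cnj (w (Ph (y, 0)) $ 2))))
   + (n $ 2 *\<^sub>R (indicator tri_open y *\<^sub>R (zT (Ph (y, 0)) $ 1 * cnj (w (Ph (y, 0)) $ 3)))
   - n $ 1 *\<^sub>R (indicator tri_open y *\<^sub>R (zT (Ph (y, 0)) $ 2 * cnj (w (Ph (y, 0)) $ 3)))))"
  by (auto simp: cut_def t_def sum_3 ccross_def of_real_vec_def scaleR_conv_of_real[where 'a = complex] algebra_simps)
 show "integrable lebesgue (cut t)"
  unfolding te by (intro Bochner_Integration.integrable_add Bochner_Integration.integrable_diff integrable_scaleR_right iQ)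
 have "(LINT y|lebesgue. cut t y) = (n $ 3 *\<^sub>R Q 2 1 - n $ 2 *\<^sub>R Q 3 1) + (n $ 1 *\<^sub>R Q 3 2 - n $ 3 *\<^sub>R Q 1 2)
   + (n $ 2 *\<^sub>R Q 1 3 - n $ 1 *\<^sub>R Q 2 3)" unfolding te Q_def using iQ
  by (simp only: Bochner_Integration.integral_add Bochner_Integration.integral_diff Bochner_Integration.integrable_add
    Bochner_Integration.integrable_diff integrable_scaleR_right integral_scaleR_right)
 note this' = this
 have "- (J *\<^sub>R (LINT y|lebesgue. cut t y)) = (D 2 3 1 + F 2 3 1) - (D 3 2 1 + F 3 2 1) + ((D 3 1 2 + F 3 1 2) - (D 1 3 2 + F 1 3 2))
   + ((D 1 2 3 + F 1 2 3) - (D 2 1 3 + F 2 1 3))" unfolding E this' by (simp add: scaleR_conv_of_real algebra_simps)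
 then show "vprod T (classical_curl zT) w - vprod T zT (classical_curl w) = - (J *\<^sub>R (LINT z|lebesgue. cut t z))"
  unfolding c1 c2 by simp
qed

end

text \<open>Both elements use the same numbering of the vertices of the common face and opposite
  normals. Their face coordinates then differ by the sign of the height alone, so traces from both
  sides are functions on one triangle.\<close>

locale face_pair = A: tet p q r n v + B: tet p q r "- n" v' for p q r n v v' :: point +
 fixes Om :: "point set" and x0 x1 :: point and r0 r1 rho :: real
 assumes Om: "open Om" "bounded Om" "interior (A.T Un B.T) <= Om"
  and ballA: "r0 > 0" "cball x0 r0 <= A.T" and ballB: "r1 > 0" "cball x1 r1 <= B.T"
  and rho: "rho > 0" "rho < 2 * r0 / 3" "rho < 2 * r1 / 3"
begin

lemma OmL: "Om : sets lebesgue" using Om(1) by (simp add: borel_open)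

lemma opposite: "B.Ph (z, t) = A.Ph (z, - t)" "B.l3 x = - A.l3 x"
 by (simp_all add: A.Ph_def B.Ph_def A.l3_def B.l3_def)

lemma cover: "dist A.m x < 2 * r0 / 3 ==> dist A.m x < 2 * r1 / 3 ==> x : A.T Un B.T"
 using A.half_ball_T[OF ballA, of x] B.half_ball_T[OF ballB, of x] linear[of 0 "A.l3 x"] by (auto simp: opposite)

lemma ball_interior: "cball A.m rho <= interior (A.T Un B.T)"
proof -
 have "ball A.m (min (2 * r0 / 3) (2 * r1 / 3)) <= A.T Un B.T" by (intro subsetI cover) auto
 then have "ball A.m (min (2 * r0 / 3) (2 * r1 / 3)) <= interior (A.T Un B.T)" by (rule interior_maximal) simp
 moreover have "cball A.m rho <= ball A.m (min (2 * r0 / 3) (2 * r1 / 3))" using rho by auto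
 ultimately show ?thesis by blast
qed

lemma ball_Om: "cball A.m rho <= Om" using ball_interior Om(3) by blast

lemma test_Om:
 assumes "smooth w" "!!x. x ~: cball A.m rho ==> w x = 0"
 shows "test_fun Om w" "x ~: A.T Un B.T ==> w x = 0"
proof -
 show "test_fun Om w"
  using assms ball_Om Om(1) by (intro test_funI[where K = "cball A.m rho"]) (auto simp: interior_open)
 have "cball A.m rho <= A.T Un B.T" using ball_interior interior_subset by blast
 then show "w x = 0" if "x ~: A.T Un B.T" using that by (intro assms(2)) blast
qed

text \<open>Within the ball of radius rho around the centroid the two half balls fill the domain and
  overlap in the plane of the face, a null set.\<close>

lemma split_integral:
 fixes F :: "point => complex"
 assumes i: "integrable (lebesgue_on Om) F" "integrable (lebesgue_on A.T) F" "integrable (lebesgue_on B.T) F"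
  and z: "!!x. x ~: cball A.m rho ==> F x = 0"
 shows "(LINT x|lebesgue_on Om. F x) = (LINT x|lebesgue_on A.T. F x) + (LINT x|lebesgue_on B.T. F x)"
proof -
 have i': "integrable lebesgue (%x. indicator Om x *\<^sub>R F x)" "integrable lebesgue (%x. indicator A.T x *\<^sub>R F x)"
  "integrable lebesgue (%x. indicator B.T x *\<^sub>R F x)"
  using i OmL A.T_sets B.T_sets by (simp_all add: integrable_lebesgue_on_iff)
 have "(LINT x|lebesgue. indicator Om x *\<^sub>R F x) = (LINT x|lebesgue. indicator A.T x *\<^sub>R F x + indicator B.T x *\<^sub>R F x)"
 proof (rule integral_cong_AE)
  show "AE x in lebesgue. indicator Om x *\<^sub>R F x = indicator A.T x *\<^sub>R F x + indicator B.T x *\<^sub>R F x"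
   using A.plane_AE unfolding AE_lebesgue_iff
  proof eventually_elim
   case (elim x)
   show ?case
   proof (cases "x : cball A.m rho")
    case True
    then have d: "dist A.m x < 2 * r0 / 3" "dist A.m x < 2 * r1 / 3" using rho by auto
    have "x : Om" using True ball_Om by blast
    moreover have "x : A.T \<longleftrightarrow> x ~: B.T"
     using cover[OF d] A.T_l3[of x] B.T_l3[of x] elim by (auto simp: opposite)
    ultimately show ?thesis by (auto simp: indicator_def)
   qed (simp add: z)
  qed
 qed (use i' in \<open>auto intro: borel_measurable_add borel_measurable_integrable\<close>)
 then show ?thesis using i' OmL A.T_sets B.T_sets by (simp add: LINT_lebesgue_on)
qed

lemma vprod_split:
 assumes L: "L2_on Om u" "L2_on A.T g" "L2_on B.T g'"
  and ae: "AE x in lebesgue. x : A.T --> u x = g x" "AE x in lebesgue. x : B.T --> u x = g' x"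
  and w: "smooth w" "!!x. x ~: cball A.m rho ==> w x = 0"
 shows "vprod Om u w = vprod A.T g w + vprod B.T g' w"
proof -
 have ae': "AE x in lebesgue. x : A.T --> g x = u x" "AE x in lebesgue. x : B.T --> g' x = u x"
  using ae by (auto elim: eventually_mono)
 have uL: "L2_on A.T u" "L2_on B.T u"
  by (rule L2_cong_AE(1)[OF A.T_sets L(2) ae'(1)], rule L2_cong_AE(1)[OF B.T_sets L(3) ae'(2)])
 have wL: "L2_on Om w" "L2_on A.T w" "L2_on B.T w"
  using w(1) Om(2) OmL A.T_sets B.T_sets compact_imp_bounded[OF A.compact_T] compact_imp_bounded[OF B.compact_T]
  by (auto intro: L2_test)
 have "vprod Om u w = vprod A.T u w + vprod B.T u w" unfolding vprod_def
  by (rule split_integral) (use vprod_integrable(1)[OF L(1) wL(1)] vprod_integrable(1)[OF uL(1) wL(2)]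
    vprod_integrable(1)[OF uL(2) wL(3)] w(2) in auto)
 moreover have "vprod A.T u w = vprod A.T g w" by (rule vprod_cong_AE[OF A.T_sets uL(1) wL(2) L(2) wL(2) ae(1)]) simp
 moreover have "vprod B.T u w = vprod B.T g' w" by (rule vprod_cong_AE[OF B.T_sets uL(2) wL(3) L(3) wL(3) ae(2)]) simp
 ultimately show ?thesis by simp
qed

text \<open>The jump \<open>jq\<close> splits into a polynomial part and the rest \<open>aq\<close>.
  The bubble of the polynomial part tests the equation, and the rest is moved to the right by
  Cauchy-Schwarz. With c = sqrt (2 C) the two uses of the bubble estimates give the factor c + c^2,
  and the factors 2 in front come from reassembling the jump.\<close>

lemma normal_jump_bound:
 fixes Pl Pl' u g g' :: cfield and X K C :: real
 assumes bc: "bubble_const K d TYPE(complex) C" and K: "K \<ge> 1" "diameter A.T <= K * rho"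
  and L: "L2_on Om u" "L2_on A.T g" "L2_on B.T g'" "!!i. L2_on A.T (Gd i i)" "!!i. L2_on B.T (Gd' i i)"
  and ae: "AE x in lebesgue. x : A.T --> u x = g x" "AE x in lebesgue. x : B.T --> u x = g' x"
  and td: "!!i. tdata A.T (%x. g x $ i) (Gd i)" "!!i. tdata B.T (%x. g' x $ i) (Gd' i)"
  and P: "pdegv d Pl" "pdegv d Pl'"
  and H0: "!!phi. test_fun Om phi ==> symm phi ==> (!!x. x ~: A.T Un B.T ==> phi x = 0) ==>
   norm (vprod Om u (classical_grad phi)) <= X * L2_norm Om (classical_grad phi)" and X: "X \<ge> 0"
 defines "jq \<equiv> %z. SUM i:UNIV. n $ i *\<^sub>R (A.tr (%x. g x $ i) z - B.tr (%x. g' x $ i) z)"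
  and "aq \<equiv> %z. SUM i:UNIV. n $ i *\<^sub>R ((A.tr (%x. g x $ i) z - Pl (A.Ph (z, 0)) $ i)
    - (B.tr (%x. g' x $ i) z - Pl' (A.Ph (z, 0)) $ i))"
 shows "A.fnorm jq <= (2 + 2 * K * (sqrt (2 * C) + 2 * C)) * (A.fnorm aq +
  (sqrt rho * (L2_norm A.T (%x. SUM i:UNIV. Gd i i x) + L2_norm B.T (%x. SUM i:UNIV. Gd' i i x)) + 3 * X / sqrt rho))"
  (is "_ <= ?CC * (_ + ?Y)")
proof -
 let ?dA = "%x. SUM i:UNIV. Gd i i x" and ?dB = "%x. SUM i:UNIV. Gd' i i x"
 define c where "c = sqrt (2 * C)"
 have C: "C > 0" using bc by (simp add: bubble_const_def)
 have c: "c \<ge> 0" "c * c = 2 * C" using C by (simp_all add: c_def)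
 have sr: "sqrt rho > 0" using rho by simp
 define Jp where "Jp x = (SUM i:UNIV. n $ i *\<^sub>R (Pl x $ i - Pl' x $ i))" for x
 have pJ: "pdegv d Jp"
  unfolding Jp_def[abs_def] by (intro pdegv_sum pdegv_linear[OF bounded_linear_scaleR_right] pdegv_diff pdegv_nth P)
 let ?JP = "%z. Jp (A.Ph (z, 0))"
 define w where "w x = bump A.m rho x *\<^sub>R Jp (A.Ph ((A.l1 x, A.l2 x), 0))" for x
 define I where "I = A.J * (LINT z|lebesgue. (norm (Jp (A.Ph (z, 0))))\<^sup>2 * bump A.m rho (A.Ph (z, 0)))"
 note fb = A.face_bubble[OF bc K pJ ballA rho(1,2), folded w_def[abs_def] w_def I_def c_def]
 have sw: "smooth w" using fb(1) by (simp add: symm_def)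
 have bT: "bounded A.T" "bounded B.T" using A.compact_T B.compact_T by (auto intro: compact_imp_bounded)
 have P0: "A.Ph (z, 0) = B.Ph (z, 0)" for z by (simp add: opposite)
 note gA = A.green_div[OF td(1) L(2) L(4) ballA rho(1,2) sw fb(2)]
 note gB = B.green_div[OF td(2) L(3) L(5) ballB rho(1,3) sw fb(2)]
 define tA where "tA z = (SUM i:UNIV. n $ i *\<^sub>R A.tr (%x. g x $ i) z)" for z
 define tB where "tB z = (SUM i:UNIV. (- n) $ i *\<^sub>R B.tr (%x. g' x $ i) z)" for z
 define W where "W z = w (A.Ph (z, 0))" for z
 define s where "s = cut ?JP"
 have cJ: "continuous_on UNIV Jp" by (rule smooth_continuous[OF smooth_pdegv[OF pJ]])
 note s = A.cut_continuous[OF cJ, folded s_def]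
 have mA: "cut tA : borel_measurable lebesgue" "integrable lebesgue (%z. cut tA z * cnj (W z))"
  using gA(2,3) by (simp_all add: tA_def[abs_def] W_def)
 have mB: "cut tB : borel_measurable lebesgue" "integrable lebesgue (%z. cut tB z * cnj (W z))"
  using gB(2,3) by (simp_all add: tB_def[abs_def] W_def P0)
 have jq: "cut jq = (%z. cut tA z + cut tB z)"
  by (auto simp: cut_def jq_def tA_def tB_def fun_eq_iff sum.distrib[symmetric] algebra_simps intro!: sum.cong)
 have aq: "cut aq = (%z. cut jq z - s z)"
  by (auto simp: cut_def jq_def aq_def s_def Jp_def fun_eq_iff sum_3 algebra_simps)
 have mj: "cut jq : borel_measurable lebesgue" unfolding jq using mA mB by measurable
 have ma: "cut aq : borel_measurable lebesgue" unfolding aq using mj s(1) by measurable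
 have f2: "(A.fnorm F)\<^sup>2 = A.J * (LINT z|lebesgue. (norm (cut F z))\<^sup>2)"
  if "cut F : borel_measurable lebesgue" for F :: "real \<times> real => complex"
  using A.J_pos by (simp add: A.fnorm_def tri_integral[OF that] real_sqrt_pow2)
 have Y0: "?Y \<ge> 0" using X sr by (intro add_nonneg_nonneg mult_nonneg_nonneg divide_nonneg_nonneg) (auto simp: L2_norm_nonneg)
 have CC: "?CC \<ge> 0" using K C by (intro add_nonneg_nonneg mult_nonneg_nonneg) auto
 show ?thesis
 proof (cases "integrable lebesgue (%z. (norm (cut jq z))\<^sup>2)")
  case False
  \<comment> \<open>the Lebesgue integral of a non-integrable function is 0\<close>
  then have "A.fnorm jq = 0" using f2[OF mj] by (simp add: not_integrable_integral_eq)
  then show ?thesis using CC Y0 A.fnorm_nonneg[of aq] by (auto intro!: mult_nonneg_nonneg add_nonneg_nonneg)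
 next
  case True
  have par: "(norm (x + y))\<^sup>2 <= 2 * (norm x)\<^sup>2 + 2 * (norm y)\<^sup>2" for x y :: complex
  proof -
   have "(norm (x + y))\<^sup>2 <= (norm x + norm y)\<^sup>2" by (intro power_mono norm_triangle_ineq) simp
   also have "... <= 2 * (norm x)\<^sup>2 + 2 * (norm y)\<^sup>2" using sum_squares_bound[of "norm x" "norm y"] by (simp add: power2_sum)
   finally show ?thesis .
  qed
  have ia: "integrable lebesgue (%z. (norm (cut aq z))\<^sup>2)"
  proof (rule Bochner_Integration.integrable_bound)
   show "integrable lebesgue (%z. 2 * (norm (cut jq z))\<^sup>2 + 2 * (norm (s z))\<^sup>2)" using True s(3) by simp
   show "(%z. (norm (cut aq z))\<^sup>2) : borel_measurable lebesgue" using ma by measurable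
   show "AE z in lebesgue. norm ((norm (cut aq z))\<^sup>2) <= norm (2 * (norm (cut jq z))\<^sup>2 + 2 * (norm (s z))\<^sup>2)"
   proof (rule AE_I2)
    fix z show "norm ((norm (cut aq z))\<^sup>2) <= norm (2 * (norm (cut jq z))\<^sup>2 + 2 * (norm (s z))\<^sup>2)"
     using par[of "cut jq z" "- s z"] by (simp add: aq)
   qed
  qed
  let ?na = "LINT z|lebesgue. (norm (cut aq z))\<^sup>2"
  have WL: "cut W : borel_measurable lebesgue" "integrable lebesgue (%z. (norm (cut W z))\<^sup>2)"
   using A.cut_continuous[OF smooth_continuous[OF sw]] by (simp_all add: W_def[abs_def])
  have aW: "cut aq z * cnj (W z) = cut aq z * cnj (cut W z)" for z by (simp add: cut_def)
  have sW: "s z * cnj (W z) = complex_of_real ((norm (Jp (A.Ph (z, 0))))\<^sup>2 * bump A.m rho (A.Ph (z, 0)))" for z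
   using fb(3)[of z] fb(9)[of z]
   by (cases "z : tri_open") (simp_all add: s_def cut_def W_def scaleR_conv_of_real complex_norm_square del: of_real_power)
  have CS: "integrable lebesgue (%z. norm (cut aq z) * norm (cut W z))"
   "(LINT z|lebesgue. \<bar>norm (cut aq z) * norm (cut W z)\<bar>) <= sqrt ?na * sqrt (LINT z|lebesgue. (norm (cut W z))\<^sup>2)"
   using ma WL ia by (intro Cauchy_Schwarz_integral; measurable)+
  have iaW: "integrable lebesgue (%z. cut aq z * cnj (W z))"
  proof (rule Bochner_Integration.integrable_bound[OF CS(1)])
   have "(%z. cnj (cut W z)) : borel_measurable lebesgue"
    by (rule measurable_compose[OF WL(1) continuous_borel[OF linear_continuous_on[OF bounded_linear_cnj]]])
   then show "(%z. cut aq z * cnj (W z)) : borel_measurable lebesgue" unfolding aW using ma by measurable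
  qed (simp add: aW norm_mult)
  have jqW: "cut jq z * cnj (W z) = cut aq z * cnj (W z) + s z * cnj (W z)" for z by (simp add: aq algebra_simps)
  have isW: "integrable lebesgue (%z. s z * cnj (W z))"
  proof -
   have "(%z. s z * cnj (W z)) = (%z. (cut tA z * cnj (W z) + cut tB z * cnj (W z)) - cut aq z * cnj (W z))"
    by (auto simp: aq jq algebra_simps)
   then show ?thesis using mA(2) mB(2) iaW by simp
  qed
  define ZA where "ZA = (LINT z|lebesgue. cut aq z * cnj (W z))"
  have "A.J *\<^sub>R (LINT z|lebesgue. cut tA z * cnj (W z)) + A.J *\<^sub>R (LINT z|lebesgue. cut tB z * cnj (W z))
    = A.J *\<^sub>R (LINT z|lebesgue. cut jq z * cnj (W z))"
   using mA(2) mB(2) by (simp add: jq ring_distribs scaleR_add_right)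
  also have "... = A.J *\<^sub>R ZA + A.J *\<^sub>R (LINT z|lebesgue. s z * cnj (W z))"
   unfolding jqW ZA_def using iaW isW by (simp add: scaleR_add_right)
  also have "A.J *\<^sub>R (LINT z|lebesgue. s z * cnj (W z)) = complex_of_real I"
   unfolding sW I_def integral_complex_of_real by (simp add: scaleR_conv_of_real)
  \<comment> \<open>The normals are opposite, so the boundary terms of the two Green formulas add up
    to the jump; its polynomial part contributes exactly \<open>I\<close>.\<close>
  finally have gI: "(sprod A.T ?dA w + vprod A.T g (classical_grad w))
    + (sprod B.T ?dB w + vprod B.T g' (classical_grad w)) = A.J *\<^sub>R ZA + complex_of_real I"
   using gA(1) gB(1) by (simp add: tA_def[abs_def] tB_def[abs_def] W_def P0)
  have gw: "smooth (classical_grad w)" by (rule smooth_classical_grad[OF sw])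
  have gwz: "classical_grad w x = 0" if "x ~: cball A.m rho" for x
   by (rule classical_grad_zero[OF closed_cball fb(2) that])
  have "vprod Om u (classical_grad w) = vprod A.T g (classical_grad w) + vprod B.T g' (classical_grad w)"
   by (rule vprod_split[OF L(1-3) ae gw gwz])
  with gI have eqI: "complex_of_real I = (sprod A.T ?dA w + sprod B.T ?dB w)
    + (vprod Om u (classical_grad w) - A.J *\<^sub>R ZA)" by (simp add: algebra_simps)
  have "norm (complex_of_real I) <= (norm (sprod A.T ?dA w) + norm (sprod B.T ?dB w))
    + (norm (vprod Om u (classical_grad w)) + norm (A.J *\<^sub>R ZA))"
   unfolding eqI by (rule order_trans[OF norm_triangle_ineq]) (intro add_mono norm_triangle_ineq norm_triangle_ineq4)
  then have "I <= (norm (sprod A.T ?dA w) + norm (sprod B.T ?dB w))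
    + (norm (vprod Om u (classical_grad w)) + norm (A.J *\<^sub>R ZA))" using fb(4) by simp
  also have "... <= (L2_norm A.T ?dA * (c * sqrt I * sqrt rho) + L2_norm B.T ?dB * (c * sqrt I * sqrt rho))
    + (X * (3 * (c * sqrt I / sqrt rho)) + A.fnorm aq * sqrt I)"
  proof (intro add_mono)
   have wL: "L2_on A.T w" "L2_on B.T w" using sw bT A.T_sets B.T_sets by (auto intro: L2_test)
   have GL: "L2_on A.T ?dA" "L2_on B.T ?dB" unfolding sum_3 by (intro L2_add(1) L)+
   show "norm (sprod A.T ?dA w) <= L2_norm A.T ?dA * (c * sqrt I * sqrt rho)"
    using sprod_integrable(2)[OF GL(1) wL(1)] by (rule order_trans) (intro mult_left_mono fb(5) A.T_sets L2_norm_nonneg)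
   show "norm (sprod B.T ?dB w) <= L2_norm B.T ?dB * (c * sqrt I * sqrt rho)"
    using sprod_integrable(2)[OF GL(2) wL(2)] by (rule order_trans) (intro mult_left_mono fb(5) B.T_sets L2_norm_nonneg)
   have "norm (vprod Om u (classical_grad w)) <= X * L2_norm Om (classical_grad w)"
    by (rule H0[OF test_Om(1)[OF sw fb(2)] fb(1) test_Om(2)[OF sw fb(2)]])
   then show "norm (vprod Om u (classical_grad w)) <= X * (3 * (c * sqrt I / sqrt rho))"
    by (rule order_trans) (intro mult_left_mono L2_norm_grad sw OmL Om(2) fb(6) X)
   have "norm ZA <= (LINT z|lebesgue. norm (cut aq z * cnj (W z)))" unfolding ZA_def by (rule integral_norm_bound)
   also have "... = (LINT z|lebesgue. \<bar>norm (cut aq z) * norm (cut W z)\<bar>)" unfolding aW by (simp add: norm_mult)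
   finally have "norm (A.J *\<^sub>R ZA) <= A.J * (sqrt ?na * sqrt (LINT z|lebesgue. (norm (cut W z))\<^sup>2))"
    using CS(2) A.J_pos by (simp add: mult_left_mono)
   also have "... = sqrt (A.J * ?na) * sqrt (A.J * (LINT z|lebesgue. (norm (cut W z))\<^sup>2))"
    using A.J_pos by (simp add: real_sqrt_mult)
   also have "... <= A.fnorm aq * sqrt I"
   proof (rule mult_mono)
    show "sqrt (A.J * ?na) <= A.fnorm aq" by (simp add: A.fnorm_def tri_integral[OF ma])
    show "sqrt (A.J * (LINT z|lebesgue. (norm (cut W z))\<^sup>2)) <= sqrt I"
     using fb(8) by (simp add: W_def[abs_def])
   qed (use A.J_pos A.fnorm_nonneg in auto)
   finally show "norm (A.J *\<^sub>R ZA) <= A.fnorm aq * sqrt I" .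
  qed
  also have "... = (c * ?Y + A.fnorm aq) * sqrt I" by (simp add: algebra_simps)
  finally have sI: "sqrt I <= c * ?Y + A.fnorm aq"
   using fb(4) c(1) Y0 A.fnorm_nonneg[of aq] by (intro sqrt_absorb) auto
  define Z where "Z = A.fnorm aq + ?Y"
  have Z: "A.fnorm aq <= Z" "?Y <= Z" "0 <= Z" using Y0 A.fnorm_nonneg[of aq] by (auto simp: Z_def)
  have "A.fnorm ?JP <= K * c * sqrt I" by (rule fb(7))
  also have "... <= K * c * (c * Z + Z)"
   using sI Z c(1) K by (intro mult_left_mono) (auto intro: order_trans add_mono mult_left_mono)
  finally have nJ: "A.fnorm ?JP <= K * (2 * C + c) * Z" using c(2) by (simp add: algebra_simps)
  have "(A.fnorm jq)\<^sup>2 <= A.J * (2 * ?na + 2 * (LINT z|lebesgue. (norm (s z))\<^sup>2))"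
  proof -
   have "(LINT z|lebesgue. (norm (cut jq z))\<^sup>2) <= (LINT z|lebesgue. 2 * (norm (cut aq z))\<^sup>2 + 2 * (norm (s z))\<^sup>2)"
   proof (rule integral_mono[OF True])
    show "integrable lebesgue (%z. 2 * (norm (cut aq z))\<^sup>2 + 2 * (norm (s z))\<^sup>2)" using ia s(3) by simp
    fix z show "(norm (cut jq z))\<^sup>2 <= 2 * (norm (cut aq z))\<^sup>2 + 2 * (norm (s z))\<^sup>2"
     using par[of "cut aq z" "s z"] by (simp add: aq)
   qed
   also have "... = 2 * ?na + 2 * (LINT z|lebesgue. (norm (s z))\<^sup>2)" using ia s(3) by simp
   finally show ?thesis unfolding f2[OF mj] using A.J_pos by (intro mult_left_mono) auto
  qed
  also have "... = 2 * (A.fnorm aq)\<^sup>2 + 2 * (A.fnorm ?JP)\<^sup>2"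
   using f2[OF ma] f2[of "%z. Jp (A.Ph (z, 0))"] s(1) by (simp add: s_def algebra_simps)
  also have "... <= (2 * A.fnorm aq + 2 * A.fnorm ?JP)\<^sup>2"
   using A.fnorm_nonneg[of aq] A.fnorm_nonneg[of "%z. Jp (A.Ph (z, 0))"] by (simp add: power2_sum power_mult_distrib)
  finally have "A.fnorm jq <= 2 * A.fnorm aq + 2 * A.fnorm ?JP"
   by (rule power2_le_imp_le) (auto intro!: add_nonneg_nonneg A.fnorm_nonneg)
  also have "... <= 2 * Z + 2 * (K * (2 * C + c) * Z)" using Z nJ by linarith
  also have "... = ?CC * Z" by (simp add: c_def algebra_simps)
  finally show ?thesis by (simp only: Z_def)
 qed
qed

text \<open>Here the jump is polynomial as a whole, so nothing has to be split off. Comparing the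
  equation with Green's formula on both elements leaves the elementwise residuals, weighted by sqrt
  rho, and the residual of the state, whose curl part costs 6 / sqrt rho.\<close>

lemma tangential_jump_bound:
 fixes u g g' zz zT zT' :: cfield and X K C :: real
 assumes bc: "bubble_const K d TYPE(complex^3) C" and K: "K \<ge> 1" "diameter A.T <= K * rho"
  and L: "L2_on Om u" "L2_on A.T g" "L2_on B.T g'" "L2_on Om zz"
  and ae: "AE x in lebesgue. x : A.T --> u x = g x" "AE x in lebesgue. x : B.T --> u x = g' x"
   "AE x in lebesgue. x : A.T --> zz x = zT x" "AE x in lebesgue. x : B.T --> zz x = zT' x"
  and P: "pdegv d zT" "pdegv d zT'"
  and H1: "!!w. test_fun Om w ==> (!!x. x ~: A.T Un B.T ==> w x = 0) ==>
   norm (vprod Om u w - vprod Om zz (classical_curl w)) <= X * (L2_norm Om w + L2_norm Om (classical_curl w))"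
  and X: "X \<ge> 0"
 shows "A.fnorm (%z. ccross (zT (A.Ph (z, 0)) - zT' (A.Ph (z, 0))) (of_real_vec n)) <= K * (2 * C) *
  (sqrt rho * (L2_norm A.T (%x. g x - classical_curl zT x) + L2_norm B.T (%x. g' x - classical_curl zT' x))
   + X * (sqrt rho + 6 / sqrt rho))" (is "_ <= _ * ?Y")
proof -
 let ?rA = "%x. g x - classical_curl zT x" and ?rB = "%x. g' x - classical_curl zT' x"
 define c where "c = sqrt (2 * C)"
 have C: "C > 0" using bc by (simp add: bubble_const_def)
 have c: "c \<ge> 0" "c * c = 2 * C" using C by (simp_all add: c_def)
 have sr: "sqrt rho > 0" using rho by simp
 define Jp where "Jp x = ccross (zT x - zT' x) (of_real_vec n)" for x
 have pJ: "pdegv d Jp" unfolding Jp_def[abs_def] by (intro pdegv_linear[OF bounded_linear_ccross_left] pdegv_diff P)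
 define w where "w x = bump A.m rho x *\<^sub>R Jp (A.Ph ((A.l1 x, A.l2 x), 0))" for x
 define I where "I = A.J * (LINT z|lebesgue. (norm (Jp (A.Ph (z, 0))))\<^sup>2 * bump A.m rho (A.Ph (z, 0)))"
 note fb = A.face_bubble[OF bc K pJ ballA rho(1,2), folded w_def[abs_def] w_def I_def c_def]
 have sw: "smooth w" using fb(1) by (simp add: symm_def)
 have bT: "bounded A.T" "bounded B.T" using A.compact_T B.compact_T by (auto intro: compact_imp_bounded)
 have P0: "B.Ph (z, 0) = A.Ph (z, 0)" for z by (simp add: opposite)
 have sz: "smooth zT" "smooth zT'" using P by (auto intro: smooth_pdegv)
 note gA = A.green_curl[OF sz(1) ballA rho(1,2) sw fb(2)]
 note gB = B.green_curl[OF sz(2) ballB rho(1,3) sw fb(2), unfolded P0]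
 define tA where "tA z = (SUM k:UNIV. ccross (zT (A.Ph (z, 0))) (of_real_vec n) $ k * cnj (w (A.Ph (z, 0)) $ k))" for z
 define tB where "tB z = (SUM k:UNIV. ccross (zT' (A.Ph (z, 0))) (of_real_vec (- n)) $ k * cnj (w (A.Ph (z, 0)) $ k))" for z
 have sum: "cut tA z + cut tB z = complex_of_real ((norm (Jp (A.Ph (z, 0))))\<^sup>2 * bump A.m rho (A.Ph (z, 0)))" for z
 proof (cases "z : tri_open")
  case True
  have "cut tA z + cut tB z = (SUM k:UNIV. Jp (A.Ph (z, 0)) $ k * cnj (w (A.Ph (z, 0)) $ k))"
   using True by (simp add: cut_def tA_def tB_def Jp_def sum_3 ccross_def of_real_vec_def algebra_simps)
  also have "... = complex_of_real ((norm (Jp (A.Ph (z, 0))))\<^sup>2 * bump A.m rho (A.Ph (z, 0)))"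
   unfolding fb(3) by (rule smult_square)
  finally show ?thesis .
 qed (simp add: cut_def fb(9))
 have gs: "A.J *\<^sub>R (LINT z|lebesgue. cut tA z) + A.J *\<^sub>R (LINT z|lebesgue. cut tB z) = complex_of_real I"
 proof -
  have "A.J *\<^sub>R (LINT z|lebesgue. cut tA z) + A.J *\<^sub>R (LINT z|lebesgue. cut tB z) = A.J *\<^sub>R (LINT z|lebesgue. cut tA z + cut tB z)"
   using gA(2) gB(2) by (simp add: tA_def[abs_def] tB_def[abs_def] scaleR_add_right)
  then show ?thesis unfolding sum I_def integral_complex_of_real by (simp add: scaleR_conv_of_real)
 qed
 have wL: "L2_on A.T w" "L2_on B.T w" using sw bT A.T_sets B.T_sets by (auto intro: L2_test)
 have czL: "L2_on A.T (classical_curl zT)" "L2_on B.T (classical_curl zT')"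
  using sz bT A.T_sets B.T_sets by (auto intro!: L2_test smooth_classical_curl)
 have zL: "L2_on A.T zT" "L2_on B.T zT'" using sz bT A.T_sets B.T_sets by (auto intro!: L2_test)
 have sc: "smooth (classical_curl w)" by (rule smooth_classical_curl[OF sw])
 have cz: "classical_curl w x = 0" if "x ~: cball A.m rho" for x
  by (rule classical_curl_zero[OF closed_cball fb(2) that])
 have s1: "vprod Om u w = vprod A.T g w + vprod B.T g' w" by (rule vprod_split[OF L(1-3) ae(1,2) sw fb(2)])
 have s2: "vprod Om zz (classical_curl w) = vprod A.T zT (classical_curl w) + vprod B.T zT' (classical_curl w)"
  by (rule vprod_split[OF L(4) zL ae(3,4) sc cz])
 have R: "vprod A.T ?rA w = vprod A.T g w - vprod A.T (classical_curl zT) w"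
  "vprod B.T ?rB w = vprod B.T g' w - vprod B.T (classical_curl zT') w"
  by (rule vprod_diff[OF L(2) czL(1) wL(1)], rule vprod_diff[OF L(3) czL(2) wL(2)])
 have eA: "A.J *\<^sub>R (LINT z|lebesgue. cut tA z) = vprod A.T zT (classical_curl w) - vprod A.T (classical_curl zT) w"
  using arg_cong[OF gA(1), of uminus] by (simp add: tA_def[abs_def])
 have eB: "A.J *\<^sub>R (LINT z|lebesgue. cut tB z) = vprod B.T zT' (classical_curl w) - vprod B.T (classical_curl zT') w"
  using arg_cong[OF gB(1), of uminus] by (simp add: tB_def[abs_def])
 have eqI: "complex_of_real I = (vprod A.T ?rA w + vprod B.T ?rB w)
   - (vprod Om u w - vprod Om zz (classical_curl w))" unfolding R s1 s2 gs[symmetric] eA eB by simp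
 have "norm (complex_of_real I) <= (norm (vprod A.T ?rA w) + norm (vprod B.T ?rB w))
   + norm (vprod Om u w - vprod Om zz (classical_curl w))"
  unfolding eqI by (rule order_trans[OF norm_triangle_ineq4]) (intro add_mono norm_triangle_ineq order_refl)
 then have "I <= (norm (vprod A.T ?rA w) + norm (vprod B.T ?rB w))
   + norm (vprod Om u w - vprod Om zz (classical_curl w))" using fb(4) by simp
 also have "... <= (L2_norm A.T ?rA * (c * sqrt I * sqrt rho)
    + L2_norm B.T ?rB * (c * sqrt I * sqrt rho))
   + X * (c * sqrt I * sqrt rho + 6 * (c * sqrt I / sqrt rho))"
 proof (intro add_mono)
  have RL: "L2_on A.T ?rA" "L2_on B.T ?rB" by (intro L2_diff(1) L czL)+
  show "norm (vprod A.T ?rA w) <= L2_norm A.T ?rA * (c * sqrt I * sqrt rho)"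
   using vprod_integrable(2)[OF RL(1) wL(1)] by (rule order_trans) (intro mult_left_mono fb(5) A.T_sets L2_norm_nonneg)
  show "norm (vprod B.T ?rB w) <= L2_norm B.T ?rB * (c * sqrt I * sqrt rho)"
   using vprod_integrable(2)[OF RL(2) wL(2)] by (rule order_trans) (intro mult_left_mono fb(5) B.T_sets L2_norm_nonneg)
  have "norm (vprod Om u w - vprod Om zz (classical_curl w)) <= X * (L2_norm Om w + L2_norm Om (classical_curl w))"
   by (rule H1[OF test_Om(1)[OF sw fb(2)] test_Om(2)[OF sw fb(2)]])
  then show "norm (vprod Om u w - vprod Om zz (classical_curl w)) <= X * (c * sqrt I * sqrt rho + 6 * (c * sqrt I / sqrt rho))"
   by (rule order_trans) (intro mult_left_mono add_mono fb(5) L2_norm_curl sw OmL Om(2) fb(6) X)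
 qed
 also have "... = (c * ?Y) * sqrt I" by (simp add: algebra_simps)
 finally have sI: "sqrt I <= c * ?Y" using fb(4) c(1) X sr
  by (intro sqrt_absorb mult_nonneg_nonneg add_nonneg_nonneg divide_nonneg_nonneg) (auto simp: L2_norm_nonneg)
 have "A.fnorm (%z. Jp (A.Ph (z, 0))) <= K * c * sqrt I" by (rule fb(7))
 also have "... <= K * c * (c * ?Y)" using sI c(1) K by (intro mult_left_mono) auto
 also have "... = K * (c * c) * ?Y" by (simp add: mult_ac)
 finally show ?thesis unfolding Jp_def c(2) .
qed

end

section \<open>Weak gradients on an element\<close>

text \<open>\<open>Gd i j\<close> is the weak derivative of component \<open>i\<close> in direction
  \<open>j\<close>. A fixed matrix lets the divergence and the traces refer to the same
  derivatives.\<close>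

definition wgrad :: "point set => cfield => (3 => 3 => point => complex) => bool" where
 "wgrad T g Gd \<longleftrightarrow> L2_on T g & (ALL i j. L2_on T (Gd i j)) \<and>
  (ALL i j psi. test_fun T psi --> sprod T (Gd i j) psi = - sprod T (%x. g x $ i) (partial j psi))"

lemma wgrad_tdata:
 assumes "wgrad T g Gd" "T : sets lebesgue" "bounded T"
 shows "tdata T (%x. g x $ i) (Gd i)"
 using assms L2_integrable[OF L2_nth] L2_integrable unfolding wgrad_def tdata_def by metis

lemma sprod_add: "L2_on G v ==> L2_on G v' ==> L2_on G w ==>
  sprod G (%x. v x + v' x) w = sprod G v w + sprod G v' w" unfolding sprod_def ring_distribs
 by (rule Bochner_Integration.integral_add) (rule sprod_integrable; assumption)+

lemma wgrad_add_smooth: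
 assumes g: "wgrad T g Gd" and p: "smooth p" and T: "T : sets lebesgue" "bounded T"
 shows "wgrad T (%x. g x + p x) (%i j x. Gd i j x + partial j p x $ i)"
 unfolding wgrad_def
proof (intro conjI allI impI)
 have L: "L2_on T g" "!!i j. L2_on T (Gd i j)" using g by (auto simp: wgrad_def)
 have pL: "L2_on T p" "!!i j. L2_on T (%x. partial j p x $ i)"
  using p T by (auto intro!: L2_test smooth_nth smooth_partial)
 show "L2_on T (%x. g x + p x)" by (intro L2_add L pL)
 show "L2_on T (%x. Gd i j x + partial j p x $ i)" for i j by (intro L2_add L pL)
 fix i j and psi :: "point => complex" assume t: "test_fun T psi"
 have s: "smooth psi" using t by (elim test_funE)
 have psiL: "L2_on T psi" "L2_on T (partial j psi)" using s T by (auto intro!: L2_test smooth_partial)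
 have "sprod T (%x. partial j p x $ i) psi = - sprod T (%x. p x $ i) (partial j psi)"
  using tdata_smooth[OF smooth_nth[OF p, of i] T] t by (simp add: tdata_def partial_nth[OF p, abs_def])
 then show "sprod T (%x. Gd i j x + partial j p x $ i) psi = - sprod T (%x. (g x + p x) $ i) (partial j psi)"
  using g t by (simp add: wgrad_def sprod_add[OF L(2) pL(2) psiL(1)] sprod_add[OF L2_nth[OF L(1)] L2_nth[OF pL(1)] psiL(2)])
qed

lemma wgrad_div:
 assumes g: "wgrad T g Gd" and T: "T : sets lebesgue" "bounded T"
 shows "has_weak_div T g (%x. SUM i:UNIV. Gd i i x)"
 unfolding has_weak_div_def
proof (intro conjI allI impI)
 have L: "L2_on T g" "!!i j. L2_on T (Gd i j)" using g by (auto simp: wgrad_def)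
 show "L2_on T (%x. SUM i:UNIV. Gd i i x)" unfolding sum_3 by (intro L2_add L)
 fix phi :: "point => complex" assume t: "test_fun T phi"
 have s: "smooth phi" using t by (elim test_funE)
 have phiL: "L2_on T phi" "!!i. L2_on T (partial i phi)" using s T by (auto intro!: L2_test smooth_partial)
 have i: "integrable (lebesgue_on T) (%x. Gd i i x * cnj (phi x))"
  "integrable (lebesgue_on T) (%x. g x $ i * cnj (partial i phi x))" for i
  by (rule sprod_integrable(1)[OF L(2) phiL(1)], rule sprod_integrable(1)[OF L2_nth[OF L(1)] phiL(2)])
 have "sprod T (%x. SUM i:UNIV. Gd i i x) phi = (SUM i:UNIV. sprod T (Gd i i) phi)"
  unfolding sprod_def sum_distrib_right using i by simp
 also have "... = - (SUM i:UNIV. sprod T (%x. g x $ i) (partial i phi))" using g t by (simp add: wgrad_def sum_negf)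
 also have "(SUM i:UNIV. sprod T (%x. g x $ i) (partial i phi)) = vprod T g (classical_grad phi)"
  unfolding vprod_def sprod_def using i by (simp add: classical_grad_def)
 finally show "sprod T (%x. SUM i:UNIV. Gd i i x) phi = - vprod T g (classical_grad phi)" .
qed

lemma H1_wgrad:
 assumes "H1_on T g" shows "EX Gd. wgrad T g Gd"
proof -
 obtain G where G: "!!i. L2_on T (G i)" "!!i phi. test_fun T phi ==> vprod T (G i) phi = - vprod T g (partial i phi)"
  using assms unfolding H1_on_def by metis
 have "sprod T (%x. G j x $ i) psi = - sprod T (%x. g x $ i) (partial j psi)" if t: "test_fun T psi" for i j psi
 proof -
  have s: "smooth psi" using t by (elim test_funE)
  have "partial j (%x. axis i (psi x) :: complex^3) x = axis i (partial j psi x)" for x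
   by (rule partial_linear[OF bounded_linear_axis smooth_differentiable[OF s]])
  then have "vprod T g (partial j (%x. axis i (psi x) :: complex^3)) = sprod T (%x. g x $ i) (partial j psi)"
   by (rule vprod_axis)
  moreover have "vprod T (G j) (%x. axis i (psi x)) = sprod T (%x. G j x $ i) psi" by (rule vprod_axis) simp
  ultimately show ?thesis using G(2)[OF test_fun_axis[OF t], of j i] by simp
 qed
 then have "wgrad T g (%i j x. G j x $ i)" using assms G(1) by (auto simp: wgrad_def H1_on_def intro: L2_nth)
 then show ?thesis by blast
qed

lemma smooth_weak_curl:
 assumes y: "smooth y" and T: "T : sets lebesgue" "bounded T"
 shows "has_weak_curl T y (classical_curl y)"
 unfolding has_weak_curl_def
proof (intro conjI allI impI)
 show "L2_on T (classical_curl y)" using y T by (intro L2_test smooth_classical_curl)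
 show "vprod T (classical_curl y) phi = vprod T y (classical_curl phi)" if "test_fun T phi" for phi
  using test_curl_green[OF that T(1) y] vprod_cnj by metis
qed

lemma weak_curl_cong:
 assumes c: "has_weak_curl T v c" "L2_on T v" and T: "T : sets lebesgue" "bounded T"
  and ae: "AE x in lebesgue. x : T --> v x = v' x"
 shows "has_weak_curl T v' c"
 unfolding has_weak_curl_def
proof (intro conjI allI impI)
 show "L2_on T c" using c by (simp add: has_weak_curl_def)
 fix phi :: cfield assume t: "test_fun T phi"
 then have "smooth phi" by (elim test_funE)
 then have cL: "L2_on T (classical_curl phi)" using T by (intro L2_test smooth_classical_curl)
 have "vprod T v (classical_curl phi) = vprod T v' (classical_curl phi)"
  by (rule vprod_cong_AE[OF T(1) c(2) cL L2_cong_AE(1)[OF T(1) c(2) ae] cL ae]) simp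
 then show "vprod T c phi = vprod T v' (classical_curl phi)" using c(1) t by (simp add: has_weak_curl_def)
qed

section \<open>Jumps\<close>

lemma face_L2_norm_nonneg: "0 <= face_L2_norm S g" unfolding face_L2_norm_def face_integral_def Let_def
 by (auto split: prod.split intro!: mult_nonneg_nonneg)

text \<open>The frame is built on the very triple selected in \<open>face_integral\<close>, so the
  surface integral becomes an integral in its coordinates without comparing numberings.\<close>

lemma face_choice:
 assumes T: "3 simplex (T :: point set)" "S facet_of T" and b: "cball x0 r0 <= T" "r0 > 0"
 obtains p q r n v where "tet p q r n v" "T = convex hull {v, p, q, r}" "S = convex hull {p, q, r}"
  "\<not> affine_dependent {p, q, r}" "card {p, q, r} = 3"
  "!!h. face_integral S h = face_frame.J (q - p) (r - p) *
   (LINT z|lebesgue_on tri. h (face_frame.Ph p (q - p) (r - p) n (z, 0)))"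
proof -
 define c where "c = (SOME (p, q, r). S = convex hull {p, q, r})"
 obtain p' q' r' where S': "S = convex hull {p', q', r'}"
  and f: "!!p q r. S = convex hull {p, q, r} ==>
   \<not> collinear {p, q, r} & \<not> affine_dependent {p, q, r} & card {p, q, r} = 3 & (EX v. T = convex hull {v, p, q, r})"
  using simplex_facet_vertices[OF T] by metis
 have "case c of (p, q, r) => S = convex hull {p, q, r}"
  unfolding c_def by (rule someI_ex) (use S' in \<open>auto intro!: exI[of _ "(p', q', r')"]\<close>)
 moreover obtain p q r where c: "c = (p, q, r)" by (cases c)
 ultimately have S: "S = convex hull {p, q, r}" by simp
 from f[OF S] obtain v where v: "\<not> collinear {p, q, r}" "\<not> affine_dependent {p, q, r}" "card {p, q, r} = 3"
  "T = convex hull {v, p, q, r}" by blast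
 from tet_exists[OF cross_nz_of_noncollinear[OF v(1)] v(4) b] obtain n where t: "tet p q r n v" by blast
 interpret t: tet p q r n v by (rule t)
 have "face_integral S h = t.J * (LINT z|lebesgue_on tri. h (t.Ph (z, 0)))" for h
  unfolding face_integral_def c_def[symmetric] c tri_def[symmetric] Let_def t.J_def t.Ph_def by simp
 then show ?thesis by (rule that[OF t v(4) S v(2,3)])
qed

lemma (in tet) fnorm_cong:
 fixes F G :: "real \<times> real => 'b::euclidean_space"
 assumes F: "cut F : borel_measurable lebesgue" and e: "AE z in lborel. z : tri_open --> G z = F z"
 shows "fnorm G = fnorm F"
proof -
 have ae: "AE z in lebesgue. cut F z = cut G z"
  using e unfolding AE_lebesgue_iff by eventually_elim (simp add: cut_def)
 have G: "cut G : borel_measurable lebesgue" by (rule borel_measurable_AE_eq[OF F ae])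
 have "(LINT z|lebesgue. (norm (cut G z))\<^sup>2) = (LINT z|lebesgue. (norm (cut F z))\<^sup>2)"
 proof (rule integral_cong_AE)
  show "(%z. (norm (cut G z))\<^sup>2) : borel_measurable lebesgue" using G by measurable
  show "(%z. (norm (cut F z))\<^sup>2) : borel_measurable lebesgue" using F by measurable
  show "AE z in lebesgue. (norm (cut G z))\<^sup>2 = (norm (cut F z))\<^sup>2" using ae by eventually_elim simp
 qed
 then show ?thesis by (simp add: fnorm_def tri_integral[OF F] tri_integral[OF G])
qed

lemma (in tet) tr_add:
 assumes "tdata T g G" "continuous_on UNIV h"
 shows "AE z in lborel. z : tri_open --> tr (%x. g x + h x) z = tr g z + h (Ph (z, 0))"
 using trace_AE[OF assms(1)]
 by eventually_elim (use Ph_line_cont[OF assms(2)] in \<open>auto intro!: trI tendsto_add\<close>)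

context face_pair
begin

lemma jump_Ph:
 assumes "((%t. F (A.Ph (z, t))) \<longlongrightarrow> l) ess_at_right_0" "((%t. F (B.Ph (z, t))) \<longlongrightarrow> l') ess_at_right_0"
 shows "jump n F (A.Ph (z, 0)) = (l :: 'b::euclidean_space) - l'"
proof -
 have "A.Ph (z, 0) - t *\<^sub>R n = A.Ph (z, t)" "A.Ph (z, 0) + t *\<^sub>R n = B.Ph (z, t)" for t
  by (simp_all add: A.Ph_def B.Ph_def)
 then show ?thesis using assms by (simp add: jump_def tendsto_Lim[OF ess_at_right_0_nontrivial])
qed

text \<open>Along almost every normal line the representative \<open>V\<close> agrees with
  \<open>g\<close> or \<open>g'\<close> at almost every small height, so its essential one-sided
  limits exist. \<open>jump\<close> takes the limit of a scalar product, computed here from the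
  limits of the components.\<close>

lemma normal_jump_AE:
 assumes ae: "AE x in lebesgue. x : A.T --> V x = g x" "AE x in lebesgue. x : B.T --> V x = g' x"
  and td: "!!i. tdata A.T (%x. g x $ i) (Gd i)" "!!i. tdata B.T (%x. g' x $ i) (Gd' i)"
 shows "AE z in lborel. z : tri_open --> normal_jump A.T A.S V (A.Ph (z, 0))
  = (SUM i:UNIV. n $ i *\<^sub>R (A.tr (%x. g x $ i) z - B.tr (%x. g' x $ i) z))"
 using A.trace_AE[OF td(1)[of 1]] A.trace_AE[OF td(1)[of 2]] A.trace_AE[OF td(1)[of 3]]
  B.trace_AE[OF td(2)[of 1]] B.trace_AE[OF td(2)[of 2]] B.trace_AE[OF td(2)[of 3]]
  A.AE_face_lines[OF ae(1)] B.AE_face_lines[OF ae(2)]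
proof eventually_elim
 case (elim z)
 show ?case
 proof
  assume z: "z : tri_open"
  have lA: "((%t. cdot (V (A.Ph (z, t))) (of_real_vec n)) \<longlongrightarrow> cdot (\<chi> i. A.tr (%x. g x $ i) z) (of_real_vec n)) ess_at_right_0"
  proof (rule Lim_transform_eventually)
   show "((%t. cdot (g (A.Ph (z, t))) (of_real_vec n)) \<longlongrightarrow> cdot (\<chi> i. A.tr (%x. g x $ i) z) (of_real_vec n)) ess_at_right_0"
    unfolding cdot_def sum_3 using elim z by (simp, intro tendsto_intros) auto
   show "\<forall>\<^sub>F t in ess_at_right_0. cdot (g (A.Ph (z, t))) (of_real_vec n) = cdot (V (A.Ph (z, t))) (of_real_vec n)"
    using elim(7)[rule_format, OF z] by eventually_elim simp
  qed
  have lB: "((%t. cdot (V (B.Ph (z, t))) (of_real_vec n)) \<longlongrightarrow> cdot (\<chi> i. B.tr (%x. g' x $ i) z) (of_real_vec n)) ess_at_right_0"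
  proof (rule Lim_transform_eventually)
   show "((%t. cdot (g' (B.Ph (z, t))) (of_real_vec n)) \<longlongrightarrow> cdot (\<chi> i. B.tr (%x. g' x $ i) z) (of_real_vec n)) ess_at_right_0"
    unfolding cdot_def sum_3 using elim z by (simp, intro tendsto_intros) auto
   show "\<forall>\<^sub>F t in ess_at_right_0. cdot (g' (B.Ph (z, t))) (of_real_vec n) = cdot (V (B.Ph (z, t))) (of_real_vec n)"
    using elim(8)[rule_format, OF z] by eventually_elim simp
  qed
  show "normal_jump A.T A.S V (A.Ph (z, 0)) = (SUM i:UNIV. n $ i *\<^sub>R (A.tr (%x. g x $ i) z - B.tr (%x. g' x $ i) z))"
   using jump_Ph[where F = "%x. cdot (V x) (of_real_vec n)", OF lA lB]
   by (simp add: normal_jump_def Let_def A.outer_normal_eq cdot_def of_real_vec_def sum_3 scaleR_conv_of_real algebra_simps)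
 qed
qed

lemma tangential_jump_AE:
 assumes ae: "AE x in lebesgue. x : A.T --> V x = g x" "AE x in lebesgue. x : B.T --> V x = g' x"
  and s: "continuous_on UNIV g" "continuous_on UNIV g'"
 shows "AE z in lborel. z : tri_open --> tangential_jump A.T A.S V (A.Ph (z, 0))
  = ccross (g (A.Ph (z, 0)) - g' (A.Ph (z, 0))) (of_real_vec n)"
 using A.AE_face_lines[OF ae(1)] B.AE_face_lines[OF ae(2)]
proof eventually_elim
 case (elim z)
 show ?case
 proof
  assume z: "z : tri_open"
  define L where "L v = ccross v (of_real_vec n)" for v
  have bl: "bounded_linear L" unfolding L_def by (rule bounded_linear_ccross_left)
  have c: "continuous_on UNIV (%x. L (g x))" "continuous_on UNIV (%x. L (g' x))"
   using bounded_linear.continuous_on[OF bl s(1)] bounded_linear.continuous_on[OF bl s(2)] by auto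
  have "\<forall>\<^sub>F t in ess_at_right_0. L (g (A.Ph (z, t))) = L (V (A.Ph (z, t)))"
   "\<forall>\<^sub>F t in ess_at_right_0. L (g' (B.Ph (z, t))) = L (V (B.Ph (z, t)))"
   using elim z by (auto elim: eventually_mono)
  then have "((%t. L (V (A.Ph (z, t)))) \<longlongrightarrow> L (g (A.Ph (z, 0)))) ess_at_right_0"
   "((%t. L (V (B.Ph (z, t)))) \<longlongrightarrow> L (g' (B.Ph (z, 0)))) ess_at_right_0"
   using A.Ph_line_cont[OF c(1)] B.Ph_line_cont[OF c(2)] by (blast intro: Lim_transform_eventually)+
  from jump_Ph[where F = "%x. L (V x)", OF this]
  show "tangential_jump A.T A.S V (A.Ph (z, 0)) = ccross (g (A.Ph (z, 0)) - g' (A.Ph (z, 0))) (of_real_vec n)"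
   using linear_diff[OF bounded_linear.linear[OF bl], of "g (A.Ph (z, 0))" "g' (A.Ph (z, 0))"]
   by (simp add: tangential_jump_def Let_def A.outer_normal_eq L_def opposite)
 qed
qed

text \<open>\<open>F\<close> and \<open>F'\<close> are the non-polynomial parts on the two sides,
  and \<open>V\<close> is a single function agreeing with both, later the one whose jump enters the
  oscillation. Adding a polynomial shifts the trace by its value, so the remainder of the preceding
  estimate has the same norm as the jump of \<open>V\<close>.\<close>

lemma normal_face_bound:
 fixes Pl Pl' u V F F' :: cfield and X K C :: real
 assumes bc: "bubble_const K d TYPE(complex) C" and K: "K \<ge> 1" "diameter A.T <= K * rho"
  and u: "L2_on Om u" and F: "wgrad A.T F Fd" "wgrad B.T F' Fd'" and P: "pdegv d Pl" "pdegv d Pl'"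
  and ae: "AE x in lebesgue. x : A.T --> u x = F x + Pl x & V x = F x"
   "AE x in lebesgue. x : B.T --> u x = F' x + Pl' x & V x = F' x"
  and H0: "!!phi. test_fun Om phi ==> symm phi ==> (!!x. x ~: A.T Un B.T ==> phi x = 0) ==>
   norm (vprod Om u (classical_grad phi)) <= X * L2_norm Om (classical_grad phi)" and X: "X \<ge> 0"
 shows "A.fnorm (%z. normal_jump A.T A.S u (A.Ph (z, 0))) <= (2 + 2 * K * (sqrt (2 * C) + 2 * C)) *
  (A.fnorm (%z. normal_jump A.T A.S V (A.Ph (z, 0))) +
  (sqrt rho * (L2_norm A.T (%x. SUM i:UNIV. Fd i i x + partial i Pl x $ i)
   + L2_norm B.T (%x. SUM i:UNIV. Fd' i i x + partial i Pl' x $ i)) + 3 * X / sqrt rho))"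
proof -
 have bT: "bounded A.T" "bounded B.T" using A.compact_T B.compact_T by (auto intro: compact_imp_bounded)
 have sP: "smooth Pl" "smooth Pl'" using P by (auto intro: smooth_pdegv)
 note g = wgrad_add_smooth[OF F(1) sP(1) A.T_sets bT(1)] wgrad_add_smooth[OF F(2) sP(2) B.T_sets bT(2)]
 note tg = wgrad_tdata[OF g(1) A.T_sets bT(1)] wgrad_tdata[OF g(2) B.T_sets bT(2)]
 note tF = wgrad_tdata[OF F(1) A.T_sets bT(1)] wgrad_tdata[OF F(2) B.T_sets bT(2)]
 have aeu: "AE x in lebesgue. x : A.T --> u x = F x + Pl x" "AE x in lebesgue. x : B.T --> u x = F' x + Pl' x"
  and aeV: "AE x in lebesgue. x : A.T --> V x = F x" "AE x in lebesgue. x : B.T --> V x = F' x"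
  using ae by (auto elim: eventually_mono)
 define jq where "jq z = (SUM i:UNIV. n $ i *\<^sub>R (A.tr (%x. (F x + Pl x) $ i) z - B.tr (%x. (F' x + Pl' x) $ i) z))" for z
 define aq where "aq z = (SUM i:UNIV. n $ i *\<^sub>R ((A.tr (%x. (F x + Pl x) $ i) z - Pl (A.Ph (z, 0)) $ i)
    - (B.tr (%x. (F' x + Pl' x) $ i) z - Pl' (A.Ph (z, 0)) $ i)))" for z
 define V0 where "V0 z = (SUM i:UNIV. n $ i *\<^sub>R (A.tr (%x. F x $ i) z - B.tr (%x. F' x $ i) z))" for z
 have cutsum: "cut (%z. SUM i:UNIV. n $ i *\<^sub>R (A.tr (%x. g x $ i) z - B.tr (%x. g' x $ i) z)) : borel_measurable lebesgue"
  if "!!i. tdata A.T (%x. g x $ i) (Gd i)" "!!i. tdata B.T (%x. g' x $ i) (Gd' i)" for g g' :: cfield and Gd Gd'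
 proof -
  have "cut (%z. SUM i:UNIV. n $ i *\<^sub>R (A.tr (%x. g x $ i) z - B.tr (%x. g' x $ i) z))
   = (%z. SUM i:UNIV. n $ i *\<^sub>R ((if z : tri_open then A.tr (%x. g x $ i) z else 0) - (if z : tri_open then B.tr (%x. g' x $ i) z else 0)))"
   by (auto simp: cut_def fun_eq_iff)
  also have "... : borel_measurable lebesgue"
   by (intro borel_measurable_sum borel_measurable_scaleR borel_measurable_const borel_measurable_diff
     A.trace_measurable[OF that(1)] B.trace_measurable[OF that(2)])
  finally show ?thesis .
 qed
 have m: "cut jq : borel_measurable lebesgue" "cut V0 : borel_measurable lebesgue"
  unfolding jq_def V0_def by (rule cutsum[OF tg], rule cutsum[OF tF])
 have cP: "continuous_on UNIV (%x. Pl x $ i)" "continuous_on UNIV (%x. Pl' x $ i)" for i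
  using sP by (auto intro: smooth_continuous smooth_nth)
 have aq: "AE z in lborel. z : tri_open --> aq z = V0 z"
  using A.tr_add[OF tF(1)[of 1] cP(1)[of 1]] A.tr_add[OF tF(1)[of 2] cP(1)[of 2]] A.tr_add[OF tF(1)[of 3] cP(1)[of 3]]
   B.tr_add[OF tF(2)[of 1] cP(2)[of 1]] B.tr_add[OF tF(2)[of 2] cP(2)[of 2]] B.tr_add[OF tF(2)[of 3] cP(2)[of 3]]
  by eventually_elim (simp add: aq_def V0_def sum_3 opposite)
 have e: "A.fnorm (%z. normal_jump A.T A.S u (A.Ph (z, 0))) = A.fnorm jq"
  "A.fnorm (%z. normal_jump A.T A.S V (A.Ph (z, 0))) = A.fnorm V0" "A.fnorm aq = A.fnorm V0"
  by (rule A.fnorm_cong[OF m(1)], unfold jq_def, rule normal_jump_AE[OF aeu tg])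
   (rule A.fnorm_cong[OF m(2)], unfold V0_def, rule normal_jump_AE[OF aeV tF],
    rule A.fnorm_cong[OF m(2) aq, unfolded V0_def])
 have gL: "L2_on A.T (%x. F x + Pl x)" "L2_on B.T (%x. F' x + Pl' x)"
  "!!i. L2_on A.T (%x. Fd i i x + partial i Pl x $ i)" "!!i. L2_on B.T (%x. Fd' i i x + partial i Pl' x $ i)"
  using g by (simp_all add: wgrad_def)
 show ?thesis unfolding e(1,2) e(3)[symmetric] unfolding jq_def[abs_def] aq_def[abs_def]
  by (rule normal_jump_bound[OF bc K u gL aeu tg P _ X]) (rule H0; simp)
qed

end

section \<open>The discrete problem\<close>

text \<open>One mesh of the collection with one pair of solutions. \<open>kappa\<close> and
  \<open>dg\<close> are parameters, to be taken from the collection and from the coefficients, so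
  every constant built from them is common to all meshes.\<close>

locale discretization = problem Om P \<omega> \<mu>0 \<epsilon>lo \<epsilon>up \<sigma>lo \<sigma>up \<mu> \<epsilon> \<sigma> f a b
 for Om and P :: "'l::finite => point set" and \<omega> \<mu>0 \<epsilon>lo \<epsilon>up \<sigma>lo \<sigma>up \<mu> \<epsilon> \<sigma> f a b +
 fixes \<T> :: "point set set" and kappa :: real and mp ep and dg :: nat and us uh :: "real^'l" and ys yh :: cfield
 assumes mesh: "conforming_mesh Om \<T>" "resolves_partition P \<T>"
  and kappa: "kappa \<ge> 1" "!!T. T : \<T> ==> EX x r. 0 < r & cball x r <= T & diameter T <= kappa * r"
  and mp: "!!k. pdegv dg (mp k :: point => real)" "!!k. AE x in lebesgue_on (P k). inverse (\<mu> x) = mp k x"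
  and ep: "!!k. pdegv dg (ep k :: point => complex)" "!!k. AE x in lebesgue_on (P k). eps_sig \<omega> \<epsilon> \<sigma> x = ep k x"
  and fH1: "!!T. T : \<T> ==> H1_on T f"
  and adm: "us : admissible a b" "uh : admissible a b"
  and ys: "is_state Om P \<omega> \<mu> es f us ys" and yh: "H0curl Om yh"
  and ned: "!!T. T : \<T> ==> EX a b. AE x in lebesgue_on T. yh x = a + ccross (of_real_vec x) b"
begin

lemma mesh_facts: "finite \<T>" "\<Union>\<T> = closure Om" "!!A B. A : \<T> ==> B : \<T> ==> (A Int B) face_of A"
 using mesh by (auto simp: conforming_mesh_def triangulation_def)

lemma elem:
 assumes T: "T : \<T>"
 shows "3 simplex T" "compact T" "T : sets lebesgue" "bounded T" "interior T <= Om"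
  "negligible (T - interior T)" "AE x in lebesgue. x : T --> x : interior T"
proof -
 show s: "3 simplex T" using mesh T by (auto simp: conforming_mesh_def)
 then obtain C where C: "\<not> affine_dependent C" "card C = 4" "T = convex hull C" by (auto simp: simplex_def)
 then have "finite C" by (intro card_ge_0_finite) simp
 then show c: "compact T" using C(3) by (simp add: finite_imp_compact compact_convex_hull)
 then show "T : sets lebesgue" "bounded T" by (auto simp: borel_compact compact_imp_bounded)
 have "T <= closure Om" using mesh_facts(2) T by blast
 from interior_mono[OF this] show "interior T <= Om" by (simp add: lipschitz_interior_closure[OF Om(1,3)])
 have "negligible (frontier T)" by (rule negligible_convex_frontier) (simp add: C(3))
 moreover have "T - interior T = frontier T" using c by (simp add: frontier_def compact_imp_closed closure_closed)
 ultimately show n: "negligible (T - interior T)" by simp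
 then have "AE x in lebesgue. x ~: T - interior T" by (intro AE_not_in) (simp add: negligible_iff_null_sets)
 then show "AE x in lebesgue. x : T --> x : interior T" by eventually_elim auto
qed

text \<open>On an element \<open>zf\<close> is polynomial and \<open>qf\<close> is the datum plus a
  polynomial. The degree \<open>Suc dg\<close> is that of a coefficient times the affine Nedelec
  field.\<close>

definition edata :: "point set => (3 => 3 => point => complex) => cfield => cfield => bool" where
 "edata T Fd pT zT \<longleftrightarrow> wgrad T f Fd & pdegv (Suc dg) pT & pdegv (Suc dg) zT \<and>
  (AE x in lebesgue. x : T --> x : Om & qf uh yh x = f x + pT x & zf yh x = zT x)"

lemma edata_exists:
 assumes T: "T : \<T>"
 shows "EX Fd pT zT. edata T Fd pT zT"
proof -
 note e = elem[OF T]
 obtain Fd where Fd: "wgrad T f Fd" using H1_wgrad[OF fH1[OF T]] by blast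
 obtain k where k: "T <= closure (P k)" using mesh(2) T by (auto simp: resolves_partition_def)
 have oP: "open (P j)" "j ~= i ==> P j Int P i = {}" "P j : sets lebesgue" for i j
  using part by (auto simp: is_partition_def borel_open)
 \<comment> \<open>Almost every point of \<open>T\<close> lies in the subdomain whose closure
   contains \<open>T\<close>: any other subdomain is open, and meeting that closure it would meet
   the subdomain itself.\<close>
 have aeP: "AE x in lebesgue. x : T --> x : P k" using AE_P e(7)
 proof eventually_elim
  case (elim x)
  show ?case
  proof
   assume x: "x : T"
   then obtain j where j: "x : P j" using elim e(5) by blast
   have "P j Int closure (P k) ~= {}" using x j k by blast
   then have "P j Int P k ~= {}" using open_Int_closure_eq_empty[OF oP(1)] by blast
   then have "j = k" by (metis oP(2))
   then show "x : P k" using j by simp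
  qed
 qed
 obtain ya yb where y: "AE x in lebesgue_on T. yh x = ya + ccross (of_real_vec x) yb" using ned[OF T] by blast
 define yT where "yT x = ya + ccross (of_real_vec x) yb" for x
 have pyT: "pdegv 1 yT"
  unfolding yT_def[abs_def] by (intro pdegv_add pdegv_const pdegv_id_linear bounded_linear_ccross)
 have aey: "AE x in lebesgue. x : T --> yT x = yh x"
  using y unfolding AE_lebesgue_on_iff[OF e(3)] yT_def by eventually_elim auto
 note Yh = H0curl_facts[OF yh]
 have TO: "T Int Om : sets lebesgue" "negligible (T - T Int Om)"
 proof -
  show "T Int Om : sets lebesgue" using e(3) OmL by (rule sets.Int)
  have "T - T Int Om <= T - interior T" using e(5) by blast
  then show "negligible (T - T Int Om)" by (rule negligible_subset[OF e(6)])
 qed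
 have cL: "L2_on T (wcurl Om yh)" by (rule L2_null_ext[OF L2_subset(1)[OF Yh(3) _ TO(1) OmL] _ TO(1) e(3) TO(2)]) auto
 have c1: "has_weak_curl T yh (wcurl Om yh)"
  by (rule weak_curl_restrict[OF Yh(2) cL e(3) OmL]) (use e(5) Om(1) in \<open>simp add: interior_open\<close>)
 have syT: "smooth yT" by (rule smooth_pdegv[OF pyT])
 have c2: "has_weak_curl T yh (classical_curl yT)"
  by (rule weak_curl_cong[OF smooth_weak_curl[OF syT e(3,4)] L2_test[OF syT e(4,3)] e(3,4) aey])
 \<comment> \<open>The curl of \<open>yh\<close> is selected by choice on the whole domain;
   uniqueness identifies it on \<open>T\<close> with the classical curl of the affine field.\<close>
 note aec = weak_curl_unique[OF c1 c2 e(3,4)]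
 define pT where "pT x = (complex_of_real (\<omega>\<^sup>2) * (complex_of_real (uh $ k) * ep k x)) *s yT x" for x
 define zT where "zT x = mp k x *\<^sub>R classical_curl yT x" for x
 have "pdegv (dg + 1) pT" unfolding pT_def[abs_def]
  by (intro pdegv_scale_bilinear[OF bounded_bilinear_smult] pdegv_linear[OF bounded_linear_mult_right] ep(1) pyT)
 moreover have "pdegv (dg + 1) zT"
  unfolding zT_def[abs_def] by (intro pdegv_scale_bilinear[OF bounded_bilinear_scaleR] mp(1) pdegv_curl pyT)
 moreover have "AE x in lebesgue. x : T --> x : Om & qf uh yh x = f x + pT x & zf yh x = zT x"
  using aeP aey aec e(7) mp(2)[of k, unfolded AE_lebesgue_on_iff[OF oP(3)]] ep(2)[of k, unfolded AE_lebesgue_on_iff[OF oP(3)]]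
 proof eventually_elim
  case (elim x)
  show ?case
  proof
   assume x: "x : T"
   then have P: "x : P k" "x : interior T" using elim by auto
   then show "x : Om & qf uh yh x = f x + pT x & zf yh x = zT x"
    using elim x e(5) by (auto simp: qf_def zf_def pT_def zT_def ctrl_P es_def)
  qed
 qed
 ultimately show ?thesis using Fd unfolding edata_def by auto
qed

end

lemma weak_div_cong:
 assumes c: "has_weak_div T v c" "L2_on T v" and T: "T : sets lebesgue" "bounded T"
  and ae: "AE x in lebesgue. x : T --> v x = v' x"
 shows "has_weak_div T v' c"
 unfolding has_weak_div_def
proof (intro conjI allI impI)
 show "L2_on T c" using c by (simp add: has_weak_div_def)
 fix phi :: "point => complex" assume t: "test_fun T phi"
 then have "smooth phi" by (elim test_funE)
 then have cL: "L2_on T (classical_grad phi)" using T by (intro L2_test smooth_classical_grad)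
 have "vprod T v (classical_grad phi) = vprod T v' (classical_grad phi)"
  by (rule vprod_cong_AE[OF T(1) c(2) cL L2_cong_AE(1)[OF T(1) c(2) ae] cL ae]) simp
 then show "sprod T c phi = - vprod T v' (classical_grad phi)" using c(1) t by (simp add: has_weak_div_def)
qed

lemma test_fun_zero: "test_fun T w ==> x ~: T ==> w x = 0" by (elim test_funE) (use interior_subset in blast)

text \<open>The radius rho is comparable to h up to powers of kappa, so the weights sqrt rho and 1 /
  sqrt rho of the face estimates combine with sqrt h to a factor h and to a constant.\<close>

lemma face_scale:
 assumes "h > 0" "kappa \<ge> (1::real)" and r: "rho = h / (2 * kappa\<^sup>2)"
 shows "rho > 0" "sqrt h * sqrt rho <= h" "sqrt h * (1 / sqrt rho) <= 2 * kappa"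
proof -
 show r0: "rho > 0" using assms by simp
 have "1 <= kappa\<^sup>2" using assms(2) by simp
 then have "rho <= h" using assms(1) unfolding r by (simp add: divide_le_eq mult_le_cancel_left1)
 then have "sqrt h * sqrt rho <= sqrt h * sqrt h" using assms(1) by (intro mult_left_mono) auto
 then show "sqrt h * sqrt rho <= h" using assms(1) by simp
 have "h = 2 * kappa\<^sup>2 * rho" using assms(2) by (simp add: r)
 also have "... <= (2 * kappa)\<^sup>2 * rho" using r0 by (simp add: power_mult_distrib)
 finally have "sqrt h <= sqrt ((2 * kappa)\<^sup>2 * rho)" by (rule real_sqrt_le_mono)
 then have "sqrt h <= 2 * kappa * sqrt rho" using assms(2) by (simp add: real_sqrt_mult)
 then show "sqrt h * (1 / sqrt rho) <= 2 * kappa" using r0 by (simp add: divide_le_eq)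
qed

context problem
begin

text \<open>Together with \<open>M2\<close> and \<open>M3\<close>, the constants for element
  residuals, normal jumps and tangential jumps. \<open>diameter Om\<close> bounds the element size,
  which multiplies the lower order terms.\<close>

definition M1 :: "real => real => real" where
 "M1 kappa Ce = kappa * Ce * ((1 + diameter Om) * C1 + 1)"

definition M2 :: "real => real => real => real" where
 "M2 kappa Ce Cs = (2 + 2 * (2 * kappa\<^sup>2) * (sqrt (2 * Cs) + 2 * Cs)) * (1 + 2 * kappa * M1 kappa Ce + 6 * kappa * C1)"

definition M3 :: "real => real => real => real" where
 "M3 kappa Ce Cv = 2 * kappa\<^sup>2 * (2 * Cv) * (2 * kappa * M1 kappa Ce + C1 * (diameter Om + 12 * kappa))"

lemma diameter_Om: "0 <= diameter Om" by (rule diameter_ge_0[OF Om(2)])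

lemma M_nonneg:
 assumes "kappa \<ge> 1" "Ce > 0"
 shows "0 <= M1 kappa Ce" "Cs > 0 ==> 0 <= M2 kappa Ce Cs" "Cv > 0 ==> 0 <= M3 kappa Ce Cv"
proof -
 show m: "0 <= M1 kappa Ce"
  unfolding M1_def using assms C1_pos diameter_Om by (intro mult_nonneg_nonneg add_nonneg_nonneg) auto
 show "0 <= M2 kappa Ce Cs" if "Cs > 0"
  unfolding M2_def using assms C1_pos m that by (intro mult_nonneg_nonneg add_nonneg_nonneg) auto
 show "0 <= M3 kappa Ce Cv" if "Cv > 0"
  unfolding M3_def using assms C1_pos m that diameter_Om by (intro mult_nonneg_nonneg add_nonneg_nonneg) auto
qed

end

context discretization
begin

definition Nb :: "point set => point set" where "Nb T = \<Union>(neighbours \<T> T)"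

definition err :: "point set => real" where
 "err T = norm (us - uh) + Hcurl_norm (Nb T) (%x. ys x - yh x)"

abbreviation osc :: "point set => real" where "osc T \<equiv> oscillation Om \<T> f T"

lemma err_nonneg: "0 <= err T" by (simp add: err_def Hcurl_norm_def)

lemma neighbours_sub: "neighbours \<T> T <= \<T>" "finite (neighbours \<T> T)"
 using mesh_facts(1) by (auto simp: neighbours_def)

lemma Nb: "compact (Nb T)" "interior (Nb T) <= Om" "negligible (Nb T - interior (Nb T))"
proof -
 show "compact (Nb T)" unfolding Nb_def using neighbours_sub elem(2) by (intro compact_Union) auto
 have "Nb T <= closure Om" unfolding Nb_def mesh_facts(2)[symmetric] by (rule Union_mono[OF neighbours_sub(1)])
 from interior_mono[OF this] show "interior (Nb T) <= Om" by (simp add: lipschitz_interior_closure[OF Om(1,3)])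
 have "negligible (\<Union>T'\<in>neighbours \<T> T. T' - interior T')"
  using neighbours_sub elem(6) by (intro negligible_Union) auto
 moreover have "Nb T - interior (Nb T) <= (\<Union>T'\<in>neighbours \<T> T. T' - interior T')"
 proof
  fix x assume x: "x : Nb T - interior (Nb T)"
  then obtain T' where T': "T' : neighbours \<T> T" "x : T'" by (auto simp: Nb_def)
  have "interior T' <= interior (Nb T)" using T'(1) by (intro interior_mono) (auto simp: Nb_def)
  then show "x : (\<Union>T'\<in>neighbours \<T> T. T' - interior T')" using x T' by auto
 qed
 ultimately show "negligible (Nb T - interior (Nb T))" by (rule negligible_subset)
qed

lemmas res = residual[OF adm ys yh Nb, folded err_def]

lemma osc_bounds:
 assumes T: "T : \<T>"
 shows "T' : neighbours \<T> T ==> diameter T' * L2_norm T' (%x. f x - proj0_vec T' f) <= osc T"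
  "T' : neighbours \<T> T ==> diameter T' * L2_norm T' (%x. wdiv T' f x - proj0_scal T' (wdiv T' f)) <= osc T"
  "S : interior_faces Om T ==>
   sqrt (diameter T) * face_L2_norm S (normal_jump T S (%x. f x - pw_proj0_vec \<T> f x)) <= osc T"
  "0 <= osc T"
proof -
 define e1 where "e1 T' = diameter T' * L2_norm T' (%x. f x - proj0_vec T' f)" for T'
 define e2 where "e2 T' = diameter T' * L2_norm T' (%x. wdiv T' f x - proj0_scal T' (wdiv T' f))" for T'
 define e3 where "e3 S = sqrt (diameter T) * face_L2_norm S (normal_jump T S (%x. f x - pw_proj0_vec \<T> f x))" for S
 have d: "0 <= diameter T'" if "T' : \<T>" for T' using elem(4)[OF that] by (rule diameter_ge_0)
 have n12: "0 <= e1 T'" "0 <= e2 T'" if "T' : neighbours \<T> T" for T'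
  using d[OF subsetD[OF neighbours_sub(1) that]] by (simp_all add: e1_def e2_def L2_norm_nonneg)
 have n3: "0 <= e3 S" for S using d[OF T] by (simp add: e3_def face_L2_norm_nonneg)
 have o: "osc T = (SUM T':neighbours \<T> T. e1 T' + e2 T') + (SUM S:interior_faces Om T. e3 S)"
  by (simp add: oscillation_def e1_def e2_def e3_def)
 have fS: "finite (interior_faces Om T)" using faces_card(1)[OF elem(1)[OF T]] by (simp add: interior_faces_def)
 have s: "0 <= (SUM T':neighbours \<T> T. e1 T' + e2 T')" "0 <= (SUM S:interior_faces Om T. e3 S)"
  using n12 n3 by (auto intro!: sum_nonneg add_nonneg_nonneg)
 show "0 <= osc T" using s o by simp
 have le: "e1 T' + e2 T' <= osc T" if "T' : neighbours \<T> T" for T'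
  using member_le_sum[OF that, of "%T'. e1 T' + e2 T'"] n12 neighbours_sub(2) s o by (fastforce intro: add_nonneg_nonneg)
 show "e1 T' <= osc T" "e2 T' <= osc T" if "T' : neighbours \<T> T" using le[OF that] n12[OF that] by auto
 show "e3 S <= osc T" if "S : interior_faces Om T" using member_le_sum[OF that, of e3] n3 fS s o by fastforce
qed

lemma diameter_le: "T : \<T> ==> diameter T <= diameter Om"
 using mesh_facts(2) diameter_subset[of T "closure Om"] diameter_closure[OF Om(2)] bounded_closure[OF Om(2)] by auto

lemma ball_diameter: "T : \<T> ==> 0 < r ==> cball x r <= T ==> r <= diameter T"
 using diameter_subset[of "cball x r" T] elem(4) by auto

text \<open>The element runs over all neighbours of \<open>T0\<close>, because the jump estimates
  call for residuals on both sides of a face; patch and oscillation stay those of \<open>T0\<close>.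
  The factor \<open>kappa\<close> exchanges the radius of the inscribed ball for the
  diameter.\<close>

lemma element_bound:
 assumes Ce: "element_const kappa (Suc dg) Ce" and T0: "T0 : \<T>" and T: "T : neighbours \<T> T0" and ed: "edata T Fd pT zT"
 shows "diameter T * L2_norm T (%x. SUM i:UNIV. Fd i i x + partial i pT x $ i) <= M1 kappa Ce * (err T0 + osc T0)"
  and "diameter T * L2_norm T (%x. f x + pT x - classical_curl zT x) <= M1 kappa Ce * (err T0 + osc T0)"
proof -
 have TT: "T : \<T>" using T neighbours_sub(1) by blast
 note e = elem[OF TT]
 note ob = osc_bounds[OF T0]
 have Ce0: "Ce > 0" using Ce by (simp add: element_const_def)
 obtain x0 r0 where b: "0 < r0" "cball x0 r0 <= T" "diameter T <= kappa * r0" using kappa(2)[OF TT] by blast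
 have x0: "x0 : T" using b(1,2) by auto
 have TK: "T <= cball x0 (kappa * r0)" using diameter_bounded_bound[OF e(4) x0] b(3) by force
 have rd: "r0 <= diameter T" by (rule ball_diameter[OF TT b(1,2)])
 define A where "A = C1 * err T0"
 have A: "0 <= A" using C1_pos err_nonneg by (simp add: A_def)
 have ed': "wgrad T f Fd" "pdegv (Suc dg) pT" "pdegv (Suc dg) zT"
  "AE x in lebesgue. x : T --> x : Om & qf uh yh x = f x + pT x & zf yh x = zT x" using ed by (auto simp: edata_def)
 define df where "df x = (SUM i:UNIV. Fd i i x)" for x
 have div: "has_weak_div T f df" unfolding df_def by (rule wgrad_div[OF ed'(1) e(3,4)])
 have L: "L2_on T f" "L2_on T df" using ed'(1) div by (auto simp: wgrad_def has_weak_div_def)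
 have z: "w x = 0" if "test_fun T w" "x ~: Nb T0" for w :: "point => 'z::real_normed_vector" and x
  using test_fun_zero[OF that(1), of x] that(2) T by (auto simp: Nb_def)
 have tO: "test_fun Om w" if "test_fun T w" for w :: "point => 'z::real_normed_vector"
  using that e(5) Om(1) by (intro test_fun_mono[OF that]) (simp add: interior_open)
 have H1: "ALL w. test_fun T w --> norm (vprod Om (qf uh yh) w - vprod Om (zf yh) (classical_curl w))
   <= A * (L2_norm Om w + L2_norm Om (classical_curl w))"
  unfolding A_def by (intro allI impI res(1)) (auto intro: tO z)
 have H0: "\<forall>phi. test_fun T phi --> symm phi --> norm (vprod Om (qf uh yh) (classical_grad phi)) <= A * L2_norm Om (classical_grad phi)"
  unfolding A_def by (intro allI impI res(2)) (auto intro: tO z)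
 \<comment> \<open>The free constants of the element estimate become the means that occur in the
   oscillation.\<close>
 define c0 where "c0 = proj0_scal T (wdiv T f)"
 define c1 where "c1 = proj0_vec T f"
 note est = conjunct2[OF Ce[unfolded element_const_def], THEN spec[where x = Om], THEN spec[where x = T],
   THEN spec[where x = x0], THEN spec[where x = r0], THEN spec[where x = "qf uh yh"], THEN spec[where x = "zf yh"],
   THEN spec[where x = f], THEN spec[where x = pT], THEN spec[where x = zT], THEN spec[where x = df],
   THEN spec[where x = A], THEN spec[where x = c0], THEN spec[where x = c1],
   THEN HOL.mp, OF Om(1), THEN HOL.mp, OF Om(2), THEN HOL.mp, OF e(3), THEN HOL.mp, OF e(4), THEN HOL.mp, OF e(5), THEN HOL.mp, OF b(1),
   THEN HOL.mp, OF b(2), THEN HOL.mp, OF TK, THEN HOL.mp, OF A, THEN HOL.mp, OF res(3), THEN HOL.mp, OF res(4), THEN HOL.mp, OF L(1),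
   THEN HOL.mp, OF L(2), THEN HOL.mp, OF ed'(2), THEN HOL.mp, OF ed'(3), THEN HOL.mp, OF ed'(4), THEN HOL.mp, OF div, THEN HOL.mp, OF H1,
   THEN HOL.mp, OF H0]
 have up: "diameter T * X <= M1 kappa Ce * (err T0 + osc T0)"
  if X: "0 <= X" "r0 * X <= Ce * (k * A + r0 * Y)" "0 <= Y" "diameter T * Y <= osc T0" "0 <= k" "k <= 1 + diameter Om" for X Y k
 proof -
  have "r0 * Y <= osc T0" using mult_right_mono[OF rd X(3)] X(4) by linarith
  moreover have "k * A <= (1 + diameter Om) * C1 * err T0"
   using mult_right_mono[OF X(6) A] by (simp add: A_def mult_ac)
  moreover have "0 <= (1 + diameter Om) * C1 * osc T0" "0 <= err T0"
   using diameter_Om C1_pos ob(4) err_nonneg by (auto intro!: mult_nonneg_nonneg)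
  ultimately have "k * A + r0 * Y <= ((1 + diameter Om) * C1 + 1) * (err T0 + osc T0)" by (simp add: algebra_simps)
  then have "Ce * (k * A + r0 * Y) <= Ce * (((1 + diameter Om) * C1 + 1) * (err T0 + osc T0))"
   using Ce0 by (intro mult_left_mono) auto
  then have "r0 * X <= Ce * (((1 + diameter Om) * C1 + 1) * (err T0 + osc T0))" using X(2) by linarith
  then have "kappa * (r0 * X) <= kappa * (Ce * (((1 + diameter Om) * C1 + 1) * (err T0 + osc T0)))"
   using kappa(1) by (intro mult_left_mono) auto
  moreover have "diameter T * X <= kappa * (r0 * X)" using mult_right_mono[OF b(3) X(1)] by (simp add: mult_ac)
  ultimately show ?thesis by (simp add: M1_def mult_ac)
 qed
 show "diameter T * L2_norm T (%x. SUM i:UNIV. Fd i i x + partial i pT x $ i) <= M1 kappa Ce * (err T0 + osc T0)"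
 proof (rule up[OF L2_norm_nonneg _ L2_norm_nonneg])
  show "r0 * L2_norm T (%x. SUM i:UNIV. Fd i i x + partial i pT x $ i) <= Ce * (1 * A + r0 * L2_norm T (%x. df x - c0))"
   using conjunct1[OF est] by (simp add: df_def sum.distrib)
  \<comment> \<open>The oscillation refers to a weak divergence selected by choice, which agrees
    almost everywhere with the diagonal sum of the weak gradient.\<close>
  have w: "has_weak_div T f (wdiv T f)" by (rule wdiv_weak[OF div])
  have "AE x in lebesgue. x : T --> wdiv T f x - c0 = df x - c0"
   using weak_div_unique[OF w div e(3,4)] e(7) by eventually_elim auto
  moreover have "L2_on T (%x. wdiv T f x - c0)"
   by (rule L2_diff(1)[OF _ L2_continuous[OF continuous_on_const e(4,3)]]) (use w in \<open>simp add: has_weak_div_def\<close>)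
  ultimately have "L2_norm T (%x. df x - c0) = L2_norm T (%x. wdiv T f x - c0)"
   by (rule L2_cong_AE(2)[OF e(3), rotated])
  then show "diameter T * L2_norm T (%x. df x - c0) <= osc T0" using ob(2)[OF T] by (simp add: c0_def)
 qed (use diameter_Om in auto)
 show "diameter T * L2_norm T (%x. f x + pT x - classical_curl zT x) <= M1 kappa Ce * (err T0 + osc T0)"
  by (rule up[OF L2_norm_nonneg conjunct2[OF est] L2_norm_nonneg])
   (use ob(1)[OF T] b(1) rd diameter_le[OF TT] in \<open>simp_all add: c1_def\<close>)
qed

text \<open>Elements intersect in common faces, so a point interior to one element is interior to no
  other and selects its mean.\<close>

lemma pw_proj: "T : \<T> ==> x : interior T ==> pw_proj0_vec \<T> f x = proj0_vec T f"
proof -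
 assume T: "T : \<T>" "x : interior T"
 have "(THE T. T : \<T> & x : interior T) = T"
 proof (rule the_equality)
  show "T : \<T> & x : interior T" using T by simp
  fix T' assume T': "T' : \<T> & x : interior T'"
  then have x: "x : T Int T'" using T interior_subset by blast
  have "T Int T' = T" using face_of_disjoint_interior[OF mesh_facts(3)[of T T']] T T' x by blast
  moreover have "T' Int T = T'" using face_of_disjoint_interior[OF mesh_facts(3)[of T' T]] T T' x by blast
  ultimately show "T' = T" by blast
 qed
 then show ?thesis by (simp add: pw_proj0_vec_def)
qed

text \<open>The neighbour across the face is comparable in size, so one bump radius serves both
  sides, and the residuals on both sides can carry the weight of \<open>T\<close>.\<close>

lemma face_bound:
 assumes Ce: "element_const kappa (Suc dg) Ce" and Cs: "bubble_const (2 * kappa\<^sup>2) (Suc dg) TYPE(complex) Cs"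
  and Cv: "bubble_const (2 * kappa\<^sup>2) (Suc dg) TYPE(complex^3) Cv" and T: "T : \<T>" and S: "S : interior_faces Om T"
 shows "sqrt (diameter T) * face_L2_norm S (normal_jump T S (qf uh yh)) <= M2 kappa Ce Cs * (err T + osc T)"
  and "sqrt (diameter T) * face_L2_norm S (tangential_jump T S (zf yh)) <= M3 kappa Ce Cv * (err T + osc T)"
proof -
 note e = elem[OF T]
 have Sf: "S facet_of T" using S by (simp add: interior_faces_def faces_def)
 obtain x0 r0 where b: "0 < r0" "cball x0 r0 <= T" "diameter T <= kappa * r0" using kappa(2)[OF T] by blast
 obtain p q r n v where c: "tet p q r n v" "T = convex hull {v, p, q, r}" "S = convex hull {p, q, r}"
  "\<not> affine_dependent {p, q, r}" "card {p, q, r} = 3"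
  "!!h. face_integral S h = face_frame.J (q - p) (r - p) *
   (LINT z|lebesgue_on tri. h (face_frame.Ph p (q - p) (r - p) n (z, 0)))"
  using face_choice[OF e(1) Sf b(2,1)] by metis
 obtain T' v' where T': "T' : \<T>" "S facet_of T'" "T' = convex hull {v', p, q, r}" "tet p q r (- n) v'"
 proof (rule neighbour_exists[OF mesh(1) Om(1) T S c(3,1,2,4,5)])
  show "EX x r. 0 < r & cball x r <= T'" if "T' : \<T>" for T' using kappa(2)[OF that] by blast
 qed
 note e' = elem[OF T'(1)]
 obtain x1 r1 where b': "0 < r1" "cball x1 r1 <= T'" "diameter T' <= kappa * r1" using kappa(2)[OF T'(1)] by blast
 interpret t: tet p q r n v by (rule c(1))
 interpret t': tet p q r "- n" v' by (rule T'(4))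
 have TT: "t.T = T" "t.S = S" "t'.T = T'" by (simp_all add: t.T_def t.S_def t'.T_def c(2,3) T'(3))
 define h where "h = diameter T"
 have k0: "kappa > 0" using kappa(1) by simp
 have h0: "h > 0" using ball_diameter[OF T b(1,2)] b(1) by (simp add: h_def)
 \<comment> \<open>By shape regularity h <= kappa r0 and, through the common face, h <= kappa
   (diameter T') <= kappa^2 r1. Hence rho is at most half of either inscribed radius, below the
   admissible 2/3, while \<open>T\<close> still lies within 2 kappa^2 bump radii.\<close>
 define rho where "rho = h / (2 * kappa\<^sup>2)"
 note fs = face_scale[OF h0 kappa(1) rho_def]
 have r0S: "r0 <= diameter S" using t.diameter_S[of r0 x0] b(1,2) by (simp add: TT)
 have "S <= T'" using T'(2) by (rule facet_of_imp_subset)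
 then have ST': "diameter S <= diameter T'" by (rule diameter_subset[OF _ e'(4)])
 have hr0: "h <= kappa * r0" using b(3) by (simp add: h_def)
 have hT': "h <= kappa * diameter T'" using hr0 mult_left_mono[OF order_trans[OF r0S ST'], of kappa] k0 by linarith
 have rho0: "rho < 2 * r0 / 3"
 proof -
  have "kappa * r0 <= kappa\<^sup>2 * r0" using self_le_power[OF kappa(1), of 2] b(1) by (intro mult_right_mono) auto
  with hr0 have "h <= kappa\<^sup>2 * r0" by linarith
  then have "rho <= r0 / 2" unfolding rho_def using k0 by (simp add: field_simps)
  then show ?thesis using b(1) by simp
 qed
 have rho1: "rho < 2 * r1 / 3"
 proof -
  have "h <= kappa * (kappa * r1)" using hT' mult_left_mono[OF b'(3), of kappa] k0 by linarith
  then have "rho <= r1 / 2" unfolding rho_def using k0 by (simp add: field_simps power2_eq_square)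
  then show ?thesis using b'(1) by simp
 qed
 have nb: "T : neighbours \<T> T" "T' : neighbours \<T> T" using T T'(1,2) Sf by (auto simp: neighbours_def faces_def)
 interpret fp: face_pair p q r n v v' Om x0 x1 r0 r1 rho
 proof (unfold_locales, unfold TT)
  have "T Un T' <= closure Om" using T T'(1) mesh_facts(2) by blast
  from interior_mono[OF this] show "interior (T Un T') <= Om" by (simp add: lipschitz_interior_closure[OF Om(1,3)])
 qed (use Om b b' fs rho0 rho1 in auto)
 have K: "1 <= 2 * kappa\<^sup>2" "diameter t.T <= 2 * kappa\<^sup>2 * rho"
  using one_le_power[OF kappa(1), of 2] k0 by (linarith, simp add: TT rho_def h_def)
 have fn: "face_L2_norm S g = t.fnorm (%z. g (t.Ph (z, 0)))" for g :: "point => 'z::euclidean_space"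
  by (simp add: face_L2_norm_def t.fnorm_def c(6))
 obtain Fd pT zT where ed: "edata T Fd pT zT" using edata_exists[OF T] by blast
 obtain Fd' pT' zT' where ed': "edata T' Fd' pT' zT'" using edata_exists[OF T'(1)] by blast
 have d: "wgrad T f Fd" "pdegv (Suc dg) pT" "pdegv (Suc dg) zT"
  "AE x in lebesgue. x : T --> x : Om & qf uh yh x = f x + pT x & zf yh x = zT x" using ed by (auto simp: edata_def)
 have d': "wgrad T' f Fd'" "pdegv (Suc dg) pT'" "pdegv (Suc dg) zT'"
  "AE x in lebesgue. x : T' --> x : Om & qf uh yh x = f x + pT' x & zf yh x = zT' x"
  using ed' by (auto simp: edata_def)
 define A where "A = C1 * err T"
 define R where "R = err T + osc T"
 note ob = osc_bounds[OF T]
 have A: "0 <= A" "A <= C1 * R" using C1_pos err_nonneg ob(4) by (auto simp: A_def R_def intro!: mult_left_mono)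
 have R: "0 <= R" "osc T <= R" using err_nonneg ob(4) by (auto simp: R_def)
 have Ce0: "Ce > 0" using Ce by (simp add: element_const_def)
 note M1n = M_nonneg(1)[OF kappa(1) Ce0]
 have scale: "h * D <= kappa * M1 kappa Ce * R" if "diameter T' * D <= M1 kappa Ce * R" "0 <= D" for D
 proof -
  have "h * D <= kappa * (diameter T' * D)" using mult_right_mono[OF hT' that(2)] by (simp add: mult.assoc)
  also have "... <= kappa * (M1 kappa Ce * R)" by (rule mult_left_mono[OF that(1)]) (use k0 in simp)
  finally show ?thesis by (simp only: mult.assoc)
 qed
 have scale0: "h * D <= kappa * M1 kappa Ce * R" if "diameter T * D <= M1 kappa Ce * R" for D
 proof -
  have "1 * (M1 kappa Ce * R) <= kappa * (M1 kappa Ce * R)" using kappa(1) M1n R by (intro mult_right_mono) auto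
  then show ?thesis using that by (simp add: h_def mult.assoc)
 qed
 have comb: "sqrt h * (sqrt rho * (D + D')) <= 2 * kappa * M1 kappa Ce * R"
  if "h * D <= kappa * M1 kappa Ce * R" "h * D' <= kappa * M1 kappa Ce * R" "0 <= D" "0 <= D'" for D D'
 proof -
  have "(sqrt h * sqrt rho) * (D + D') <= h * (D + D')" using fs(2) that by (intro mult_right_mono) auto
  then show ?thesis using that by (simp add: algebra_simps)
 qed
 have inT: "x ~: Nb T ==> x ~: t.T Un t'.T" for x using nb by (auto simp: Nb_def TT)
 show "sqrt (diameter T) * face_L2_norm S (normal_jump T S (qf uh yh)) <= M2 kappa Ce Cs * (err T + osc T)"
 proof -
  define V where "V x = f x - pw_proj0_vec \<T> f x" for x
  \<comment> \<open>The means pass from the datum to the polynomial part, so that the non-polynomial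
    rest is the function whose jump the oscillation contains.\<close>
  define c0 where "c0 = proj0_vec T f"
  define c1 where "c1 = proj0_vec T' f"
  have w: "wgrad T (%x. f x + (- c0)) Fd" "wgrad T' (%x. f x + (- c1)) Fd'"
   using wgrad_add_smooth[OF d(1) smooth_const[where c = "- c0"] e(3,4)]
    wgrad_add_smooth[OF d'(1) smooth_const[where c = "- c1"] e'(3,4)] by simp_all
  have P: "pdegv (Suc dg) (%x. c0 + pT x)" "pdegv (Suc dg) (%x. c1 + pT' x)" by (intro pdegv_add pdegv_const d d')+
  have dP: "partial i (%x. c0 + pT x) = partial i pT" "partial i (%x. c1 + pT' x) = partial i pT'" for i
   using partial_add[OF smooth_const smooth_pdegv[OF d(2)]] partial_add[OF smooth_const smooth_pdegv[OF d'(2)]]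
   by (auto simp: fun_eq_iff)
  have ae: "AE x in lebesgue. x : T --> qf uh yh x = (f x + (- c0)) + (c0 + pT x) & V x = f x + (- c0)"
   "AE x in lebesgue. x : T' --> qf uh yh x = (f x + (- c1)) + (c1 + pT' x) & V x = f x + (- c1)"
   using d(4) e(7) by (eventually_elim, auto simp: V_def c0_def pw_proj[OF T])
    (use d'(4) e'(7) in \<open>eventually_elim, auto simp: V_def c1_def pw_proj[OF T'(1)]\<close>)
  define D where "D = L2_norm T (%x. SUM i:UNIV. Fd i i x + partial i pT x $ i)"
  define D' where "D' = L2_norm T' (%x. SUM i:UNIV. Fd' i i x + partial i pT' x $ i)"
  define CC where "CC = 2 + 2 * (2 * kappa\<^sup>2) * (sqrt (2 * Cs) + 2 * Cs)"
  have CC: "0 <= CC" using Cs by (auto simp: CC_def bubble_const_def intro!: add_nonneg_nonneg mult_nonneg_nonneg)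
  have "t.fnorm (%z. normal_jump t.T t.S (qf uh yh) (t.Ph (z, 0))) <= (2 + 2 * (2 * kappa\<^sup>2) * (sqrt (2 * Cs) + 2 * Cs)) *
   (t.fnorm (%z. normal_jump t.T t.S V (t.Ph (z, 0))) +
   (sqrt rho * (L2_norm t.T (%x. SUM i:UNIV. Fd i i x + partial i (%x. c0 + pT x) x $ i)
    + L2_norm t'.T (%x. SUM i:UNIV. Fd' i i x + partial i (%x. c1 + pT' x) x $ i)) + 3 * A / sqrt rho))"
  proof (rule fp.normal_face_bound[OF Cs K res(3) w[folded TT] P ae[folded TT] _ A(1)])
   show "norm (vprod Om (qf uh yh) (classical_grad phi)) <= A * L2_norm Om (classical_grad phi)"
    if "test_fun Om phi" "symm phi" "!!x. x ~: t.T Un t'.T ==> phi x = 0" for phi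
    unfolding A_def using that(3) inT by (intro res(2) that(1,2)) blast
  qed
  then have "face_L2_norm S (normal_jump T S (qf uh yh)) <= CC * (face_L2_norm S (normal_jump T S V) + (sqrt rho * (D + D') + 3 * A / sqrt rho))"
   unfolding TT dP fn[symmetric] CC_def D_def D'_def .
  then have "sqrt h * face_L2_norm S (normal_jump T S (qf uh yh)) <= sqrt h * (CC * (face_L2_norm S (normal_jump T S V) + (sqrt rho * (D + D') + 3 * A / sqrt rho)))"
   using h0 by (intro mult_left_mono) auto
  also have "... = CC * (sqrt h * face_L2_norm S (normal_jump T S V) + (sqrt h * (sqrt rho * (D + D')) + 3 * A * (sqrt h * (1 / sqrt rho))))"
   by (simp add: algebra_simps)
  also have "... <= CC * (R + (2 * kappa * M1 kappa Ce * R + 3 * (C1 * R) * (2 * kappa)))"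
  proof (intro mult_left_mono[OF _ CC] add_mono)
   show "sqrt h * face_L2_norm S (normal_jump T S V) <= R"
    using ob(3)[OF S] R(2) unfolding h_def V_def[abs_def] by linarith
   show "sqrt h * (sqrt rho * (D + D')) <= 2 * kappa * M1 kappa Ce * R"
    using element_bound(1)[OF Ce T nb(1) ed] element_bound(1)[OF Ce T nb(2) ed']
    by (intro comb scale scale0) (simp_all add: D_def D'_def R_def L2_norm_nonneg)
   show "3 * A * (sqrt h * (1 / sqrt rho)) <= 3 * (C1 * R) * (2 * kappa)"
    by (rule mult_mono) (use A fs h0 R C1_pos in auto)
  qed
  also have "... = M2 kappa Ce Cs * R" by (simp add: M2_def CC_def algebra_simps)
  finally show ?thesis by (simp add: h_def R_def)
 qed
 show "sqrt (diameter T) * face_L2_norm S (tangential_jump T S (zf yh)) <= M3 kappa Ce Cv * (err T + osc T)"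
 proof -
  have sp: "smooth pT" "smooth pT'" "smooth zT" "smooth zT'" using d d' by (auto intro: smooth_pdegv)
  have ae: "AE x in lebesgue. x : T --> qf uh yh x = f x + pT x" "AE x in lebesgue. x : T' --> qf uh yh x = f x + pT' x"
   "AE x in lebesgue. x : T --> zf yh x = zT x" "AE x in lebesgue. x : T' --> zf yh x = zT' x"
   using d(4) d'(4) by (auto elim: eventually_mono)
  have L: "L2_on T (%x. f x + pT x)" "L2_on T' (%x. f x + pT' x)"
   using d(1) d'(1) sp e e' by (auto simp: wgrad_def intro!: L2_add(1) L2_test)
  define D where "D = L2_norm T (%x. f x + pT x - classical_curl zT x)"
  define D' where "D' = L2_norm T' (%x. f x + pT' x - classical_curl zT' x)"
  have "t.fnorm (%z. ccross (zT (t.Ph (z, 0)) - zT' (t.Ph (z, 0))) (of_real_vec n)) <= 2 * kappa\<^sup>2 * (2 * Cv) *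
   (sqrt rho * (L2_norm t.T (%x. f x + pT x - classical_curl zT x) + L2_norm t'.T (%x. f x + pT' x - classical_curl zT' x))
   + A * (sqrt rho + 6 / sqrt rho))"
  proof (rule fp.tangential_jump_bound[OF Cv K res(3) L[folded TT] res(4) ae[folded TT] d(3) d'(3) _ A(1)])
   show "norm (vprod Om (qf uh yh) w - vprod Om (zf yh) (classical_curl w)) <= A * (L2_norm Om w + L2_norm Om (classical_curl w))"
    if "test_fun Om w" "!!x. x ~: t.T Un t'.T ==> w x = 0" for w
    unfolding A_def using that(2) inT by (intro res(1) that(1)) blast
  qed
  moreover have "t.fnorm (%z. tangential_jump t.T t.S (zf yh) (t.Ph (z, 0)))
    = t.fnorm (%z. ccross (zT (t.Ph (z, 0)) - zT' (t.Ph (z, 0))) (of_real_vec n))"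
  proof (rule t.fnorm_cong)
   have "continuous_on UNIV (%x. ccross (zT x - zT' x) (of_real_vec n))"
    using sp by (intro bounded_linear.continuous_on[OF bounded_linear_ccross_left] smooth_continuous smooth_diff)
   from t.cut_continuous(1)[OF this]
   show "cut (%z. ccross (zT (t.Ph (z, 0)) - zT' (t.Ph (z, 0))) (of_real_vec n)) : borel_measurable lebesgue" .
  qed (rule fp.tangential_jump_AE[OF ae(3,4)[folded TT] smooth_continuous[OF sp(3)] smooth_continuous[OF sp(4)]])
  ultimately have "face_L2_norm S (tangential_jump T S (zf yh)) <= 2 * kappa\<^sup>2 * (2 * Cv) * (sqrt rho * (D + D') + A * (sqrt rho + 6 / sqrt rho))"
   unfolding TT fn D_def D'_def by simp
  then have "sqrt h * face_L2_norm S (tangential_jump T S (zf yh)) <= sqrt h * (2 * kappa\<^sup>2 * (2 * Cv) * (sqrt rho * (D + D') + A * (sqrt rho + 6 / sqrt rho)))"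
   using h0 by (intro mult_left_mono) auto
  also have "... = 2 * kappa\<^sup>2 * (2 * Cv) * (sqrt h * (sqrt rho * (D + D')) + A * (sqrt h * sqrt rho + 6 * (sqrt h * (1 / sqrt rho))))"
   by (simp add: algebra_simps)
  also have "... <= 2 * kappa\<^sup>2 * (2 * Cv) * (2 * kappa * M1 kappa Ce * R + (C1 * R) * (diameter Om + 6 * (2 * kappa)))"
  proof (rule mult_left_mono, rule add_mono)
   show "sqrt h * (sqrt rho * (D + D')) <= 2 * kappa * M1 kappa Ce * R"
    using element_bound(2)[OF Ce T nb(1) ed] element_bound(2)[OF Ce T nb(2) ed']
    by (intro comb scale scale0) (simp_all add: D_def D'_def R_def L2_norm_nonneg)
   have "h <= diameter Om" using diameter_le[OF T] by (simp add: h_def)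
   then have "sqrt h * sqrt rho + 6 * (sqrt h * (1 / sqrt rho)) <= diameter Om + 6 * (2 * kappa)" using fs(2,3) by linarith
   then show "A * (sqrt h * sqrt rho + 6 * (sqrt h * (1 / sqrt rho))) <= (C1 * R) * (diameter Om + 6 * (2 * kappa))"
    by (rule mult_mono[OF A(2)]) (use fs(1) h0 R C1_pos in auto)
   show "0 <= 2 * kappa\<^sup>2 * (2 * Cv)" using Cv by (simp add: bubble_const_def)
  qed
  also have "... = M3 kappa Ce Cv * R" by (simp add: M3_def algebra_simps)
  finally show ?thesis by (simp add: h_def R_def)
 qed
qed

text \<open>The weak divergence and curl inside the indicator are replaced by the explicit ones on
  the element. An element has at most four faces, so the sum of squared jumps is a multiple of one
  bound.\<close>

lemma indicator_bound:
 assumes Ce: "element_const kappa (Suc dg) Ce" and Cs: "bubble_const (2 * kappa\<^sup>2) (Suc dg) TYPE(complex) Cs"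
  and Cv: "bubble_const (2 * kappa\<^sup>2) (Suc dg) TYPE(complex^3) Cv" and T: "T : \<T>"
 shows "indicator_st Om P \<omega> \<mu> es f uh yh T <= 4 * (M1 kappa Ce + M2 kappa Ce Cs + M3 kappa Ce Cv) * (err T + osc T)"
proof -
 note e = elem[OF T]
 define R where "R = err T + osc T"
 have R: "0 <= R" using err_nonneg osc_bounds(4)[OF T] by (simp add: R_def)
 have Ce0: "Ce > 0" "Cs > 0" "Cv > 0" using Ce Cs Cv by (auto simp: element_const_def bubble_const_def)
 have Mn: "0 <= M1 kappa Ce" "0 <= M2 kappa Ce Cs" "0 <= M3 kappa Ce Cv" using M_nonneg[OF kappa(1) Ce0(1)] Ce0 by auto
 have fS: "finite (interior_faces Om T)" "card (interior_faces Om T) <= 4"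
  using faces_card[OF e(1)] card_mono[of "faces T" "interior_faces Om T"] by (auto simp: interior_faces_def)
 have nb: "T : neighbours \<T> T"
 proof -
  obtain C where C: "\<not> affine_dependent C" "card C = 4" "T = convex hull C" using e(1) by (auto simp: simplex_def)
  then obtain u where u: "u : C" by fastforce
  have "card (C - {u}) = 3" using C(2) u by (simp add: card_ge_0_finite)
  then have "convex hull (C - {u}) ~= {}" by (metis card.empty convex_hull_eq_empty zero_neq_numeral)
  then have "convex hull (C - {u}) facet_of T"
   unfolding C(3) facet_of_convex_hull_affine_independent[OF C(1)] using u by blast
  then show ?thesis using T by (auto simp: neighbours_def faces_def)
 qed
 obtain Fd pT zT where ed: "edata T Fd pT zT" using edata_exists[OF T] by blast
 let ?dv = "%x. SUM i:UNIV. Fd i i x + partial i pT x $ i" and ?rs = "%x. f x + pT x - classical_curl zT x"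
 let ?sum = "%Y. SUM S:interior_faces Om T. (Y S)\<^sup>2"
 have d: "wgrad T f Fd" "pdegv (Suc dg) pT" "pdegv (Suc dg) zT"
  "AE x in lebesgue. x : T --> x : Om & qf uh yh x = f x + pT x & zf yh x = zT x" using ed by (auto simp: edata_def)
 have sp: "smooth pT" "smooth zT" using d by (auto intro: smooth_pdegv)
 have aeq: "AE x in lebesgue. x : T --> f x + pT x = qf uh yh x" and aez: "AE x in lebesgue. x : T --> zT x = zf yh x"
  using d(4) by (auto elim: eventually_mono)
 have L: "L2_on T (%x. f x + pT x)" "L2_on T zT" "L2_on T (classical_curl zT)"
  using d(1) sp e by (auto simp: wgrad_def intro!: L2_add(1) L2_test smooth_classical_curl)
 have dv: "has_weak_div T (qf uh yh) ?dv"
  by (rule weak_div_cong[OF wgrad_div[OF wgrad_add_smooth[OF d(1) sp(1) e(3,4)] e(3,4)] L(1) e(3,4) aeq])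
 have "AE x in lebesgue. x : T --> (SUM i:UNIV. Fd i i x + partial i pT x $ i) = wdiv T (qf uh yh) x"
  using weak_div_unique[OF dv wdiv_weak[OF dv] e(3,4)] e(7) by eventually_elim auto
 then have n1: "L2_norm T (wdiv T (qf uh yh)) = L2_norm T ?dv"
  using dv by (intro L2_cong_AE(2)[OF e(3)]) (auto simp: has_weak_div_def)
 have cz: "has_weak_curl T (zf yh) (classical_curl zT)"
  by (rule weak_curl_cong[OF smooth_weak_curl[OF sp(2) e(3,4)] L(2) e(3,4) aez])
 have "AE x in lebesgue. x : T --> f x + pT x - classical_curl zT x
   = f x - wcurl T (zf yh) x + (complex_of_real (\<omega>\<^sup>2) * ctrl_coeff P es uh x) *s yh x"
  using weak_curl_unique[OF cz wcurl_weak[OF cz] e(3,4)] e(7) aeq by eventually_elim (auto simp: qf_def)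
 then have n2: "L2_norm T (%x. f x - wcurl T (zf yh) x + (complex_of_real (\<omega>\<^sup>2) * ctrl_coeff P es uh x) *s yh x)
   = L2_norm T ?rs" by (rule L2_cong_AE(2)[OF e(3) L2_diff(1)[OF L(1,3)]])
 \<comment> \<open>Four faces with weight 1/2 give 2 (M' R)^2, and (M R)^2 + 2 (M' R)^2 is at most
   (2 (M + M') R)^2.\<close>
 have sq: "X\<^sup>2 + diameter T / 2 * ?sum Y <= (2 * (M + M') * R)\<^sup>2"
  if X: "0 <= X" "X <= M * R" and Y: "!!S. S : interior_faces Om T ==> sqrt (diameter T) * Y S <= M' * R" "!!S. 0 <= Y S"
   and M: "0 <= M" "0 <= M'" for X Y M M'
 proof -
  have dT: "0 <= diameter T" by (rule diameter_ge_0[OF e(4)])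
  have "diameter T / 2 * ?sum Y = (SUM S:interior_faces Om T. (sqrt (diameter T) * Y S)\<^sup>2) / 2"
   using dT by (simp add: power_mult_distrib sum_distrib_left sum_divide_distrib)
  also have "... <= (SUM S:interior_faces Om T. (M' * R)\<^sup>2) / 2"
   using dT Y by (intro divide_right_mono sum_mono power_mono mult_nonneg_nonneg) auto
  also have "... <= 4 * (M' * R)\<^sup>2 / 2" using fS(2) by (simp add: mult_right_mono)
  finally have "X\<^sup>2 + diameter T / 2 * ?sum Y <= (M * R)\<^sup>2 + 2 * (M' * R)\<^sup>2"
   using power_mono[OF X(2,1), of 2] by simp
  also have "... <= (2 * (M * R + M' * R))\<^sup>2"
  proof -
   have "0 <= (M * R) * (M' * R)" using M R by (intro mult_nonneg_nonneg)
   moreover have "0 <= (M * R)\<^sup>2" "0 <= (M' * R)\<^sup>2" by simp_all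
   ultimately show ?thesis unfolding power_mult_distrib[of 2] power2_sum by simp
  qed
  finally show ?thesis by (simp add: algebra_simps)
 qed
 have "indicator1_sq Om P \<omega> es f uh yh T <= (2 * (M1 kappa Ce + M2 kappa Ce Cs) * R)\<^sup>2"
  using sq[of "diameter T * L2_norm T (wdiv T (qf uh yh))" "M1 kappa Ce" "%S. face_L2_norm S (normal_jump T S (qf uh yh))" "M2 kappa Ce Cs"]
   element_bound(1)[OF Ce T nb ed] face_bound(1)[OF Ce Cs Cv T] Mn diameter_ge_0[OF e(4)]
  unfolding indicator1_sq_def Let_def qf_def[symmetric] n1
  by (simp add: R_def power_mult_distrib L2_norm_nonneg face_L2_norm_nonneg)
 moreover have "indicator2_sq Om P \<omega> \<mu> es f uh yh T <= (2 * (M1 kappa Ce + M3 kappa Ce Cv) * R)\<^sup>2"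
  using sq[of "diameter T * L2_norm T ?rs" "M1 kappa Ce" "%S. face_L2_norm S (tangential_jump T S (zf yh))" "M3 kappa Ce Cv"]
   element_bound(2)[OF Ce T nb ed] face_bound(2)[OF Ce Cs Cv T] Mn diameter_ge_0[OF e(4)]
  unfolding indicator2_sq_def Let_def zf_def[symmetric] n2
  by (simp add: R_def power_mult_distrib L2_norm_nonneg face_L2_norm_nonneg)
 ultimately have "indicator_st Om P \<omega> \<mu> es f uh yh T <= sqrt ((2 * (M1 kappa Ce + M2 kappa Ce Cs) * R)\<^sup>2 + (2 * (M1 kappa Ce + M3 kappa Ce Cv) * R)\<^sup>2)"
  unfolding indicator_st_def by (intro real_sqrt_le_mono add_mono)
 also have "... <= 2 * (M1 kappa Ce + M2 kappa Ce Cs) * R + 2 * (M1 kappa Ce + M3 kappa Ce Cv) * R"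
  using Mn R by (intro sqrt_sum_squares_le_sum) auto
 also have "... <= 4 * (M1 kappa Ce + M2 kappa Ce Cs + M3 kappa Ce Cv) * R"
  using Mn R mult_nonneg_nonneg[OF Mn(1) R] mult_nonneg_nonneg[OF Mn(2) R] mult_nonneg_nonneg[OF Mn(3) R] by (simp add: algebra_simps)
 finally show ?thesis by (simp only: R_def)
qed

end

section \<open>Choice of one constant for the whole collection of meshes\<close>

theorem theorem5p12:
  fixes Om :: "(real^3) set"
    and P :: "'l::finite \<Rightarrow> (real^3) set"
    and \<omega> \<mu>0 \<epsilon>lo \<epsilon>up \<sigma>lo \<sigma>up \<alpha> :: real
    and \<mu> \<epsilon> \<sigma> :: "real^3 \<Rightarrow> real"
    and f yOm EOm :: "real^3 \<Rightarrow> complex^3"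
    and a b :: "real^'l"
    and \<T>0 :: "(real^3) set set"
    and \<TT> :: "(real^3) set set set"
  assumes domain: "open Om" "bounded Om" "Om \<noteq> {}" "connected Om" "simply_connected Om"
      "polyhedral Om" "lipschitz_boundary Om"
    and partition: "is_partition Om P"
    and omega: "\<omega> > 0"
    and mu: "Linf_on Om \<mu>" "\<mu>0 > 0" "AE x in lebesgue_on Om. \<mu>0 \<le> \<mu> x"
    and eps: "Linf_on Om \<epsilon>" "0 < \<epsilon>lo" "AE x in lebesgue_on Om. \<epsilon>lo \<le> \<epsilon> x \<and> \<epsilon> x \<le> \<epsilon>up"
    and sigma: "Linf_on Om \<sigma>" "0 < \<sigma>lo" "AE x in lebesgue_on Om. \<sigma>lo \<le> \<sigma> x \<and> \<sigma> x \<le> \<sigma>up"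
    and data: "L2_on Om f" "L2_on Om yOm" "L2_on Om EOm" "\<alpha> > 0"
    and bounds: "\<And>k. 0 < a $ k" "\<And>k. a $ k < b $ k"
    and mu_poly: "piecewise_polynomial P (\<lambda>x. inverse (\<mu> x))"
    and eps_sig_poly: "piecewise_polynomial P (eps_sig \<omega> \<epsilon> \<sigma>)"
    and initial_mesh: "conforming_mesh Om \<T>0"
    and meshes: "\<And>\<T>. \<T> \<in> \<TT> \<Longrightarrow>
        conforming_mesh Om \<T> \<and> mesh_refines \<T> \<T>0 \<and> resolves_partition P \<T>"
    and regular: "shape_regular \<TT>"
  shows "\<exists>C>0. \<forall>\<T>\<in>\<TT>. \<forall>us uh ys yh.
      (\<forall>T\<in>\<T>. H1_on T f) \<longrightarrow>
      local_min_on (admissible a b)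
        (reduced_j Om P \<omega> \<mu> (eps_sig \<omega> \<epsilon> \<sigma>) f yOm EOm \<alpha>) us \<longrightarrow>
      is_state Om P \<omega> \<mu> (eps_sig \<omega> \<epsilon> \<sigma>) f us ys \<longrightarrow>
      local_min_on (admissible a b)
        (discrete_reduced_j Om P \<omega> \<mu> (eps_sig \<omega> \<epsilon> \<sigma>) f yOm EOm \<alpha> \<T>) uh \<longrightarrow>
      is_discrete_state Om P \<omega> \<mu> (eps_sig \<omega> \<epsilon> \<sigma>) f \<T> uh yh \<longrightarrow>
      (\<forall>T\<in>\<T>.
        indicator_st Om P \<omega> \<mu> (eps_sig \<omega> \<epsilon> \<sigma>) f uh yh T
        \<le> C * (norm (us - uh)
               + Hcurl_norm (\<Union>(neighbours \<T> T)) (\<lambda>x. ys x - yh x)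
               + oscillation Om \<T> f T))"
proof -
 interpret pr: problem Om P \<omega> \<mu>0 \<epsilon>lo \<epsilon>up \<sigma>lo \<sigma>up \<mu> \<epsilon> \<sigma> f a b
  by unfold_locales (fact domain partition omega mu eps sigma data bounds)+
 obtain mp where mp: "!!k. polynomial_function (mp k)" "!!k. AE x in lebesgue_on (P k). inverse (\<mu> x) = mp k x"
  using mu_poly unfolding piecewise_polynomial_def by metis
 obtain ep where ep: "!!k. polynomial_function (ep k)" "!!k. AE x in lebesgue_on (P k). eps_sig \<omega> \<epsilon> \<sigma> x = ep k x"
  using eps_sig_poly unfolding piecewise_polynomial_def by metis
 obtain dm where dm: "!!k. pdegv (dm k) (mp k)" using polynomial_pdegv[OF mp(1)] by metis
 obtain de where de: "!!k. pdegv (de k) (ep k)" using polynomial_pdegv[OF ep(1)] by metis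
 \<comment> \<open>One degree for all subdomains: they are finitely many, and the sum dominates each
   summand.\<close>
 define dg where "dg = (SUM k:UNIV. dm k + de k)"
 have "dm k + de k <= dg" for k unfolding dg_def by (rule member_le_sum) auto
 then have deg: "pdegv dg (mp k)" "pdegv dg (ep k)" for k
  by (auto intro: pdegv_mono[OF dm] pdegv_mono[OF de] dest: add_leD1 add_leD2)
 obtain kappa0 where k0: "!!\<T> T. \<T> : \<TT> ==> T : \<T> ==> EX x r. 0 < r & cball x r <= T & diameter T <= kappa0 * r"
  using regular unfolding shape_regular_def by blast
 \<comment> \<open>Raised to at least 1, as the bubble and scaling estimates require.\<close>
 define kappa where "kappa = max kappa0 1"
 have k1: "kappa \<ge> 1" by (simp add: kappa_def)
 have k: "EX x r. 0 < r & cball x r <= T & diameter T <= kappa * r" if T: "\<T> : \<TT>" "T : \<T>" for \<T> T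
 proof -
  obtain x r where x: "0 < r" "cball x r <= T" "diameter T <= kappa0 * r" using k0[OF T] by blast
  have "kappa0 * r <= kappa * r" using x(1) by (intro mult_right_mono) (auto simp: kappa_def)
  then show ?thesis using x by (intro exI[of _ x] exI[of _ r]) linarith
 qed
 have K: "1 <= 2 * kappa\<^sup>2" using one_le_power[OF k1, of 2] by linarith
 obtain Ce where Ce: "element_const kappa (Suc dg) Ce" using element_const_exists[OF k1] by blast
 obtain Cs where Cs: "bubble_const (2 * kappa\<^sup>2) (Suc dg) TYPE(complex) Cs" using bubble_const_exists[OF K] by blast
 obtain Cv where Cv: "bubble_const (2 * kappa\<^sup>2) (Suc dg) TYPE(complex^3) Cv" using bubble_const_exists[OF K] by blast
 \<comment> \<open>Built from the data, \<open>kappa\<close> and the degree before any mesh is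
   fixed. The summand 1 makes it positive and is harmless because the bracket on the right side is
   nonnegative.\<close>
 define C where "C = 4 * (pr.M1 kappa Ce + pr.M2 kappa Ce Cs + pr.M3 kappa Ce Cv) + 1"
 have "Ce > 0" "Cs > 0" "Cv > 0" using Ce Cs Cv by (auto simp: element_const_def bubble_const_def)
 then have C: "C > 0" using pr.M_nonneg[OF k1, of Ce] by (simp add: C_def add_nonneg_pos)
 show ?thesis
 proof (intro exI[of _ C] conjI ballI allI impI C)
  fix \<T> us uh ys yh T
  assume TT: "\<T> : \<TT>" and H1: "ALL T:\<T>. H1_on T f"
   and us: "local_min_on (admissible a b) (reduced_j Om P \<omega> \<mu> (eps_sig \<omega> \<epsilon> \<sigma>) f yOm EOm \<alpha>) us"
   and ys: "is_state Om P \<omega> \<mu> (eps_sig \<omega> \<epsilon> \<sigma>) f us ys"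
   and uh: "local_min_on (admissible a b) (discrete_reduced_j Om P \<omega> \<mu> (eps_sig \<omega> \<epsilon> \<sigma>) f yOm EOm \<alpha> \<T>) uh"
   and yh: "is_discrete_state Om P \<omega> \<mu> (eps_sig \<omega> \<epsilon> \<sigma>) f \<T> uh yh" and T: "T : \<T>"
  interpret d: discretization Om P \<omega> \<mu>0 \<epsilon>lo \<epsilon>up \<sigma>lo \<sigma>up \<mu> \<epsilon> \<sigma> f a b \<T> kappa mp ep dg us uh ys yh
  proof
   show "is_state Om P \<omega> \<mu> pr.es f us ys" using ys by (simp add: pr.es_def)
   show "EX x r. 0 < r & cball x r <= T & diameter T <= kappa * r" if "T : \<T>" for T by (rule k[OF TT that])
   show "AE x in lebesgue_on (P k). inverse (\<mu> x) = mp k x" "AE x in lebesgue_on (P k). eps_sig \<omega> \<epsilon> \<sigma> x = ep k x" for k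
    by (rule mp(2), rule ep(2))
  qed (use meshes[OF TT] k1 deg H1 us uh yh in \<open>auto simp: local_min_on_def is_discrete_state_def Nedelec_space_def\<close>)
  define R where "R = d.err T + oscillation Om \<T> f T"
  have R: "0 <= R" using d.err_nonneg d.osc_bounds(4)[OF T] by (simp add: R_def)
  have "indicator_st Om P \<omega> \<mu> pr.es f uh yh T <= (C - 1) * R"
   using d.indicator_bound[OF Ce Cs Cv T] by (simp add: C_def R_def)
  also have "... <= C * R" using R by (simp add: mult_right_mono)
  finally show "indicator_st Om P \<omega> \<mu> (eps_sig \<omega> \<epsilon> \<sigma>) f uh yh T
    <= C * (norm (us - uh) + Hcurl_norm (\<Union>(neighbours \<T> T)) (%x. ys x - yh x) + oscillation Om \<T> f T)"
   by (simp add: R_def d.err_def d.Nb_def pr.es_def)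
 qed
qed

end
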